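(* Let $z>0$ and $(a,b,c)\in V$. The functions $\phi_{\tilde\gamma}\in\mathcal D\subset\mathcal H$ ($\tilde\gamma\in S$) are mutually orthogonal in $\mathcal H$. Their quadratic norms are given by $\|\phi_{\tilde\gamma}\|^2=\nu(\{\tilde\gamma\})^{-1}$.
   Context: Fix $0<q<1$ and $z>0$. Notation: $(x;q)_\infty=\prod_{i\ge 0}(1-xq^i)$, $(x;q)_k=(x;q)_\infty/(xq^k;q)_\infty$ for $k\in\mathbb Z$, $(x_1,\dots,x_r;q)_k=\prod_j(x_j;q)_k$ (also for $k=\infty$), $\theta(x)=(x,q/x;q)_\infty$, $\theta(x_1,\dots,x_r)=\prod_j\theta(x_j)$, and ${}_3\phi_2\left(\begin{array}{c}\alpha_1,\alpha_2,\alpha_3\\ \beta_1,\beta_2\end{array};q,y\right)=\sum_{n\ge0}\frac{(\alpha_1,\alpha_2,\alpha_3;q)_n}{(q,\beta_1,\beta_2;q)_n}y^n$. $\mathbb Z_+=\{0,1,2,\dots\}$. $V=\{(a,b,c): a,b,c>0,\ ab,ac,bc<1\}$. $I=\{-q^k: k\in\mathbb Z_+\}\cup\{zq^k: k\in\mathbb Z\}$. For $f:I\to\mathbb C$ and $x\in I\setminus\{-1\}$, $(Lf)(x)=A(x)(f(qx)-f(x))+B(x)(f(q^{-1}x)-f(x))$, with $A(x)=a^2\left(1+\frac1{abx}\right)\left(1+\frac1{acx}\right)$ and $B(x)=\left(1+\frac{q}{bcx}\right)\left(1+\frac1x\right)$; $(Lf)(-1)=A(-1)(f(-q)-f(-1))$.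 $p(x)=\frac{(-abx,-acx;q)_\infty}{(-bcx,-qx;q)_\infty}>0$ on $I$. $\mathcal H$ is the Hilbert space of $f:I\to\mathbb C$ with $\|f\|^2=\langle f,f\rangle<\infty$, where $$\langle f,g\rangle=\sum_{k\ge0}f(-q^k)\overline{g(-q^k)}\frac{(1-q)q^k}{p(-q^k)}+\sum_{k\in\mathbb Z}f(zq^k)\overline{g(zq^k)}\frac{(1-q)zq^k}{p(zq^k)}.$$ $(D_qf)(x)=\frac{f(x)-f(qx)}{(1-q)x}$. $\mathcal D$ is the space of $f\in\mathcal H$ with $Lf\in\mathcal H$ such that $\lim_{k\to\infty}f(zq^k)=\lim_{k\to\infty}f(-q^k)$ and $\lim_{k\to\infty}(D_qf)(zq^k)=\lim_{k\to\infty}(D_qf)(-q^k)$ (all limits existing). $\mu(\gamma)=-1-a^2+a(\gamma+\gamma^{-1})$ for $\gamma\in\mathbb C^*$. $\phi_\gamma:I\to\mathbb C$ is given by $\phi_\gamma(x)={}_3\phi_2\left(\begin{array}{c}a\gamma,a/\gamma,-1/x\\ ab,ac\end{array};q,-bcx\right)$ for $x\in I$ with $bc|x|<1$, and extended to all of $I$ by requiring $(L\phi_\gamma)(x)=\mu(\gamma)\phi_\gamma(x)$ for all $x\in I\setminus\{-1\}$ (this extension exists and is unique). $$S=\left\{\tfrac1{q^ke}: e\in\{a,b,c\},\ k\in\mathbb Z_+,\ \tfrac1{q^ke}<1\right\}\cup\left\{-\tfrac{abcz}{q^{k+1}}: k\in\mathbb Z,\ \tfrac{abcz}{q^{k+1}}<1\right\}.$$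 $M=\frac{(ab,ac;q)_\infty^2\,\theta(-abz,-acz,-bcz)}{(1-q)z\,\theta(-1/z)}$. For $e\in\{a,b,c\}$, $k\in\mathbb Z_+$, $1/q^ke<1$, and $f,g$ such that $\{e,f,g\}=\{a,b,c\}$ (with multiplicity), $$\nu(\{1/q^ke\})=\frac{M\,(e^{-2};q)_\infty}{(q,ef,f/e,eg,g/e;q)_\infty\,\theta(-fgz,-e^2fgz)}\cdot\frac{(e^2,ef,eg;q)_k}{(q,qe/f,qe/g;q)_k}\,\frac{1-e^2q^{2k}}{1-e^2}\left(\frac{-q^{(k+1)/2}}{fg}\right)^k,$$ and for $k\in\mathbb Z$ with $abcz/q^{k+1}<1$, $$\nu(\{-abcz/q^{k+1}\})=\frac{M}{(q,q,-q/abz,-q/acz,-q/bcz,-a^2bcz/q,-ab^2cz/q,-abc^2z/q;q)_\infty}\cdot\frac{(-q/abz,-q/acz,-q/bcz;q)_k}{(-q^2/a^2bcz,-q^2/ab^2cz,-q^2/abc^2z;q)_k}\left(q^{2k}-\frac{a^2b^2c^2z^2}{q^2}\right)\left(\frac{q^{(k+3)/2}}{a^2b^2c^2z}\right)^k.$$ *)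

theory Defs
  imports "HOL-Analysis.Analysis" "HOL-Library.FuncSet" "HOL-Library.Multiset"
begin

text \<open>Throughout, \<open>0 < q < 1\<close> and \<open>z > 0\<close>. The base \<open>q\<close> is real; the argument of a
  \<open>q\<close>-shifted factorial is real or complex. Multiple arguments are given as lists.\<close>

definition qpoch_inf :: "real \<Rightarrow> 'a::real_normed_field \<Rightarrow> 'a" where
  "qpoch_inf q x = (\<Prod>i. 1 - x * of_real q ^ i)"

text \<open>The symbol \<open>(x;q)\<^sub>k = (x;q)\<^sub>\<infinity> / (x q\<^sup>k;q)\<^sub>\<infinity>\<close> for integer \<open>k\<close>. For \<open>k \<ge> 0\<close> the quotient is
  written in its cancelled form, because for \<open>x = q\<^sup>-\<^sup>n\<close> it can be \<open>0 / 0\<close>; this occurs for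
  the parameter \<open>-1/x\<close> of the hypergeometric series at \<open>x = -q\<^sup>n\<close>. The lemma \<open>qpoch_eq_ratio\<close>
  below confirms the quotient formula wherever the denominator does not vanish.\<close>

definition qpoch :: "real \<Rightarrow> 'a::real_normed_field \<Rightarrow> int \<Rightarrow> 'a" where
  "qpoch q x k =
     (if k \<ge> 0 then \<Prod>i<nat k. 1 - x * of_real q ^ i
      else qpoch_inf q x / qpoch_inf q (x * of_real q powi k))"

lemma qpoch_eq_ratio:
  fixes x :: "'a::{real_normed_field, banach}"
  assumes q: "0 < q" "q < 1" and nz: "qpoch_inf q (x * of_real q powi k) \<noteq> 0"
  shows "qpoch q x k = qpoch_inf q x / qpoch_inf q (x * of_real q powi k)"
proof (cases "k \<ge> 0")
  case True
  define n where "n = nat k"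
  have k: "k = int n" using True by (simp add: n_def)
  let ?f = "\<lambda>i. 1 - x * of_real q ^ i"
  have "summable (\<lambda>i. norm (?f i - 1))"
    using q by (simp add: norm_mult norm_power summable_mult summable_geometric)
  hence conv: "convergent_prod ?f"
    by (intro abs_convergent_prod_imp_convergent_prod summable_imp_abs_convergent_prod)
  have shift: "qpoch_inf q (x * of_real q powi k) = (\<Prod>i. ?f (i + n))"
    by (simp add: qpoch_inf_def k power_add mult_ac)
  have "(\<Prod>i. ?f i) = (\<Prod>i<n. ?f i) * (\<Prod>i. ?f (i + n))"
    using has_prod_ignore_initial_segment'[OF conv, of n] has_prod_unique[symmetric] by blast
  hence "qpoch_inf q x = (\<Prod>i<n. ?f i) * qpoch_inf q (x * of_real q powi k)"
    by (simp only: shift qpoch_inf_def[of q x])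
  moreover have "qpoch q x k = (\<Prod>i<n. ?f i)"
    by (simp add: qpoch_def k)
  ultimately show ?thesis using nz by simp
qed (simp add: qpoch_def)

definition qpochs_inf :: "real \<Rightarrow> 'a::real_normed_field list \<Rightarrow> 'a" where
  "qpochs_inf q xs = prod_list (map (qpoch_inf q) xs)"

definition qpochs :: "real \<Rightarrow> 'a::real_normed_field list \<Rightarrow> int \<Rightarrow> 'a" where
  "qpochs q xs k = prod_list (map (\<lambda>x. qpoch q x k) xs)"

definition qtheta :: "real \<Rightarrow> real \<Rightarrow> real" where
  "qtheta q x = qpochs_inf q [x, q / x]"

definition qthetas :: "real \<Rightarrow> real list \<Rightarrow> real" where
  "qthetas q xs = prod_list (map (qtheta q) xs)"

definition phi32 :: "complex \<Rightarrow> complex \<Rightarrow> complex \<Rightarrow> complex \<Rightarrow> complex \<Rightarrow> real \<Rightarrow> complex \<Rightarrow> complex" where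
  "phi32 \<alpha>1 \<alpha>2 \<alpha>3 \<beta>1 \<beta>2 q y =
     (\<Sum>n. qpochs q [\<alpha>1, \<alpha>2, \<alpha>3] (int n) / qpochs q [of_real q, \<beta>1, \<beta>2] (int n) * y ^ n)"

definition par_dom :: "(real \<times> real \<times> real) set" where
  "par_dom = {(a, b, c). a > 0 \<and> b > 0 \<and> c > 0 \<and> a * b < 1 \<and> a * c < 1 \<and> b * c < 1}"

definition grid :: "real \<Rightarrow> real \<Rightarrow> real set" where
  "grid q z = {- (q ^ k) | k :: nat. True} \<union> {z * q powi k | k :: int. True}"

text \<open>A function on the grid is represented by an element of \<open>extensional (grid q z)\<close>, so that
  equality in HOL is equality of functions on the grid.\<close>

definition coeffA :: "real \<Rightarrow> real \<Rightarrow> real \<Rightarrow> real \<Rightarrow> real" where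
  "coeffA a b c x = a\<^sup>2 * (1 + 1 / (a * b * x)) * (1 + 1 / (a * c * x))"

definition coeffB :: "real \<Rightarrow> real \<Rightarrow> real \<Rightarrow> real \<Rightarrow> real" where
  "coeffB q b c x = (1 + q / (b * c * x)) * (1 + 1 / x)"

definition Lop ::
  "real \<Rightarrow> real \<Rightarrow> real \<Rightarrow> real \<Rightarrow> real \<Rightarrow> (real \<Rightarrow> complex) \<Rightarrow> (real \<Rightarrow> complex)" where
  "Lop q a b c z f =
     (\<lambda>x\<in>grid q z.
        if x = -1 then of_real (coeffA a b c (-1)) * (f (- q) - f (-1))
        else of_real (coeffA a b c x) * (f (q * x) - f x)
             + of_real (coeffB q b c x) * (f (x / q) - f x))"

definition pfun :: "real \<Rightarrow> real \<Rightarrow> real \<Rightarrow> real \<Rightarrow> real \<Rightarrow> real" where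
  "pfun q a b c x =
     qpochs_inf q [- (a * b * x), - (a * c * x)] / qpochs_inf q [- (b * c * x), - (q * x)]"

definition wt_neg :: "real \<Rightarrow> real \<Rightarrow> real \<Rightarrow> real \<Rightarrow> nat \<Rightarrow> real" where
  "wt_neg q a b c k = (1 - q) * q ^ k / pfun q a b c (- (q ^ k))"

definition wt_pos :: "real \<Rightarrow> real \<Rightarrow> real \<Rightarrow> real \<Rightarrow> real \<Rightarrow> int \<Rightarrow> real" where
  "wt_pos q a b c z k = (1 - q) * z * q powi k / pfun q a b c (z * q powi k)"

definition ip ::
  "real \<Rightarrow> real \<Rightarrow> real \<Rightarrow> real \<Rightarrow> real \<Rightarrow> (real \<Rightarrow> complex) \<Rightarrow> (real \<Rightarrow> complex) \<Rightarrow> complex" where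
  "ip q a b c z f g =
     (\<Sum>\<^sub>\<infinity>k::nat. f (- (q ^ k)) * cnj (g (- (q ^ k))) * of_real (wt_neg q a b c k))
     + (\<Sum>\<^sub>\<infinity>k::int. f (z * q powi k) * cnj (g (z * q powi k)) * of_real (wt_pos q a b c z k))"

definition Hsp :: "real \<Rightarrow> real \<Rightarrow> real \<Rightarrow> real \<Rightarrow> real \<Rightarrow> (real \<Rightarrow> complex) set" where
  "Hsp q a b c z =
     {f \<in> extensional (grid q z).
        (\<lambda>k::nat. (norm (f (- (q ^ k))))\<^sup>2 * wt_neg q a b c k) summable_on UNIV \<and>
        (\<lambda>k::int. (norm (f (z * q powi k)))\<^sup>2 * wt_pos q a b c z k) summable_on UNIV}"

definition Dq :: "real \<Rightarrow> (real \<Rightarrow> complex) \<Rightarrow> real \<Rightarrow> complex" where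
  "Dq q f x = (f x - f (q * x)) / of_real ((1 - q) * x)"

definition Ddom :: "real \<Rightarrow> real \<Rightarrow> real \<Rightarrow> real \<Rightarrow> real \<Rightarrow> (real \<Rightarrow> complex) set" where
  "Ddom q a b c z =
     {f \<in> Hsp q a b c z.
        Lop q a b c z f \<in> Hsp q a b c z \<and>
        (\<exists>l. (\<lambda>k. f (z * q ^ k)) \<longlonglongrightarrow> l \<and> (\<lambda>k. f (- (q ^ k))) \<longlonglongrightarrow> l) \<and>
        (\<exists>l. (\<lambda>k. Dq q f (z * q ^ k)) \<longlonglongrightarrow> l \<and> (\<lambda>k. Dq q f (- (q ^ k))) \<longlonglongrightarrow> l)}"

definition mu :: "real \<Rightarrow> complex \<Rightarrow> complex" where
  "mu a \<gamma> = - 1 - (of_real a)\<^sup>2 + of_real a * (\<gamma> + inverse \<gamma>)"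

definition phi :: "real \<Rightarrow> real \<Rightarrow> real \<Rightarrow> real \<Rightarrow> real \<Rightarrow> complex \<Rightarrow> (real \<Rightarrow> complex)" where
  "phi q a b c z \<gamma> =
     (THE f. f \<in> extensional (grid q z) \<and>
        (\<forall>x\<in>grid q z. b * c * \<bar>x\<bar> < 1 \<longrightarrow>
           f x = phi32 (of_real a * \<gamma>) (of_real a / \<gamma>) (of_real (- 1 / x))
                   (of_real (a * b)) (of_real (a * c)) q (of_real (- (b * c * x)))) \<and>
        (\<forall>x\<in>grid q z - {-1}. Lop q a b c z f x = mu a \<gamma> * f x))"

definition Sset :: "real \<Rightarrow> real \<Rightarrow> real \<Rightarrow> real \<Rightarrow> real \<Rightarrow> real set" where
  "Sset q a b c z =
     {1 / (q ^ k * e) | e (k :: nat). e \<in> {a, b, c} \<and> 1 / (q ^ k * e) < 1}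
     \<union> {- (a * b * c * z / q powi (k + 1)) | k :: int. a * b * c * z / q powi (k + 1) < 1}"

definition Mconst :: "real \<Rightarrow> real \<Rightarrow> real \<Rightarrow> real \<Rightarrow> real \<Rightarrow> real" where
  "Mconst q a b c z =
     (qpochs_inf q [a * b, a * c])\<^sup>2 * qthetas q [- (a * b * z), - (a * c * z), - (b * c * z)]
     / ((1 - q) * z * qtheta q (- 1 / z))"

text \<open>The point mass of \<open>\<nu>\<close> at \<open>1 / (q\<^sup>k e)\<close>, to be used when \<open>{e, f, g} = {a, b, c}\<close> as multisets.\<close>

definition nu_pos ::
  "real \<Rightarrow> real \<Rightarrow> real \<Rightarrow> real \<Rightarrow> real \<Rightarrow> real \<Rightarrow> real \<Rightarrow> real \<Rightarrow> nat \<Rightarrow> real" where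
  "nu_pos q a b c z e f g k =
     Mconst q a b c z * qpoch_inf q (1 / e\<^sup>2)
     / (qpochs_inf q [q, e * f, f / e, e * g, g / e]
        * qthetas q [- (f * g * z), - (e\<^sup>2 * f * g * z)])
     * (qpochs q [e\<^sup>2, e * f, e * g] (int k) / qpochs q [q, q * e / f, q * e / g] (int k))
     * ((1 - e\<^sup>2 * q ^ (2 * k)) / (1 - e\<^sup>2))
     * (- (q powr ((real k + 1) / 2)) / (f * g)) ^ k"

text \<open>The point mass of \<open>\<nu>\<close> at \<open>- abcz / q\<^bsup>k+1\<^esup>\<close>.\<close>

definition nu_neg :: "real \<Rightarrow> real \<Rightarrow> real \<Rightarrow> real \<Rightarrow> real \<Rightarrow> int \<Rightarrow> real" where
  "nu_neg q a b c z k =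
     Mconst q a b c z
     / qpochs_inf q [q, q, - (q / (a * b * z)), - (q / (a * c * z)), - (q / (b * c * z)),
         - (a\<^sup>2 * b * c * z / q), - (a * b\<^sup>2 * c * z / q), - (a * b * c\<^sup>2 * z / q)]
     * (qpochs q [- (q / (a * b * z)), - (q / (a * c * z)), - (q / (b * c * z))] k
        / qpochs q [- (q\<^sup>2 / (a\<^sup>2 * b * c * z)), - (q\<^sup>2 / (a * b\<^sup>2 * c * z)),
            - (q\<^sup>2 / (a * b * c\<^sup>2 * z))] k)
     * (q powi (2 * k) - a\<^sup>2 * b\<^sup>2 * c\<^sup>2 * z\<^sup>2 / q\<^sup>2)
     * (q powr ((real_of_int k + 3) / 2) / (a\<^sup>2 * b\<^sup>2 * c\<^sup>2 * z)) powi k"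

end

theory Submission
  imports Defs "HOL-Complex_Analysis.Complex_Analysis"
begin

text \<open>Write \<open>F\<^sub>\<gamma>(x) = \<^sub>3\<phi>\<^sub>2(a\<gamma>, a/\<gamma>, -1/x; ab, ac; q, -bcx)\<close>. This series solves the
  \<open>q\<close>-difference equation \<open>L f = \<mu>(\<gamma>) f\<close>, but it converges only for \<open>bc|x| < 1\<close>, and everything that matters
  for orthogonality happens at \<open>x = z q\<^sup>-\<^sup>k\<close>, \<open>k \<rightarrow> \<infinity>\<close>. A three-term transformation is
  avoided as follows. A second series \<open>E\<^sub>\<gamma>(x)\<close>, which converges for all \<open>x > 0\<close> when
  \<open>|\<gamma>| > b\<close>, satisfies the same equation (\<open>bigE_qdiff\<close>). Both functions are holomorphic near
  \<open>x = 0\<close>, both take the value \<open>1\<close> at \<open>x = -1\<close>, and the equation at the points \<open>-q\<^sup>k\<close> is a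
  recurrence that starts at \<open>-1\<close>. So they agree at all points \<open>-q\<^sup>k\<close>, and hence
  everywhere near \<open>0\<close> by the identity theorem (\<open>bigF_eq_bigE\<close>). Thus \<open>E\<^sub>\<gamma>\<close> is the
  extension \<open>\<phi>\<^sub>\<gamma>\<close> on the grid (\<open>phi_eqI\<close>, \<open>is_phi_E\<close>).

  Since \<open>\<phi>\<^sub>\<gamma>\<close> depends only on \<open>\<gamma> + 1/\<gamma>\<close>, one may take \<open>|\<gamma>| > 1\<close>. Dominated convergence and the
  \<open>q\<close>-Gauss sum give \<open>\<phi>\<^sub>\<gamma>(z q\<^sup>-\<^sup>k) \<sim> c(\<gamma>) (a\<gamma>)\<^sup>k\<close>, locally uniformly in \<open>\<gamma>\<close>
  (\<open>E_at_infinity\<close>), with \<open>c(\<gamma>)\<close> an explicit product. The spectral points are the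
  inverses of zeros of \<open>c\<close>. There \<open>\<phi>\<^sub>\<gamma>\<close> decays, \<open>\<phi>\<^sub>\<gamma>(z q\<^sup>-\<^sup>k) \<sim> D (a/\<gamma>)\<^sup>k\<close>: for
  \<open>\<gamma> = a q\<^sup>n\<close> it is a polynomial in \<open>x\<close> (\<open>asymp_polynomial\<close>), and for
  \<open>\<gamma> = -q\<^sup>k\<^sup>+\<^sup>1/(abcz)\<close> the leading terms of \<open>E\<^sub>\<gamma>\<close> vanish at the far grid points and the rest is
  summed by the \<open>q\<close>-binomial theorem (\<open>asymp_second\<close>).

  Green's formula (\<open>green\<close>) expresses \<open>\<mu>(\<gamma>) - \<mu>(\<gamma>')\<close> times a partial inner product by a
  Casorati determinant at a far grid point; no boundary term arises at \<open>0\<close>, because the solutions are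
  smooth there. Two decaying solutions are therefore orthogonal (\<open>orthogonal\<close>). For the
  norm at a zero \<open>\<gamma>\<^sub>0\<close> of \<open>c\<close>, the formula is applied to \<open>\<phi>\<^sub>\<gamma>\<close> and \<open>\<phi>\<close> at \<open>\<gamma>\<^sub>0\<close> with
  \<open>\<gamma>\<close> on a circle around \<open>\<gamma>\<^sub>0\<close>; the maximum principle carries the limit to the centre, and the squared norm
  is a constant multiple of \<open>\<gamma>\<^sub>0 c'(\<gamma>\<^sub>0) D\<close> (\<open>norm_eigenfunction\<close>). Quasi-periodicity of \<open>\<theta>\<close>
  turns this into the inverse of the point mass.

  These arguments need \<open>b, c < 1\<close>, which holds if \<open>a\<close> is the largest parameter. The statement is
  symmetric in \<open>b\<close> and \<open>c\<close>, and multiplication by \<open>(-acx;q)\<^sub>\<infinity>/(-bcx;q)\<^sub>\<infinity>\<close> interchanges \<open>a\<close>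
  and \<open>b\<close> (\<open>spectral_gauged\<close>), so this is no restriction.\<close>

section \<open>Finite and infinite q-shifted factorials\<close>

text \<open>The symbol \<open>(x;q)\<^sub>n\<close> for a natural number \<open>n\<close>.\<close>

definition qpochn :: "real \<Rightarrow> 'a::real_normed_field \<Rightarrow> nat \<Rightarrow> 'a" where
  "qpochn q x n = (\<Prod>i<n. 1 - x * of_real q ^ i)"

lemma qpoch_of_nat: "qpoch q x (int n) = qpochn q x n"
  by (simp add: qpoch_def qpochn_def)

lemma qpochn_0 [simp]: "qpochn q x 0 = 1"
  by (simp add: qpochn_def)

lemma qpochn_Suc: "qpochn q x (Suc n) = qpochn q x n * (1 - x * of_real q ^ n)"
  by (simp add: qpochn_def)

lemma qpochn_add: "qpochn q x (m + n) = qpochn q x m * qpochn q (x * of_real q ^ m) n"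
  by (induction n) (simp_all add: qpochn_Suc power_add mult_ac)

lemma qpochn_Suc_left: "qpochn q x (Suc n) = (1 - x) * qpochn q (x * of_real q) n"
  using qpochn_add[of q x 1 n] by (simp add: qpochn_Suc)

lemma qpochn_of_real: "qpochn q (of_real x :: 'a::real_normed_field) n = of_real (qpochn q x n)"
  by (simp add: qpochn_def)

lemma qpochn_eq_0_iff: "qpochn q x n = 0 \<longleftrightarrow> (\<exists>i<n. x * of_real q ^ i = 1)"
  by (auto simp: qpochn_def)

text \<open>The product is reversed; with \<open>n = k\<close> this isolates the growth of
  \<open>(y q\<^sup>-\<^sup>k;q)\<^sub>k\<close> as \<open>k \<rightarrow> \<infinity>\<close>.\<close>

lemma qpochn_reverse:
  assumes "q \<noteq> 0" "y \<noteq> 0"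
  shows "qpochn q (y / of_real q ^ k) k
    = (-y) ^ k / of_real q ^ (\<Sum>{..k}) * qpochn q (of_real q / y) k"
proof (induction k)
  case (Suc k)
  have "qpochn q (y / of_real q ^ Suc k) (Suc k)
      = (1 - y / of_real q ^ Suc k) * qpochn q (y / of_real q ^ k) k"
    using assms by (simp add: qpochn_Suc_left field_simps)
  also have "1 - y / of_real q ^ Suc k
      = (- y) / of_real q ^ Suc k * (1 - of_real q / y * of_real q ^ k)"
    using assms by (simp add: field_simps)
  finally show ?case using assms
    by (simp add: Suc.IH qpochn_Suc power_add field_simps)
qed simp

lemma qpochn_reverse_partial:
  assumes "q \<noteq> 0" "n \<le> k"
  shows "qpochn q (y / of_real q ^ k) n * qpochn q (y / of_real q ^ (k - n)) (k - n)
    = qpochn q (y / of_real q ^ k) k"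
proof -
  have "y / of_real q ^ k * of_real q ^ n = y / of_real q ^ (k - n)"
    using assms by (simp add: field_simps flip: power_add)
  with qpochn_add[of q "y / of_real q ^ k" n "k - n"] show ?thesis
    using assms by simp
qed

locale qbase =
  fixes q :: real
  assumes q_pos: "0 < q" and q_less_1: "q < 1"
begin

lemma q_power_le: "q ^ i \<le> 1" "q ^ i > 0"
  using q_pos q_less_1 by (auto intro: power_le_one less_imp_le)

lemma abs_q [simp]: "\<bar>q\<bar> = q"
  using q_pos by simp

lemma q_nonneg [simp]: "0 \<le> q"
  using q_pos by simp

lemma q_nz [simp]: "q \<noteq> 0"
  using q_pos by simp

lemma norm_q_power [simp]: "norm (of_real q ^ i :: 'a::real_normed_field) = q ^ i"
  using q_pos by (simp add: norm_power)

lemma sum_q_power_le: "(\<Sum>i<n. q ^ i) \<le> 1 / (1 - q)"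
proof -
  have "(\<Sum>i<n. q ^ i) = (1 - q ^ n) / (1 - q)"
    using q_less_1 by (simp add: sum_gp_strict)
  also have "\<dots> \<le> 1 / (1 - q)"
    using q_less_1 q_power_le[of n] by (intro divide_right_mono) auto
  finally show ?thesis .
qed

lemma prod_1_plus_le: 
  assumes "r \<ge> 0"
  shows "(\<Prod>i<n. 1 + r * q ^ i) \<le> exp (r / (1 - q))"
proof -
  have "(\<Prod>i<n. 1 + r * q ^ i) \<le> exp (\<Sum>i<n. r * q ^ i)"
    using assms q_pos by (intro prod_le_exp_sum) auto
  also have "(\<Sum>i<n. r * q ^ i) \<le> r * (1 / (1 - q))"
    unfolding sum_distrib_left[symmetric] using assms sum_q_power_le
    by (intro mult_left_mono) auto
  finally show ?thesis by simp
qed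

lemma norm_qpochn_le:
  fixes x :: "'a::real_normed_field"
  shows "norm (qpochn q x n) \<le> exp (norm x / (1 - q))"
proof -
  have "norm (qpochn q x n) = (\<Prod>i<n. norm (1 - x * of_real q ^ i))"
    by (simp add: qpochn_def prod_norm)
  also have "\<dots> \<le> (\<Prod>i<n. 1 + norm x * q ^ i)"
  proof (intro prod_mono conjI)
    fix i show "norm (1 - x * of_real q ^ i) \<le> 1 + norm x * q ^ i"
      using norm_triangle_ineq4[of 1 "x * of_real q ^ i"] by (simp add: norm_mult)
  qed auto
  also have "\<dots> \<le> exp (norm x / (1 - q))" by (rule prod_1_plus_le) simp
  finally show ?thesis .
qed

lemma norm_qpochn_minus_1_le:
  fixes x :: "'a::{real_normed_field}"
  shows "norm (qpochn q x n - 1) \<le> exp (norm x / (1 - q)) - 1"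
proof -
  have "norm (qpochn q x n - 1) = norm ((\<Prod>i<n. 1 + (- x * of_real q ^ i)) - 1)"
    by (simp add: qpochn_def)
  also have "\<dots> \<le> (\<Prod>i<n. 1 + norm (- x * of_real q ^ i)) - 1"
    by (rule norm_prod_minus1_le_prod_minus1)
  also have "\<dots> = (\<Prod>i<n. 1 + norm x * q ^ i) - 1"
    by (simp add: norm_mult)
  also have "\<dots> \<le> exp (norm x / (1 - q)) - 1"
    using prod_1_plus_le[of "norm x" n] by simp
  finally show ?thesis .
qed

lemma convergent_qprod:
  fixes x :: "'a::{real_normed_field, banach}"
  shows "convergent_prod (\<lambda>i. 1 - x * of_real q ^ i)"
proof -
  have "summable (\<lambda>i. norm (1 - x * of_real q ^ i - 1))"
    using q_pos q_less_1 by (simp add: norm_mult norm_power summable_mult summable_geometric)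
  thus ?thesis
    by (intro abs_convergent_prod_imp_convergent_prod summable_imp_abs_convergent_prod)
qed

lemma qpoch_inf_0 [simp]: "qpoch_inf q (0 :: 'a::{real_normed_field, banach}) = 1"
  by (simp add: qpoch_inf_def)

lemma qpochn_LIMSEQ:
  fixes x :: "'a::{real_normed_field, banach}"
  shows "(\<lambda>n. qpochn q x n) \<longlonglongrightarrow> qpoch_inf q x"
  using has_prod_imp_tendsto'[OF convergent_prod_has_prod[OF convergent_qprod]]
  by (simp add: qpochn_def qpoch_inf_def)

lemma qpoch_inf_of_real:
  "qpoch_inf q (of_real x :: 'a::{real_normed_field, banach}) = of_real (qpoch_inf q x)"
proof -
  have "(\<lambda>n. of_real (qpochn q x n) :: 'a) \<longlonglongrightarrow> of_real (qpoch_inf q x)"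
    by (intro tendsto_of_real qpochn_LIMSEQ)
  with qpochn_LIMSEQ[of "of_real x :: 'a"] show ?thesis
    by (simp add: qpochn_of_real LIMSEQ_unique)
qed

lemma qpoch_inf_split:
  fixes x :: "'a::{real_normed_field, banach}"
  shows "qpoch_inf q x = qpochn q x n * qpoch_inf q (x * of_real q ^ n)"
proof (rule LIMSEQ_unique)
  show "(\<lambda>k. qpochn q x (n + k)) \<longlonglongrightarrow> qpoch_inf q x"
    using LIMSEQ_ignore_initial_segment[OF qpochn_LIMSEQ[of x], of n] by (simp add: add.commute)
  show "(\<lambda>k. qpochn q x (n + k)) \<longlonglongrightarrow> qpochn q x n * qpoch_inf q (x * of_real q ^ n)"
    by (simp add: qpochn_add tendsto_mult_left qpochn_LIMSEQ)
qed

lemma qpoch_inf_step: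
  fixes x :: "'a::{real_normed_field, banach}"
  shows "qpoch_inf q x = (1 - x) * qpoch_inf q (x * of_real q)"
  using qpoch_inf_split[of x 1] by (simp add: qpochn_Suc)

lemma qpoch_inf_nonzero:
  fixes x :: "'a::{real_normed_field, banach}"
  assumes "\<And>i. x * of_real q ^ i \<noteq> 1"
  shows "qpoch_inf q x \<noteq> 0"
  unfolding qpoch_inf_def using assms by (intro prodinf_nonzero convergent_qprod) auto

lemma mult_q_power_neq_1:
  fixes x :: "'a::real_normed_field"
  assumes "norm x < 1"
  shows "x * of_real q ^ i \<noteq> 1"
proof
  assume "x * of_real q ^ i = 1"
  hence "norm (x * of_real q ^ i) = 1" by simp
  hence "norm x * q ^ i = 1" by (simp add: norm_mult)
  moreover have "norm x * q ^ i \<le> norm x * 1"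
    by (intro mult_left_mono q_power_le) auto
  ultimately show False using assms by simp
qed

lemma qpoch_inf_nonzero_small:
  fixes x :: "'a::{real_normed_field, banach}"
  assumes "norm x < 1"
  shows "qpoch_inf q x \<noteq> 0"
  using mult_q_power_neq_1[OF assms] by (rule qpoch_inf_nonzero)

lemma qpoch_inf_pos:
  fixes x :: real
  assumes "x < 1" 
  shows "qpoch_inf q x > 0"
proof -
  have less: "x * q ^ i < 1" for i
  proof (cases "x \<ge> 0")
    case True
    hence "x * q ^ i \<le> x * 1" by (intro mult_left_mono q_power_le)
    thus ?thesis using assms by simp
  next
    case False
    hence "x * q ^ i \<le> 0" using q_power_le[of i] by (simp add: mult_le_0_iff)
    thus ?thesis by simp
  qed
  have "qpochn q x n \<ge> 0" for n
    unfolding qpochn_def using less by (intro prod_nonneg) (auto simp: less_imp_le)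
  hence "qpoch_inf q x \<ge> 0" by (intro LIMSEQ_le_const[OF qpochn_LIMSEQ]) auto
  moreover have "qpoch_inf q x \<noteq> 0"
    using less by (intro qpoch_inf_nonzero) (auto simp: less_imp_neq)
  ultimately show ?thesis by simp
qed

lemma norm_qpoch_inf_le:
  fixes x :: "'a::{real_normed_field, banach}"
  shows "norm (qpoch_inf q x) \<le> exp (norm x / (1 - q))"
  by (rule LIMSEQ_le_const2[OF tendsto_norm[OF qpochn_LIMSEQ]]) (auto intro: norm_qpochn_le)

lemma norm_qpoch_inf_minus_1_le:
  fixes x :: "'a::{real_normed_field, banach}"
  shows "norm (qpoch_inf q x - 1) \<le> exp (norm x / (1 - q)) - 1"
  by (rule LIMSEQ_le_const2[OF tendsto_norm[OF tendsto_diff[OF qpochn_LIMSEQ tendsto_const]]])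
     (auto intro: norm_qpochn_minus_1_le)

lemma norm_qpoch_inf_minus_qpochn_le:
  fixes x :: "'a::{real_normed_field, banach}"
  assumes "norm x \<le> r"
  shows "norm (qpoch_inf q x - qpochn q x n)
    \<le> exp (r / (1 - q)) * (exp (r * q ^ n / (1 - q)) - 1)"
proof -
  have "r \<ge> 0" using assms norm_ge_zero order_trans by blast
  have "qpoch_inf q x - qpochn q x n = qpochn q x n * (qpoch_inf q (x * of_real q ^ n) - 1)"
    by (subst qpoch_inf_split[of x n]) (simp add: algebra_simps)
  hence "norm (qpoch_inf q x - qpochn q x n)
      = norm (qpochn q x n) * norm (qpoch_inf q (x * of_real q ^ n) - 1)"
    by (simp add: norm_mult)
  also have "\<dots> \<le> exp (norm x / (1 - q)) * (exp (norm (x * of_real q ^ n) / (1 - q)) - 1)"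
    by (intro mult_mono norm_qpochn_le norm_qpoch_inf_minus_1_le) auto
  also have "\<dots> \<le> exp (r / (1 - q)) * (exp (r * q ^ n / (1 - q)) - 1)"
    using assms q_less_1 q_pos \<open>r \<ge> 0\<close>
    by (intro mult_mono diff_mono) (auto simp: norm_mult intro!: divide_right_mono mult_right_mono)
  finally show ?thesis .
qed

lemma qpochn_error_LIMSEQ:
  "(\<lambda>n. exp (r / (1 - q)) * (exp (r * q ^ n / (1 - q)) - 1)) \<longlonglongrightarrow> 0"
proof -
  have "(\<lambda>n. q ^ n) \<longlonglongrightarrow> 0" using q_pos q_less_1 by (intro LIMSEQ_power_zero) auto
  hence "(\<lambda>n. exp (r / (1 - q)) * (exp (r * q ^ n / (1 - q)) - 1)) \<longlonglongrightarrow>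
           exp (r / (1 - q)) * (exp (r * 0 / (1 - q)) - 1)"
    using q_less_1 by (intro tendsto_intros) auto
  thus ?thesis by simp
qed

lemma uniform_limit_qpochn:
  "uniform_limit (cball (0::'a::{real_normed_field, banach}) r)
     (\<lambda>n x. qpochn q x n) (qpoch_inf q) sequentially"
proof (rule uniform_limitI)
  fix e :: real assume "e > 0"
  with qpochn_error_LIMSEQ[of r]
  have "\<forall>\<^sub>F n in sequentially. exp (r / (1 - q)) * (exp (r * q ^ n / (1 - q)) - 1) < e"
    by (rule order_tendstoD)
  thus "\<forall>\<^sub>F n in sequentially. \<forall>x::'a\<in>cball 0 r. dist (qpochn q x n) (qpoch_inf q x) < e"
  proof eventually_elim
    case (elim n)
    show ?case
    proof
      fix x :: 'a assume "x \<in> cball 0 r"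
      hence "norm (qpoch_inf q x - qpochn q x n)
          \<le> exp (r / (1 - q)) * (exp (r * q ^ n / (1 - q)) - 1)"
        by (intro norm_qpoch_inf_minus_qpochn_le) auto
      thus "dist (qpochn q x n) (qpoch_inf q x) < e"
        using elim by (simp add: dist_norm norm_minus_commute)
    qed
  qed
qed

lemma isCont_qpoch_inf:
  fixes x :: "'a::{real_normed_field, banach}"
  shows "isCont (qpoch_inf q) x"
proof -
  have "continuous_on (cball 0 (norm x + 1)) (qpoch_inf q :: 'a \<Rightarrow> 'a)"
    by (rule uniform_limit_theorem[OF always_eventually uniform_limit_qpochn])
       (auto simp: qpochn_def intro!: continuous_intros)
  hence "continuous_on (ball 0 (norm x + 1)) (qpoch_inf q :: 'a \<Rightarrow> 'a)"
    by (rule continuous_on_subset) auto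
  thus ?thesis by (simp add: continuous_on_eq_continuous_at)
qed

lemma tendsto_qpoch_inf [tendsto_intros]:
  fixes f :: "_ \<Rightarrow> 'a::{real_normed_field, banach}"
  shows "(f \<longlongrightarrow> x) F \<Longrightarrow> ((\<lambda>t. qpoch_inf q (f t)) \<longlongrightarrow> qpoch_inf q x) F"
  using isCont_tendsto_compose[OF isCont_qpoch_inf] .

lemma continuous_on_qpoch_inf [continuous_intros]:
  fixes f :: "_ \<Rightarrow> 'a::{real_normed_field, banach}"
  shows "continuous_on S f \<Longrightarrow> continuous_on S (\<lambda>t. qpoch_inf q (f t))"
  by (auto simp: continuous_on_def intro: tendsto_qpoch_inf)

lemma tendsto_qpochn [tendsto_intros]:
  fixes f :: "_ \<Rightarrow> 'a::real_normed_field"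
  shows "(f \<longlongrightarrow> x) F \<Longrightarrow> ((\<lambda>t. qpochn q (f t) n) \<longlongrightarrow> qpochn q x n) F"
  unfolding qpochn_def by (intro tendsto_intros)

text \<open>Argument and length may move simultaneously.\<close>

lemma tendsto_qpochn_at_top:
  fixes f :: "_ \<Rightarrow> 'a::{real_normed_field, banach}"
  assumes f: "(f \<longlongrightarrow> x) F" and m: "filterlim m at_top F"
  shows "((\<lambda>t. qpochn q (f t) (m t)) \<longlongrightarrow> qpoch_inf q x) F"
proof -
  have "((\<lambda>t. qpoch_inf q (f t) - qpochn q (f t) (m t)) \<longlongrightarrow> 0) F"
  proof (rule Lim_null_comparison)
    have "\<forall>\<^sub>F t in F. norm (f t) < norm x + 1"
      using tendsto_norm[OF f] by (rule order_tendstoD) simp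
    thus "\<forall>\<^sub>F t in F. norm (qpoch_inf q (f t) - qpochn q (f t) (m t))
      \<le> exp ((norm x + 1) / (1 - q)) * (exp ((norm x + 1) * q ^ m t / (1 - q)) - 1)"
      by eventually_elim (rule norm_qpoch_inf_minus_qpochn_le, simp)
    show "((\<lambda>t. exp ((norm x + 1) / (1 - q)) * (exp ((norm x + 1) * q ^ m t / (1 - q)) - 1))
            \<longlongrightarrow> 0) F"
      using filterlim_compose[OF qpochn_error_LIMSEQ m] .
  qed
  from tendsto_diff[OF tendsto_qpoch_inf[OF f] this] show ?thesis by simp
qed

lemma holomorphic_on_qpochn [holomorphic_intros]:
  "f holomorphic_on S \<Longrightarrow> (\<lambda>x. qpochn q (f x) n) holomorphic_on S"
  unfolding qpochn_def by (intro holomorphic_intros)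

lemma holomorphic_qpoch_inf: "qpoch_inf q holomorphic_on (UNIV :: complex set)"
proof (rule holomorphic_uniform_sequence)
  show "(\<lambda>x. qpochn q x n) holomorphic_on UNIV" for n
    by (intro holomorphic_intros)
  fix x :: complex
  have "uniform_limit (cball x 1) (\<lambda>n x. qpochn q x n) (qpoch_inf q) sequentially"
  proof (rule uniform_limit_on_subset[OF uniform_limit_qpochn])
    show "cball x 1 \<subseteq> cball 0 (norm x + 1)"
      by (simp add: cball_subset_cball_iff)
  qed
  thus "\<exists>d>0. cball x d \<subseteq> UNIV \<and>
      uniform_limit (cball x d) (\<lambda>n x. qpochn q x n) (qpoch_inf q) sequentially"
    by (intro exI[of _ 1]) auto
qed auto

lemma holomorphic_on_qpoch_inf [holomorphic_intros]:
  "f holomorphic_on S \<Longrightarrow> (\<lambda>x. qpoch_inf q (f x)) holomorphic_on S"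
  using holomorphic_on_compose_gen[OF _ holomorphic_qpoch_inf, of f S] by (simp add: o_def)

lemma qpochn_inverse_bounded:
  fixes x :: "'a::{real_normed_field, banach}"
  assumes "\<And>i. x * of_real q ^ i \<noteq> 1"
  shows "\<exists>K>0. \<forall>n. norm (inverse (qpochn q x n)) \<le> K"
proof -
  have "(\<lambda>n. inverse (qpochn q x n)) \<longlonglongrightarrow> inverse (qpoch_inf q x)"
    using qpoch_inf_nonzero[OF assms] by (intro tendsto_inverse qpochn_LIMSEQ)
  hence "Bseq (\<lambda>n. inverse (qpochn q x n))" by (intro convergent_imp_Bseq convergentI)
  thus ?thesis by (auto simp: Bseq_def)
qed

lemma qpoch_inf_reverse:
  fixes y :: "'a::{real_normed_field, banach}"
  assumes "y \<noteq> 0"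
  shows "qpoch_inf q (y / of_real q ^ k)
    = (-y) ^ k / of_real q ^ (\<Sum>{..k}) * qpochn q (of_real q / y) k * qpoch_inf q y"
  using qpoch_inf_split[of "y / of_real q ^ k" k] qpochn_reverse[of q y k] assms q_pos by simp

end

section \<open>The q-binomial theorem and the q-Gauss sum\<close>

lemma holomorphic_on_suminf:
  fixes f :: "nat \<Rightarrow> complex \<Rightarrow> complex"
  assumes "open S" and hol: "\<And>n. f n holomorphic_on S"
    and bound: "\<And>x. x \<in> S \<Longrightarrow> \<exists>d>0. \<exists>M. cball x d \<subseteq> S \<and> summable M \<and>
                  (\<forall>n. \<forall>y\<in>cball x d. norm (f n y) \<le> M n)"
  shows "(\<lambda>x. \<Sum>n. f n x) holomorphic_on S"
proof (rule holomorphic_uniform_sequence[OF \<open>open S\<close>])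
  show "(\<lambda>x. \<Sum>n<k. f n x) holomorphic_on S" for k
    by (intro holomorphic_intros hol)
  fix x assume "x \<in> S"
  from bound[OF this] obtain d M where "d > 0" "cball x d \<subseteq> S" "summable M"
    "\<And>n y. y \<in> cball x d \<Longrightarrow> norm (f n y) \<le> M n" by blast
  thus "\<exists>d>0. cball x d \<subseteq> S \<and>
      uniform_limit (cball x d) (\<lambda>k x. \<Sum>n<k. f n x) (\<lambda>x. \<Sum>n. f n x) sequentially"
    by (intro exI[of _ d] conjI Weierstrass_m_test) auto
qed

context qbase
begin

lemma summable_bounded_geometric:
  fixes t :: "nat \<Rightarrow> 'a::{real_normed_field, banach}"
  assumes "\<And>n. norm (t n) \<le> K" "norm w < 1"
  shows "summable (\<lambda>n. t n * w ^ n)"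
proof (rule summable_comparison_test)
  show "\<exists>N. \<forall>n\<ge>N. norm (t n * w ^ n) \<le> K * norm w ^ n"
    using assms(1) by (auto simp: norm_mult norm_power intro!: mult_right_mono)
  show "summable (\<lambda>n. K * norm w ^ n)"
    using assms(2) by (intro summable_mult summable_geometric) auto
qed

lemma q_neq_1 [simp]: "of_real q * of_real q ^ i \<noteq> (1 :: 'a::real_normed_field)"
  using mult_q_power_neq_1[of "of_real q :: 'a" i] q_pos q_less_1 by simp

lemma qpochn_q_nonzero [simp]: "qpochn q (of_real q :: 'a::real_normed_field) n \<noteq> 0"
  by (auto simp: qpochn_eq_0_iff)

lemma q_binomial_coeff_bounded:
  fixes A :: "'a::{real_normed_field, banach}"
  obtains K where "K > 0" "\<And>n. norm (qpochn q A n / qpochn q (of_real q) n) \<le> K"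
proof -
  obtain K where K: "K > 0" "\<And>n. norm (inverse (qpochn q (of_real q :: 'a) n)) \<le> K"
    using qpochn_inverse_bounded[of "of_real q :: 'a"] by auto
  have "norm (qpochn q A n / qpochn q (of_real q) n) \<le> exp (norm A / (1 - q)) * K" for n
    using mult_mono[OF norm_qpochn_le[of A n] K(2)[of n]]
    by (simp add: divide_inverse[of "qpochn q A n"] norm_mult)
  with K(1) show ?thesis by (intro that[of "exp (norm A / (1 - q)) * K"]) auto
qed

theorem q_binomial:
  fixes A w :: "'a::{real_normed_field, banach}"
  assumes w: "norm w < 1"
  shows "(\<lambda>n. qpochn q A n / qpochn q (of_real q) n * w ^ n) sums
           (qpoch_inf q (A * w) / qpoch_inf q w)"
proof -
  define t where "t = (\<lambda>n. qpochn q A n / qpochn q (of_real q) n)"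
  define h where "h = (\<lambda>w. \<Sum>n. t n * w ^ n)"
  obtain K where K: "K > 0" "\<And>n. norm (t n) \<le> K"
    using q_binomial_coeff_bounded[of A] unfolding t_def by blast
  have sm: "summable (\<lambda>n. t n * w ^ n)" if "norm w < 1" for w
    using summable_bounded_geometric[OF K(2) that] .
  have small: "norm (v * of_real q ^ n) < 1" if "norm v < 1" for v :: 'a and n
  proof -
    have "norm v * q ^ n \<le> norm v * 1" by (intro mult_left_mono q_power_le) auto
    thus ?thesis using that by (simp add: norm_mult)
  qed
  have step: "(1 - v) * h v = (1 - A * v) * h (v * of_real q)" if v: "norm v < 1" for v
  proof -
    have vq: "norm (v * of_real q) < 1" using small[OF v, of 1] by simp
    have "h v - h (v * of_real q) = (\<Sum>n. t n * v ^ n - t n * (v * of_real q) ^ n)"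
      unfolding h_def by (rule suminf_diff[OF sm[OF v] sm[OF vq]])
    also have "\<dots> = (\<Sum>n. t (Suc n) * v ^ Suc n - t (Suc n) * (v * of_real q) ^ Suc n)"
      using suminf_split_head[OF summable_diff[OF sm[OF v] sm[OF vq]]] by simp
    also have "(\<lambda>n. t (Suc n) * v ^ Suc n - t (Suc n) * (v * of_real q) ^ Suc n)
        = (\<lambda>n. v * (t n * v ^ n) - A * v * (t n * (v * of_real q) ^ n))"
    proof
      fix n
      have nz: "1 - of_real q * of_real q ^ n \<noteq> (0::'a)" using q_neq_1[of n, where 'a='a] by simp
      have "t (Suc n) * (1 - of_real q * of_real q ^ n) = t n * (1 - A * of_real q ^ n)"
        using nz by (simp add: t_def qpochn_Suc)
      hence "t (Suc n) * (1 - of_real q * of_real q ^ n) * v ^ Suc n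
          = t n * (1 - A * of_real q ^ n) * v ^ Suc n" by simp
      thus "t (Suc n) * v ^ Suc n - t (Suc n) * (v * of_real q) ^ Suc n
          = v * (t n * v ^ n) - A * v * (t n * (v * of_real q) ^ n)"
        by (simp add: power_mult_distrib algebra_simps)
    qed
    also have "(\<Sum>n. v * (t n * v ^ n) - A * v * (t n * (v * of_real q) ^ n))
        = v * h v - A * v * h (v * of_real q)"
      unfolding h_def using sm[OF v] sm[OF vq]
      by (subst suminf_diff[symmetric]) (auto intro!: summable_mult simp: suminf_mult)
    finally show ?thesis by (simp add: algebra_simps)
  qed
  have iter: "qpochn q w n * h w = qpochn q (A * w) n * h (w * of_real q ^ n)" for n
  proof (induction n)
    case (Suc n)
    have "qpochn q w (Suc n) * h w = (1 - w * of_real q ^ n) * (qpochn q w n * h w)"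
      by (simp add: qpochn_Suc)
    also have "\<dots> = qpochn q (A * w) n * ((1 - w * of_real q ^ n) * h (w * of_real q ^ n))"
      by (simp add: Suc.IH)
    also have "\<dots> = qpochn q (A * w) (Suc n) * h (w * of_real q ^ Suc n)"
      by (subst step[OF small[OF w]]) (simp add: qpochn_Suc mult_ac)
    finally show ?case .
  qed simp
  have "isCont h 0"
    unfolding h_def using sm[of "of_real (1/2)"] by (intro isCont_powser[of _ "of_real (1/2)"]) auto
  moreover have "(\<lambda>n. w * of_real q ^ n) \<longlonglongrightarrow> w * 0"
    using q_pos q_less_1 by (intro tendsto_mult tendsto_const LIMSEQ_power_zero) auto
  ultimately have "(\<lambda>n. h (w * of_real q ^ n)) \<longlonglongrightarrow> h 0"
    using isCont_tendsto_compose by fastforce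
  moreover have "h 0 = 1" unfolding h_def powser_zero by (simp add: t_def)
  ultimately have "(\<lambda>n. qpochn q (A * w) n * h (w * of_real q ^ n)) \<longlonglongrightarrow> qpoch_inf q (A * w) * 1"
    by (intro tendsto_mult qpochn_LIMSEQ) simp
  moreover have "(\<lambda>n. qpochn q w n * h w) \<longlonglongrightarrow> qpoch_inf q w * h w"
    by (intro tendsto_mult qpochn_LIMSEQ tendsto_const)
  ultimately have "qpoch_inf q w * h w = qpoch_inf q (A * w)"
    unfolding iter using LIMSEQ_unique by fastforce
  hence "h w = qpoch_inf q (A * w) / qpoch_inf q w"
    using qpoch_inf_nonzero_small[OF w] by (simp add: field_simps)
  with summable_sums[OF sm[OF w]] show ?thesis by (simp add: h_def t_def)
qed

text \<open>The q-Gauss sum is stated with \<open>(C;q)\<^sub>n\<close> replaced by \<open>(C q\<^sup>n;q)\<^sub>\<infinity>\<close>, \<open>C = A B w\<close>, so that no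
  condition on \<open>C\<close> is needed. It follows from the contiguous relation between \<open>w\<close> and \<open>q w\<close>,
  the difference of the two series being a telescoping series.\<close>

theorem q_gauss:
  fixes A B w :: "'a::{real_normed_field, banach}"
  assumes w: "norm w < 1"
  shows "(\<lambda>n. qpochn q A n * qpochn q B n / qpochn q (of_real q) n *
           qpoch_inf q (A * B * w * of_real q ^ n) * w ^ n)
    sums (qpoch_inf q (A * w) * qpoch_inf q (B * w) / qpoch_inf q w)"
proof -
  define S where "S = (\<lambda>v n. qpochn q A n * qpochn q B n / qpochn q (of_real q) n * v ^ n)"
  define t where "t = (\<lambda>v n. qpochn q A n * qpochn q B n / qpochn q (of_real q) n *
           qpoch_inf q (A * B * v * of_real q ^ n) * v ^ n)"
  define f where "f = (\<lambda>N. \<Sum>n. t (w * of_real q ^ N) n)"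
  obtain K1 where K1: "K1 > 0" "\<And>n. norm (qpochn q A n / qpochn q (of_real q) n) \<le> K1"
    using q_binomial_coeff_bounded[of A] by blast
  define K where "K = K1 * exp (norm B / (1 - q)) * exp (norm (A * B * w) / (1 - q))"
  have small: "norm (v * of_real q ^ n) \<le> norm v" for v :: 'a and n
  proof -
    have "norm v * q ^ n \<le> norm v * 1" by (intro mult_left_mono q_power_le) auto
    thus ?thesis by (simp add: norm_mult)
  qed
  have bound: "norm (t (w * of_real q ^ N) n) \<le> K * norm w ^ n" for N n
  proof -
    define v where "v = w * of_real q ^ N"
    have v: "norm v ^ n \<le> norm w ^ n" unfolding v_def by (intro power_mono small) simp
    have "norm (A * B * v * of_real q ^ n) \<le> norm (A * B * w)"
      using small[of "A * B * w" "N + n"] by (simp add: v_def power_add mult_ac)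
    hence "exp (norm (A * B * v * of_real q ^ n) / (1 - q)) \<le> exp (norm (A * B * w) / (1 - q))"
      using q_less_1 by (simp add: divide_right_mono)
    with norm_qpoch_inf_le have P: "norm (qpoch_inf q (A * B * v * of_real q ^ n))
        \<le> exp (norm (A * B * w) / (1 - q))" by (rule order_trans)
    have "t v n = qpochn q A n / qpochn q (of_real q) n * qpochn q B n *
        qpoch_inf q (A * B * v * of_real q ^ n) * v ^ n"
      by (simp add: t_def)
    also have "norm \<dots> = norm (qpochn q A n / qpochn q (of_real q) n) * norm (qpochn q B n) *
        norm (qpoch_inf q (A * B * v * of_real q ^ n)) * norm v ^ n"
      by (simp only: norm_mult norm_power)
    also have "\<dots> \<le> K * norm w ^ n"
      unfolding K_def using K1(1) by (intro mult_mono K1(2) P v norm_qpochn_le) simp_all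
    finally show ?thesis unfolding v_def .
  qed
  have sm: "summable (t (w * of_real q ^ N))" for N
  proof (rule summable_comparison_test)
    show "\<exists>M. \<forall>n\<ge>M. norm (t (w * of_real q ^ N) n) \<le> K * norm w ^ n" using bound by blast
    show "summable (\<lambda>n. K * norm w ^ n)"
      using w by (intro summable_mult summable_geometric) auto
  qed
  have step: "(1 - v) * f N = (1 - A * v) * (1 - B * v) * f (Suc N)"
    if v: "v = w * of_real q ^ N" for v N
  proof -
    define c where "c = A * B * v"
    define G where "G = (\<lambda>n. - (1 - of_real q ^ n) * t v n)"
    have tele: "(1 - v) * t v n - (1 - A * v) * (1 - B * v) * t (v * of_real q) n
        = G (Suc n) - G n" for n
    proof -
      define X :: 'a where "X = of_real q ^ n"
      define W where "W = qpoch_inf q (c * X * of_real q)"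
      have nz: "1 - of_real q * X \<noteq> 0" using q_neq_1[of n, where 'a='a] by (simp add: X_def)
      have t1: "t v n = S v n * (1 - c * X) * W"
        using qpoch_inf_step[of "c * X"] by (simp add: t_def S_def c_def X_def W_def mult_ac)
      have t2: "t (v * of_real q) n = S v n * X * W"
        by (simp add: t_def S_def c_def X_def W_def power_mult_distrib mult_ac)
      have "S v (Suc n) * (1 - of_real q * X) = S v n * (1 - A * X) * (1 - B * X) * v"
        using nz unfolding S_def qpochn_Suc power_Suc X_def[symmetric]
        by (simp add: divide_simps mult_ac)
      moreover have "t v (Suc n) = S v (Suc n) * W"
        by (simp add: t_def S_def c_def X_def W_def mult_ac)
      ultimately have t3: "(1 - of_real q * X) * t v (Suc n)
          = S v n * (1 - A * X) * (1 - B * X) * v * W"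
        by (metis mult.assoc mult.commute)
      have GS: "G (Suc n) = - (S v n * (1 - A * X) * (1 - B * X) * v * W)"
        unfolding t3[symmetric] by (simp add: G_def X_def algebra_simps)
      have Gn: "G n = - (1 - X) * (S v n * (1 - c * X) * W)"
        unfolding t1[symmetric] by (simp add: G_def X_def)
      have "(1 - v) * t v n - (1 - A * v) * (1 - B * v) * t (v * of_real q) n - (G (Suc n) - G n)
        = S v n * W * ((1 - v) * (1 - c * X) - (1 - A * v) * (1 - B * v) * X
            + (1 - A * X) * (1 - B * X) * v - (1 - X) * (1 - c * X))"
        unfolding t1 t2 GS Gn by (simp add: algebra_simps)
      also have "\<dots> = 0" unfolding c_def by (simp add: algebra_simps)
      finally show ?thesis by simp
    qed
    have tv: "t v = t (w * of_real q ^ N)" and tvq: "t (v * of_real q) = t (w * of_real q ^ Suc N)"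
      by (simp_all add: v mult_ac)
    have "t v \<longlonglongrightarrow> 0" unfolding tv by (rule summable_LIMSEQ_zero[OF sm])
    moreover have "(\<lambda>n. of_real q ^ n :: 'a) \<longlonglongrightarrow> 0"
      using q_pos q_less_1 by (intro LIMSEQ_power_zero) auto
    ultimately have "G \<longlonglongrightarrow> - (1 - 0) * 0"
      unfolding G_def by (intro tendsto_mult tendsto_minus tendsto_diff tendsto_const)
    hence "(\<lambda>n. G (Suc n) - G n) sums (0 - G 0)" by (intro telescope_sums) simp
    hence "(\<lambda>n. (1 - v) * t v n - (1 - A * v) * (1 - B * v) * t (v * of_real q) n) sums 0"
      unfolding tele by (simp add: G_def)
    moreover have "(\<lambda>n. (1 - v) * t v n - (1 - A * v) * (1 - B * v) * t (v * of_real q) n)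
        sums ((1 - v) * f N - (1 - A * v) * (1 - B * v) * f (Suc N))"
      unfolding f_def tv tvq by (intro sums_diff sums_mult summable_sums sm)
    ultimately show ?thesis using sums_unique2 by fastforce
  qed
  have iter: "qpochn q w N * f 0 = qpochn q (A * w) N * qpochn q (B * w) N * f N" for N
  proof (induction N)
    case (Suc N)
    have "qpochn q w (Suc N) * f 0 = (1 - w * of_real q ^ N) * (qpochn q w N * f 0)"
      unfolding qpochn_Suc by (simp only: mult_ac)
    also have "\<dots> = qpochn q (A * w) N * qpochn q (B * w) N * ((1 - w * of_real q ^ N) * f N)"
      unfolding Suc.IH by (simp only: mult_ac)
    also have "\<dots> = qpochn q (A * w) (Suc N) * qpochn q (B * w) (Suc N) * f (Suc N)"
      unfolding step[OF refl] qpochn_Suc by (simp only: mult_ac)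
    finally show ?case .
  qed simp
  have "f \<longlonglongrightarrow> (\<Sum>n. if n = 0 then 1 else 0)"
  proof -
    have lim0: "(\<lambda>N. w * of_real q ^ N) \<longlonglongrightarrow> w * 0"
      using q_pos q_less_1 by (intro tendsto_mult tendsto_const LIMSEQ_power_zero) auto
    have "((\<lambda>N. t (w * of_real q ^ N) n) \<longlongrightarrow> (if n = 0 then 1 else 0)) sequentially" for n
    proof -
      have "((\<lambda>v. t v n) \<longlongrightarrow> t (w * 0) n) (at (w * 0))"
        unfolding t_def by (intro tendsto_intros) auto
      hence "((\<lambda>N. t (w * of_real q ^ N) n) \<longlongrightarrow> t (w * 0) n) sequentially"
        by (intro isCont_tendsto_compose[OF _ lim0]) (simp add: isCont_def)
      moreover have "t (w * 0) n = (if n = 0 then 1 else 0)" by (simp add: t_def)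
      ultimately show ?thesis by simp
    qed
    moreover have "\<forall>\<^sub>F (n, N) in at_top \<times>\<^sub>F sequentially.
        norm (t (w * of_real q ^ N) n) \<le> K * norm w ^ n"
      using bound by (intro always_eventually) auto
    moreover have "summable (\<lambda>n. K * norm w ^ n)"
      using w by (intro summable_mult summable_geometric) auto
    ultimately show ?thesis
      unfolding f_def using tannerys_theorem[of "\<lambda>n N. t (w * of_real q ^ N) n"] by auto
  qed
  moreover have "(\<Sum>n::nat. if n = 0 then 1 else 0 :: 'a) = 1"
    using suminf_finite[of "{0}" "\<lambda>n. if n = 0 then 1 else 0 :: 'a"] by simp
  ultimately have "f \<longlonglongrightarrow> 1" by simp
  hence "(\<lambda>N. qpochn q (A * w) N * qpochn q (B * w) N * f N)
      \<longlonglongrightarrow> qpoch_inf q (A * w) * qpoch_inf q (B * w) * 1"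
    by (intro tendsto_mult qpochn_LIMSEQ)
  moreover have "(\<lambda>N. qpochn q w N * f 0) \<longlonglongrightarrow> qpoch_inf q w * f 0"
    by (intro tendsto_mult qpochn_LIMSEQ tendsto_const)
  ultimately have "qpoch_inf q w * f 0 = qpoch_inf q (A * w) * qpoch_inf q (B * w)"
    unfolding iter using LIMSEQ_unique by fastforce
  hence "f 0 = qpoch_inf q (A * w) * qpoch_inf q (B * w) / qpoch_inf q w"
    using qpoch_inf_nonzero_small[OF w] by (simp add: field_simps)
  with summable_sums[OF sm[of 0]] show ?thesis by (simp add: f_def t_def)
qed

end

section \<open>The q-difference equation and its solution regular at the origin\<close>

text \<open>The eigenvalue equation \<open>L f = \<mu> f\<close> at the point \<open>x\<close>, multiplied by \<open>b c x\<^sup>2\<close>; the eigenvalue is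
  \<open>\<mu> = -1 - a\<^sup>2 + a s\<close>. Here \<open>x\<close> and the parameters may be complex.\<close>

definition big_qdiff ::
  "real \<Rightarrow> complex \<Rightarrow> complex \<Rightarrow> complex \<Rightarrow> complex \<Rightarrow> (complex \<Rightarrow> complex) \<Rightarrow> complex \<Rightarrow> bool" where
  "big_qdiff q a b c s f x \<longleftrightarrow>
     (a * b * x + 1) * (a * c * x + 1) * (f (of_real q * x) - f x)
     + (b * c * x + of_real q) * (x + 1) * (f (x / of_real q) - f x)
     = b * c * x\<^sup>2 * (-1 - a\<^sup>2 + a * s) * f x"

text \<open>The series \<open>\<^sub>3\<phi>\<^sub>2(a\<gamma>, a/\<gamma>, -1/x; ab, ac; q, -bcx)\<close>, with
  \<open>(-1/x;q)\<^sub>n (-bcx)\<^sup>n\<close> written as a polynomial in \<open>x\<close>, so that \<open>x = 0\<close> is included.\<close>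

definition bigF_term ::
  "real \<Rightarrow> complex \<Rightarrow> complex \<Rightarrow> complex \<Rightarrow> complex \<Rightarrow> complex \<Rightarrow> nat \<Rightarrow> complex" where
  "bigF_term q a b c \<gamma> x n =
     qpochn q (a * \<gamma>) n * qpochn q (a / \<gamma>) n /
       (qpochn q (of_real q) n * qpochn q (a * b) n * qpochn q (a * c) n)
     * (\<Prod>i<n. - (b * c) * (x + of_real q ^ i))"

definition bigF ::
  "real \<Rightarrow> complex \<Rightarrow> complex \<Rightarrow> complex \<Rightarrow> complex \<Rightarrow> complex \<Rightarrow> complex" where
  "bigF q a b c \<gamma> x = (\<Sum>n. bigF_term q a b c \<gamma> x n)"

text \<open>Complex parameters with \<open>|ab|, |ac|, |bc| < 1\<close>; they are taken complex because the solutions are treated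
  as holomorphic functions.\<close>

locale qpar = qbase +
  fixes a b c :: complex
  assumes abc_nz: "a \<noteq> 0" "b \<noteq> 0" "c \<noteq> 0"
    and norm_ab: "norm (a * b) < 1" and norm_ac: "norm (a * c) < 1" and norm_bc: "norm (b * c) < 1"
begin

abbreviation Q :: complex where "Q \<equiv> of_real q"

lemma ab_ac_factor_nz: "1 - a * b * Q ^ n \<noteq> 0" "1 - a * c * Q ^ n \<noteq> 0"
  using mult_q_power_neq_1[OF norm_ab, of n] mult_q_power_neq_1[OF norm_ac, of n] by auto

lemma qpochn_ab_ac_nz: "qpochn q (a * b) n \<noteq> 0" "qpochn q (a * c) n \<noteq> 0"
  using mult_q_power_neq_1[OF norm_ab] mult_q_power_neq_1[OF norm_ac]
  by (auto simp: qpochn_eq_0_iff)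

lemma qpoch_inf_ab_ac_bc_nz:
  "qpoch_inf q (a * b) \<noteq> 0" "qpoch_inf q (a * c) \<noteq> 0" "qpoch_inf q (b * c) \<noteq> 0"
  using norm_ab norm_ac norm_bc by (auto intro!: qpoch_inf_nonzero_small)

lemma bigF_majorant_summable:
  assumes r: "r \<ge> 0" "norm (b * c) * r < 1"
  shows "summable (\<lambda>n. \<Prod>i<n. norm (b * c) * (r + q ^ i))"
proof -
  define \<beta> where "\<beta> = norm (b * c)"
  have \<beta>: "\<beta> \<ge> 0" by (simp add: \<beta>_def)
  have \<beta>r: "\<beta> * r < 1" using r(2) by (simp only: \<beta>_def)
  have "(\<lambda>n. \<beta> * (r + q ^ n)) \<longlonglongrightarrow> \<beta> * (r + 0)"
    using q_pos q_less_1 by (intro tendsto_mult tendsto_add tendsto_const LIMSEQ_power_zero) auto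
  moreover have "\<beta> * (r + 0) < (1 + \<beta> * r) / 2" using \<beta>r by simp
  ultimately have "\<forall>\<^sub>F n in sequentially. \<beta> * (r + q ^ n) < (1 + \<beta> * r) / 2"
    by (rule order_tendstoD)
  then obtain N where N: "\<And>n. n \<ge> N \<Longrightarrow> \<beta> * (r + q ^ n) < (1 + \<beta> * r) / 2"
    by (auto simp: eventually_at_top_linorder)
  show ?thesis
  proof (rule summable_ratio_test[of "(1 + \<beta> * r) / 2" N], unfold \<beta>_def[symmetric])
    show "(1 + \<beta> * r) / 2 < 1" using \<beta>r by simp
    fix n assume "n \<ge> N"
    define p where "p = (\<Prod>i<n. \<beta> * (r + q ^ i))"
    have p: "p \<ge> 0" unfolding p_def using r(1) \<beta> by (intro prod_nonneg) auto
    have "norm (p * (\<beta> * (r + q ^ n))) = p * (\<beta> * (r + q ^ n))"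
      using p r(1) \<beta> by simp
    also have "\<dots> \<le> p * ((1 + \<beta> * r) / 2)"
      using N[OF \<open>n \<ge> N\<close>] p by (intro mult_left_mono) auto
    also have "\<dots> = (1 + \<beta> * r) / 2 * norm p" using p by simp
    finally show "norm (\<Prod>i<Suc n. \<beta> * (r + q ^ i)) \<le> (1 + \<beta> * r) / 2 * norm (\<Prod>i<n. \<beta> * (r + q ^ i))"
      by (simp add: p_def)
  qed
qed

lemma bigF_term_bound:
  assumes r: "r \<ge> 0" "norm (b * c) * r < 1"
  obtains M where "summable M" "\<And>x n. norm x \<le> r \<Longrightarrow> norm (bigF_term q a b c \<gamma> x n) \<le> M n"
proof -
  obtain K1 where K1: "K1 > 0" "\<And>n. norm (qpochn q (a * \<gamma>) n / qpochn q Q n) \<le> K1"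
    using q_binomial_coeff_bounded[of "a * \<gamma>"] by blast
  obtain K2 where K2: "K2 > 0" "\<And>n. norm (inverse (qpochn q (a * b) n)) \<le> K2"
    using qpochn_inverse_bounded[OF mult_q_power_neq_1[OF norm_ab]] by auto
  obtain K3 where K3: "K3 > 0" "\<And>n. norm (inverse (qpochn q (a * c) n)) \<le> K3"
    using qpochn_inverse_bounded[OF mult_q_power_neq_1[OF norm_ac]] by auto
  define K where "K = K1 * exp (norm (a / \<gamma>) / (1 - q)) * K2 * K3"
  have le: "norm (bigF_term q a b c \<gamma> x n) \<le> K * (\<Prod>i<n. norm (b * c) * (r + q ^ i))"
    if x: "norm x \<le> r" for x n
  proof -
    have P: "norm (\<Prod>i<n. - (b * c) * (x + Q ^ i)) \<le> (\<Prod>i<n. norm (b * c) * (r + q ^ i))"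
      unfolding prod_norm[symmetric]
    proof (intro prod_mono conjI)
      fix i
      have "norm (x + Q ^ i) \<le> norm x + q ^ i"
        using norm_triangle_ineq[of x "Q ^ i"] by simp
      also have "\<dots> \<le> r + q ^ i" using x by simp
      finally show "norm (- (b * c) * (x + Q ^ i)) \<le> norm (b * c) * (r + q ^ i)"
        unfolding norm_mult norm_minus_cancel by (intro mult_left_mono) auto
    qed auto
    have "bigF_term q a b c \<gamma> x n = qpochn q (a * \<gamma>) n / qpochn q Q n * qpochn q (a / \<gamma>) n *
        inverse (qpochn q (a * b) n) * inverse (qpochn q (a * c) n) *
        (\<Prod>i<n. - (b * c) * (x + Q ^ i))"
      unfolding bigF_term_def by (simp add: divide_inverse mult_ac)
    also have "norm \<dots> = norm (qpochn q (a * \<gamma>) n / qpochn q Q n) * norm (qpochn q (a / \<gamma>) n) *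
        norm (inverse (qpochn q (a * b) n)) * norm (inverse (qpochn q (a * c) n)) *
        norm (\<Prod>i<n. - (b * c) * (x + Q ^ i))"
      by (simp only: norm_mult)
    also have "\<dots> \<le> K * (\<Prod>i<n. norm (b * c) * (r + q ^ i))"
      unfolding K_def using K1(1) K2(1) K3(1)
      by (intro mult_mono K1(2) K2(2) K3(2) P norm_qpochn_le mult_nonneg_nonneg) auto
    finally show ?thesis .
  qed
  show ?thesis
    by (rule that[OF summable_mult[OF bigF_majorant_summable[OF r]] le])
qed

lemma summable_bigF:
  assumes "norm (b * c * x) < 1"
  shows "summable (bigF_term q a b c \<gamma> x)"
proof -
  have r: "norm (b * c) * norm x < 1" using assms by (simp only: norm_mult)
  obtain M where M: "summable M"
    "\<And>y n. norm y \<le> norm x \<Longrightarrow> norm (bigF_term q a b c \<gamma> y n) \<le> M n"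
    using bigF_term_bound[OF norm_ge_zero r, of \<gamma>] by blast
  show ?thesis by (rule summable_comparison_test[OF _ M(1)]) (use M(2) in blast)
qed

lemma holomorphic_bigF: "bigF q a b c \<gamma> holomorphic_on ball 0 (1 / norm (b * c))"
proof -
  have bc: "norm (b * c) > 0" using abc_nz by simp
  have "(\<lambda>x. \<Sum>n. bigF_term q a b c \<gamma> x n) holomorphic_on ball 0 (1 / norm (b * c))"
  proof (rule holomorphic_on_suminf)
    show "(\<lambda>x. bigF_term q a b c \<gamma> x n) holomorphic_on ball 0 (1 / norm (b * c))" for n
      unfolding bigF_term_def by (intro holomorphic_intros)
    fix x assume x: "x \<in> ball (0::complex) (1 / norm (b * c))"
    define d where "d = (1 / norm (b * c) - norm x) / 2"
    have d: "d > 0" using x by (simp add: d_def)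
    have "norm x + d < 1 / norm (b * c)" using x by (simp add: d_def field_simps)
    hence r: "norm (b * c) * (norm x + d) < 1" using bc by (simp add: field_simps)
    have le: "norm y \<le> norm x + d" if "y \<in> cball x d" for y
      using that norm_triangle_sub[of y x] by (simp add: dist_norm norm_minus_commute)
    obtain M where M: "summable M"
      "\<And>y n. norm y \<le> norm x + d \<Longrightarrow> norm (bigF_term q a b c \<gamma> y n) \<le> M n"
      using bigF_term_bound[OF _ r, of \<gamma>] add_nonneg_nonneg[OF norm_ge_zero less_imp_le[OF d]]
      by blast
    have "cball x d \<subseteq> ball 0 (1 / norm (b * c))"
      using le \<open>norm x + d < 1 / norm (b * c)\<close> by fastforce
    with M le d show "\<exists>d>0. \<exists>M. cball x d \<subseteq> ball 0 (1 / norm (b * c)) \<and> summable M \<and>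
        (\<forall>n. \<forall>y\<in>cball x d. norm (bigF_term q a b c \<gamma> y n) \<le> M n)"
      by (intro exI[of _ d] exI[of _ M]) auto
  qed auto
  thus ?thesis by (simp add: bigF_def[abs_def])
qed

lemma bigF_inverse: "bigF q a b c (inverse \<gamma>) = bigF q a b c \<gamma>"
  by (intro ext) (simp add: bigF_def bigF_term_def divide_inverse mult_ac)

lemma bigF_neg1: "bigF q a b c \<gamma> (-1) = 1"
proof -
  have "bigF_term q a b c \<gamma> (-1) n = (if n = 0 then 1 else 0)" for n
  proof (cases n)
    case (Suc m)
    have "(\<Prod>i<n. - (b * c) * (-1 + Q ^ i)) = 0"
      unfolding Suc by (rule prod_zero) (auto intro: bexI[of _ 0])
    thus ?thesis by (simp add: bigF_term_def Suc del: prod.lessThan_Suc)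
  qed (simp add: bigF_term_def)
  thus ?thesis using suminf_finite[of "{0}" "\<lambda>n. if n = 0 then 1 else 0 :: complex"]
    by (simp add: bigF_def)
qed

text \<open>The operator maps the \<open>n\<close>-th basis polynomial to a combination of the \<open>n\<close>-th and the
  \<open>(n-1)\<close>-st one; in the series for \<open>L f - \<mu> f\<close> these contributions telescope.\<close>

theorem bigF_qdiff:
  assumes \<gamma>: "\<gamma> \<noteq> 0" and x: "x \<noteq> 0" "norm (b * c * x) < 1" and x': "x = -1 \<or> norm (b * c * (x / Q)) < 1"
  shows "big_qdiff q a b c (\<gamma> + inverse \<gamma>) (bigF q a b c \<gamma>) x"
proof -
  define s where "s = \<gamma> + inverse \<gamma>"
  define u where "u = (\<lambda>n. qpochn q (a * \<gamma>) n * qpochn q (a / \<gamma>) n /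
       (qpochn q Q n * qpochn q (a * b) n * qpochn q (a * c) n))"
  define t where "t = (\<lambda>x n. \<Prod>i<n. - (b * c) * (x + Q ^ i))"
  have F: "bigF_term q a b c \<gamma> y n = u n * t y n" for y n
    by (simp add: bigF_term_def u_def t_def)
  have t0: "t y 0 = 1" and tS: "t y (Suc n) = t y n * (- (b * c) * (y + Q ^ n))" for y n
    by (simp_all add: t_def)
  have t1: "t (Q * x) (Suc n) = - (b * c) * Q ^ n * (Q * x + 1) * t x n" for n
  proof (induction n)
    case (Suc n)
    have "t (Q * x) (Suc (Suc n)) = - (b * c) * Q ^ n * (Q * x + 1) * t x n
        * (- (b * c) * (Q * x + Q ^ Suc n))"
      unfolding tS[of _ "Suc n"] Suc.IH ..
    also have "\<dots> = - (b * c) * Q ^ Suc n * (Q * x + 1) * (t x n * (- (b * c) * (x + Q ^ n)))"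
      by (simp add: algebra_simps)
    finally show ?case unfolding tS[of x n] .
  qed (simp add: t0 tS)
  have t3: "Q ^ n * ((x + 1) * t (x / Q) n) = t x n * (x + Q ^ n)" for n
  proof (induction n)
    case (Suc n)
    have "Q ^ Suc n * ((x + 1) * t (x / Q) (Suc n))
        = (Q ^ n * ((x + 1) * t (x / Q) n)) * (- (b * c) * (Q * (x / Q) + Q ^ Suc n))"
    proof -
      have "Q * (x / Q) + Q ^ Suc n = Q * (x / Q + Q ^ n)" by (simp add: distrib_left)
      thus ?thesis unfolding tS by (simp only: power_Suc mult_ac)
    qed
    also have "\<dots> = t x (Suc n) * (x + Q ^ Suc n)"
      unfolding Suc.IH tS by simp
    finally show ?case .
  qed (simp add: t0)
  have uS: "u (Suc n) * ((1 - Q * Q ^ n) * (1 - a * b * Q ^ n) * (1 - a * c * Q ^ n))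
      = u n * ((1 - a * \<gamma> * Q ^ n) * (1 - a / \<gamma> * Q ^ n))" for n
  proof -
    have "1 - Q * Q ^ n \<noteq> 0" using q_neq_1[of n, where 'a=complex] by simp
    moreover have "(p1 * e1 * (p2 * e2)) / (r1 * d1 * (r2 * d2) * (r3 * d3)) * (d1 * d2 * d3)
        = p1 * p2 / (r1 * r2 * r3) * (e1 * e2)"
      if "d1 \<noteq> 0" "d2 \<noteq> 0" "d3 \<noteq> 0" for p1 p2 e1 e2 r1 r2 r3 d1 d2 d3 :: complex
      using that by (simp add: mult_ac)
    ultimately show ?thesis unfolding u_def qpochn_Suc using ab_ac_factor_nz[of n] by blast
  qed
  define \<mu>' where "\<mu>' = (\<lambda>n. a\<^sup>2 * Q ^ n + 1 / Q ^ n - a * s)"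
  define U where "U = (\<lambda>n. \<mu>' n * (u n * t x n))"
  define Lt where "Lt = (\<lambda>n. (a * b * x + 1) * (a * c * x + 1) * (u n * t (Q * x) n - u n * t x n)
      + (b * c * x + Q) * ((x + 1) * (u n * t (x / Q) n) - (x + 1) * (u n * t x n))
      - b * c * x\<^sup>2 * (-1 - a\<^sup>2 + a * s) * (u n * t x n))"
  have L0: "Lt 0 = b * c * x\<^sup>2 * U 0"
    by (simp add: Lt_def U_def t0 u_def \<mu>'_def algebra_simps)
  have LS: "Lt (Suc n) = b * c * x\<^sup>2 * (U (Suc n) - U n)" for n
  proof -
    define X where "X = Q ^ n"
    define v where "v = u (Suc n)"
    define T where "T = t x n"
    have X: "X \<noteq> 0" by (simp add: X_def)
    have e1: "t (Q * x) (Suc n) = - (b * c) * X * (Q * x + 1) * T"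
      using t1 by (simp add: X_def T_def)
    have e2: "t x (Suc n) = T * (- (b * c) * (x + X))" by (simp add: tS T_def X_def)
    have e3: "(x + 1) * t (x / Q) (Suc n) * (Q * X) = T * (- (b * c) * (x + X)) * (x + Q * X)"
      using t3[of "Suc n"] unfolding e2 by (simp add: X_def mult_ac)
    define \<delta> where "\<delta> = - (b * c) * (x + X)"
    define \<alpha> where "\<alpha> = (a * b * x + 1) * (a * c * x + 1)"
    define \<eta> where "\<eta> = b * c * x + Q"
    define \<kappa> where "\<kappa> = b * c * x\<^sup>2 * (-1 - a\<^sup>2 + a * s)"
    define \<beta> where "\<beta> = - (b * c) * X * (Q * x + 1)"
    define \<pi> where "\<pi> = (1 - Q * X) * (1 - a * b * X) * (1 - a * c * X)"
    have "\<mu>' n * X = a\<^sup>2 * X * X + 1 - a * s * X"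
      using X by (simp add: \<mu>'_def X_def[symmetric] distrib_right left_diff_distrib)
    also have "\<dots> = (1 - a * \<gamma> * X) * (1 - a / \<gamma> * X)"
      using \<gamma> by (simp add: s_def field_simps power2_eq_square)
    finally have mu: "\<mu>' n * X = (1 - a * \<gamma> * X) * (1 - a / \<gamma> * X)" .
    have "U n * X = u n * (\<mu>' n * X) * T" by (simp add: U_def T_def)
    also have "\<dots> = v * \<pi> * T"
      unfolding mu using uS[of n] by (simp add: X_def v_def \<pi>_def)
    finally have Un: "U n * X = v * \<pi> * T" .
    have mu': "\<mu>' (Suc n) * (Q * X) = a\<^sup>2 * (Q * X) * (Q * X) + 1 - a * s * (Q * X)"
      using X by (simp add: \<mu>'_def X_def[symmetric] distrib_right left_diff_distrib)
    have "U (Suc n) * (Q * X) = \<mu>' (Suc n) * (Q * X) * (v * (T * \<delta>))"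
      by (simp add: U_def v_def e2 \<delta>_def)
    hence US: "U (Suc n) * (Q * X) = (a\<^sup>2 * (Q * X) * (Q * X) + 1 - a * s * (Q * X)) * (v * (T * \<delta>))"
      unfolding mu' .
    have "Lt (Suc n) * (Q * X) = v * ((\<alpha> * (\<beta> * T - T * \<delta>) - \<eta> * ((x + 1) * (T * \<delta>)) - \<kappa> * (T * \<delta>)) * (Q * X)
        + \<eta> * ((x + 1) * t (x / Q) (Suc n) * (Q * X)))"
      unfolding Lt_def e1 e2 v_def[symmetric] \<alpha>_def[symmetric] \<beta>_def[symmetric] \<delta>_def[symmetric]
        \<eta>_def[symmetric] \<kappa>_def[symmetric]
      by (simp add: algebra_simps)
    also have "\<dots> = v * T * ((\<alpha> * (\<beta> - \<delta>) - \<eta> * (x + 1) * \<delta> - \<kappa> * \<delta>) * (Q * X) + \<eta> * \<delta> * (x + Q * X))"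
      unfolding e3 \<delta>_def[symmetric] by (simp add: algebra_simps)
    also have "(\<alpha> * (\<beta> - \<delta>) - \<eta> * (x + 1) * \<delta> - \<kappa> * \<delta>) * (Q * X) + \<eta> * \<delta> * (x + Q * X)
      = b * c * x\<^sup>2 * ((a\<^sup>2 * (Q * X) * (Q * X) + 1 - a * s * (Q * X)) * \<delta> - \<pi> * Q)"
      unfolding \<alpha>_def \<beta>_def \<delta>_def \<eta>_def \<kappa>_def \<pi>_def
      by (simp add: algebra_simps power2_eq_square)
    also have "v * T * (b * c * x\<^sup>2 * ((a\<^sup>2 * (Q * X) * (Q * X) + 1 - a * s * (Q * X)) * \<delta> - \<pi> * Q))
        = b * c * x\<^sup>2 * (U (Suc n) * (Q * X) - U n * X * Q)"
      unfolding US Un by (simp add: algebra_simps)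
    also have "\<dots> = b * c * x\<^sup>2 * (U (Suc n) - U n) * (Q * X)" by (simp add: algebra_simps)
    finally show ?thesis using X by simp
  qed
  have partial: "(\<Sum>n<Suc N. Lt n) = b * c * x\<^sup>2 * U N" for N
  proof (induction N)
    case (Suc N)
    have "(\<Sum>n<Suc (Suc N). Lt n) = (\<Sum>n<Suc N. Lt n) + Lt (Suc N)" by simp
    also have "\<dots> = b * c * x\<^sup>2 * U (Suc N)" unfolding Suc.IH LS by (simp add: algebra_simps)
    finally show ?case .
  qed (simp add: L0)
  have qx: "norm (b * c * (Q * x)) < 1"
  proof -
    have "norm (b * c * (Q * x)) = q * norm (b * c * x)" by (simp add: norm_mult)
    also have "\<dots> \<le> 1 * norm (b * c * x)" using q_less_1 by (intro mult_right_mono) auto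
    finally show ?thesis using x by simp
  qed
  have sm: "summable (\<lambda>n. u n * t x n)" "summable (\<lambda>n. u n * t (Q * x) n)"
    using summable_bigF[OF x(2), of \<gamma>] summable_bigF[OF qx, of \<gamma>] by (simp_all add: F[abs_def])
  have sums1: "(\<lambda>n. (x + 1) * (u n * t (x / Q) n)) sums ((x + 1) * bigF q a b c \<gamma> (x / Q))"
  proof (cases "x = -1")
    case False
    hence "summable (\<lambda>n. u n * t (x / Q) n)"
      using summable_bigF[of "x / Q" \<gamma>] x' by (simp add: F[abs_def])
    thus ?thesis unfolding bigF_def F by (intro sums_mult summable_sums)
  qed simp
  have Lsums: "Lt sums ((a * b * x + 1) * (a * c * x + 1) * (bigF q a b c \<gamma> (Q * x) - bigF q a b c \<gamma> x)
      + (b * c * x + Q) * ((x + 1) * bigF q a b c \<gamma> (x / Q) - (x + 1) * bigF q a b c \<gamma> x)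
      - b * c * x\<^sup>2 * (-1 - a\<^sup>2 + a * s) * bigF q a b c \<gamma> x)"
    unfolding Lt_def
    by (intro sums_add sums_diff sums_mult sums1) (unfold bigF_def F, (intro summable_sums sm)+)
  have "U \<longlonglongrightarrow> 0"
  proof -
    have Qlim: "(\<lambda>n. Q ^ n) \<longlonglongrightarrow> 0"
      using q_pos q_less_1 by (intro LIMSEQ_power_zero) auto
    have "(\<lambda>n. (x + 1) * (u n * t (x / Q) n)) \<longlonglongrightarrow> 0"
      using sums1 by (intro summable_LIMSEQ_zero sums_summable)
    hence "(\<lambda>n. (x + 1) * (u n * t (x / Q) n) * ((a\<^sup>2 * Q ^ n * Q ^ n + 1 - a * s * Q ^ n) / (x + Q ^ n)))
        \<longlonglongrightarrow> 0 * ((a\<^sup>2 * 0 * 0 + 1 - a * s * 0) / (x + 0))"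
      using x by (intro tendsto_mult tendsto_divide tendsto_add tendsto_diff tendsto_const Qlim) auto
    moreover have "\<forall>\<^sub>F n in sequentially. (x + 1) * (u n * t (x / Q) n)
        * ((a\<^sup>2 * Q ^ n * Q ^ n + 1 - a * s * Q ^ n) / (x + Q ^ n)) = U n"
    proof -
      have "\<forall>\<^sub>F n in sequentially. x + Q ^ n \<noteq> 0"
        using x tendsto_imp_eventually_ne[OF tendsto_add[OF tendsto_const Qlim], of x 0] by simp
      thus ?thesis
      proof eventually_elim
        case (elim n)
        have "(x + 1) * t (x / Q) n = t x n * (x + Q ^ n) / Q ^ n"
          using t3[of n] by (simp add: field_simps)
        hence e: "(x + 1) * (u n * t (x / Q) n) = u n * (t x n * (x + Q ^ n) / Q ^ n)"
          by (simp only: mult.left_commute)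
        have "\<mu>' n = (a\<^sup>2 * Q ^ n * Q ^ n + 1 - a * s * Q ^ n) / Q ^ n"
          by (simp add: \<mu>'_def add_divide_distrib diff_divide_distrib)
        thus ?case unfolding e U_def using elim by simp
      qed
    qed
    ultimately show ?thesis by (simp add: tendsto_cong)
  qed
  hence "(\<lambda>N. b * c * x\<^sup>2 * U N) \<longlonglongrightarrow> b * c * x\<^sup>2 * 0" by (intro tendsto_intros)
  hence "(\<lambda>N. \<Sum>n<Suc N. Lt n) \<longlonglongrightarrow> 0" unfolding partial by simp
  hence "Lt sums 0"
    unfolding sums_def using filterlim_sequentially_Suc[of "\<lambda>N. \<Sum>n<N. Lt n"] by blast
  from sums_unique2[OF Lsums this] show ?thesis
    by (simp add: big_qdiff_def s_def algebra_simps)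
qed

end

section \<open>A representation of the solution valid for all positive arguments\<close>

text \<open>The transformation of \<open>\<^sub>3\<phi>\<^sub>2(a\<gamma>, a/\<gamma>, -1/x; ab, ac; q, -bcx)\<close> into a multiple of
  \<open>\<^sub>3\<phi>\<^sub>2(a\<gamma>, c\<gamma>, -acx; ac, -abc\<gamma>x; q, b/\<gamma>)\<close>, which converges for \<open>|\<gamma>| > |b|\<close> and all \<open>x\<close>. The
  series \<open>bigG\<close> contains the factor \<open>(-abc\<gamma>x;q)\<^sub>\<infinity>\<close>, and is entire in \<open>x\<close>; \<open>bigE\<close> is its multiple by
  \<open>(b/\<gamma>;q)\<^sub>\<infinity> / (ab, -bcx;q)\<^sub>\<infinity>\<close>, so that \<open>bigE\<close> equals \<open>1\<close> at \<open>x = -1\<close>.\<close>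

definition bigG_coeff :: "real \<Rightarrow> complex \<Rightarrow> complex \<Rightarrow> complex \<Rightarrow> complex \<Rightarrow> nat \<Rightarrow> complex" where
  "bigG_coeff q a b c \<gamma> n = qpochn q (a * \<gamma>) n * qpochn q (c * \<gamma>) n /
       (qpochn q (of_real q) n * qpochn q (a * c) n)"

definition bigG_term ::
  "real \<Rightarrow> complex \<Rightarrow> complex \<Rightarrow> complex \<Rightarrow> complex \<Rightarrow> complex \<Rightarrow> nat \<Rightarrow> complex" where
  "bigG_term q a b c \<gamma> x n = bigG_coeff q a b c \<gamma> n * qpochn q (- (a * c * x)) n
     * qpoch_inf q (- (a * b * c * \<gamma> * x) * of_real q ^ n) * (b / \<gamma>) ^ n"

definition bigG ::
  "real \<Rightarrow> complex \<Rightarrow> complex \<Rightarrow> complex \<Rightarrow> complex \<Rightarrow> complex \<Rightarrow> complex" where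
  "bigG q a b c \<gamma> x = (\<Sum>n. bigG_term q a b c \<gamma> x n)"

definition bigE ::
  "real \<Rightarrow> complex \<Rightarrow> complex \<Rightarrow> complex \<Rightarrow> complex \<Rightarrow> complex \<Rightarrow> complex" where
  "bigE q a b c \<gamma> x = qpoch_inf q (b / \<gamma>) * bigG q a b c \<gamma> x /
     (qpoch_inf q (a * b) * qpoch_inf q (- (b * c * x)))"

context qpar
begin

lemma bigG_coeff_bound:
  obtains K where "K > 0" "\<And>\<gamma> n. norm \<gamma> \<le> R \<Longrightarrow> norm (bigG_coeff q a b c \<gamma> n) \<le> K"
proof -
  obtain K1 where K1: "K1 > 0" "\<And>n. norm (inverse (qpochn q Q n)) \<le> K1"
    using qpochn_inverse_bounded[of Q] by auto
  obtain K2 where K2: "K2 > 0" "\<And>n. norm (inverse (qpochn q (a * c) n)) \<le> K2"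
    using qpochn_inverse_bounded[OF mult_q_power_neq_1[OF norm_ac]] by auto
  define K where "K = exp (norm a * R / (1 - q)) * exp (norm c * R / (1 - q)) * K1 * K2"
  have "norm (bigG_coeff q a b c \<gamma> n) \<le> K" if \<gamma>: "norm \<gamma> \<le> R" for \<gamma> n
  proof -
    have P: "norm (qpochn q (y * \<gamma>) n) \<le> exp (norm y * R / (1 - q))" for y
    proof -
      have "norm (y * \<gamma>) / (1 - q) \<le> norm y * R / (1 - q)"
        unfolding norm_mult using \<gamma> q_less_1 by (intro divide_right_mono mult_left_mono) auto
      thus ?thesis by (rule order_trans[OF norm_qpochn_le iffD2[OF exp_le_cancel_iff]])
    qed
    have "bigG_coeff q a b c \<gamma> n = qpochn q (a * \<gamma>) n * qpochn q (c * \<gamma>) n *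
        inverse (qpochn q Q n) * inverse (qpochn q (a * c) n)"
      by (simp add: bigG_coeff_def divide_inverse mult_ac)
    also have "norm \<dots> = norm (qpochn q (a * \<gamma>) n) * norm (qpochn q (c * \<gamma>) n) *
        norm (inverse (qpochn q Q n)) * norm (inverse (qpochn q (a * c) n))"
      by (simp only: norm_mult)
    also have "\<dots> \<le> K"
      unfolding K_def using K1(1) K2(1)
      by (intro mult_mono P K1(2) K2(2) mult_nonneg_nonneg) auto
    finally show ?thesis .
  qed
  moreover have "K > 0" unfolding K_def using K1(1) K2(1) by simp
  ultimately show ?thesis using that by blast
qed

lemma bigG_term_bound:
  obtains K where "K > 0"
    "\<And>\<gamma> x n. norm \<gamma> \<le> R \<Longrightarrow> norm x \<le> X \<Longrightarrow> norm (b / \<gamma>) \<le> \<rho> \<Longrightarrow>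
       norm (bigG_term q a b c \<gamma> x n) \<le> K * \<rho> ^ n"
proof -
  obtain K1 where K1: "K1 > 0" "\<And>\<gamma> n. norm \<gamma> \<le> R \<Longrightarrow> norm (bigG_coeff q a b c \<gamma> n) \<le> K1"
    using bigG_coeff_bound[of R] by blast
  define K where "K = K1 * exp (norm (a * c) * X / (1 - q)) * exp (norm (a * b * c) * R * X / (1 - q))"
  have "norm (bigG_term q a b c \<gamma> x n) \<le> K * \<rho> ^ n"
    if \<gamma>: "norm \<gamma> \<le> R" "norm (b / \<gamma>) \<le> \<rho>" and x: "norm x \<le> X" for \<gamma> x n
  proof -
    have X: "X \<ge> 0" "R \<ge> 0" using x \<gamma>(1) norm_ge_zero order_trans by blast+
    have "norm (- (a * c * x)) / (1 - q) \<le> norm (a * c) * X / (1 - q)"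
      unfolding norm_minus_cancel norm_mult[of _ x] using x q_less_1
      by (intro divide_right_mono mult_left_mono) auto
    hence P1: "norm (qpochn q (- (a * c * x)) n) \<le> exp (norm (a * c) * X / (1 - q))"
      by (rule order_trans[OF norm_qpochn_le iffD2[OF exp_le_cancel_iff]])
    have "norm (- (a * b * c * \<gamma> * x) * Q ^ n) / (1 - q) \<le> norm (a * b * c) * R * X * 1 / (1 - q)"
      unfolding norm_minus_cancel norm_mult[of _ x] norm_mult[of _ \<gamma>] norm_mult[of _ "Q ^ n"]
      using x \<gamma>(1) q_less_1 X
      by (intro divide_right_mono mult_mono mult_nonneg_nonneg) (auto simp: q_power_le)
    hence P2: "norm (qpoch_inf q (- (a * b * c * \<gamma> * x) * Q ^ n))
        \<le> exp (norm (a * b * c) * R * X / (1 - q))"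
      unfolding mult_1_right by (rule order_trans[OF norm_qpoch_inf_le iffD2[OF exp_le_cancel_iff]])
    show ?thesis
      unfolding K_def bigG_term_def norm_mult[of _ "qpoch_inf _ _"] norm_mult[of _ "_ ^ n"]
        norm_mult[of _ "qpochn _ _ _"] norm_power
      using K1(1) \<gamma>
      by (intro mult_mono K1(2) P1 P2 power_mono mult_nonneg_nonneg) auto
  qed
  moreover have "K > 0" unfolding K_def using K1(1) by simp
  ultimately show ?thesis using that by blast
qed

lemma summable_bigG:
  assumes "norm (b / \<gamma>) < 1"
  shows "summable (bigG_term q a b c \<gamma> x)"
proof -
  obtain K where K: "K > 0" "\<And>\<gamma>' y n. norm \<gamma>' \<le> norm \<gamma> \<Longrightarrow> norm y \<le> norm x \<Longrightarrow> norm (b / \<gamma>') \<le> norm (b / \<gamma>) \<Longrightarrow>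
       norm (bigG_term q a b c \<gamma>' y n) \<le> K * norm (b / \<gamma>) ^ n"
    using bigG_term_bound[of "norm \<gamma>" "norm x" "norm (b / \<gamma>)"] by blast
  have "summable (\<lambda>n. K * norm (b / \<gamma>) ^ n)"
    using assms by (intro summable_mult summable_geometric) auto
  moreover have "norm (bigG_term q a b c \<gamma> x n) \<le> K * norm (b / \<gamma>) ^ n" for n
    by (rule K(2)) simp_all
  ultimately show ?thesis by (rule summable_comparison_test')
qed

lemma bigG_bounded:
  assumes "\<rho> < 1"
  obtains K where "\<And>\<gamma> x. norm \<gamma> \<le> R \<Longrightarrow> norm x \<le> X \<Longrightarrow> norm (b / \<gamma>) \<le> \<rho> \<Longrightarrow>
       norm (bigG q a b c \<gamma> x) \<le> K"
proof -
  obtain K where K: "K > 0" "\<And>\<gamma> x n. norm \<gamma> \<le> R \<Longrightarrow> norm x \<le> X \<Longrightarrow> norm (b / \<gamma>) \<le> \<rho> \<Longrightarrow>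
       norm (bigG_term q a b c \<gamma> x n) \<le> K * \<rho> ^ n"
    using bigG_term_bound[of R X \<rho>] by blast
  have "norm (bigG q a b c \<gamma> x) \<le> (\<Sum>n. K * \<rho> ^ n)"
    if "norm \<gamma> \<le> R" "norm x \<le> X" "norm (b / \<gamma>) \<le> \<rho>" for \<gamma> x
  proof -
    have "\<rho> \<ge> 0" using that(3) norm_ge_zero order_trans by blast
    hence "summable (\<lambda>n. K * \<rho> ^ n)"
      using assms by (intro summable_mult summable_geometric) auto
    thus ?thesis unfolding bigG_def
      by (intro norm_suminf_le K(2)[OF that])
  qed
  thus ?thesis using that by blast
qed

lemma holomorphic_bigG_x:
  assumes "norm (b / \<gamma>) < 1"
  shows "bigG q a b c \<gamma> holomorphic_on UNIV"
proof -
  have "(\<lambda>x. \<Sum>n. bigG_term q a b c \<gamma> x n) holomorphic_on UNIV"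
  proof (rule holomorphic_on_suminf)
    show "(\<lambda>x. bigG_term q a b c \<gamma> x n) holomorphic_on UNIV" for n
      unfolding bigG_term_def by (intro holomorphic_intros)
    fix x :: complex
    obtain K where K: "K > 0" "\<And>\<gamma>' y n. norm \<gamma>' \<le> norm \<gamma> \<Longrightarrow> norm y \<le> norm x + 1 \<Longrightarrow>
        norm (b / \<gamma>') \<le> norm (b / \<gamma>) \<Longrightarrow> norm (bigG_term q a b c \<gamma>' y n) \<le> K * norm (b / \<gamma>) ^ n"
      using bigG_term_bound[of "norm \<gamma>" "norm x + 1" "norm (b / \<gamma>)"] by blast
    have "norm y \<le> norm x + 1" if "y \<in> cball x 1" for y
      using that norm_triangle_sub[of y x] by (simp add: dist_norm norm_minus_commute)
    with K(2)[OF order_refl _ order_refl] have "\<forall>n. \<forall>y\<in>cball x 1. norm (bigG_term q a b c \<gamma> y n) \<le> K * norm (b / \<gamma>) ^ n" by blast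
    moreover have "summable (\<lambda>n. K * norm (b / \<gamma>) ^ n)"
      using assms by (intro summable_mult summable_geometric) auto
    ultimately show "\<exists>d>0. \<exists>M. cball x d \<subseteq> UNIV \<and> summable M \<and>
        (\<forall>n. \<forall>y\<in>cball x d. norm (bigG_term q a b c \<gamma> y n) \<le> M n)"
      by (intro exI[of _ "1::real"] exI[of _ "\<lambda>n. K * norm (b / \<gamma>) ^ n"] conjI) simp_all
  qed auto
  thus ?thesis by (simp add: bigG_def[abs_def])
qed

lemma open_norm_gt: "open {\<gamma>::complex. norm \<gamma> > r}"
  by (intro open_Collect_less continuous_intros)

lemma holomorphic_bigG_\<gamma>: "(\<lambda>\<gamma>. bigG q a b c \<gamma> x) holomorphic_on {\<gamma>. norm \<gamma> > norm b}"
proof -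
  have "(\<lambda>\<gamma>. \<Sum>n. bigG_term q a b c \<gamma> x n) holomorphic_on {\<gamma>. norm \<gamma> > norm b}"
  proof (rule holomorphic_on_suminf[OF open_norm_gt])
    show "(\<lambda>\<gamma>. bigG_term q a b c \<gamma> x n) holomorphic_on {\<gamma>. norm \<gamma> > norm b}" for n
      unfolding bigG_term_def bigG_coeff_def
      using qpochn_ab_ac_nz by (intro holomorphic_intros) auto
    fix \<gamma> :: complex assume \<gamma>: "\<gamma> \<in> {\<gamma>. norm \<gamma> > norm b}"
    define d where "d = (norm \<gamma> - norm b) / 2"
    have d: "d > 0" using \<gamma> by (simp add: d_def)
    define \<rho> where "\<rho> = norm b / (norm b + d)"
    have b: "norm b > 0" using abc_nz by simp
    have "0 < norm b + d" using d b by linarith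
    hence \<rho>: "0 \<le> \<rho>" "\<rho> < 1" using d by (simp_all add: \<rho>_def divide_less_eq)
    have lower: "norm b + d \<le> norm y" and upper: "norm y \<le> norm \<gamma> + d" if "y \<in> cball \<gamma> d" for y
    proof -
      have "norm (\<gamma> - y) \<le> d" using that by (simp add: dist_norm)
      moreover have "norm \<gamma> = norm b + 2 * d" by (simp add: d_def field_simps)
      ultimately show "norm b + d \<le> norm y" "norm y \<le> norm \<gamma> + d"
        using norm_triangle_sub[of \<gamma> y] norm_triangle_sub[of y \<gamma>]
        by (simp_all add: norm_minus_commute)
    qed
    have ratio: "norm (b / y) \<le> \<rho>" if "y \<in> cball \<gamma> d" for y
      unfolding norm_divide \<rho>_def
      by (rule frac_le[OF norm_ge_zero order_refl \<open>0 < norm b + d\<close> lower[OF that]])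
    obtain K where K: "K > 0" "\<And>y x' n. norm y \<le> norm \<gamma> + d \<Longrightarrow> norm x' \<le> norm x \<Longrightarrow>
        norm (b / y) \<le> \<rho> \<Longrightarrow> norm (bigG_term q a b c y x' n) \<le> K * \<rho> ^ n"
      using bigG_term_bound[of "norm \<gamma> + d" "norm x" \<rho>] by blast
    have "\<forall>n. \<forall>y\<in>cball \<gamma> d. norm (bigG_term q a b c y x n) \<le> K * \<rho> ^ n"
      using K(2)[OF upper order_refl ratio] by blast
    moreover have "summable (\<lambda>n. K * \<rho> ^ n)"
      using \<rho> by (intro summable_mult summable_geometric) auto
    moreover have "cball \<gamma> d \<subseteq> {\<gamma>. norm \<gamma> > norm b}" using lower d by fastforce
    ultimately show "\<exists>d>0. \<exists>M. cball \<gamma> d \<subseteq> {\<gamma>. norm \<gamma> > norm b} \<and> summable M \<and>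
        (\<forall>n. \<forall>y\<in>cball \<gamma> d. norm (bigG_term q a b c y x n) \<le> M n)"
      using d by (intro exI[of _ d] exI[of _ "\<lambda>n. K * \<rho> ^ n"] conjI) simp_all
  qed
  thus ?thesis by (simp add: bigG_def)
qed

lemma bigG_qdiff:
  assumes \<gamma>: "\<gamma> \<noteq> 0" "norm (b / \<gamma>) < 1"
  shows "(a * b * x + 1) * (a * c * x + 1) * (1 + b * c * x) * bigG q a b c \<gamma> (Q * x)
    + Q * (x + 1) * bigG q a b c \<gamma> (x / Q)
    = ((a * b + a * c + b * c + Q) * x + 1 + Q + a * b * c * (\<gamma> + inverse \<gamma>) * x\<^sup>2) * bigG q a b c \<gamma> x"
proof -
  define g where "g = inverse \<gamma>"
  have \<gamma>g: "\<gamma> * g = 1" using \<gamma> by (simp add: g_def)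
  define v where "v = - (a * c * x)"
  define Y where "Y = a * b * c * \<gamma> * x"
  define C where "C = (\<lambda>n. bigG_coeff q a b c \<gamma> n * (b / \<gamma>) ^ n)"
  define W where "W = (\<lambda>n. qpoch_inf q (- (Y * Q ^ n)))"
  define r where "r = - (a * c * x\<^sup>2 * (1 - b * \<gamma>))"
  define Z where "Z = (a * b + a * c + b * c + Q) * x + 1 + Q + a * b * c * (\<gamma> + g) * x\<^sup>2"
  define L where "L = (\<lambda>n. (a * b * x + 1) * (a * c * x + 1) * (1 + b * c * x) * bigG_term q a b c \<gamma> (Q * x) n
     + Q * (x + 1) * bigG_term q a b c \<gamma> (x / Q) n - Z * bigG_term q a b c \<gamma> x n)"
  define U where "U = (\<lambda>n. r * C (Suc n) * (1 - Q * Q ^ n) * (1 - a * c * Q ^ n) * qpochn q v n * W (Suc n))"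
  have CS: "C (Suc n) * ((1 - Q * Q ^ n) * (1 - a * c * Q ^ n))
      = C n * ((1 - a * \<gamma> * Q ^ n) * (1 - c * \<gamma> * Q ^ n) * (b * g))" for n
  proof -
    have nz: "1 - Q * Q ^ n \<noteq> 0" using q_neq_1[of n, where 'a=complex] by simp
    have "(p1 * e1 * (p2 * e2)) / (r1 * d1 * (r2 * d2)) * (z * zn) * (d1 * d2)
        = p1 * p2 / (r1 * r2) * zn * (e1 * e2 * z)"
      if "d1 \<noteq> 0" "d2 \<noteq> 0" for p1 p2 e1 e2 r1 r2 d1 d2 z zn :: complex
      using that by (simp add: mult_ac)
    thus ?thesis unfolding C_def bigG_coeff_def qpochn_Suc power_Suc g_def divide_inverse[of b, symmetric]
      using nz ab_ac_factor_nz(2)[of n] by blast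
  qed
  have WS: "W n = (1 + Y * Q ^ n) * W (Suc n)" for n
    using qpoch_inf_step[of "- (Y * Q ^ n)"] by (simp add: W_def mult_ac)
  have T1: "bigG_term q a b c \<gamma> x n = C n * qpochn q v n * W n" for n
    by (simp add: bigG_term_def C_def W_def v_def Y_def mult_ac)
  have T2: "bigG_term q a b c \<gamma> (Q * x) n = C n * qpochn q (v * Q) n * W (Suc n)" for n
    by (simp add: bigG_term_def C_def W_def v_def Y_def mult_ac)
  have T3: "bigG_term q a b c \<gamma> (x / Q) n
      = C n * qpochn q (v / Q) n * ((1 + Y * Q ^ n / Q) * W n)" for n
  proof -
    have "qpoch_inf q (- (a * b * c * \<gamma> * (x / Q)) * Q ^ n) = (1 + Y * Q ^ n / Q) * W n"
      using qpoch_inf_step[of "- (a * b * c * \<gamma> * (x / Q)) * Q ^ n"] by (simp add: W_def Y_def)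
    thus ?thesis by (simp add: bigG_term_def C_def v_def)
  qed
  have v': "1 - v = a * c * x + 1" by (simp add: v_def)
  have L_eq: "L n = C n * ((a * b * x + 1) * (1 + b * c * x) * ((1 - v) * qpochn q (v * Q) n) * W (Suc n)
      + Q * (x + 1) * qpochn q (v / Q) n * ((1 + Y * Q ^ n / Q) * W n)
      - Z * (qpochn q v n * W n))" for n
  proof -
    have "A * B * D * (K * h * w) + E * (K * k * l) - Z * (K * m * w')
        = K * (A * D * (B * h) * w + E * k * l - Z * (m * w'))" for A B D K h w E k l m w' :: complex
      by (simp add: algebra_simps)
    thus ?thesis unfolding L_def T1 T2 T3 v' by blast
  qed
  have L0: "L 0 = U 0"
  proof -
    have "U 0 = r * (C 1 * ((1 - Q * Q ^ 0) * (1 - a * c * Q ^ 0))) * W 1" by (simp add: U_def)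
    also have "\<dots> = C 0 * (r * ((1 - a * \<gamma>) * (1 - c * \<gamma>) * (b * g))) * W 1"
      using CS[of 0] by simp
    finally have U0: "U 0 = C 0 * (r * ((1 - a * \<gamma>) * (1 - c * \<gamma>) * (b * g))) * W 1" .
    have W0: "W 0 = (1 + Y) * W 1" using WS[of 0] by simp
    have QY: "Q * (x + 1) * ((1 + Y / Q) * w) = (x + 1) * (Q + Y) * w" for w
    proof -
      have "Q * (1 + Y / Q) = Q + Y" by (simp add: distrib_left)
      hence "(x + 1) * (Q * (1 + Y / Q)) * w = (x + 1) * (Q + Y) * w" by (simp only:)
      thus ?thesis by (simp only: mult_ac)
    qed
    have "L 0 = C 0 * ((a * b * x + 1) * (1 + b * c * x) * (1 - v) * W 1
        + Q * (x + 1) * ((1 + Y / Q) * ((1 + Y) * W 1)) - Z * ((1 + Y) * W 1))"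
      unfolding L_eq W0 by simp
    also have "\<dots> = C 0 * ((a * b * x + 1) * (1 + b * c * x) * (1 - v)
        + (x + 1) * (Q + Y) * (1 + Y) - Z * (1 + Y)) * W 1"
      unfolding QY by (simp add: algebra_simps)
    also have "(a * b * x + 1) * (1 + b * c * x) * (1 - v) + (x + 1) * (Q + Y) * (1 + Y) - Z * (1 + Y)
        = r * ((1 - a * \<gamma>) * (1 - c * \<gamma>) * (b * g))"
      using \<gamma>g unfolding v_def Y_def Z_def r_def by algebra
    finally show ?thesis unfolding U0 .
  qed
  have LS: "L (Suc n) = U (Suc n) - U n" for n
  proof -
    define X where "X = Q ^ n"
    define H where "H = qpochn q v n"
    define V where "V = W (Suc (Suc n))"
    have W1: "W (Suc n) = (1 + Y * Q * X) * V"
      unfolding V_def using WS[of "Suc n"] by (simp add: X_def mult_ac)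
    have h1: "(1 - v) * qpochn q (v * Q) (Suc n) = H * (1 - v * X) * (1 - v * Q * X)"
    proof -
      have "(1 - v) * qpochn q (v * Q) (Suc n) = qpochn q v (Suc (Suc n))"
        by (simp only: qpochn_Suc_left[of q v])
      thus ?thesis by (simp add: qpochn_Suc H_def X_def mult_ac)
    qed
    have h2: "qpochn q v (Suc n) = H * (1 - v * X)" by (simp add: qpochn_Suc H_def X_def)
    have h3: "Q * qpochn q (v / Q) (Suc n) = (Q - v) * H"
      unfolding qpochn_Suc_left H_def by (simp add: left_diff_distrib right_diff_distrib)
    have U1: "U (Suc n) = C (Suc n) * (r * ((1 - a * \<gamma> * (Q * X)) * (1 - c * \<gamma> * (Q * X)) * (b * g))) * (H * (1 - v * X)) * V"
    proof -
      have "U (Suc n) = r * (C (Suc (Suc n)) * ((1 - Q * Q ^ Suc n) * (1 - a * c * Q ^ Suc n))) * qpochn q v (Suc n) * V"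
        unfolding U_def V_def by (simp only: mult_ac)
      thus ?thesis unfolding CS h2 by (simp add: X_def mult_ac)
    qed
    have U2: "U n = C (Suc n) * (r * ((1 - Q * X) * (1 - a * c * X))) * H * ((1 + Y * Q * X) * V)"
      unfolding U_def W1 H_def X_def by (simp only: mult_ac)
    have "Q * (x + 1) * qpochn q (v / Q) (Suc n) * ((1 + Y * Q ^ Suc n / Q) * W (Suc n))
        = (x + 1) * (Q * qpochn q (v / Q) (Suc n)) * ((1 + Y * X) * W (Suc n))"
      by (simp add: X_def)
    hence "L (Suc n) = C (Suc n) * ((a * b * x + 1) * (1 + b * c * x) * (H * (1 - v * X) * (1 - v * Q * X)) * V
      + (x + 1) * ((Q - v) * H) * ((1 + Y * X) * ((1 + Y * Q * X) * V))
      - Z * (H * (1 - v * X) * ((1 + Y * Q * X) * V)))"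
      unfolding L_eq h1 h2 h3 W1 V_def[symmetric] by simp
    also have "\<dots> = C (Suc n) * H * V * ((a * b * x + 1) * (1 + b * c * x) * ((1 - v * X) * (1 - v * Q * X))
      + (x + 1) * (Q - v) * (1 + Y * X) * (1 + Y * Q * X)
      - Z * (1 - v * X) * (1 + Y * Q * X))"
      by (simp add: algebra_simps)
    also have "(a * b * x + 1) * (1 + b * c * x) * ((1 - v * X) * (1 - v * Q * X))
      + (x + 1) * (Q - v) * (1 + Y * X) * (1 + Y * Q * X)
      - Z * (1 - v * X) * (1 + Y * Q * X)
      = r * ((1 - a * \<gamma> * (Q * X)) * (1 - c * \<gamma> * (Q * X)) * (b * g) * (1 - v * X)
          - (1 - Q * X) * (1 - a * c * X) * (1 + Y * Q * X))"
      using \<gamma>g unfolding v_def Y_def Z_def r_def by algebra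
    also have "C (Suc n) * H * V * \<dots> = U (Suc n) - U n"
      unfolding U1 U2 by (simp add: algebra_simps)
    finally show ?thesis .
  qed
  have partial: "(\<Sum>n<Suc N. L n) = U N" for N
    by (induction N) (use L0 LS in simp_all)
  have sm: "summable (bigG_term q a b c \<gamma> y)" for y by (rule summable_bigG[OF \<gamma>(2)])
  have "U \<longlonglongrightarrow> 0"
  proof -
    have Qlim: "(\<lambda>n. Q ^ n) \<longlonglongrightarrow> 0"
      using q_pos q_less_1 by (intro LIMSEQ_power_zero) auto
    obtain K where "K > 0" "\<And>\<gamma>' n. norm \<gamma>' \<le> norm \<gamma> \<Longrightarrow> norm (bigG_coeff q a b c \<gamma>' n) \<le> K"
      using bigG_coeff_bound[of "norm \<gamma>"] by blast
    hence K: "norm (bigG_coeff q a b c \<gamma> n) \<le> K" for n by simp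
    have "C \<longlonglongrightarrow> 0"
      unfolding C_def by (rule summable_LIMSEQ_zero[OF summable_bounded_geometric[OF K \<gamma>(2)]])
    hence C0: "(\<lambda>n. C (Suc n)) \<longlonglongrightarrow> 0" by (rule LIMSEQ_Suc)
    have "W \<longlonglongrightarrow> qpoch_inf q (- (Y * 0))"
      unfolding W_def by (intro tendsto_qpoch_inf tendsto_minus tendsto_mult tendsto_const Qlim)
    hence "(\<lambda>n. W (Suc n)) \<longlonglongrightarrow> 1" by (simp add: LIMSEQ_Suc)
    with C0 have "U \<longlonglongrightarrow> r * 0 * (1 - Q * 0) * (1 - a * c * 0) * qpoch_inf q v * 1"
      unfolding U_def by (intro tendsto_mult tendsto_diff tendsto_const Qlim qpochn_LIMSEQ)
    thus ?thesis by simp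
  qed
  hence "(\<lambda>N. \<Sum>n<Suc N. L n) \<longlonglongrightarrow> 0" unfolding partial .
  hence "L sums 0"
    unfolding sums_def using filterlim_sequentially_Suc[of "\<lambda>N. \<Sum>n<N. L n"] by blast
  moreover have "L sums ((a * b * x + 1) * (a * c * x + 1) * (1 + b * c * x) * bigG q a b c \<gamma> (Q * x)
     + Q * (x + 1) * bigG q a b c \<gamma> (x / Q) - Z * bigG q a b c \<gamma> x)"
    unfolding L_def bigG_def by (intro sums_add sums_diff sums_mult summable_sums sm)
  ultimately have "(a * b * x + 1) * (a * c * x + 1) * (1 + b * c * x) * bigG q a b c \<gamma> (Q * x)
     + Q * (x + 1) * bigG q a b c \<gamma> (x / Q) - Z * bigG q a b c \<gamma> x = 0"
    by (rule sums_unique2[symmetric])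
  thus ?thesis unfolding Z_def g_def by simp
qed

theorem bigE_qdiff:
  assumes \<gamma>: "\<gamma> \<noteq> 0" "norm (b / \<gamma>) < 1"
    and x: "qpoch_inf q (- (b * c * x)) \<noteq> 0" "x = -1 \<or> qpoch_inf q (- (b * c * (x / Q))) \<noteq> 0"
  shows "big_qdiff q a b c (\<gamma> + inverse \<gamma>) (bigE q a b c \<gamma>) x"
proof -
  define k where "k = qpoch_inf q (b / \<gamma>) / qpoch_inf q (a * b)"
  define P where "P = qpoch_inf q (- (b * c * x))"
  define G where "G = bigG q a b c \<gamma>"
  have E: "bigE q a b c \<gamma> y = k * G y / qpoch_inf q (- (b * c * y))" for y
    by (simp add: bigE_def k_def G_def)
  have P: "P \<noteq> 0" using x by (simp add: P_def)
  have "P = (1 + b * c * x) * qpoch_inf q (- (b * c * (Q * x)))"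
    using qpoch_inf_step[of "- (b * c * x)"] by (simp add: P_def mult_ac)
  hence e1: "bigE q a b c \<gamma> (Q * x) * P = k * G (Q * x) * (1 + b * c * x)"
    using P by (auto simp: E)
  have "qpoch_inf q (- (b * c * (x / Q))) = (1 + b * c * x / Q) * P"
    using qpoch_inf_step[of "- (b * c * (x / Q))"] by (simp add: P_def)
  hence R: "(b * c * x + Q) * P = Q * qpoch_inf q (- (b * c * (x / Q)))"
    by (simp add: field_simps)
  have e2: "(b * c * x + Q) * (x + 1) * bigE q a b c \<gamma> (x / Q) * P = k * (Q * (x + 1) * G (x / Q))"
  proof (cases "x = -1")
    case False
    hence nz: "qpoch_inf q (- (b * c * (x / Q))) \<noteq> 0" using x(2) by blast
    have "(b * c * x + Q) * (x + 1) * bigE q a b c \<gamma> (x / Q) * P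
        = (x + 1) * bigE q a b c \<gamma> (x / Q) * ((b * c * x + Q) * P)" by (simp only: mult_ac)
    also have "\<dots> = k * (Q * (x + 1) * G (x / Q))" unfolding R E using nz by simp
    finally show ?thesis .
  qed simp
  have e3: "bigE q a b c \<gamma> x * P = k * G x" using P by (simp add: E P_def)
  have eq: "(a * b * x + 1) * (a * c * x + 1) * (1 + b * c * x) * G (Q * x)
    + Q * (x + 1) * G (x / Q)
    = ((a * b + a * c + b * c + Q) * x + 1 + Q + a * b * c * (\<gamma> + inverse \<gamma>) * x\<^sup>2) * G x"
    unfolding G_def by (rule bigG_qdiff[OF \<gamma>])
  define s where "s = \<gamma> + inverse \<gamma>"
  have "((a * b * x + 1) * (a * c * x + 1) * (bigE q a b c \<gamma> (Q * x) - bigE q a b c \<gamma> x)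
     + (b * c * x + Q) * (x + 1) * (bigE q a b c \<gamma> (x / Q) - bigE q a b c \<gamma> x)) * P
    = (a * b * x + 1) * (a * c * x + 1) * (bigE q a b c \<gamma> (Q * x) * P - bigE q a b c \<gamma> x * P)
     + ((b * c * x + Q) * (x + 1) * bigE q a b c \<gamma> (x / Q) * P - (b * c * x + Q) * (x + 1) * (bigE q a b c \<gamma> x * P))"
    by (simp add: algebra_simps)
  also have "\<dots> = k * (((a * b * x + 1) * (a * c * x + 1) * (1 + b * c * x) * G (Q * x)
       + Q * (x + 1) * G (x / Q))
     - ((a * b * x + 1) * (a * c * x + 1) + (b * c * x + Q) * (x + 1)) * G x)"
    unfolding e1 e2 e3 by (simp add: algebra_simps)
  also have "\<dots> = (b * c * x\<^sup>2 * (-1 - a\<^sup>2 + a * s)) * (k * G x)"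
    unfolding eq s_def[symmetric] by (simp add: algebra_simps power2_eq_square)
  also have "\<dots> = b * c * x\<^sup>2 * (-1 - a\<^sup>2 + a * s) * bigE q a b c \<gamma> x * P"
    unfolding e3[symmetric] by (simp add: mult_ac)
  finally show ?thesis using P by (simp add: big_qdiff_def s_def)
qed

lemma bigE_neg1:
  assumes \<gamma>: "\<gamma> \<noteq> 0" "norm (b / \<gamma>) < 1"
  shows "bigE q a b c \<gamma> (-1) = 1"
proof -
  have "bigG_term q a b c \<gamma> (-1) = (\<lambda>n. qpochn q (a * \<gamma>) n * qpochn q (c * \<gamma>) n / qpochn q Q n *
      qpoch_inf q (a * \<gamma> * (c * \<gamma>) * (b / \<gamma>) * Q ^ n) * (b / \<gamma>) ^ n)"
    using qpochn_ab_ac_nz(2) \<gamma> by (intro ext) (simp add: bigG_term_def bigG_coeff_def mult_ac)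
  with q_gauss[OF \<gamma>(2), of "a * \<gamma>" "c * \<gamma>"]
  have "bigG_term q a b c \<gamma> (-1) sums
      (qpoch_inf q (a * \<gamma> * (b / \<gamma>)) * qpoch_inf q (c * \<gamma> * (b / \<gamma>)) / qpoch_inf q (b / \<gamma>))"
    by simp
  hence "bigG q a b c \<gamma> (-1)
      = qpoch_inf q (a * \<gamma> * (b / \<gamma>)) * qpoch_inf q (c * \<gamma> * (b / \<gamma>)) / qpoch_inf q (b / \<gamma>)"
    unfolding bigG_def by (rule sums_unique[symmetric])
  also have "\<dots> = qpoch_inf q (a * b) * qpoch_inf q (b * c) / qpoch_inf q (b / \<gamma>)"
    using \<gamma> by (simp add: mult_ac)
  finally show ?thesis
    using qpoch_inf_ab_ac_bc_nz qpoch_inf_nonzero_small[OF \<gamma>(2)] by (simp add: bigE_def)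
qed

end

section \<open>Identification of the solutions\<close>

context qpar
begin

lemma norm_bc_q_power: "norm (b * c * - (Q ^ k)) < 1"
proof -
  have "norm (b * c) * q ^ k \<le> norm (b * c) * 1" by (intro mult_left_mono q_power_le) auto
  thus ?thesis using norm_bc by (simp add: norm_mult)
qed

text \<open>The coefficient of \<open>f(x/q)\<close> vanishes at \<open>x = -1\<close>, so the equation at the points \<open>-q\<^sup>k\<close> is a
  recurrence for the values at these points with one initial value.\<close>

lemma neg_grid_unique:
  assumes f: "\<And>k. big_qdiff q a b c s f (- (Q ^ k))" and g: "\<And>k. big_qdiff q a b c s g (- (Q ^ k))"
    and init: "f (-1) = g (-1)"
  shows "f (- (Q ^ k)) = g (- (Q ^ k))"
proof (induction k rule: less_induct)
  case (less k)
  show ?case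
  proof (cases k)
    case 0
    thus ?thesis using init by simp
  next
    case (Suc m)
    define x where "x = - (Q ^ m)"
    have fx: "f x = g x" using less.IH[of m] Suc by (simp add: x_def)
    have "(x + 1) * f (x / Q) = (x + 1) * g (x / Q)"
    proof (cases m)
      case (Suc l)
      hence "x / Q = - (Q ^ l)" by (simp add: x_def)
      thus ?thesis using less.IH[of l] Suc \<open>k = Suc m\<close> by simp
    qed (simp add: x_def)
    hence B: "(b * c * x + Q) * (x + 1) * (f (x / Q) - f x) = (b * c * x + Q) * (x + 1) * (g (x / Q) - g x)"
      unfolding fx by (simp add: right_diff_distrib mult.assoc)
    have A: "(a * b * x + 1) * (a * c * x + 1) \<noteq> 0"
      using ab_ac_factor_nz[of m] by (simp add: x_def)
    have "(a * b * x + 1) * (a * c * x + 1) * (f (Q * x) - f x)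
        = (a * b * x + 1) * (a * c * x + 1) * (g (Q * x) - g x)"
      using f[of m] g[of m] B unfolding big_qdiff_def x_def[symmetric] fx by (metis add_right_cancel)
    hence "f (Q * x) - f x = g (Q * x) - g x" using A by simp
    hence "f (Q * x) = g (Q * x)" using fx by simp
    thus ?thesis by (simp add: Suc x_def)
  qed
qed

text \<open>The points \<open>-q\<^sup>k\<close> accumulate at \<open>0\<close>.\<close>

lemma identity_theorem_at_0:
  assumes hol: "f holomorphic_on ball 0 r" "g holomorphic_on ball 0 r"
    and eq: "\<And>k. f (- (Q ^ k)) = g (- (Q ^ k))" and x: "norm x < r"
  shows "f x = g x"
proof -
  define U where "U = {- (Q ^ k) | k. - (Q ^ k) \<in> ball 0 r}"
  have r: "r > 0" using x norm_ge_zero le_less_trans by blast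
  have lim: "(\<lambda>k. - (Q ^ k)) \<longlonglongrightarrow> - 0"
    using q_pos q_less_1 by (intro tendsto_minus LIMSEQ_power_zero) auto
  hence "\<forall>\<^sub>F k in sequentially. - (Q ^ k) \<in> ball 0 r"
    using r by (intro topological_tendstoD) auto
  then obtain N where N: "\<And>k. k \<ge> N \<Longrightarrow> - (Q ^ k) \<in> ball 0 r"
    by (auto simp: eventually_at_top_linorder)
  have "0 islimpt U"
    unfolding islimpt_sequential
  proof (intro exI[of _ "\<lambda>k. - (Q ^ (k + N))"] conjI allI)
    show "- (Q ^ (k + N)) \<in> U - {0}" for k using N[of "k + N"] by (auto simp: U_def)
    show "(\<lambda>k. - (Q ^ (k + N))) \<longlonglongrightarrow> 0"
      using LIMSEQ_ignore_initial_segment[OF lim, of N] by simp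
  qed
  hence "f x - g x = 0"
    using eq x r
    by (intro analytic_continuation[of "\<lambda>x. f x - g x" "ball 0 r" U 0 x] holomorphic_intros hol)
       (auto simp: U_def)
  thus ?thesis by simp
qed

lemma qpoch_inf_bc_nz: "norm (b * c * x) < 1 \<Longrightarrow> qpoch_inf q (- (b * c * x)) \<noteq> 0"
  by (intro qpoch_inf_nonzero_small) simp

lemma bigF_qdiff_neg_grid:
  assumes "\<gamma> \<noteq> 0"
  shows "big_qdiff q a b c (\<gamma> + inverse \<gamma>) (bigF q a b c \<gamma>) (- (Q ^ k))"
proof (rule bigF_qdiff[OF assms _ norm_bc_q_power])
  show "- (Q ^ k) = -1 \<or> norm (b * c * (- (Q ^ k) / Q)) < 1"
  proof (cases k)
    case (Suc m)
    thus ?thesis using norm_bc_q_power[of m] by simp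
  qed simp
qed simp

theorem bigF_eq_bigE:
  assumes \<gamma>: "\<gamma> \<noteq> 0" "norm (b / \<gamma>) < 1" and x: "norm (b * c * x) < 1"
  shows "bigF q a b c \<gamma> x = bigE q a b c \<gamma> x"
proof (rule identity_theorem_at_0[where f = "bigF q a b c \<gamma>" and g = "bigE q a b c \<gamma>"
      and r = "1 / norm (b * c)"])
  have bc: "norm (b * c) > 0" using abc_nz by simp
  have in_ball: "norm (b * c * y) < 1" if "y \<in> ball 0 (1 / norm (b * c))" for y
    using that bc unfolding norm_mult[of "b * c"] by (simp add: field_simps)
  show "bigE q a b c \<gamma> holomorphic_on ball 0 (1 / norm (b * c))"
    unfolding bigE_def
    using in_ball qpoch_inf_bc_nz qpoch_inf_ab_ac_bc_nz(1)
    by (intro holomorphic_intros holomorphic_on_subset[OF holomorphic_bigG_x[OF \<gamma>(2)]]) auto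
  show "norm x < 1 / norm (b * c)"
    using x bc unfolding norm_mult[of "b * c"] by (simp add: field_simps)
  show "bigF q a b c \<gamma> (- (Q ^ k)) = bigE q a b c \<gamma> (- (Q ^ k))" for k
  proof (rule neg_grid_unique[OF bigF_qdiff_neg_grid[OF \<gamma>(1)]])
    show "big_qdiff q a b c (\<gamma> + inverse \<gamma>) (bigE q a b c \<gamma>) (- (Q ^ k))" for k
    proof (rule bigE_qdiff[OF \<gamma> qpoch_inf_bc_nz[OF norm_bc_q_power]])
      show "- (Q ^ k) = -1 \<or> qpoch_inf q (- (b * c * (- (Q ^ k) / Q))) \<noteq> 0"
      proof (cases k)
        case (Suc m)
        thus ?thesis using qpoch_inf_bc_nz[OF norm_bc_q_power[of m]] by simp
      qed simp
    qed
    show "bigF q a b c \<gamma> (-1) = bigE q a b c \<gamma> (-1)"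
      by (simp add: bigF_neg1 bigE_neg1[OF \<gamma>])
  qed
qed (rule holomorphic_bigF)

text \<open>Conjugation by \<open>(-acx;q)\<^sub>\<infinity> / (-bcx;q)\<^sub>\<infinity>\<close> interchanges the roles of \<open>a\<close> and \<open>b\<close>.
  The constant makes the factor equal to \<open>1\<close> at \<open>x = -1\<close>.\<close>

definition gauge :: "complex \<Rightarrow> complex" where
  "gauge x = qpoch_inf q (b * c) * qpoch_inf q (- (a * c * x)) /
     (qpoch_inf q (a * c) * qpoch_inf q (- (b * c * x)))"

lemma gauge_qdiff:
  assumes f: "big_qdiff q b a c s f x"
    and x: "qpoch_inf q (- (b * c * x)) \<noteq> 0" "x = -1 \<or> qpoch_inf q (- (b * c * (x / Q))) \<noteq> 0"
  shows "big_qdiff q a b c s (\<lambda>x. gauge x * f x) x"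
proof -
  define k where "k = qpoch_inf q (b * c) / qpoch_inf q (a * c)"
  define P where "P = (\<lambda>y. qpoch_inf q (- (b * c * y)))"
  define R where "R = (\<lambda>y. qpoch_inf q (- (a * c * y)))"
  have g: "gauge y = k * R y / P y" for y by (simp add: gauge_def k_def P_def R_def)
  have Px: "P x \<noteq> 0" using x(1) by (simp add: P_def)
  have "P x = (1 + b * c * x) * P (Q * x)" "R x = (1 + a * c * x) * R (Q * x)"
    using qpoch_inf_step[of "- (b * c * x)"] qpoch_inf_step[of "- (a * c * x)"]
    by (simp_all add: P_def R_def mult_ac)
  hence e1: "(a * c * x + 1) * gauge (Q * x) = (b * c * x + 1) * gauge x"
    using Px by (auto simp: g add.commute)
  have e2: "(b * c * x + Q) * ((x + 1) * gauge (x / Q)) = (a * c * x + Q) * ((x + 1) * gauge x)"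
  proof (cases "x = -1")
    case False
    hence nz: "P (x / Q) \<noteq> 0" using x(2) by (simp add: P_def)
    have "P (x / Q) = (1 + b * c * x / Q) * P x" "R (x / Q) = (1 + a * c * x / Q) * R x"
      using qpoch_inf_step[of "- (b * c * (x / Q))"] qpoch_inf_step[of "- (a * c * (x / Q))"]
      by (simp_all add: P_def R_def)
    hence PR: "Q * P (x / Q) = (b * c * x + Q) * P x" "Q * R (x / Q) = (a * c * x + Q) * R x"
      by (simp_all add: field_simps)
    have "(b * c * x + Q) * gauge (x / Q) = (b * c * x + Q) * P x * k * (Q * R (x / Q)) / (Q * P (x / Q) * P x)"
      using Px by (simp add: g)
    also have "\<dots> = (a * c * x + Q) * gauge x"
      unfolding PR(1)[symmetric] PR(2) using nz Px by (simp add: g)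
    finally show ?thesis by (simp only: mult.left_commute)
  qed simp
  define m where "m = (-1 - a\<^sup>2 + a * s)"
  define m' where "m' = (-1 - b\<^sup>2 + b * s)"
  define G where "G = gauge x"
  have f': "(a * b * x + 1) * (b * c * x + 1) * f (Q * x) + (a * c * x + Q) * (x + 1) * f (x / Q)
      = ((a * b * x + 1) * (b * c * x + 1) + (a * c * x + Q) * (x + 1) + a * c * x\<^sup>2 * m') * f x"
    using f unfolding big_qdiff_def m'_def by (simp add: algebra_simps)
  have "(a * b * x + 1) * (a * c * x + 1) * (gauge (Q * x) * f (Q * x) - G * f x)
      + (b * c * x + Q) * (x + 1) * (gauge (x / Q) * f (x / Q) - G * f x)
    = (a * b * x + 1) * ((a * c * x + 1) * gauge (Q * x)) * f (Q * x)
      + (b * c * x + Q) * ((x + 1) * gauge (x / Q)) * f (x / Q)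
      - ((a * b * x + 1) * (a * c * x + 1) + (b * c * x + Q) * (x + 1)) * (G * f x)"
    by (simp add: algebra_simps)
  also have "\<dots> = G * ((a * b * x + 1) * (b * c * x + 1) * f (Q * x) + (a * c * x + Q) * (x + 1) * f (x / Q))
      - ((a * b * x + 1) * (a * c * x + 1) + (b * c * x + Q) * (x + 1)) * (G * f x)"
    unfolding e1 e2 G_def[symmetric] by (simp add: algebra_simps)
  also have "\<dots> = ((a * b * x + 1) * (b * c * x + 1) + (a * c * x + Q) * (x + 1) + a * c * x\<^sup>2 * m'
      - ((a * b * x + 1) * (a * c * x + 1) + (b * c * x + Q) * (x + 1))) * (G * f x)"
    unfolding f' by (simp add: algebra_simps)
  also have "(a * b * x + 1) * (b * c * x + 1) + (a * c * x + Q) * (x + 1) + a * c * x\<^sup>2 * m'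
      - ((a * b * x + 1) * (a * c * x + 1) + (b * c * x + Q) * (x + 1)) = b * c * x\<^sup>2 * m"
    unfolding m_def m'_def by (simp add: algebra_simps power2_eq_square)
  finally show ?thesis unfolding big_qdiff_def m_def G_def by (simp add: mult_ac)
qed

lemma bigF_gauge:
  assumes \<gamma>: "\<gamma> \<noteq> 0" and x: "norm (b * c * x) < 1" "norm (a * c * x) < 1"
  shows "bigF q a b c \<gamma> x = gauge x * bigF q b a c \<gamma> x"
proof -
  interpret S: qpar q b a c
    using abc_nz norm_ab norm_ac norm_bc by unfold_locales (simp_all add: mult.commute)
  define r where "r = min (1 / norm (b * c)) (1 / norm (a * c))"
  have bc: "norm (b * c) > 0" "norm (a * c) > 0" using abc_nz by simp_all
  have in_ball: "norm (b * c * y) < 1" if "norm y < r" for y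
    using that bc unfolding norm_mult[of "b * c"] r_def by (simp add: field_simps)
  show ?thesis
  proof (rule identity_theorem_at_0[where f = "bigF q a b c \<gamma>" and r = r
        and g = "\<lambda>x. gauge x * bigF q b a c \<gamma> x"])
    show "bigF q a b c \<gamma> holomorphic_on ball 0 r"
      by (rule holomorphic_on_subset[OF holomorphic_bigF]) (auto simp: r_def)
    have "bigF q b a c \<gamma> holomorphic_on ball 0 r"
      by (rule holomorphic_on_subset[OF S.holomorphic_bigF]) (auto simp: r_def)
    thus "(\<lambda>x. gauge x * bigF q b a c \<gamma> x) holomorphic_on ball 0 r"
      unfolding gauge_def using in_ball qpoch_inf_bc_nz qpoch_inf_ab_ac_bc_nz
      by (intro holomorphic_intros) auto
    show "norm x < r"
      using x bc unfolding norm_mult[of "b * c"] norm_mult[of "a * c"] r_def by (simp add: field_simps)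
    show "bigF q a b c \<gamma> (- (Q ^ k)) = gauge (- (Q ^ k)) * bigF q b a c \<gamma> (- (Q ^ k))" for k
    proof (rule neg_grid_unique[OF bigF_qdiff_neg_grid[OF \<gamma>]])
      show "big_qdiff q a b c (\<gamma> + inverse \<gamma>) (\<lambda>x. gauge x * bigF q b a c \<gamma> x) (- (Q ^ k))" for k
      proof (rule gauge_qdiff[OF S.bigF_qdiff_neg_grid[OF \<gamma>] qpoch_inf_bc_nz[OF norm_bc_q_power]])
        show "- (Q ^ k) = -1 \<or> qpoch_inf q (- (b * c * (- (Q ^ k) / Q))) \<noteq> 0"
        proof (cases k)
          case (Suc m)
          thus ?thesis using qpoch_inf_bc_nz[OF norm_bc_q_power[of m]] by simp
        qed simp
      qed
      show "bigF q a b c \<gamma> (-1) = gauge (-1) * bigF q b a c \<gamma> (-1)"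
        using qpoch_inf_ab_ac_bc_nz by (simp add: bigF_neg1 S.bigF_neg1 gauge_def)
    qed
  qed
qed

end

section \<open>The functions on the grid\<close>

text \<open>The eigenvalue equation at the grid point \<open>x\<close> with the eigenvalue \<open>m\<close>, multiplied by
  \<open>b c x\<^sup>2\<close>. At \<open>x = -1\<close> the value of \<open>f\<close> at \<open>x / q\<close>, outside the grid, is multiplied by \<open>0\<close>.\<close>

definition grid_qdiff ::
  "real \<Rightarrow> real \<Rightarrow> real \<Rightarrow> real \<Rightarrow> complex \<Rightarrow> (real \<Rightarrow> complex) \<Rightarrow> real \<Rightarrow> bool" where
  "grid_qdiff q a b c m f x \<longleftrightarrow>
     of_real ((a * b * x + 1) * (a * c * x + 1)) * (f (q * x) - f x)
     + of_real ((b * c * x + q) * (x + 1)) * (f (x / q) - f x) = of_real (b * c * x\<^sup>2) * (m * f x)"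

text \<open>\<open>is_phi q a b c z \<gamma> f\<close> states that \<open>f\<close> solves the eigenvalue equation on the whole grid and
  agrees with the series near the origin; it determines \<open>f\<close>.\<close>

definition is_phi ::
  "real \<Rightarrow> real \<Rightarrow> real \<Rightarrow> real \<Rightarrow> real \<Rightarrow> complex \<Rightarrow> (real \<Rightarrow> complex) \<Rightarrow> bool" where
  "is_phi q a b c z \<gamma> f \<longleftrightarrow> f \<in> extensional (grid q z) \<and>
     (\<forall>x\<in>grid q z. grid_qdiff q a b c (mu a \<gamma>) f x) \<and>
     (\<exists>\<delta>>0. \<forall>x\<in>grid q z. \<bar>x\<bar> < \<delta> \<longrightarrow>
        f x = bigF q (of_real a) (of_real b) (of_real c) \<gamma> (of_real x))"

text \<open>The setting of the theorem: a point \<open>(a, b, c)\<close> of \<open>V\<close> and \<open>z > 0\<close>.\<close>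

locale bigq = qbase +
  fixes a b c z :: real
  assumes a_pos: "a > 0" and b_pos: "b > 0" and c_pos: "c > 0" and z_pos: "z > 0"
    and ab_less: "a * b < 1" and ac_less: "a * c < 1" and bc_less: "b * c < 1"

sublocale bigq \<subseteq> C: qpar q "complex_of_real a" "complex_of_real b" "complex_of_real c"
  using a_pos b_pos c_pos ab_less ac_less bc_less
  by unfold_locales (simp_all flip: of_real_mult)

context bigq
begin

abbreviation F :: "complex \<Rightarrow> complex \<Rightarrow> complex" where
  "F \<equiv> bigF q (of_real a) (of_real b) (of_real c)"

abbreviation E :: "complex \<Rightarrow> complex \<Rightarrow> complex" where
  "E \<equiv> bigE q (of_real a) (of_real b) (of_real c)"

lemma neg_in_grid: "- (q ^ k) \<in> grid q z" and pos_in_grid: "z * q powi i \<in> grid q z"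
  by (auto simp: grid_def)

lemma grid_cases [consumes 1, case_names neg pos]:
  assumes "x \<in> grid q z"
  obtains k where "x = - (q ^ k)" | i where "x = z * q powi i"
  using assms by (auto simp: grid_def)

lemma pos_grid_pos: "z * q powi i > 0"
  using z_pos q_pos by simp

lemma grid_nonzero: "x \<in> grid q z \<Longrightarrow> x \<noteq> 0"
  using z_pos by (auto simp: grid_def)

lemma q_times_pos_grid: "q * (z * q powi i) = z * q powi (i + 1)"
  by (simp add: power_int_add)

lemma pos_grid_div_q: "z * q powi i / q = z * q powi (i - 1)"
  by (simp add: power_int_diff)

lemma q_times_neg_grid: "q * - (q ^ k) = - (q ^ Suc k)"
  by simp

lemma neg_grid_div_q: "- (q ^ Suc k) / q = - (q ^ k)"
  by simp

lemma q_times_in_grid: "x \<in> grid q z \<Longrightarrow> q * x \<in> grid q z"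
  by (erule grid_cases) (simp_all only: q_times_neg_grid q_times_pos_grid neg_in_grid pos_in_grid)

lemma div_q_in_grid: "x \<in> grid q z \<Longrightarrow> x \<noteq> -1 \<Longrightarrow> x / q \<in> grid q z"
proof (erule grid_cases)
  fix k assume "x \<noteq> -1" "x = - (q ^ k)"
  thus ?thesis by (cases k) (auto simp: grid_def)
qed (simp only: pos_grid_div_q pos_in_grid)

lemma Lop_eq_iff:
  assumes x: "x \<in> grid q z"
  shows "Lop q a b c z f x = m * f x \<longleftrightarrow> grid_qdiff q a b c m f x"
proof -
  have nz: "x \<noteq> 0" using grid_nonzero[OF x] .
  have A: "coeffA a b c x * (b * c * x\<^sup>2) = (a * b * x + 1) * (a * c * x + 1)"
    using a_pos b_pos c_pos nz by (simp add: coeffA_def field_simps power2_eq_square)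
  have B: "coeffB q b c x * (b * c * x\<^sup>2) = (b * c * x + q) * (x + 1)"
    using b_pos c_pos nz by (simp add: coeffB_def field_simps power2_eq_square)
  have "of_real (b * c * x\<^sup>2) \<noteq> (0::complex)" using b_pos c_pos nz by simp
  hence "Lop q a b c z f x = m * f x \<longleftrightarrow> Lop q a b c z f x * of_real (b * c * x\<^sup>2) = m * f x * of_real (b * c * x\<^sup>2)"
    using mult_right_cancel by metis
  also have "Lop q a b c z f x * of_real (b * c * x\<^sup>2)
      = of_real (coeffA a b c x * (b * c * x\<^sup>2)) * (f (q * x) - f x)
        + of_real (coeffB q b c x * (b * c * x\<^sup>2)) * (f (x / q) - f x)"
  proof (cases "x = -1")
    case True
    hence "coeffB q b c x = 0" by (simp add: coeffB_def)
    with True x show ?thesis by (simp add: Lop_def mult_ac)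
  next
    case False
    with x show ?thesis by (simp add: Lop_def algebra_simps)
  qed
  also have "\<dots> = of_real ((a * b * x + 1) * (a * c * x + 1)) * (f (q * x) - f x)
     + of_real ((b * c * x + q) * (x + 1)) * (f (x / q) - f x)" unfolding A B ..
  finally show ?thesis by (simp add: grid_qdiff_def mult_ac)
qed

lemma mu_eq: "mu a \<gamma> = -1 - (of_real a)\<^sup>2 + of_real a * (\<gamma> + inverse \<gamma>)"
  by (simp add: mu_def)

lemma grid_qdiffI:
  assumes h: "big_qdiff q (of_real a) (of_real b) (of_real c) (\<gamma> + inverse \<gamma>) h (of_real x)"
    and f: "f x = h (of_real x)" "f (q * x) = h (of_real (q * x))"
      "x = -1 \<or> f (x / q) = h (of_real (x / q))"
  shows "grid_qdiff q a b c (mu a \<gamma>) f x"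
proof (cases "x = -1")
  case False
  thus ?thesis using h f by (simp add: grid_qdiff_def big_qdiff_def mu_eq mult_ac)
next
  case True
  thus ?thesis using h f by (simp add: grid_qdiff_def big_qdiff_def mu_eq mult_ac)
qed

lemma phi32_eq_F:
  assumes "x \<noteq> 0"
  shows "phi32 (of_real a * \<gamma>) (of_real a / \<gamma>) (of_real (- 1 / x)) (of_real (a * b)) (of_real (a * c)) q
     (of_real (- (b * c * x))) = F \<gamma> (of_real x)"
proof -
  have "qpochn q (of_real (-1 / x)) n * of_real (- (b * c * x)) ^ n
      = (\<Prod>i<n. - (of_real b * of_real c) * (of_real x + complex_of_real q ^ i))" for n
  proof -
    have "qpochn q (of_real (-1 / x)) n * of_real (- (b * c * x)) ^ n
        = (\<Prod>i<n. (1 - of_real (-1 / x) * complex_of_real q ^ i) * of_real (- (b * c * x)))"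
      unfolding qpochn_def prod.distrib by simp
    also have "\<dots> = (\<Prod>i<n. - (of_real b * of_real c) * (of_real x + complex_of_real q ^ i))"
      using assms by (intro prod.cong) (auto simp: field_simps)
    finally show ?thesis .
  qed
  hence "qpochs q [of_real a * \<gamma>, of_real a / \<gamma>, of_real (- 1 / x)] (int n) /
        qpochs q [of_real q, of_real (a * b), of_real (a * c)] (int n) * of_real (- (b * c * x)) ^ n
      = bigF_term q (of_real a) (of_real b) (of_real c) \<gamma> (of_real x) n" for n
    unfolding bigF_term_def qpochs_def qpoch_of_nat list.map prod_list.Cons prod_list.Nil
    by (simp add: mult.assoc flip: times_divide_eq_left)
  thus ?thesis by (simp add: phi32_def bigF_def)
qed

lemma grid_qdiff_agree:
  assumes "grid_qdiff q a b c m f x" "grid_qdiff q a b c m g x" "f x = g x" "f (q * x) = g (q * x)"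
    and nz: "(b * c * x + q) * (x + 1) \<noteq> 0"
  shows "f (x / q) = g (x / q)"
proof -
  have "of_real ((b * c * x + q) * (x + 1)) * (f (x / q) - f x)
      = complex_of_real ((b * c * x + q) * (x + 1)) * (g (x / q) - f x)"
    using assms(1-4) unfolding grid_qdiff_def by (metis add_left_cancel)
  thus ?thesis using nz by (simp del: of_real_mult)
qed

lemma pos_grid_agree:
  assumes N: "\<And>i. i \<ge> N \<Longrightarrow> f (z * q powi i) = g (z * q powi i)"
    and f: "\<And>i. i > M \<Longrightarrow> grid_qdiff q a b c m f (z * q powi i)"
    and g: "\<And>i. i > M \<Longrightarrow> grid_qdiff q a b c m g (z * q powi i)"
    and i: "i \<ge> M"
  shows "f (z * q powi i) = g (z * q powi i)"
proof (cases "M \<le> N")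
  case True
  have "i \<le> N \<Longrightarrow> M \<le> i \<longrightarrow> (\<forall>j\<ge>i. f (z * q powi j) = g (z * q powi j))" for i
  proof (induction i rule: int_le_induct)
    case (step i)
    show ?case
    proof (intro impI allI)
      fix j assume M: "M \<le> i - 1" and j: "i - 1 \<le> j"
      have IH: "f (z * q powi j) = g (z * q powi j)" if "j \<ge> i" for j
        using step M that by simp
      have "f (z * q powi i / q) = g (z * q powi i / q)"
      proof (rule grid_qdiff_agree[OF f g IH])
        show "f (q * (z * q powi i)) = g (q * (z * q powi i))"
          unfolding q_times_pos_grid by (rule IH) simp
        have "b * c * (z * q powi i) > 0" using b_pos c_pos pos_grid_pos by simp
        thus "(b * c * (z * q powi i) + q) * (z * q powi i + 1) \<noteq> 0"
          using pos_grid_pos[of i] q_pos by (smt (verit) mult_pos_pos)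
      qed (use M in simp_all)
      hence "f (z * q powi (i - 1)) = g (z * q powi (i - 1))" unfolding pos_grid_div_q .
      thus "f (z * q powi j) = g (z * q powi j)" using IH[of j] j by (cases "j = i - 1") auto
    qed
  qed (use N in simp)
  from this[of "min i N"] True i show ?thesis by auto
qed (use N i in simp)

lemma neg_grid_agree:
  assumes N: "\<And>k. k \<ge> N \<Longrightarrow> f (- (q ^ k)) = g (- (q ^ k))"
    and f: "\<And>k. grid_qdiff q a b c m f (- (q ^ k))"
    and g: "\<And>k. grid_qdiff q a b c m g (- (q ^ k))"
  shows "f (- (q ^ k)) = g (- (q ^ k))"
proof -
  have "n \<le> N \<Longrightarrow> \<forall>k\<ge>N - n. f (- (q ^ k)) = g (- (q ^ k))" for n
  proof (induction n)
    case (Suc n)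
    hence IH: "f (- (q ^ k)) = g (- (q ^ k))" if "k \<ge> N - n" for k using that by simp
    define l where "l = N - Suc n"
    have l: "N - n = Suc l" using Suc.prems by (simp add: l_def)
    have "f (- (q ^ Suc l) / q) = g (- (q ^ Suc l) / q)"
    proof (rule grid_qdiff_agree[OF f g IH])
      show "f (q * - (q ^ Suc l)) = g (q * - (q ^ Suc l))"
        unfolding q_times_neg_grid by (rule IH) (simp add: l)
      have "b * c * q ^ l < 1 * 1"
        using b_pos c_pos bc_less q_power_le[of l] by (intro mult_less_le_imp_less) auto
      hence "q * (b * c * q ^ l) < q * 1" using q_pos by (intro mult_strict_left_mono) auto
      moreover have "q ^ Suc l < 1" using q_pos q_less_1 by (intro power_Suc_less_one) auto
      ultimately have "0 < b * c * - (q ^ Suc l) + q" "0 < - (q ^ Suc l) + 1"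
        by (simp_all add: mult_ac)
      from mult_pos_pos[OF this] show "(b * c * - (q ^ Suc l) + q) * (- (q ^ Suc l) + 1) \<noteq> 0"
        by (rule less_imp_neq[symmetric])
    qed (simp add: l)
    hence "f (- (q ^ l)) = g (- (q ^ l))" unfolding neg_grid_div_q .
    moreover have "k = l \<or> k \<ge> N - n" if "k \<ge> N - Suc n" for k using that l by (auto simp: l_def)
    ultimately show ?case using IH by blast
  qed (use N in simp)
  from this[of N] show ?thesis by simp
qed

lemma eventually_small_grid:
  assumes "\<delta> > 0"
  obtains N :: int and K :: nat where "\<And>i. i \<ge> N \<Longrightarrow> \<bar>z * q powi i\<bar> < \<delta>" "\<And>k. k \<ge> K \<Longrightarrow> \<bar>- (q ^ k)\<bar> < \<delta>"
proof -
  have lim: "(\<lambda>k. q ^ k) \<longlonglongrightarrow> 0" using q_pos q_less_1 by (intro LIMSEQ_power_zero) auto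
  have "(\<lambda>k. z * q ^ k) \<longlonglongrightarrow> z * 0" by (intro tendsto_mult tendsto_const lim)
  hence "\<forall>\<^sub>F k in sequentially. z * q ^ k < \<delta>" using assms by (intro order_tendstoD) auto
  then obtain N where N: "\<And>k. k \<ge> N \<Longrightarrow> z * q ^ k < \<delta>" by (auto simp: eventually_at_top_linorder)
  have "\<forall>\<^sub>F k in sequentially. q ^ k < \<delta>" using lim assms by (rule order_tendstoD)
  then obtain K where K: "\<And>k. k \<ge> K \<Longrightarrow> q ^ k < \<delta>" by (auto simp: eventually_at_top_linorder)
  have "\<bar>z * q powi i\<bar> < \<delta>" if "i \<ge> int N" for i
    using N[of "nat i"] that pos_grid_pos[of i] by (simp add: power_int_def)
  moreover have "\<bar>- (q ^ k)\<bar> < \<delta>" if "k \<ge> K" for k using K[OF that] q_power_le[of k] by simp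
  ultimately show ?thesis using that by blast
qed

lemma F_grid_qdiff:
  assumes \<gamma>: "\<gamma> \<noteq> 0" and x: "x \<noteq> 0" "b * c * \<bar>x\<bar> < 1" "x = -1 \<or> b * c * \<bar>x / q\<bar> < 1"
  shows "grid_qdiff q a b c (mu a \<gamma>) (\<lambda>x. F \<gamma> (of_real x)) x"
proof (rule grid_qdiffI[of _ "F \<gamma>"])
  have n: "norm (of_real b * of_real c * complex_of_real y) = b * c * \<bar>y\<bar>" for y
    using b_pos c_pos by (simp add: norm_mult)
  show "big_qdiff q (of_real a) (of_real b) (of_real c) (\<gamma> + inverse \<gamma>) (F \<gamma>) (of_real x)"
  proof (rule C.bigF_qdiff[OF \<gamma>])
    show "norm (of_real b * of_real c * complex_of_real x) < 1" using x n by simp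
    show "complex_of_real x = - 1 \<or> norm (of_real b * of_real c * (complex_of_real x / of_real q)) < 1"
      using x(3) n[of "x / q"] by auto
  qed (use x in simp)
qed auto

text \<open>Agreement with the series near \<open>0\<close> propagates by the recurrence to all grid points in the disc of
  convergence.\<close>

lemma is_phi_eq_F:
  assumes \<gamma>: "\<gamma> \<noteq> 0" and f: "is_phi q a b c z \<gamma> f" and x: "x \<in> grid q z" "b * c * \<bar>x\<bar> < 1"
  shows "f x = F \<gamma> (of_real x)"
proof -
  obtain \<delta> where \<delta>: "\<delta> > 0" "\<And>x. x \<in> grid q z \<Longrightarrow> \<bar>x\<bar> < \<delta> \<Longrightarrow> f x = F \<gamma> (of_real x)"
    using f by (auto simp: is_phi_def)
  have eq: "grid_qdiff q a b c (mu a \<gamma>) f x" if "x \<in> grid q z" for x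
    using f that by (auto simp: is_phi_def)
  obtain N :: int and K :: nat where NK: "\<And>i. i \<ge> N \<Longrightarrow> \<bar>z * q powi i\<bar> < \<delta>"
      "\<And>k. k \<ge> K \<Longrightarrow> \<bar>- (q ^ k)\<bar> < \<delta>"
    using eventually_small_grid[OF \<delta>(1)] by blast
  have bc: "b * c > 0" using b_pos c_pos by simp
  from x(1) show ?thesis
  proof (cases rule: grid_cases)
    case (neg k)
    have less: "b * c * \<bar>- (q ^ k)\<bar> < 1" for k
    proof -
      have "b * c * q ^ k \<le> b * c * 1" using bc q_power_le[of k] by (intro mult_left_mono) auto
      thus ?thesis using bc_less by simp
    qed
    show ?thesis unfolding neg
    proof (rule neg_grid_agree[where N = K])
      show "grid_qdiff q a b c (mu a \<gamma>) (\<lambda>x. F \<gamma> (of_real x)) (- (q ^ k))" for k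
      proof (rule F_grid_qdiff[OF \<gamma> _ less])
        show "- (q ^ k) = - 1 \<or> b * c * \<bar>- (q ^ k) / q\<bar> < 1"
          using less[of "k - 1"] by (cases k) auto
      qed simp
    qed (use NK \<delta> eq neg_in_grid in auto)
  next
    case (pos i)
    have mono: "q powi j \<le> q powi i" if "i \<le> j" for j
      using that q_pos q_less_1 by (intro power_int_decreasing) auto
    have less: "b * c * \<bar>z * q powi j\<bar> < 1" if "i \<le> j" for j
    proof -
      have "b * c * (z * q powi j) \<le> b * c * (z * q powi i)"
        using bc z_pos mono[OF that] by (intro mult_left_mono) auto
      thus ?thesis using x(2) pos pos_grid_pos[of i] pos_grid_pos[of j] by simp
    qed
    show ?thesis unfolding pos
    proof (rule pos_grid_agree[where N = N and M = i])
      show "grid_qdiff q a b c (mu a \<gamma>) (\<lambda>x. F \<gamma> (of_real x)) (z * q powi j)" if "j > i" for j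
        using less[of j] less[of "j - 1"] that z_pos
        by (intro F_grid_qdiff[OF \<gamma>]) (simp_all add: pos_grid_div_q)
    qed (use NK \<delta> eq pos_in_grid in auto)
  qed
qed

text \<open>Beyond the disc of convergence the recurrence determines the extension, since the coefficient of
  \<open>f(x/q)\<close> is positive for \<open>x > 0\<close>.\<close>

theorem phi_eqI:
  assumes \<gamma>: "\<gamma> \<noteq> 0" and f: "is_phi q a b c z \<gamma> f"
  shows "phi q a b c z \<gamma> = f"
  unfolding phi_def
proof (rule the_equality)
  have eq: "grid_qdiff q a b c (mu a \<gamma>) f x" if "x \<in> grid q z" for x
    using f that by (auto simp: is_phi_def)
  have P: "phi32 (of_real a * \<gamma>) (of_real a / \<gamma>) (of_real (- 1 / x)) (of_real (a * b)) (of_real (a * c)) q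
     (of_real (- (b * c * x))) = F \<gamma> (of_real x)" if "x \<in> grid q z" for x
    using phi32_eq_F grid_nonzero that by blast
  show "f \<in> extensional (grid q z) \<and>
    (\<forall>x\<in>grid q z. b * c * \<bar>x\<bar> < 1 \<longrightarrow>
        f x = phi32 (of_real a * \<gamma>) (of_real a / \<gamma>) (of_real (- 1 / x)) (of_real (a * b))
              (of_real (a * c)) q (of_real (- (b * c * x)))) \<and>
    (\<forall>x\<in>grid q z - {- 1}. Lop q a b c z f x = mu a \<gamma> * f x)"
    using f P is_phi_eq_F[OF \<gamma> f] Lop_eq_iff by (auto simp: is_phi_def)
  fix g assume g: "g \<in> extensional (grid q z) \<and>
    (\<forall>x\<in>grid q z. b * c * \<bar>x\<bar> < 1 \<longrightarrow>
        g x = phi32 (of_real a * \<gamma>) (of_real a / \<gamma>) (of_real (- 1 / x)) (of_real (a * b))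
              (of_real (a * c)) q (of_real (- (b * c * x)))) \<and>
    (\<forall>x\<in>grid q z - {- 1}. Lop q a b c z g x = mu a \<gamma> * g x)"
  hence gF: "g x = F \<gamma> (of_real x)" if "x \<in> grid q z" "b * c * \<bar>x\<bar> < 1" for x
    using P that by auto
  have g_eq: "grid_qdiff q a b c (mu a \<gamma>) g x" if "x \<in> grid q z" "x \<noteq> -1" for x
    using g that Lop_eq_iff[of x g] by auto
  have bc: "b * c > 0" using b_pos c_pos by simp
  obtain N :: int and K :: nat where NK: "\<And>i. i \<ge> N \<Longrightarrow> \<bar>z * q powi i\<bar> < 1 / (b * c)"
      "\<And>k. k \<ge> K \<Longrightarrow> \<bar>- (q ^ k)\<bar> < 1 / (b * c)"
    using eventually_small_grid[of "1 / (b * c)"] bc by auto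
  have "g x = f x" if "x \<in> grid q z" for x
    using that
  proof (cases rule: grid_cases)
    case (neg k)
    have "b * c * q ^ k \<le> b * c * 1" using bc q_power_le[of k] by (intro mult_left_mono) auto
    hence "b * c * \<bar>x\<bar> < 1" using bc_less neg by simp
    thus ?thesis using gF is_phi_eq_F[OF \<gamma> f] that by simp
  next
    case (pos i)
    show ?thesis unfolding pos
    proof (rule pos_grid_agree[where N = N and M = "i - 1"])
      fix j assume "j \<ge> N"
      hence "b * c * \<bar>z * q powi j\<bar> < 1" using NK(1)[of j] bc by (simp add: field_simps)
      thus "g (z * q powi j) = f (z * q powi j)"
        using gF is_phi_eq_F[OF \<gamma> f] pos_in_grid by simp
    next
      fix j show "grid_qdiff q a b c (mu a \<gamma>) g (z * q powi j)"
        using pos_grid_pos[of j] by (intro g_eq pos_in_grid) auto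
    qed (use eq pos_in_grid in auto)
  qed
  moreover have "g x = f x" if "x \<notin> grid q z" for x
    using g f that by (auto simp: is_phi_def extensional_def)
  ultimately show "g = f" by blast
qed

end

text \<open>The weight of the inner product, at positive and at negative grid points.\<close>

definition grid_wt :: "real \<Rightarrow> real \<Rightarrow> real \<Rightarrow> real \<Rightarrow> real \<Rightarrow> real" where
  "grid_wt q a b c x = (1 - q) * \<bar>x\<bar> / pfun q a b c x"

text \<open>The Casorati determinant, normalised so that it is a primitive of the weighted product of two
  eigenfunctions.\<close>

definition casorati ::
  "real \<Rightarrow> real \<Rightarrow> real \<Rightarrow> real \<Rightarrow> (real \<Rightarrow> complex) \<Rightarrow> (real \<Rightarrow> complex) \<Rightarrow> real \<Rightarrow> complex" where
  "casorati q a b c f g x =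
     of_real (grid_wt q a b c x * ((a * b * x + 1) * (a * c * x + 1) / (b * c * x\<^sup>2)))
     * (f (q * x) * g x - f x * g (q * x))"

lemma summable_norm_geometric_limit:
  fixes v :: "nat \<Rightarrow> complex"
  assumes v: "v \<longlonglongrightarrow> L" and r: "0 \<le> r" "r < 1" and u: "\<And>n. norm (u n) = norm (v n) * r ^ n"
  shows "summable (\<lambda>n. norm (u n))"
proof -
  have "Bseq v" using v by (intro convergent_imp_Bseq convergentI)
  then obtain K where K: "\<And>n. norm (v n) \<le> K" by (auto simp: Bseq_def)
  have "summable (\<lambda>n. K * r ^ n)" using r by (intro summable_mult summable_geometric) auto
  moreover have "norm (norm (u n)) \<le> K * r ^ n" for n
    unfolding u using r(1) by (simp add: mult_right_mono K)
  ultimately show ?thesis by (rule summable_comparison_test')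
qed

lemma has_sum_int:
  fixes h :: "int \<Rightarrow> 'a::banach"
  assumes "summable (\<lambda>n. norm (h (int n)))" "summable (\<lambda>n. norm (h (- 1 - int n)))"
  shows "(h has_sum ((\<Sum>n. h (int n)) + (\<Sum>n. h (- 1 - int n)))) UNIV"
proof -
  have r1: "range int = {0..}"
  proof (intro equalityI subsetI)
    fix i :: int assume "i \<in> {0..}"
    hence "i = int (nat i)" by simp
    thus "i \<in> range int" by blast
  qed auto
  have r2: "range (\<lambda>n. - 1 - int n) = {..<0}"
  proof (intro equalityI subsetI)
    fix i :: int assume "i \<in> {..<0}"
    hence "i = - 1 - int (nat (- 1 - i))" by simp
    thus "i \<in> range (\<lambda>n. - 1 - int n)" by blast
  qed auto
  have "((\<lambda>n. h (int n)) has_sum (\<Sum>n. h (int n))) UNIV"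
    by (rule norm_summable_imp_has_sum[OF assms(1) summable_sums[OF summable_norm_cancel[OF assms(1)]]])
  hence "(h has_sum (\<Sum>n. h (int n))) {0..}"
    using has_sum_reindex[of int UNIV h] r1 by (simp add: o_def inj_def)
  moreover have "((\<lambda>n. h (- 1 - int n)) has_sum (\<Sum>n. h (- 1 - int n))) UNIV"
    by (rule norm_summable_imp_has_sum[OF assms(2) summable_sums[OF summable_norm_cancel[OF assms(2)]]])
  hence "(h has_sum (\<Sum>n. h (- 1 - int n))) {..<0}"
    using has_sum_reindex[of "\<lambda>n. - 1 - int n" UNIV h] r2 by (simp add: o_def inj_def)
  moreover have "{0..} \<union> {..<0} = (UNIV :: int set)" "{0..} \<inter> {..<0} = ({} :: int set)" by auto
  ultimately show ?thesis using has_sum_Un_disjoint by metis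
qed

lemma suminf_int_shift_LIMSEQ:
  fixes h :: "int \<Rightarrow> 'a::banach"
  assumes "summable (\<lambda>n. norm (h (int n)))" "summable (\<lambda>n. norm (h (- 1 - int n)))"
  shows "(\<lambda>K. \<Sum>j. h (int j - int K)) \<longlonglongrightarrow> infsum h UNIV"
proof -
  have s1: "summable (\<lambda>n. h (int n))" and s2: "summable (\<lambda>n. h (- 1 - int n))"
    by (rule summable_norm_cancel[OF assms(1)], rule summable_norm_cancel[OF assms(2)])
  have "(\<Sum>j. h (int j - int K)) = (\<Sum>n. h (int n)) + (\<Sum>i<K. h (- 1 - int i))" for K
  proof -
    have "summable (\<lambda>j. h (int (j + K) - int K))" using s1 by simp
    hence "summable (\<lambda>j. h (int j - int K))" by (rule summable_iff_shift[THEN iffD1])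
    hence "(\<Sum>j. h (int j - int K)) = (\<Sum>j. h (int (j + K) - int K)) + (\<Sum>j<K. h (int j - int K))"
      by (rule suminf_split_initial_segment)
    also have "(\<Sum>j<K. h (int j - int K)) = (\<Sum>i<K. h (- 1 - int i))"
      by (rule sum.reindex_bij_witness[of _ "\<lambda>i. K - Suc i" "\<lambda>i. K - Suc i"]) auto
    finally show ?thesis by simp
  qed
  moreover have "(\<lambda>K. (\<Sum>n. h (int n)) + (\<Sum>i<K. h (- 1 - int i)))
      \<longlonglongrightarrow> (\<Sum>n. h (int n)) + (\<Sum>n. h (- 1 - int n))"
    by (intro tendsto_add tendsto_const summable_LIMSEQ s2)
  ultimately show ?thesis using infsumI[OF has_sum_int[OF assms]] by simp
qed

context bigq
begin

lemma is_phi_inverse: "is_phi q a b c z (inverse \<gamma>) f \<longleftrightarrow> is_phi q a b c z \<gamma> f"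
proof -
  have "mu a (inverse \<gamma>) = mu a \<gamma>" by (simp add: mu_def add.commute)
  thus ?thesis unfolding is_phi_def C.bigF_inverse by simp
qed

lemma norm_less_1_pos:
  assumes "x > 0" "k > 0"
  shows "qpoch_inf q (- (complex_of_real k * of_real x)) \<noteq> 0"
proof -
  have "qpoch_inf q (- (k * x)) > 0" using assms by (intro qpoch_inf_pos) (smt (verit) mult_pos_pos)
  hence "complex_of_real (qpoch_inf q (- (k * x))) \<noteq> 0" by simp
  thus ?thesis by (simp flip: qpoch_inf_of_real)
qed

lemma qpoch_inf_bc_grid_nz:
  assumes "x \<in> grid q z"
  shows "qpoch_inf q (- (of_real b * of_real c * complex_of_real x)) \<noteq> 0"
  using assms
proof (cases rule: grid_cases)
  case (neg k)
  show ?thesis using C.qpoch_inf_bc_nz[OF C.norm_bc_q_power[of k]] by (simp add: neg)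
next
  case (pos i)
  show ?thesis unfolding pos of_real_mult[symmetric, of b c]
    using pos_grid_pos b_pos c_pos by (intro norm_less_1_pos) auto
qed

theorem is_phi_E:
  assumes \<gamma>: "\<gamma> \<noteq> 0" "norm (of_real b / \<gamma>) < 1"
  shows "is_phi q a b c z \<gamma> (\<lambda>x\<in>grid q z. E \<gamma> (of_real x))"
  unfolding is_phi_def
proof (intro conjI ballI)
  fix x assume x: "x \<in> grid q z"
  show "grid_qdiff q a b c (mu a \<gamma>) (\<lambda>x\<in>grid q z. E \<gamma> (of_real x)) x"
  proof (rule grid_qdiffI[of _ "E \<gamma>"])
    show "big_qdiff q (of_real a) (of_real b) (of_real c) (\<gamma> + inverse \<gamma>) (E \<gamma>) (of_real x)"
    proof (rule C.bigE_qdiff[OF \<gamma> qpoch_inf_bc_grid_nz[OF x]])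
      show "complex_of_real x = -1 \<or>
          qpoch_inf q (- (of_real b * of_real c * (complex_of_real x / of_real q))) \<noteq> 0"
        using qpoch_inf_bc_grid_nz[OF div_q_in_grid[OF x]] by (cases "x = -1") simp_all
    qed
  qed (use x q_times_in_grid div_q_in_grid in auto)
next
  have bc: "b * c > 0" using b_pos c_pos by simp
  show "\<exists>\<delta>>0. \<forall>x\<in>grid q z. \<bar>x\<bar> < \<delta> \<longrightarrow> (\<lambda>x\<in>grid q z. E \<gamma> (of_real x)) x = F \<gamma> (of_real x)"
  proof (intro exI[of _ "1 / (b * c)"] conjI ballI impI)
    fix x assume "x \<in> grid q z" "\<bar>x\<bar> < 1 / (b * c)"
    hence "norm (of_real b * of_real c * complex_of_real x) < 1"
      using bc b_pos c_pos by (simp add: norm_mult field_simps)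
    from C.bigF_eq_bigE[OF \<gamma> this] show "(\<lambda>x\<in>grid q z. E \<gamma> (of_real x)) x = F \<gamma> (of_real x)"
      using \<open>x \<in> grid q z\<close> by simp
  qed (use bc in simp)
qed simp

subsection \<open>Behaviour at the origin\<close>

lemma F_has_derivative_0: "(F \<gamma> has_field_derivative deriv (F \<gamma>) 0) (at 0)"
proof (rule holomorphic_derivI[OF C.holomorphic_bigF])
  show "(0::complex) \<in> ball 0 (1 / norm (complex_of_real b * of_real c))"
    using b_pos c_pos by simp
qed simp

lemma F_tendsto_0:
  fixes x :: "nat \<Rightarrow> real"
  assumes x: "x \<longlonglongrightarrow> 0"
  shows "(\<lambda>n. F \<gamma> (of_real (x n))) \<longlonglongrightarrow> F \<gamma> 0"
proof -
  have "(\<lambda>n. complex_of_real (x n)) \<longlonglongrightarrow> of_real 0" by (intro tendsto_of_real x)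
  thus ?thesis
    using isCont_tendsto_compose[OF DERIV_isCont[OF F_has_derivative_0]] by fastforce
qed

lemma F_difference_tendsto_0:
  fixes x :: "nat \<Rightarrow> real"
  assumes x: "x \<longlonglongrightarrow> 0" "\<And>n. x n \<noteq> 0"
  shows "(\<lambda>n. (F \<gamma> (of_real (q * x n)) - F \<gamma> (of_real (x n))) / of_real (x n))
    \<longlonglongrightarrow> (of_real q - 1) * deriv (F \<gamma>) 0"
proof -
  define d where "d = deriv (F \<gamma>) 0"
  have D: "((\<lambda>h. (F \<gamma> h - F \<gamma> 0) / h) \<longlongrightarrow> d) (at 0)"
    using F_has_derivative_0[of \<gamma>] by (simp add: has_field_derivative_iff d_def)
  have lim: "(\<lambda>n. (F \<gamma> (of_real (y n)) - F \<gamma> 0) / of_real (y n)) \<longlonglongrightarrow> d"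
    if y: "y \<longlonglongrightarrow> 0" "\<And>n. y n \<noteq> 0" for y :: "nat \<Rightarrow> real"
  proof (rule filterlim_compose[OF D])
    have "(\<lambda>n. complex_of_real (y n)) \<longlonglongrightarrow> of_real 0" by (intro tendsto_of_real y)
    thus "filterlim (\<lambda>n. complex_of_real (y n)) (at 0) sequentially"
      using y(2) by (auto simp: filterlim_at)
  qed
  have "(\<lambda>n. q * x n) \<longlonglongrightarrow> q * 0" by (intro tendsto_mult tendsto_const x)
  hence "(\<lambda>n. of_real q * ((F \<gamma> (of_real (q * x n)) - F \<gamma> 0) / of_real (q * x n))
      - (F \<gamma> (of_real (x n)) - F \<gamma> 0) / of_real (x n)) \<longlonglongrightarrow> of_real q * d - d"
    using x by (intro tendsto_diff tendsto_mult tendsto_const lim) auto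
  moreover have "of_real q * ((F \<gamma> (of_real (q * x n)) - F \<gamma> 0) / of_real (q * x n))
      - (F \<gamma> (of_real (x n)) - F \<gamma> 0) / of_real (x n)
    = (F \<gamma> (of_real (q * x n)) - F \<gamma> (of_real (x n))) / of_real (x n)" for n
  proof -
    have "of_real q * (A / of_real (q * x n)) = A / of_real (x n)" for A :: complex by simp
    thus ?thesis by (simp only: diff_divide_distrib[symmetric]) simp
  qed
  ultimately show ?thesis by (simp add: d_def left_diff_distrib)
qed

lemma grid_LIMSEQ_0: "(\<lambda>k. z * q ^ k) \<longlonglongrightarrow> 0" "(\<lambda>k. - (q ^ k)) \<longlonglongrightarrow> 0"
proof -
  have "(\<lambda>k. q ^ k) \<longlonglongrightarrow> 0" using q_pos q_less_1 by (intro LIMSEQ_power_zero) auto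
  from tendsto_mult[OF tendsto_const this, of z] tendsto_minus[OF this]
  show "(\<lambda>k. z * q ^ k) \<longlonglongrightarrow> 0" "(\<lambda>k. - (q ^ k)) \<longlonglongrightarrow> 0" by simp_all
qed

lemma pos_grid_nat: "z * q ^ k \<in> grid q z"
  using pos_in_grid[of "int k"] by simp

lemma is_phi_eventually_F:
  assumes f: "is_phi q a b c z \<gamma> f" and x: "x \<longlonglongrightarrow> 0" "\<And>n. x n \<in> grid q z"
  shows "\<forall>\<^sub>F n in sequentially. f (x n) = F \<gamma> (of_real (x n)) \<and> f (q * x n) = F \<gamma> (of_real (q * x n))"
proof -
  obtain \<delta> where \<delta>: "\<delta> > 0" "\<And>x. x \<in> grid q z \<Longrightarrow> \<bar>x\<bar> < \<delta> \<Longrightarrow> f x = F \<gamma> (of_real x)"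
    using f by (auto simp: is_phi_def)
  have "\<forall>\<^sub>F n in sequentially. \<bar>x n\<bar> < \<delta>"
    using tendsto_rabs[OF x(1)] \<delta>(1) by (intro order_tendstoD) auto
  thus ?thesis
  proof eventually_elim
    case (elim n)
    have "q * \<bar>x n\<bar> \<le> 1 * \<bar>x n\<bar>" using q_less_1 by (intro mult_right_mono) auto
    hence "\<bar>q * x n\<bar> < \<delta>" using elim by (simp add: abs_mult)
    thus ?case using \<delta>(2) x(2) q_times_in_grid elim by blast
  qed
qed

lemma is_phi_tendsto_0:
  assumes f: "is_phi q a b c z \<gamma> f" and x: "x \<longlonglongrightarrow> 0" "\<And>n. x n \<in> grid q z"
  shows "(\<lambda>n. f (x n)) \<longlonglongrightarrow> F \<gamma> 0"
    and "(\<lambda>n. (f (q * x n) - f (x n)) / of_real (x n)) \<longlonglongrightarrow> (of_real q - 1) * deriv (F \<gamma>) 0"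
proof -
  note ev = is_phi_eventually_F[OF f x]
  show "(\<lambda>n. f (x n)) \<longlonglongrightarrow> F \<gamma> 0"
    by (rule Lim_transform_eventually[OF F_tendsto_0[OF x(1)]]) (use ev in eventually_elim, simp)
  show "(\<lambda>n. (f (q * x n) - f (x n)) / of_real (x n)) \<longlonglongrightarrow> (of_real q - 1) * deriv (F \<gamma>) 0"
    by (rule Lim_transform_eventually[OF F_difference_tendsto_0[OF x(1) grid_nonzero[OF x(2)]]])
       (use ev in eventually_elim, simp)
qed

lemma is_phi_Lop:
  assumes "is_phi q a b c z \<gamma> f"
  shows "Lop q a b c z f = (\<lambda>x\<in>grid q z. mu a \<gamma> * f x)"
proof
  fix x show "Lop q a b c z f x = (\<lambda>x\<in>grid q z. mu a \<gamma> * f x) x"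
    using assms Lop_eq_iff[of x f "mu a \<gamma>"] by (cases "x \<in> grid q z") (auto simp: is_phi_def Lop_def)
qed

text \<open>The boundary conditions at \<open>0\<close> hold because \<open>f\<close> is the restriction of one function holomorphic at
  \<open>0\<close> on both parts of the grid.\<close>

theorem is_phi_Ddom:
  assumes f: "is_phi q a b c z \<gamma> f" and H: "f \<in> Hsp q a b c z"
  shows "f \<in> Ddom q a b c z"
proof -
  have "Lop q a b c z f \<in> Hsp q a b c z"
  proof -
    have e: "(\<lambda>x\<in>grid q z. mu a \<gamma> * f x) (- (q ^ k)) = mu a \<gamma> * f (- (q ^ k))"
      "(\<lambda>x\<in>grid q z. mu a \<gamma> * f x) (z * q powi i) = mu a \<gamma> * f (z * q powi i)" for k i
      using neg_in_grid pos_in_grid by simp_all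
    have s: "(\<lambda>k::nat. (norm (mu a \<gamma>))\<^sup>2 * ((norm (f (- (q ^ k))))\<^sup>2 * wt_neg q a b c k)) summable_on UNIV"
      "(\<lambda>k::int. (norm (mu a \<gamma>))\<^sup>2 * ((norm (f (z * q powi k)))\<^sup>2 * wt_pos q a b c z k)) summable_on UNIV"
      using H by (auto simp: Hsp_def intro!: summable_on_cmult_right)
    show ?thesis
      unfolding is_phi_Lop[OF f] Hsp_def mem_Collect_eq e
      using s by (simp add: norm_mult power_mult_distrib mult.assoc)
  qed
  moreover have Dq: "Dq q f x = (f (q * x) - f x) / of_real x * of_real (- 1 / (1 - q))"
    if "x \<noteq> 0" for x
    using that q_less_1 by (simp add: Dq_def field_simps)
  have "(\<lambda>k. Dq q f (x k)) \<longlonglongrightarrow> (of_real q - 1) * deriv (F \<gamma>) 0 * of_real (- 1 / (1 - q))"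
    if x: "x \<longlonglongrightarrow> 0" "\<And>n. x n \<in> grid q z" for x
    unfolding Dq[OF grid_nonzero[OF x(2)]]
    by (intro tendsto_mult tendsto_const is_phi_tendsto_0[OF f x])
  note this[OF grid_LIMSEQ_0(1) pos_grid_nat] this[OF grid_LIMSEQ_0(2) neg_in_grid]
  moreover note is_phi_tendsto_0(1)[OF f grid_LIMSEQ_0(1) pos_grid_nat]
    is_phi_tendsto_0(1)[OF f grid_LIMSEQ_0(2) neg_in_grid]
  ultimately show ?thesis using H by (auto simp: Ddom_def)
qed

section \<open>The weight and Green's formula\<close>

lemma wt_neg_eq: "wt_neg q a b c k = grid_wt q a b c (- (q ^ k))"
  by (simp add: wt_neg_def grid_wt_def)

lemma wt_pos_eq: "wt_pos q a b c z i = grid_wt q a b c (z * q powi i)"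
  using pos_grid_pos[of i] by (simp add: wt_pos_def grid_wt_def)

lemma pfun_eq: "pfun q a b c x = qpoch_inf q (- (a * b * x)) * qpoch_inf q (- (a * c * x)) /
    (qpoch_inf q (- (b * c * x)) * qpoch_inf q (- (q * x)))"
  by (simp add: pfun_def qpochs_inf_def)

lemma grid_qpoch_inf_pos:
  assumes x: "x \<in> grid q z" and k: "0 < k" "k < 1"
  shows "qpoch_inf q (- (k * x)) > 0"
proof (rule qpoch_inf_pos)
  from x show "- (k * x) < 1"
  proof (cases rule: grid_cases)
    case (neg j)
    have "k * q ^ j \<le> k * 1" using k q_power_le[of j] by (intro mult_left_mono) auto
    also have "k * 1 < 1" using k by simp
    finally show ?thesis by (simp add: neg)
  next
    case (pos i)
    have "k * x > 0" using k pos_grid_pos by (simp add: pos)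
    thus ?thesis by simp
  qed
qed

lemma pfun_pos:
  assumes x: "x \<in> grid q z"
  shows "pfun q a b c x > 0"
  unfolding pfun_eq using a_pos b_pos c_pos ab_less ac_less bc_less q_pos q_less_1
  by (intro divide_pos_pos mult_pos_pos grid_qpoch_inf_pos[OF x]) auto

lemma grid_wt_pos: "x \<in> grid q z \<Longrightarrow> grid_wt q a b c x > 0"
  unfolding grid_wt_def using pfun_pos q_less_1 grid_nonzero by (intro divide_pos_pos mult_pos_pos) auto

lemma grid_wt_q:
  assumes x: "x \<in> grid q z"
  shows "grid_wt q a b c (q * x) * ((b * c * x + 1) * (q * x + 1))
    = q * grid_wt q a b c x * ((a * b * x + 1) * (a * c * x + 1))"
proof -
  have step: "qpoch_inf q (- (k * x)) = (k * x + 1) * qpoch_inf q (- (k * (q * x)))" for k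
    using qpoch_inf_step[of "- (k * x)"] by (simp add: mult_ac add.commute)
  have nz: "qpoch_inf q (- (a * b * y)) \<noteq> 0" "qpoch_inf q (- (a * c * y)) \<noteq> 0"
    "qpoch_inf q (- (b * c * y)) \<noteq> 0" "qpoch_inf q (- (q * y)) \<noteq> 0" if "y \<in> grid q z" for y
    using grid_qpoch_inf_pos[OF that] a_pos b_pos c_pos ab_less ac_less bc_less q_pos q_less_1
    by (metis less_irrefl mult_pos_pos)+
  have "pfun q a b c x * ((b * c * x + 1) * (q * x + 1))
      = pfun q a b c (q * x) * ((a * b * x + 1) * (a * c * x + 1))"
    using nz[OF x] nz[OF q_times_in_grid[OF x]] unfolding pfun_eq step[of "a * b"] step[of "a * c"]
      step[of "b * c"] step[of q] by simp
  hence e: "1 / pfun q a b c (q * x) * ((b * c * x + 1) * (q * x + 1))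
      = 1 / pfun q a b c x * ((a * b * x + 1) * (a * c * x + 1))"
    using pfun_pos[OF x] pfun_pos[OF q_times_in_grid[OF x]] by (simp add: divide_simps mult_ac)
  have "grid_wt q a b c (q * x) * ((b * c * x + 1) * (q * x + 1))
      = (1 - q) * (q * \<bar>x\<bar>) * (1 / pfun q a b c (q * x) * ((b * c * x + 1) * (q * x + 1)))"
    by (simp add: grid_wt_def abs_mult)
  thus ?thesis unfolding e by (simp add: grid_wt_def)
qed

lemma grid_wt_tendsto_0:
  assumes x: "x \<longlonglongrightarrow> 0" "\<And>n. x n \<in> grid q z"
  shows "(\<lambda>n. grid_wt q a b c (x n) / \<bar>x n\<bar>) \<longlonglongrightarrow> 1 - q"
proof -
  have "(\<lambda>n. (1 - q) / pfun q a b c (x n)) \<longlonglongrightarrow> (1 - q) / (qpoch_inf q (- (a * b * 0)) *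
      qpoch_inf q (- (a * c * 0)) / (qpoch_inf q (- (b * c * 0)) * qpoch_inf q (- (q * 0))))"
    unfolding pfun_eq using x(1)
    by (intro tendsto_intros) auto
  moreover have "grid_wt q a b c (x n) / \<bar>x n\<bar> = (1 - q) / pfun q a b c (x n)" for n
    using grid_nonzero[OF x(2)[of n]] by (simp add: grid_wt_def)
  ultimately show ?thesis by simp
qed

lemma casorati_difference:
  assumes x: "x \<in> grid q z" "x \<noteq> -1"
    and f: "grid_qdiff q a b c m1 f x" and g: "grid_qdiff q a b c m2 g x"
  shows "(m1 - m2) * (f x * g x * of_real (grid_wt q a b c x))
    = casorati q a b c f g x - casorati q a b c f g (x / q)"
proof -
  define w where "w = grid_wt q a b c x"
  define A where "A = (a * b * x + 1) * (a * c * x + 1)"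
  define B where "B = (b * c * x + q) * (x + 1)"
  define y where "y = b * c * x\<^sup>2"
  have nz: "x \<noteq> 0" using grid_nonzero x by blast
  have y: "y \<noteq> 0" using nz b_pos c_pos by (simp add: y_def)
  have yq: "x / q \<in> grid q z" using div_q_in_grid x by blast
  define y' where "y' = b * c * (x / q)\<^sup>2"
  define A' where "A' = (a * b * (x / q) + 1) * (a * c * (x / q) + 1)"
  have wq: "w * ((b * c * (x / q) + 1) * (x + 1)) = q * grid_wt q a b c (x / q) * A'"
    using grid_wt_q[OF yq] by (simp add: w_def A'_def)
  have "q * (b * c * (x / q) + 1) = b * c * x + q" by (simp add: distrib_left)
  hence B: "B = q * ((b * c * (x / q) + 1) * (x + 1))" unfolding B_def by (metis mult.assoc)
  have Y: "y = q * q * y'" by (simp add: y_def y'_def power2_eq_square)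
  have "w * B / y = q * (w * ((b * c * (x / q) + 1) * (x + 1))) / (q * q * y')"
    unfolding B Y by (simp only: mult_ac)
  also have "\<dots> = grid_wt q a b c (x / q) * (A' / y')" unfolding wq by simp
  finally have "w * B / y = grid_wt q a b c (x / q) *
      ((a * b * (x / q) + 1) * (a * c * (x / q) + 1) / (b * c * (x / q)\<^sup>2))"
    unfolding A'_def y'_def .
  hence cas: "casorati q a b c f g (x / q) = of_real (w * B / y) * (f x * g (x / q) - f (x / q) * g x)"
    by (simp add: casorati_def)
  have cas': "casorati q a b c f g x = of_real (w * A / y) * (f (q * x) * g x - f x * g (q * x))"
    by (simp add: casorati_def w_def A_def y_def)
  have f': "of_real y * (m1 * f x) = of_real A * (f (q * x) - f x) + of_real B * (f (x / q) - f x)"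
    and g': "of_real y * (m2 * g x) = of_real A * (g (q * x) - g x) + of_real B * (g (x / q) - g x)"
    using f g by (simp_all add: grid_qdiff_def A_def B_def y_def)
  have "(m1 - m2) * (f x * g x * of_real w) * of_real y
      = of_real w * ((of_real y * (m1 * f x)) * g x - f x * (of_real y * (m2 * g x)))"
    by (simp add: algebra_simps)
  also have "\<dots> = of_real w * of_real A * (f (q * x) * g x - f x * g (q * x))
      - of_real w * of_real B * (f x * g (x / q) - f (x / q) * g x)"
    unfolding f' g' by (simp add: algebra_simps)
  also have "\<dots> = (casorati q a b c f g x - casorati q a b c f g (x / q)) * of_real y"
    unfolding cas cas' using y by (simp add: field_simps)
  finally show ?thesis using y by (simp add: w_def)
qed

lemma casorati_at_neg1:
  assumes f: "grid_qdiff q a b c m1 f (-1)" and g: "grid_qdiff q a b c m2 g (-1)"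
  shows "(m1 - m2) * (f (-1) * g (-1) * of_real (grid_wt q a b c (-1))) = casorati q a b c f g (-1)"
proof -
  define A where "A = (1 - a * b) * (1 - a * c)"
  define y where "y = b * c"
  have y: "y \<noteq> 0" using b_pos c_pos by (simp add: y_def)
  have f': "of_real y * (m1 * f (-1)) = of_real A * (f (- q) - f (-1))"
    and g': "of_real y * (m2 * g (-1)) = of_real A * (g (- q) - g (-1))"
    using f g by (simp_all add: grid_qdiff_def A_def y_def)
  have "(m1 - m2) * (f (-1) * g (-1)) * of_real y
      = (of_real y * (m1 * f (-1))) * g (-1) - f (-1) * (of_real y * (m2 * g (-1)))"
    by (simp add: algebra_simps)
  also have "\<dots> = of_real A * (f (- q) * g (-1) - f (-1) * g (- q))"
    unfolding f' g' by (simp add: algebra_simps)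
  finally have e: "(m1 - m2) * (f (-1) * g (-1)) = of_real (A / y) * (f (- q) * g (-1) - f (-1) * g (- q))"
    using y by (simp add: field_simps)
  have "casorati q a b c f g (-1)
      = of_real (grid_wt q a b c (-1)) * (of_real (A / y) * (f (- q) * g (-1) - f (-1) * g (- q)))"
    by (simp add: casorati_def A_def y_def)
  thus ?thesis unfolding e[symmetric] by (simp only: mult_ac)
qed

lemma casorati_tendsto_0:
  assumes f: "is_phi q a b c z \<gamma>1 f" and g: "is_phi q a b c z \<gamma>2 g"
    and x: "x \<longlonglongrightarrow> 0" "\<And>n. x n \<in> grid q z" and s: "\<And>n. sgn (x n) = s"
  shows "(\<lambda>n. casorati q a b c f g (x n)) \<longlonglongrightarrow>
    of_real (s * ((1 - q) / (b * c))) * ((of_real q - 1) * deriv (F \<gamma>1) 0 * F \<gamma>2 0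
       - F \<gamma>1 0 * ((of_real q - 1) * deriv (F \<gamma>2) 0))"
proof -
  have "(\<lambda>n. of_real (s * (grid_wt q a b c (x n) / \<bar>x n\<bar> *
           ((a * b * x n + 1) * (a * c * x n + 1) / (b * c))))
         * ((f (q * x n) - f (x n)) / of_real (x n) * g (x n)
            - f (x n) * ((g (q * x n) - g (x n)) / of_real (x n))))
      \<longlonglongrightarrow> of_real (s * ((1 - q) * ((a * b * 0 + 1) * (a * c * 0 + 1) / (b * c))))
        * ((of_real q - 1) * deriv (F \<gamma>1) 0 * F \<gamma>2 0 - F \<gamma>1 0 * ((of_real q - 1) * deriv (F \<gamma>2) 0))"
    using b_pos c_pos
    by (intro tendsto_mult tendsto_diff tendsto_of_real tendsto_const tendsto_divide tendsto_add
          grid_wt_tendsto_0 is_phi_tendsto_0[OF f] is_phi_tendsto_0[OF g] x) auto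
  moreover have "casorati q a b c f g (x n) = of_real (s * (grid_wt q a b c (x n) / \<bar>x n\<bar> *
           ((a * b * x n + 1) * (a * c * x n + 1) / (b * c))))
         * ((f (q * x n) - f (x n)) / of_real (x n) * g (x n)
            - f (x n) * ((g (q * x n) - g (x n)) / of_real (x n)))" for n
  proof -
    have nz: "x n \<noteq> 0" using grid_nonzero[OF x(2)] .
    have sx: "s / \<bar>x n\<bar> = 1 / x n" 
      using nz unfolding s[of n, symmetric] by (simp add: sgn_if)
    define w where "w = grid_wt q a b c (x n) * ((a * b * x n + 1) * (a * c * x n + 1)) / (b * c)"
    have "s * (grid_wt q a b c (x n) / \<bar>x n\<bar> * ((a * b * x n + 1) * (a * c * x n + 1) / (b * c)))
        = (s / \<bar>x n\<bar>) * w" by (simp add: w_def)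
    also have "\<dots> = w / x n" by (simp add: sx)
    finally have e: "s * (grid_wt q a b c (x n) / \<bar>x n\<bar> *
      ((a * b * x n + 1) * (a * c * x n + 1) / (b * c))) = w / x n" .
    have e': "grid_wt q a b c (x n) * ((a * b * x n + 1) * (a * c * x n + 1) / (b * c * (x n)\<^sup>2))
        = w / x n / x n" by (simp add: w_def power2_eq_square)
    have "of_real (w / x n) * ((f (q * x n) - f (x n)) / of_real (x n) * g (x n)
            - f (x n) * ((g (q * x n) - g (x n)) / of_real (x n)))
      = of_real (w / x n) * ((f (q * x n) * g (x n) - f (x n) * g (q * x n)) / of_real (x n))"
      by (simp add: diff_divide_distrib algebra_simps)
    thus ?thesis unfolding casorati_def e e' by simp
  qed
  ultimately show ?thesis by simp
qed

text \<open>The part of the bilinear form coming from all grid points \<open>x \<le> z q\<^sup>-\<^sup>K\<close>.\<close>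

definition partial_form :: "(real \<Rightarrow> complex) \<Rightarrow> (real \<Rightarrow> complex) \<Rightarrow> nat \<Rightarrow> complex" where
  "partial_form f g K =
     (\<Sum>k. f (- (q ^ k)) * g (- (q ^ k)) * of_real (grid_wt q a b c (- (q ^ k))))
     + (\<Sum>j. f (z * q powi (int j - int K)) * g (z * q powi (int j - int K))
            * of_real (grid_wt q a b c (z * q powi (int j - int K))))"

lemma summable_weighted:
  shows "(\<lambda>k. h (- (q ^ k))) \<longlonglongrightarrow> L \<Longrightarrow>
      summable (\<lambda>k. norm (h (- (q ^ k)) * complex_of_real (grid_wt q a b c (- (q ^ k)))))"
    and "(\<lambda>k. h (z * q ^ k)) \<longlonglongrightarrow> L \<Longrightarrow>
      summable (\<lambda>k. norm (h (z * q ^ k) * complex_of_real (grid_wt q a b c (z * q ^ k))))"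
proof -
  note lim = tendsto_mult[OF _ tendsto_of_real[OF grid_wt_tendsto_0]]
  show "summable (\<lambda>k. norm (h (- (q ^ k)) * complex_of_real (grid_wt q a b c (- (q ^ k)))))"
    if "(\<lambda>k. h (- (q ^ k))) \<longlonglongrightarrow> L"
    by (rule summable_norm_geometric_limit[OF lim[OF that grid_LIMSEQ_0(2) neg_in_grid], of q])
       (use q_pos q_less_1 in \<open>auto simp: norm_mult norm_divide\<close>)
  show "summable (\<lambda>k. norm (h (z * q ^ k) * complex_of_real (grid_wt q a b c (z * q ^ k))))"
    if "(\<lambda>k. h (z * q ^ k)) \<longlonglongrightarrow> L"
  proof (rule summable_norm_geometric_limit[of _ _ q])
    show "(\<lambda>n. h (z * q ^ n) * of_real (grid_wt q a b c (z * q ^ n) / \<bar>z * q ^ n\<bar>) * of_real z)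
      \<longlonglongrightarrow> L * of_real (1 - q) * of_real z"
      by (intro tendsto_mult[OF lim[OF that grid_LIMSEQ_0(1) pos_grid_nat] tendsto_const])
  qed (use q_pos q_less_1 z_pos in \<open>auto simp: norm_mult norm_divide\<close>)
qed

lemma summable_near_0:
  assumes f: "is_phi q a b c z \<gamma>1 f" and g: "is_phi q a b c z \<gamma>2 g"
  shows "summable (\<lambda>k. norm (f (- (q ^ k)) * g (- (q ^ k)) * of_real (grid_wt q a b c (- (q ^ k)))))"
    and "summable (\<lambda>k. norm (f (z * q ^ k) * g (z * q ^ k) * of_real (grid_wt q a b c (z * q ^ k))))"
  by (rule summable_weighted[of "\<lambda>x. f x * g x" "F \<gamma>1 0 * F \<gamma>2 0"];
      intro tendsto_mult is_phi_tendsto_0(1)[OF f] is_phi_tendsto_0(1)[OF g]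
        grid_LIMSEQ_0 neg_in_grid pos_grid_nat)+

text \<open>The differences of Casorati determinants telescope; the determinants at \<open>-q\<^sup>k\<close> and at \<open>z q\<^sup>k\<close> tend to \<open>0\<close> for
  \<open>k \<rightarrow> \<infinity>\<close>, and the one at \<open>-1\<close> accounts for the boundary point.\<close>

theorem green:
  assumes f: "is_phi q a b c z \<gamma>1 f" and g: "is_phi q a b c z \<gamma>2 g"
  shows "(mu a \<gamma>1 - mu a \<gamma>2) * partial_form f g K
    = - casorati q a b c f g (z * q powi (- int K - 1))"
proof -
  define m where "m = mu a \<gamma>1 - mu a \<gamma>2"
  define h where "h = (\<lambda>x. f x * g x * of_real (grid_wt q a b c x))"
  define W where "W = casorati q a b c f g"
  have fe: "grid_qdiff q a b c (mu a \<gamma>1) f x" and ge: "grid_qdiff q a b c (mu a \<gamma>2) g x"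
    if "x \<in> grid q z" for x using f g that by (auto simp: is_phi_def)
  have diff: "m * h x = W x - W (x / q)" if "x \<in> grid q z" "x \<noteq> -1" for x
    unfolding m_def h_def W_def using casorati_difference[OF that fe ge] that by simp
  have neg: "m * (\<Sum>k<Suc n. h (- (q ^ k))) = W (- (q ^ n))" for n
  proof (induction n)
    case 0
    have "-1 \<in> grid q z" using neg_in_grid[of 0] by simp
    from casorati_at_neg1[OF fe[OF this] ge[OF this]] show ?case by (simp add: m_def h_def W_def)
  next
    case (Suc n)
    have "q ^ Suc n < 1" using q_pos q_less_1 by (intro power_Suc_less_one) auto
    hence "m * h (- (q ^ Suc n)) = W (- (q ^ Suc n)) - W (- (q ^ n))"
      using diff[OF neg_in_grid[of "Suc n"]] unfolding neg_grid_div_q by simp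
    thus ?case using Suc.IH by (simp add: distrib_left)
  qed
  have pos: "m * (\<Sum>j<n. h (z * q powi (int j - int K)))
      = W (z * q powi (int n - int K - 1)) - W (z * q powi (- int K - 1))" for n
  proof (induction n)
    case (Suc n)
    have "m * h (z * q powi (int n - int K)) = W (z * q powi (int n - int K)) - W (z * q powi (int n - int K - 1))"
      using diff[OF pos_in_grid[of "int n - int K"]] pos_grid_pos[of "int n - int K"]
      unfolding pos_grid_div_q by simp
    thus ?case using Suc.IH by (simp add: distrib_left)
  qed simp
  have sneg: "summable (\<lambda>k. h (- (q ^ k)))"
    using summable_near_0(1)[OF f g] unfolding h_def by (rule summable_norm_cancel)
  have "summable (\<lambda>k. h (z * q ^ k))"
    using summable_near_0(2)[OF f g] unfolding h_def by (rule summable_norm_cancel)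
  hence "summable (\<lambda>j. h (z * q powi (int (j + K) - int K)))" by simp
  hence spos: "summable (\<lambda>j. h (z * q powi (int j - int K)))" by (rule summable_iff_shift[THEN iffD1])
  define S where "S = (\<lambda>n. m * (\<Sum>k<Suc n. h (- (q ^ k))) + m * (\<Sum>j<n + K + 1. h (z * q powi (int j - int K))))"
  have "S \<longlonglongrightarrow> m * (\<Sum>k. h (- (q ^ k))) + m * (\<Sum>j. h (z * q powi (int j - int K)))"
    unfolding S_def
    using LIMSEQ_Suc[OF summable_LIMSEQ[OF sneg]]
      LIMSEQ_ignore_initial_segment[OF summable_LIMSEQ[OF spos], of "K + 1"]
    by (intro tendsto_add tendsto_mult tendsto_const) (simp_all add: add.assoc del: sum.lessThan_Suc)
  also have "m * (\<Sum>k. h (- (q ^ k))) + m * (\<Sum>j. h (z * q powi (int j - int K))) = m * partial_form f g K"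
    by (simp add: partial_form_def h_def distrib_left)
  finally have lim1: "S \<longlonglongrightarrow> m * partial_form f g K" .
  have "S = (\<lambda>n. W (- (q ^ n)) + W (z * q ^ n) - W (z * q powi (- int K - 1)))"
    unfolding S_def neg pos by (simp add: algebra_simps)
  moreover have "(\<lambda>n. W (- (q ^ n)) + W (z * q ^ n) - W (z * q powi (- int K - 1)))
      \<longlonglongrightarrow> - W (z * q powi (- int K - 1))"
  proof -
    define D where "D = (of_real q - 1) * deriv (F \<gamma>1) 0 * F \<gamma>2 0
       - F \<gamma>1 0 * ((of_real q - 1) * deriv (F \<gamma>2) 0)"
    define r where "r = (1 - q) / (b * c)"
    have "(\<lambda>n. W (- (q ^ n))) \<longlonglongrightarrow> of_real (-1 * r) * D"
      unfolding W_def D_def r_def using q_pos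
      by (intro casorati_tendsto_0[OF f g grid_LIMSEQ_0(2) neg_in_grid]) (simp add: sgn_if)
    moreover have "(\<lambda>n. W (z * q ^ n)) \<longlonglongrightarrow> of_real (1 * r) * D"
      unfolding W_def D_def r_def using q_pos z_pos
      by (intro casorati_tendsto_0[OF f g grid_LIMSEQ_0(1) pos_grid_nat]) (simp add: sgn_if)
    ultimately have "(\<lambda>n. W (- (q ^ n)) + W (z * q ^ n) - W (z * q powi (- int K - 1)))
      \<longlonglongrightarrow> of_real (-1 * r) * D + of_real (1 * r) * D
          - W (z * q powi (- int K - 1))"
      by (intro tendsto_intros)
    thus ?thesis by simp
  qed
  ultimately have "S \<longlonglongrightarrow> - W (z * q powi (- int K - 1))" by (simp only:)
  with lim1 show ?thesis unfolding m_def W_def by (rule LIMSEQ_unique)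
qed

end

section \<open>Asymptotic behaviour at infinity\<close>

text \<open>A limit in which the index and the point move simultaneously, at every point of a compact set, is
  uniform on the set.\<close>

lemma joint_limit_uniform_on_compact:
  fixes f :: "nat \<Rightarrow> 'a::topological_space \<Rightarrow> complex"
  assumes S: "compact S" and lim: "\<And>s. s \<in> S \<Longrightarrow> ((\<lambda>(k, x). f k x) \<longlongrightarrow> 0) (sequentially \<times>\<^sub>F nhds s)"
    and e: "e > 0"
  shows "\<exists>N. \<forall>k\<ge>N. \<forall>x\<in>S. norm (f k x) < e"
proof -
  have "\<exists>U N. open U \<and> s \<in> U \<and> (\<forall>k\<ge>N. \<forall>x\<in>U. norm (f k x) < e)" if "s \<in> S" for s
  proof -
    have "\<forall>\<^sub>F p in sequentially \<times>\<^sub>F nhds s. norm ((\<lambda>(k, x). f k x) p) < e"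
      using tendsto_norm_zero[OF lim[OF that]] e by (rule order_tendstoD)
    then obtain P R where P: "eventually P sequentially" and R: "eventually R (nhds s)"
      and PR: "\<And>k x. P k \<Longrightarrow> R x \<Longrightarrow> norm (f k x) < e"
      by (auto simp: eventually_prod_filter)
    from P obtain N where "\<And>k. k \<ge> N \<Longrightarrow> P k" by (auto simp: eventually_at_top_linorder)
    moreover from R obtain U where "open U" "s \<in> U" "\<And>x. x \<in> U \<Longrightarrow> R x"
      by (auto simp: eventually_nhds)
    ultimately show ?thesis using PR by blast
  qed
  then obtain U N where U: "\<And>s. s \<in> S \<Longrightarrow> open (U s) \<and> s \<in> U s \<and>
      (\<forall>k\<ge>N s. \<forall>x\<in>U s. norm (f k x) < e)"
    by metis
  obtain T where T: "T \<subseteq> S" "finite T" "S \<subseteq> (\<Union>s\<in>T. U s)"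
    using compactE_image[OF S, of S U] U by (metis (no_types, lifting) UN_I subsetI)
  show ?thesis
  proof (cases "T = {}")
    case False
    show ?thesis
    proof (intro exI[of _ "Max (N ` T)"] allI impI ballI)
      fix k x assume k: "Max (N ` T) \<le> k" and "x \<in> S"
      then obtain s where s: "s \<in> T" "x \<in> U s" using T(3) by blast
      have "N s \<le> Max (N ` T)" using s(1) T(2) by simp
      thus "norm (f k x) < e" using U[of s] s T(1) k by auto
    qed
  qed (use T in auto)
qed

context qbase
begin

lemma qpochn_neg_ge_1:
  assumes "t \<ge> (0::real)"
  shows "qpochn q (- t) n \<ge> 1"
proof -
  have "(\<Prod>i<n. (1::real)) \<le> (\<Prod>i<n. 1 - (- t) * q ^ i)"
    using assms by (intro prod_mono) auto
  thus ?thesis by (simp add: qpochn_def)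
qed

lemma qpoch_inf_neg_ge_1:
  assumes "t \<ge> (0::real)"
  shows "qpoch_inf q (- t) \<ge> 1"
  by (rule LIMSEQ_le_const[OF qpochn_LIMSEQ]) (use qpochn_neg_ge_1[OF assms] in blast)

lemma norm_inverse_qpochn_neg_le:
  assumes "t \<ge> 0"
  shows "norm (inverse (qpochn q (complex_of_real (- t)) n)) \<le> 1"
    "norm (inverse (qpoch_inf q (complex_of_real (- t)))) \<le> 1"
  using qpochn_neg_ge_1[OF assms, of n] qpoch_inf_neg_ge_1[OF assms]
  unfolding qpochn_of_real qpoch_inf_of_real norm_inverse norm_of_real
  by (simp_all add: inverse_eq_divide divide_le_eq)

end

context bigq
begin

text \<open>The limit of \<open>a\<^sup>2\<^sup>k\<close> times the weight at \<open>z q\<^sup>-\<^sup>k\<close>.\<close>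

definition limit_weight :: real where
  "limit_weight = (1 - q) * z * (qtheta q (- (b * c * z)) * qtheta q (- 1 / z)) /
     (qtheta q (- (a * b * z)) * qtheta q (- (a * c * z)))"

lemma qtheta_eq: "qtheta q x = qpoch_inf q x * qpoch_inf q (q / x)"
  by (simp add: qtheta_def qpochs_inf_def)

lemma pos_grid_neg_index: "z * q powi (- int k) = z / q ^ k"
  by (simp add: power_int_minus divide_inverse)

lemma grid_wt_at_infinity:
  "(\<lambda>k. grid_wt q a b c (z / q ^ k) * a ^ (2 * k)) \<longlonglongrightarrow> limit_weight"
proof -
  define r where "r = (\<lambda>t k. qpochn q (q / - t) k * qpoch_inf q (- t))"
  have nz: "r t k \<noteq> 0" if "t > 0" for t k
  proof -
    have "qpochn q (q / - t) k \<ge> 1" using qpochn_neg_ge_1[of "q / t" k] that by simp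
    moreover have "qpoch_inf q (- t) \<ge> 1" using qpoch_inf_neg_ge_1[of t] that by simp
    ultimately show ?thesis by (auto simp: r_def)
  qed
  have P: "qpoch_inf q (- (y * (z / q ^ k))) = (y * z) ^ k / q ^ (\<Sum>{..k}) * r (y * z) k" if "y > 0" for y k
    using qpoch_inf_reverse[of "- (y * z)" k] that z_pos by (simp add: r_def)
  have "grid_wt q a b c (z / q ^ k) * a ^ (2 * k)
      = (1 - q) * z * (r (b * c * z) k * r (q * z) k / (r (a * b * z) k * r (a * c * z) k))" for k
  proof -
    define T where "T = q ^ (\<Sum>{..k})"
    have T: "T \<noteq> 0" by (simp add: T_def)
    have "\<bar>z / q ^ k\<bar> = z / q ^ k" using z_pos q_pos by simp
    hence "grid_wt q a b c (z / q ^ k) * a ^ (2 * k) = (1 - q) * (z / q ^ k) *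
       (((b * c * z) ^ k / T * r (b * c * z) k * ((q * z) ^ k / T * r (q * z) k)) /
        ((a * b * z) ^ k / T * r (a * b * z) k * ((a * c * z) ^ k / T * r (a * c * z) k))) * a ^ (2 * k)"
      unfolding grid_wt_def pfun_eq using P[of "b * c" k] P[of q k] P[of "a * b" k] P[of "a * c" k]
        a_pos b_pos c_pos q_pos by (simp add: T_def)
    also have "\<dots> = (1 - q) * z * (r (b * c * z) k * r (q * z) k / (r (a * b * z) k * r (a * c * z) k))"
      using T a_pos b_pos c_pos z_pos q_pos nz[of "a * b * z" k] nz[of "a * c * z" k]
      by (simp add: field_simps power_mult_distrib power_mult power2_eq_square)
    finally show ?thesis .
  qed
  moreover have "(\<lambda>k. (1 - q) * z * (r (b * c * z) k * r (q * z) k / (r (a * b * z) k * r (a * c * z) k)))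
    \<longlonglongrightarrow> (1 - q) * z * (qtheta q (- (b * c * z)) * qtheta q (- (q * z)) /
        (qtheta q (- (a * b * z)) * qtheta q (- (a * c * z))))"
  proof -
    have lim: "r t \<longlonglongrightarrow> qtheta q (- t)" for t
      unfolding r_def qtheta_eq
      using tendsto_mult[OF qpochn_LIMSEQ tendsto_const, of "q / - t" "qpoch_inf q (- t)"]
      by (simp add: mult.commute)
    have "qtheta q (- t) \<noteq> 0" if "t > 0" for t
      using qpoch_inf_neg_ge_1[of t] qpoch_inf_neg_ge_1[of "q / t"] that by (auto simp: qtheta_eq)
    thus ?thesis using a_pos b_pos c_pos z_pos by (intro tendsto_mult tendsto_divide tendsto_const lim) auto
  qed
  moreover have "qtheta q (- (q * z)) = qtheta q (- 1 / z)"
    using z_pos by (simp add: qtheta_eq mult.commute)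
  ultimately show ?thesis by (simp add: limit_weight_def)
qed

text \<open>The function \<open>\<theta>\<close> for a complex argument.\<close>

definition ctheta :: "complex \<Rightarrow> complex" where
  "ctheta x = qpoch_inf q x * qpoch_inf q (of_real q / x)"

lemma ctheta_of_real: "ctheta (of_real x) = of_real (qtheta q x)"
  unfolding ctheta_def qtheta_eq of_real_mult qpoch_inf_of_real[symmetric] by simp

text \<open>The coefficient of the growing solution: \<open>\<phi>\<^sub>\<gamma>(z q\<^sup>-\<^sup>k) \<sim> cfun \<gamma> (a\<gamma>)\<^sup>k\<close> for \<open>|\<gamma>| > 1\<close>.\<close>

definition cfun :: "complex \<Rightarrow> complex" where
  "cfun \<gamma> = qpoch_inf q (of_real a / \<gamma>) * qpoch_inf q (of_real b / \<gamma>) * qpoch_inf q (of_real c / \<gamma>)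
     * ctheta (- (of_real (a * b * c * z) * \<gamma>)) /
     (of_real (qpoch_inf q (a * b) * qpoch_inf q (a * c) * qtheta q (- (b * c * z)))
       * qpoch_inf q (inverse (\<gamma>\<^sup>2)))"

text \<open>The \<open>n\<close>-th term of \<open>bigG\<close> at \<open>x = z q\<^sup>-\<^sup>k\<close>, divided by \<open>(-bcx;q)\<^sub>\<infinity>\<close> and by the expected growth
  \<open>(a\<gamma>)\<^sup>k\<close>. Its limit for \<open>k \<rightarrow> \<infinity>\<close> is a multiple of \<open>bigG_coeff \<gamma> n \<gamma>\<^sup>-\<^sup>2\<^sup>n\<close>, which is summed by the
  q-Gauss sum in \<open>gauss_at_infinity\<close>. The shifted factorials are rewritten differently for
  \<open>n \<le> k\<close> and \<open>n \<ge> k\<close>, in order to obtain a bound independent of \<open>k\<close>.\<close>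

definition norm_term :: "nat \<Rightarrow> complex \<Rightarrow> nat \<Rightarrow> complex" where
  "norm_term k \<gamma> n = bigG_term q (of_real a) (of_real b) (of_real c) \<gamma> (of_real (z / q ^ k)) n /
     (qpoch_inf q (of_real (- (b * c * z / q ^ k))) * (of_real a * \<gamma>) ^ k)"

abbreviation gcoeff :: "complex \<Rightarrow> nat \<Rightarrow> complex" where
  "gcoeff \<equiv> bigG_coeff q (of_real a) (of_real b) (of_real c)"

lemma norm_term_initial:
  assumes \<gamma>: "\<gamma> \<noteq> 0" and n: "n \<le> k"
  shows "norm_term k \<gamma> n = gcoeff \<gamma> n * inverse (\<gamma>\<^sup>2) ^ n *
    (qpochn q (of_real (- (q / (a * c * z)))) k * inverse (qpochn q (of_real (- (q / (a * c * z)))) (k - n))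
     * qpochn q (of_real q / - (of_real (a * b * c * z) * \<gamma>)) (k - n)
     * qpoch_inf q (- (of_real (a * b * c * z) * \<gamma>))
     * inverse (qpochn q (of_real (- (q / (b * c * z)))) k)
     * inverse (qpoch_inf q (of_real (- (b * c * z)))))"
proof -
  define Q where "Q = complex_of_real q"
  define y1 where "y1 = complex_of_real (- (a * c * z))"
  define y2 where "y2 = - (complex_of_real (a * b * c * z) * \<gamma>)"
  define y3 where "y3 = complex_of_real (- (b * c * z))"
  have nz: "y1 \<noteq> 0" "y2 \<noteq> 0" "y3 \<noteq> 0" "Q \<noteq> 0"
    using a_pos b_pos c_pos z_pos \<gamma> by (simp_all add: y1_def y2_def y3_def Q_def)
  define l where "l = k - n"
  have kl: "k = n + l" using n by (simp add: l_def)
  define p1 where "p1 = qpochn q (Q / y1) k"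
  define p1' where "p1' = qpochn q (Q / y1) l"
  define p2 where "p2 = qpochn q (Q / y2) l"
  define p3 where "p3 = qpochn q (Q / y3) k"
  have neg: "Q / y1 = of_real (- (q / (a * c * z)))" "Q / y3 = of_real (- (q / (b * c * z)))"
    by (simp_all add: Q_def y1_def y3_def)
  have p_nz: "p1' \<noteq> 0"
  proof -
    have "qpochn q (- (q / (a * c * z))) l \<ge> 1"
      using a_pos c_pos z_pos q_pos by (intro qpochn_neg_ge_1) auto
    thus ?thesis unfolding p1'_def neg qpochn_of_real by simp
  qed
  define Tk where "Tk = Q ^ (\<Sum>{..k})"
  define Tl where "Tl = Q ^ (\<Sum>{..l})"
  have T: "Tk \<noteq> 0" "Tl \<noteq> 0" using nz by (simp_all add: Tk_def Tl_def)
  have r1: "qpochn q (y1 / Q ^ k) n = (- y1) ^ n * Tl / Tk * (p1 / p1')"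
  proof -
    have "qpochn q (y1 / Q ^ k) n * qpochn q (y1 / Q ^ l) l = qpochn q (y1 / Q ^ k) k"
      using qpochn_reverse_partial[OF q_nz n, of y1] by (simp add: Q_def l_def)
    hence "qpochn q (y1 / Q ^ k) n * ((- y1) ^ l / Tl * p1') = (- y1) ^ k / Tk * p1"
      using qpochn_reverse[of q y1 k] qpochn_reverse[of q y1 l] nz
      by (simp add: Q_def Tk_def Tl_def p1_def p1'_def)
    hence "qpochn q (y1 / Q ^ k) n * (p1' * (- y1) ^ l) * Tk = (- y1) ^ n * (- y1) ^ l * p1 * Tl"
      using T unfolding kl power_add by (simp add: field_simps)
    thus ?thesis using T p_nz nz by (simp add: field_simps)
  qed
  have r2: "qpoch_inf q (y2 / Q ^ l) = (- y2) ^ l / Tl * p2 * qpoch_inf q y2"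
    using qpoch_inf_reverse[OF nz(2), of l] by (simp add: Q_def Tl_def p2_def)
  have r3: "qpoch_inf q (y3 / Q ^ k) = (- y3) ^ k / Tk * p3 * qpoch_inf q y3"
    using qpoch_inf_reverse[OF nz(3), of k] by (simp add: Q_def Tk_def p3_def)
  have e1: "- (of_real a * of_real c * complex_of_real (z / q ^ k)) = y1 / Q ^ k"
    by (simp add: y1_def Q_def)
  have e2: "- (of_real a * of_real b * of_real c * \<gamma> * complex_of_real (z / q ^ k)) * of_real q ^ n = y2 / Q ^ l"
    by (simp add: y2_def Q_def kl power_add)
  have e3: "complex_of_real (- (b * c * z / q ^ k)) = y3 / Q ^ k"
    by (simp add: y3_def Q_def)
  have y: "- y2 = of_real b * \<gamma> * (- y1)" "- y2 = of_real a * \<gamma> * (- y3)"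
    by (simp_all add: y1_def y2_def y3_def)
  have pw: "(- y1) ^ n * (- y2) ^ l * (of_real b / \<gamma>) ^ n
      = inverse (\<gamma>\<^sup>2) ^ n * ((- y3) ^ k * (of_real a * \<gamma>) ^ k)"
  proof -
    have "(- y3) ^ k * (of_real a * \<gamma>) ^ k = (- y2) ^ n * (- y2) ^ l"
      unfolding power_mult_distrib[symmetric] y(2) kl power_add[symmetric] by (simp add: mult_ac)
    also have "(- y2) ^ n = (of_real b * \<gamma>) ^ n * (- y1) ^ n"
      unfolding y(1) power_mult_distrib ..
    also have "inverse (\<gamma>\<^sup>2) ^ n * ((of_real b * \<gamma>) ^ n * (- y1) ^ n * (- y2) ^ l)
        = (inverse (\<gamma>\<^sup>2) * (of_real b * \<gamma>)) ^ n * (- y1) ^ n * (- y2) ^ l"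
      by (simp add: power_mult_distrib)
    also have "inverse (\<gamma>\<^sup>2) * (of_real b * \<gamma>) = of_real b / \<gamma>"
      using \<gamma> by (simp add: power2_eq_square field_simps)
    finally show ?thesis by (simp add: mult_ac)
  qed
  have "norm_term k \<gamma> n = gcoeff \<gamma> n * ((- y1) ^ n * Tl / Tk * (p1 / p1')) *
      ((- y2) ^ l / Tl * p2 * qpoch_inf q y2) * (of_real b / \<gamma>) ^ n /
      ((- y3) ^ k / Tk * p3 * qpoch_inf q y3 * (of_real a * \<gamma>) ^ k)"
    unfolding norm_term_def bigG_term_def e1 e2 e3 r1 r2 r3 ..
  also have "\<dots> = gcoeff \<gamma> n * ((- y1) ^ n * (- y2) ^ l * (of_real b / \<gamma>) ^ n) * (p1 * inverse p1' * p2 * qpoch_inf q y2)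
     / (((- y3) ^ k * (of_real a * \<gamma>) ^ k) * (p3 * qpoch_inf q y3))"
  proof -
    have "g * (A * t' / t * (u / u')) * (B / t' * v * w) * D / (H / t * s * r * Y)
        = g * (A * B * D) * (u * inverse u' * v * w) / ((H * Y) * (s * r))"
      if "t \<noteq> 0" "t' \<noteq> 0" for g A B D H Y t t' u u' v w s r :: complex
      using that by (simp add: divide_simps mult_ac)
    thus ?thesis using T by blast
  qed
  also have "\<dots> = gcoeff \<gamma> n * inverse (\<gamma>\<^sup>2) ^ n *
      (p1 * inverse p1' * p2 * qpoch_inf q y2 * inverse p3 * inverse (qpoch_inf q y3))"
  proof -
    have "g * (I * H) * p / (H * (s * r)) = g * I * (p * inverse s * inverse r)"
      if "H \<noteq> 0" for g I H p s r :: complex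
      using that by (simp add: divide_simps)
    moreover have "(- y3) ^ k * (of_real a * \<gamma>) ^ k \<noteq> 0" using nz a_pos \<gamma> by simp
    ultimately show ?thesis unfolding pw by blast
  qed
  finally show ?thesis
    unfolding p1_def p1'_def p2_def p3_def neg unfolding y2_def y3_def Q_def l_def .
qed

lemma norm_term_final:
  assumes \<gamma>: "\<gamma> \<noteq> 0"
  shows "norm_term k \<gamma> (k + m) = gcoeff \<gamma> (k + m) * (inverse (\<gamma>\<^sup>2) ^ k * (of_real b / \<gamma>) ^ m) *
    (qpochn q (of_real (- (q / (a * c * z)))) k * qpochn q (of_real (- (a * c * z))) m
     * qpoch_inf q (- (of_real (a * b * c * z) * \<gamma>) * of_real q ^ m)
     * inverse (qpochn q (of_real (- (q / (b * c * z)))) k)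
     * inverse (qpoch_inf q (of_real (- (b * c * z)))))"
proof -
  define Q where "Q = complex_of_real q"
  define y1 where "y1 = complex_of_real (- (a * c * z))"
  define y2 where "y2 = - (complex_of_real (a * b * c * z) * \<gamma>)"
  define y3 where "y3 = complex_of_real (- (b * c * z))"
  have nz: "y1 \<noteq> 0" "y2 \<noteq> 0" "y3 \<noteq> 0" "Q \<noteq> 0"
    using a_pos b_pos c_pos z_pos \<gamma> by (simp_all add: y1_def y2_def y3_def Q_def)
  define p1 where "p1 = qpochn q (Q / y1) k"
  define p3 where "p3 = qpochn q (Q / y3) k"
  have neg: "Q / y1 = of_real (- (q / (a * c * z)))" "Q / y3 = of_real (- (q / (b * c * z)))"
    by (simp_all add: Q_def y1_def y3_def)
  define Tk where "Tk = Q ^ (\<Sum>{..k})"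
  have T: "Tk \<noteq> 0" using nz by (simp add: Tk_def)
  have r1: "qpochn q (y1 / Q ^ k) (k + m) = (- y1) ^ k / Tk * p1 * qpochn q y1 m"
    using qpochn_add[of q "y1 / Q ^ k" k m] qpochn_reverse[of q y1 k] nz
    by (simp add: Q_def Tk_def p1_def)
  have r3: "qpoch_inf q (y3 / Q ^ k) = (- y3) ^ k / Tk * p3 * qpoch_inf q y3"
    using qpoch_inf_reverse[OF nz(3), of k] by (simp add: Q_def Tk_def p3_def)
  have e1: "- (of_real a * of_real c * complex_of_real (z / q ^ k)) = y1 / Q ^ k"
    by (simp add: y1_def Q_def)
  have e2: "- (of_real a * of_real b * of_real c * \<gamma> * complex_of_real (z / q ^ k)) * of_real q ^ (k + m) = y2 * Q ^ m"
    by (simp add: y2_def Q_def power_add)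
  have e3: "complex_of_real (- (b * c * z / q ^ k)) = y3 / Q ^ k"
    by (simp add: y3_def Q_def)
  have y: "- y1 * of_real b = of_real a * (- y3)" by (simp add: y1_def y3_def)
  have pw: "(- y1) ^ k * (of_real b / \<gamma>) ^ (k + m)
      = inverse (\<gamma>\<^sup>2) ^ k * (of_real b / \<gamma>) ^ m * ((- y3) ^ k * (of_real a * \<gamma>) ^ k)"
  proof -
    have "- y1 * (of_real b / \<gamma>) = (- y1 * of_real b) / \<gamma>" by simp
    also have "\<dots> = inverse (\<gamma>\<^sup>2) * (- y3 * (of_real a * \<gamma>))"
      unfolding y using \<gamma> by (simp add: power2_eq_square field_simps)
    finally have "(- y1 * (of_real b / \<gamma>)) ^ k = (inverse (\<gamma>\<^sup>2) * (- y3 * (of_real a * \<gamma>))) ^ k" by simp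
    thus ?thesis unfolding power_mult_distrib power_add by (simp add: mult_ac)
  qed
  have "norm_term k \<gamma> (k + m) = gcoeff \<gamma> (k + m) * ((- y1) ^ k / Tk * p1 * qpochn q y1 m) *
      qpoch_inf q (y2 * Q ^ m) * (of_real b / \<gamma>) ^ (k + m) /
      ((- y3) ^ k / Tk * p3 * qpoch_inf q y3 * (of_real a * \<gamma>) ^ k)"
    unfolding norm_term_def bigG_term_def e1 e2 e3 r1 r3 ..
  also have "\<dots> = gcoeff \<gamma> (k + m) * ((- y1) ^ k * (of_real b / \<gamma>) ^ (k + m)) *
     (p1 * qpochn q y1 m * qpoch_inf q (y2 * Q ^ m))
     / (((- y3) ^ k * (of_real a * \<gamma>) ^ k) * (p3 * qpoch_inf q y3))"
  proof -
    have "g * (A / t * u * v) * w * D / (H / t * s * r * Y)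
        = g * (A * D) * (u * v * w) / ((H * Y) * (s * r))"
      if "t \<noteq> 0" for g A D H Y t u v w s r :: complex
      using that by (simp add: divide_simps mult_ac)
    thus ?thesis using T by blast
  qed
  also have "\<dots> = gcoeff \<gamma> (k + m) * (inverse (\<gamma>\<^sup>2) ^ k * (of_real b / \<gamma>) ^ m) *
      (p1 * qpochn q y1 m * qpoch_inf q (y2 * Q ^ m) * inverse p3 * inverse (qpoch_inf q y3))"
  proof -
    have "g * (I * H) * p / (H * (s * r)) = g * I * (p * inverse s * inverse r)"
      if "H \<noteq> 0" for g I H p s r :: complex
      using that by (simp add: divide_simps)
    moreover have "(- y3) ^ k * (of_real a * \<gamma>) ^ k \<noteq> 0" using nz a_pos \<gamma> by simp
    ultimately show ?thesis unfolding pw by blast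
  qed
  finally show ?thesis
    unfolding p1_def p3_def neg unfolding y1_def y2_def y3_def Q_def .
qed

lemma norm_term_bound:
  assumes r: "r > 1" and b: "b \<le> 1"
  obtains K where "\<And>\<gamma> k n. r \<le> norm \<gamma> \<Longrightarrow> norm \<gamma> \<le> R \<Longrightarrow> norm (norm_term k \<gamma> n) \<le> K * (1 / r) ^ n"
proof -
  obtain K0 where K0: "K0 > 0" "\<And>\<gamma> n. norm \<gamma> \<le> R \<Longrightarrow> norm (gcoeff \<gamma> n) \<le> K0"
    using C.bigG_coeff_bound[of R] by blast
  define ex where "ex = (\<lambda>t. exp (t / (1 - q)))"
  have ex1: "ex t \<ge> 1" if "t \<ge> 0" for t using that q_less_1 by (simp add: ex_def)
  have ex_nn: "0 \<le> ex t" for t by (simp add: ex_def)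
  have r_nn: "0 \<le> 1 / r" using r by simp
  define t4 where "t4 = a * c * z"
  define t1 where "t1 = q / t4"
  define t2 where "t2 = q / (a * b * c * z)"
  define t3 where "t3 = a * b * c * z * R"
  have t: "t1 \<ge> 0" "t2 \<ge> 0" "t4 \<ge> 0" "q / (b * c * z) \<ge> 0" "b * c * z \<ge> 0"
    using a_pos b_pos c_pos z_pos q_pos by (simp_all add: t1_def t2_def t4_def)
  define K where "K = K0 * (ex t1 * ex t2 * ex t3 * ex t4)"
  show ?thesis
  proof (rule that[of K])
    fix \<gamma> :: complex and k n assume \<gamma>: "r \<le> norm \<gamma>" "norm \<gamma> \<le> R"
    have \<gamma>nz: "\<gamma> \<noteq> 0" using \<gamma> r by auto
    have R: "R \<ge> 0" using \<gamma> norm_ge_zero order_trans by blast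
    hence t3: "t3 \<ge> 0" using a_pos b_pos c_pos z_pos by (simp add: t3_def)
    have inv: "norm (inverse (\<gamma>\<^sup>2)) \<le> 1 / r"
    proof -
      have "r * 1 \<le> norm \<gamma> * norm \<gamma>" using \<gamma> r by (intro mult_mono) auto
      hence "1 / norm (\<gamma>\<^sup>2) \<le> 1 / r" using r by (simp add: norm_mult power2_eq_square frac_le)
      thus ?thesis by (simp add: norm_inverse divide_inverse)
    qed
    have inv2: "norm (inverse (\<gamma>\<^sup>2)) \<le> 1"
      using inv r by (smt (verit) divide_le_eq_1)
    have bg: "norm (of_real b / \<gamma>) \<le> 1 / r"
      unfolding norm_divide using b b_pos \<gamma> r by (intro frac_le) auto
    have mono: "ex s \<le> ex t" if "s \<le> t" for s t
      using that q_less_1 by (simp add: ex_def divide_right_mono)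
    have P: "norm (qpochn q x m) \<le> ex s" "norm (qpoch_inf q x) \<le> ex s" if "norm x \<le> s" for x :: complex and s m
      using norm_qpochn_le[of x m] norm_qpoch_inf_le[of x] mono[OF that] unfolding ex_def by linarith+
    have P1: "norm (qpochn q (complex_of_real (- t1)) m) \<le> ex t1" for m
      using t by (intro P) simp
    have P2: "norm (qpochn q (of_real q / - (of_real (a * b * c * z) * \<gamma>)) m) \<le> ex t2" for m
    proof (rule P)
      have "a * b * c * z * 1 \<le> a * b * c * z * norm \<gamma>"
        using \<gamma> r a_pos b_pos c_pos z_pos by (intro mult_left_mono) auto
      hence "q / (a * b * c * z * norm \<gamma>) \<le> t2"
        unfolding t2_def using a_pos b_pos c_pos z_pos by (intro frac_le) auto
      thus "norm (of_real q / - (of_real (a * b * c * z) * \<gamma>)) \<le> t2"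
        using a_pos b_pos c_pos z_pos by (simp add: norm_divide norm_mult)
    qed
    have n3: "norm (of_real (a * b * c * z) * \<gamma>) \<le> t3"
      unfolding t3_def norm_mult using \<gamma> a_pos b_pos c_pos z_pos
      by (intro mult_mono) (auto simp: norm_mult)
    have P3: "norm (qpoch_inf q (- (of_real (a * b * c * z) * \<gamma>) * of_real q ^ m)) \<le> ex t3" for m
    proof (rule P)
      have "norm (of_real (a * b * c * z) * \<gamma>) * q ^ m \<le> t3 * 1"
        using n3 t3 q_power_le[of m] by (intro mult_mono) auto
      thus "norm (- (of_real (a * b * c * z) * \<gamma>) * of_real q ^ m) \<le> t3"
        unfolding norm_mult[of _ "of_real q ^ m"] norm_minus_cancel by simp
    qed
    have P3': "norm (qpoch_inf q (- (of_real (a * b * c * z) * \<gamma>))) \<le> ex t3"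
      using P3[of 0] by simp
    have P4: "norm (qpochn q (complex_of_real (- t4)) m) \<le> ex t4" for m
      using t by (intro P) simp
    show "norm (norm_term k \<gamma> n) \<le> K * (1 / r) ^ n"
    proof (cases "n \<le> k")
      case True
      have "norm (norm_term k \<gamma> n) \<le> K0 * (1 / r) ^ n * (ex t1 * 1 * ex t2 * ex t3 * 1 * 1)"
        unfolding norm_term_initial[OF \<gamma>nz True] norm_mult[of "_ * _"] norm_mult[of "qpochn _ _ _"]
          norm_mult[of "gcoeff _ _"] norm_power t4_def[symmetric] t1_def[symmetric]
        by (intro mult_mono K0(2) \<gamma> power_mono inv P1 P2 P3' norm_inverse_qpochn_neg_le t
              mult_nonneg_nonneg norm_ge_zero zero_le_power ex_nn zero_le_one less_imp_le[OF K0(1)] r_nn)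
      also have "\<dots> = K0 * (1 / r) ^ n * (ex t1 * ex t2 * ex t3 * 1)" by simp
      also have "\<dots> \<le> K0 * (1 / r) ^ n * (ex t1 * ex t2 * ex t3 * ex t4)"
        using K0(1) r ex1[OF t(3)] by (intro mult_left_mono) (auto simp: ex_nn)
      finally show ?thesis by (simp add: K_def mult_ac)
    next
      case False
      define m where "m = n - k"
      have n: "n = k + m" using False by (simp add: m_def)
      have "norm (norm_term k \<gamma> n) \<le> K0 * ((1 / r) ^ k * (1 / r) ^ m) * (ex t1 * ex t4 * ex t3 * 1 * 1)"
        unfolding n norm_term_final[OF \<gamma>nz] norm_mult[of "_ * _"] norm_mult[of "qpochn _ _ _"]
          norm_mult[of "gcoeff _ _"] norm_mult[of "_ ^ _"] norm_power
          t4_def[symmetric] t1_def[symmetric]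
        by (intro mult_mono K0(2) \<gamma> power_mono inv bg P1 P3 P4 norm_inverse_qpochn_neg_le t
              mult_nonneg_nonneg norm_ge_zero zero_le_power ex_nn zero_le_one less_imp_le[OF K0(1)] r_nn)
      also have "\<dots> = K0 * (1 / r) ^ n * (ex t1 * 1 * ex t3 * ex t4)" by (simp add: n power_add)
      also have "\<dots> \<le> K0 * (1 / r) ^ n * (ex t1 * ex t2 * ex t3 * ex t4)"
        using K0(1) r ex1[OF t(2)] by (intro mult_left_mono mult_right_mono) (auto simp: ex_nn)
      finally show ?thesis by (simp add: K_def mult_ac)
    qed
  qed
qed

lemma gauss_at_infinity:
  assumes \<gamma>: "norm \<gamma> > 1"
  shows "(\<Sum>n. gcoeff \<gamma> n * inverse (\<gamma>\<^sup>2) ^ n)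
    = qpoch_inf q (of_real a / \<gamma>) * qpoch_inf q (of_real c / \<gamma>) /
      (of_real (qpoch_inf q (a * c)) * qpoch_inf q (inverse (\<gamma>\<^sup>2)))"
proof -
  define w where "w = inverse (\<gamma>\<^sup>2)"
  have \<gamma>nz: "\<gamma> \<noteq> 0" using \<gamma> by auto
  have "1 * 1 < norm \<gamma> * norm \<gamma>" using \<gamma> by (intro mult_strict_mono) auto
  moreover have "norm w = inverse (norm \<gamma> * norm \<gamma>)"
    by (simp add: w_def power2_eq_square norm_inverse norm_mult)
  ultimately have w: "norm w < 1" by (simp only: inverse_less_1_iff) simp
  define ac where "ac = complex_of_real a * of_real c"
  have g: "complex_of_real a * \<gamma> * (of_real c * \<gamma>) * w = ac"
    "complex_of_real a * \<gamma> * w = of_real a / \<gamma>" "complex_of_real c * \<gamma> * w = of_real c / \<gamma>"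
    using \<gamma>nz by (simp_all add: w_def ac_def power2_eq_square field_simps)
  have Pac: "qpoch_inf q ac \<noteq> 0" using C.qpoch_inf_ab_ac_bc_nz(2) by (simp add: ac_def)
  have trm: "qpochn q (of_real a * \<gamma>) n * qpochn q (of_real c * \<gamma>) n / qpochn q (of_real q) n *
      qpoch_inf q (ac * of_real q ^ n) * w ^ n = qpoch_inf q ac * (gcoeff \<gamma> n * w ^ n)" for n
    using qpoch_inf_split[of ac n] C.qpochn_ab_ac_nz(2)[of n]
    by (simp add: bigG_coeff_def ac_def)
  from q_gauss[OF w, of "of_real a * \<gamma>" "of_real c * \<gamma>"]
  have "(\<lambda>n. qpoch_inf q ac * (gcoeff \<gamma> n * w ^ n)) sums
      (qpoch_inf q (of_real a / \<gamma>) * qpoch_inf q (of_real c / \<gamma>) / qpoch_inf q w)"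
    unfolding g trm .
  hence "(\<lambda>n. gcoeff \<gamma> n * w ^ n) sums
      (qpoch_inf q (of_real a / \<gamma>) * qpoch_inf q (of_real c / \<gamma>) / qpoch_inf q w / qpoch_inf q ac)"
    using sums_mult_D Pac sums_divide[of _ _ "qpoch_inf q ac"] by fastforce
  moreover have "qpoch_inf q ac = of_real (qpoch_inf q (a * c))"
    unfolding ac_def of_real_mult[symmetric] qpoch_inf_of_real ..
  ultimately show ?thesis unfolding w_def by (simp add: sums_iff mult_ac)
qed

lemma summable_norm_term:
  assumes "norm (of_real b / \<gamma>) < 1"
  shows "summable (norm_term k \<gamma>)"
  unfolding norm_term_def by (intro summable_divide C.summable_bigG[OF assms])

lemma E_norm_term:
  assumes "norm (of_real b / \<gamma>) < 1"
  shows "qpoch_inf q (of_real b / \<gamma>) / of_real (qpoch_inf q (a * b)) * (\<Sum>n. norm_term k \<gamma> n)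
    = E \<gamma> (of_real (z / q ^ k)) / (of_real a * \<gamma>) ^ k"
proof -
  from C.summable_bigG[OF assms]
  have "(\<Sum>n. norm_term k \<gamma> n) = bigG q (of_real a) (of_real b) (of_real c) \<gamma> (of_real (z / q ^ k)) /
     (qpoch_inf q (of_real (- (b * c * z / q ^ k))) * (of_real a * \<gamma>) ^ k)"
    unfolding norm_term_def bigG_def by (rule suminf_divide)
  thus ?thesis by (simp add: bigE_def qpoch_inf_of_real[symmetric])
qed

theorem E_at_infinity:
  assumes b: "b \<le> 1" and \<gamma>: "norm \<gamma>\<^sub>0 > 1"
  shows "((\<lambda>(k, \<gamma>). E \<gamma> (of_real (z / q ^ k)) / (of_real a * \<gamma>) ^ k) \<longlongrightarrow> cfun \<gamma>\<^sub>0)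
    (sequentially \<times>\<^sub>F nhds \<gamma>\<^sub>0)"
proof -
  let ?F = "sequentially \<times>\<^sub>F nhds \<gamma>\<^sub>0"
  have \<gamma>nz: "\<gamma>\<^sub>0 \<noteq> 0" using \<gamma> by auto
  have fst_lim: "filterlim fst sequentially ?F" and snd_lim: "(snd \<longlongrightarrow> \<gamma>\<^sub>0) ?F"
    by (rule filterlim_fst, rule filterlim_snd)
  define r where "r = (1 + norm \<gamma>\<^sub>0) / 2"
  define R where "R = norm \<gamma>\<^sub>0 + 1"
  have r: "r > 1" "r < norm \<gamma>\<^sub>0" using \<gamma> by (simp_all add: r_def field_simps)
  obtain K where K: "\<And>\<gamma> k n. r \<le> norm \<gamma> \<Longrightarrow> norm \<gamma> \<le> R \<Longrightarrow> norm (norm_term k \<gamma> n) \<le> K * (1 / r) ^ n"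
    using norm_term_bound[OF r(1) b, of R] by blast
  have near: "\<forall>\<^sub>F p in ?F. r \<le> norm (snd p) \<and> norm (snd p) \<le> R \<and> snd p \<noteq> 0"
  proof -
    have "\<forall>\<^sub>F p in ?F. r < norm (snd p)" "\<forall>\<^sub>F p in ?F. norm (snd p) < R"
      using order_tendstoD[OF tendsto_norm[OF snd_lim]] r by (auto simp: R_def)
    thus ?thesis by eventually_elim (use r in auto)
  qed
  define y2 where "y2 = (\<lambda>\<gamma>. - (complex_of_real (a * b * c * z) * \<gamma>))"
  define P3 where "P3 = complex_of_real (qtheta q (- (b * c * z)))"
  have y2: "y2 \<gamma>\<^sub>0 \<noteq> 0" using \<gamma>nz a_pos b_pos c_pos z_pos by (simp add: y2_def)
  have y2_lim: "((\<lambda>p. y2 (snd p)) \<longlongrightarrow> y2 \<gamma>\<^sub>0) ?F"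
    unfolding y2_def by (intro tendsto_intros snd_lim)
  define X where "X = ctheta (y2 \<gamma>\<^sub>0) / P3"
  have neg_nz: "qpochn q (complex_of_real (- t)) n \<noteq> 0" "qpoch_inf q (complex_of_real (- t)) \<noteq> 0"
    if "t \<ge> 0" for t n
    using qpochn_neg_ge_1[OF that, of n] qpoch_inf_neg_ge_1[OF that]
    unfolding qpochn_of_real qpoch_inf_of_real by auto
  have pos: "q / (a * c * z) \<ge> 0" "q / (b * c * z) \<ge> 0" "b * c * z \<ge> 0"
    using a_pos b_pos c_pos z_pos q_pos by simp_all
  have term_lim: "((\<lambda>p. norm_term (fst p) (snd p) n) \<longlongrightarrow> gcoeff \<gamma>\<^sub>0 n * inverse (\<gamma>\<^sub>0\<^sup>2) ^ n * X) ?F" for n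
  proof -
    have "filterlim (\<lambda>k. k - n) at_top sequentially"
      by (rule filterlim_at_top_mono[of "\<lambda>k. k - n"]) (auto intro: filterlim_minus_const_nat_at_top)
    hence kn: "filterlim (\<lambda>p. fst p - n) at_top ?F"
      using filterlim_compose[OF _ fst_lim] by blast
    have co: "((\<lambda>p. gcoeff (snd p) n) \<longlongrightarrow> gcoeff \<gamma>\<^sub>0 n) ?F"
      unfolding bigG_coeff_def using C.qpochn_ab_ac_nz(2)[of n]
      by (intro tendsto_intros snd_lim) auto
    have "((\<lambda>p. gcoeff (snd p) n * inverse ((snd p)\<^sup>2) ^ n *
      (qpochn q (of_real (- (q / (a * c * z)))) (fst p) * inverse (qpochn q (of_real (- (q / (a * c * z)))) (fst p - n))
       * qpochn q (of_real q / y2 (snd p)) (fst p - n) * qpoch_inf q (y2 (snd p))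
       * inverse (qpochn q (of_real (- (q / (b * c * z)))) (fst p)) * inverse (qpoch_inf q (of_real (- (b * c * z))))))
      \<longlongrightarrow> gcoeff \<gamma>\<^sub>0 n * inverse (\<gamma>\<^sub>0\<^sup>2) ^ n *
      (qpoch_inf q (of_real (- (q / (a * c * z)))) * inverse (qpoch_inf q (of_real (- (q / (a * c * z)))))
       * qpoch_inf q (of_real q / y2 \<gamma>\<^sub>0) * qpoch_inf q (y2 \<gamma>\<^sub>0)
       * inverse (qpoch_inf q (of_real (- (q / (b * c * z))))) * inverse (qpoch_inf q (of_real (- (b * c * z)))))) ?F"
      by (intro tendsto_mult tendsto_inverse tendsto_power co snd_lim tendsto_const y2_lim y2
            tendsto_qpochn_at_top tendsto_divide tendsto_qpoch_inf fst_lim kn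
            neg_nz(2)[OF pos(1)] neg_nz(2)[OF pos(2)] neg_nz(2)[OF pos(3)])
         (use \<gamma>nz in simp)
    moreover have "qpoch_inf q (of_real (- (q / (a * c * z)))) * inverse (qpoch_inf q (of_real (- (q / (a * c * z)))))
       * qpoch_inf q (of_real q / y2 \<gamma>\<^sub>0) * qpoch_inf q (y2 \<gamma>\<^sub>0)
       * inverse (qpoch_inf q (of_real (- (q / (b * c * z))))) * inverse (qpoch_inf q (of_real (- (b * c * z)))) = X"
    proof -
      have "P3 = qpoch_inf q (of_real (- (b * c * z))) * qpoch_inf q (of_real (- (q / (b * c * z))))"
        unfolding P3_def qtheta_eq of_real_mult qpoch_inf_of_real[symmetric] by simp
      thus ?thesis using neg_nz(2)[OF pos(1)] by (simp add: X_def ctheta_def divide_inverse mult_ac)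
    qed
    ultimately have "((\<lambda>p. gcoeff (snd p) n * inverse ((snd p)\<^sup>2) ^ n *
      (qpochn q (of_real (- (q / (a * c * z)))) (fst p) * inverse (qpochn q (of_real (- (q / (a * c * z)))) (fst p - n))
       * qpochn q (of_real q / y2 (snd p)) (fst p - n) * qpoch_inf q (y2 (snd p))
       * inverse (qpochn q (of_real (- (q / (b * c * z)))) (fst p)) * inverse (qpoch_inf q (of_real (- (b * c * z))))))
      \<longlongrightarrow> gcoeff \<gamma>\<^sub>0 n * inverse (\<gamma>\<^sub>0\<^sup>2) ^ n * X) ?F" by simp
    moreover have "\<forall>\<^sub>F p in ?F. n \<le> fst p"
      using fst_lim by (simp add: filterlim_at_top)
    hence "\<forall>\<^sub>F p in ?F. gcoeff (snd p) n * inverse ((snd p)\<^sup>2) ^ n *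
      (qpochn q (of_real (- (q / (a * c * z)))) (fst p) * inverse (qpochn q (of_real (- (q / (a * c * z)))) (fst p - n))
       * qpochn q (of_real q / y2 (snd p)) (fst p - n) * qpoch_inf q (y2 (snd p))
       * inverse (qpochn q (of_real (- (q / (b * c * z)))) (fst p)) * inverse (qpoch_inf q (of_real (- (b * c * z)))))
      = norm_term (fst p) (snd p) n"
      using near
    proof eventually_elim
      case (elim p)
      have "snd p \<noteq> 0" using elim by blast
      from norm_term_initial[OF this elim(1)] show ?case unfolding y2_def by (rule sym)
    qed
    ultimately show ?thesis by (rule Lim_transform_eventually)
  qed
  have bound: "\<forall>\<^sub>F (n, p) in at_top \<times>\<^sub>F ?F. norm (norm_term (fst p) (snd p) n) \<le> K * (1 / r) ^ n"
  proof -
    have "\<forall>\<^sub>F x in at_top \<times>\<^sub>F ?F. r \<le> norm (snd (snd x)) \<and> norm (snd (snd x)) \<le> R \<and> snd (snd x) \<noteq> 0"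
      using near filterlim_iff[THEN iffD1, OF filterlim_snd] by blast
    thus ?thesis by eventually_elim (auto simp: case_prod_beta intro: K)
  qed
  have "summable (\<lambda>n. K * (1 / r) ^ n)"
    using r by (intro summable_mult summable_geometric) auto
  from tannerys_theorem[OF term_lim bound this]
  have "((\<lambda>p. \<Sum>n. norm_term (fst p) (snd p) n) \<longlongrightarrow> (\<Sum>n. gcoeff \<gamma>\<^sub>0 n * inverse (\<gamma>\<^sub>0\<^sup>2) ^ n * X)) ?F"
    and sm: "summable (\<lambda>n. norm (gcoeff \<gamma>\<^sub>0 n * inverse (\<gamma>\<^sub>0\<^sup>2) ^ n * X))"
    by (auto simp: prod_filter_eq_bot)
  moreover have "(\<Sum>n. gcoeff \<gamma>\<^sub>0 n * inverse (\<gamma>\<^sub>0\<^sup>2) ^ n * X) = (\<Sum>n. gcoeff \<gamma>\<^sub>0 n * inverse (\<gamma>\<^sub>0\<^sup>2) ^ n) * X"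
  proof (cases "X = 0")
    case False
    have "summable (\<lambda>n. gcoeff \<gamma>\<^sub>0 n * inverse (\<gamma>\<^sub>0\<^sup>2) ^ n * X)" using sm by (rule summable_norm_cancel)
    from summable_divide[OF this, of X]
    have "summable (\<lambda>n. gcoeff \<gamma>\<^sub>0 n * inverse (\<gamma>\<^sub>0\<^sup>2) ^ n)" using False by simp
    thus ?thesis by (rule suminf_mult2[symmetric])
  qed simp
  ultimately have lim: "((\<lambda>p. \<Sum>n. norm_term (fst p) (snd p) n) \<longlongrightarrow> (\<Sum>n. gcoeff \<gamma>\<^sub>0 n * inverse (\<gamma>\<^sub>0\<^sup>2) ^ n) * X) ?F"
    by simp
  have Pb: "((\<lambda>p. qpoch_inf q (of_real b / snd p) / of_real (qpoch_inf q (a * b)))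
      \<longlongrightarrow> qpoch_inf q (of_real b / \<gamma>\<^sub>0) / of_real (qpoch_inf q (a * b))) ?F"
    using \<gamma>nz qpoch_inf_pos[OF ab_less] by (intro tendsto_intros snd_lim) auto
  have "((\<lambda>p. qpoch_inf q (of_real b / snd p) / of_real (qpoch_inf q (a * b)) *
        (\<Sum>n. norm_term (fst p) (snd p) n)) \<longlongrightarrow> cfun \<gamma>\<^sub>0) ?F"
  proof -
    have "cfun \<gamma>\<^sub>0 = qpoch_inf q (of_real b / \<gamma>\<^sub>0) / of_real (qpoch_inf q (a * b)) *
        ((\<Sum>n. gcoeff \<gamma>\<^sub>0 n * inverse (\<gamma>\<^sub>0\<^sup>2) ^ n) * X)"
      unfolding gauss_at_infinity[OF \<gamma>] cfun_def X_def P3_def y2_def by (simp add: mult_ac)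
    thus ?thesis using tendsto_mult[OF Pb lim] by simp
  qed
  moreover have "\<forall>\<^sub>F p in ?F. qpoch_inf q (of_real b / snd p) / of_real (qpoch_inf q (a * b)) *
        (\<Sum>n. norm_term (fst p) (snd p) n) = (\<lambda>(k, \<gamma>). E \<gamma> (of_real (z / q ^ k)) / (of_real a * \<gamma>) ^ k) p"
    using near
  proof eventually_elim
    case (elim p)
    obtain k \<gamma> where p: "p = (k, \<gamma>)" by (cases p)
    have \<gamma>': "\<gamma> \<noteq> 0" "norm \<gamma> \<ge> r" using elim by (auto simp: p)
    have "norm (of_real b / \<gamma>) < 1"
    proof -
      have "b < norm \<gamma>" using b r \<gamma>' by linarith
      thus ?thesis using b_pos \<gamma>'(1) by (simp add: norm_divide)
    qed
    from E_norm_term[OF this, of k] show ?case by (simp add: p)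
  qed
  ultimately show ?thesis by (rule Lim_transform_eventually)
qed

end

section \<open>Orthogonality and norms of decaying eigenfunctions\<close>

context bigq
begin

text \<open>The condition that \<open>f(z q\<^sup>-\<^sup>k)\<close> is asymptotically \<open>D (a/\<gamma>)\<^sup>k\<close>.\<close>

definition asymp :: "(real \<Rightarrow> complex) \<Rightarrow> complex \<Rightarrow> complex \<Rightarrow> bool" where
  "asymp f \<gamma> D \<longleftrightarrow> (\<lambda>k. f (z / q ^ k) * (\<gamma> / of_real a) ^ k) \<longlonglongrightarrow> D"

lemma far_grid: "z / q ^ k \<in> grid q z"
  using pos_in_grid[of "- int k"] unfolding pos_grid_neg_index .

lemma far_grid_Suc: "z * q powi (- 1 - int n) = z / q ^ Suc n"
  using pos_grid_neg_index[of "Suc n"] by (simp add: algebra_simps)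

lemma far_grid_Suc': "z * q powi (- int K - 1) = z / q ^ Suc K"
proof -
  have "- int K - 1 = - 1 - int K" by simp
  thus ?thesis by (simp only: far_grid_Suc)
qed

text \<open>The weight at \<open>z q\<^sup>-\<^sup>k\<close>, rescaled to have a finite nonzero limit.\<close>

definition far_wt :: "nat \<Rightarrow> real" where
  "far_wt k = grid_wt q a b c (z / q ^ k) * a ^ (2 * k)"

lemma summable_far:
  assumes f: "asymp f \<gamma>1 D1" and g: "asymp g \<gamma>2 D2" and \<gamma>: "norm (\<gamma>1 * \<gamma>2) > 1"
  shows "summable (\<lambda>n. norm (f (z * q powi (- 1 - int n)) * g (z * q powi (- 1 - int n)) *
           of_real (grid_wt q a b c (z * q powi (- 1 - int n)))))"
proof (rule summable_norm_geometric_limit[of _ _ "1 / norm (\<gamma>1 * \<gamma>2)"])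
  have "far_wt \<longlonglongrightarrow> limit_weight" unfolding far_wt_def[abs_def] by (rule grid_wt_at_infinity)
  thus "(\<lambda>n. f (z / q ^ Suc n) * (\<gamma>1 / of_real a) ^ Suc n * (g (z / q ^ Suc n) * (\<gamma>2 / of_real a) ^ Suc n)
      * of_real (far_wt (Suc n)) / (\<gamma>1 * \<gamma>2)) \<longlonglongrightarrow> D1 * D2 * of_real limit_weight / (\<gamma>1 * \<gamma>2)"
    using f g \<gamma> unfolding asymp_def
    by (intro tendsto_mult tendsto_divide tendsto_of_real tendsto_const LIMSEQ_Suc) auto
  fix n
  define u where "u = f (z / q ^ Suc n) * g (z / q ^ Suc n) * of_real (grid_wt q a b c (z / q ^ Suc n))"
  have nz: "\<gamma>1 * \<gamma>2 \<noteq> 0" using \<gamma> by auto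
  have "f (z / q ^ Suc n) * (\<gamma>1 / of_real a) ^ Suc n * (g (z / q ^ Suc n) * (\<gamma>2 / of_real a) ^ Suc n)
      * of_real (far_wt (Suc n)) / (\<gamma>1 * \<gamma>2)
    = u * ((\<gamma>1 / of_real a) * (\<gamma>2 / of_real a) * (of_real a * of_real a)) ^ Suc n / (\<gamma>1 * \<gamma>2)"
    unfolding u_def far_wt_def power_mult_distrib by (simp add: power_mult power2_eq_square power_mult_distrib)
  also have "(\<gamma>1 / of_real a) * (\<gamma>2 / of_real a) * (of_real a * of_real a) = \<gamma>1 * \<gamma>2"
    using a_pos by simp
  also have "u * (\<gamma>1 * \<gamma>2) ^ Suc n / (\<gamma>1 * \<gamma>2) = u * (\<gamma>1 * \<gamma>2) ^ n" using nz by simp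
  finally have e: "f (z / q ^ Suc n) * (\<gamma>1 / of_real a) ^ Suc n * (g (z / q ^ Suc n) * (\<gamma>2 / of_real a) ^ Suc n)
      * of_real (far_wt (Suc n)) / (\<gamma>1 * \<gamma>2) = u * (\<gamma>1 * \<gamma>2) ^ n" .
  have "norm (u * (\<gamma>1 * \<gamma>2) ^ n) * (1 / norm (\<gamma>1 * \<gamma>2)) ^ n
      = norm u * (norm (\<gamma>1 * \<gamma>2) * (1 / norm (\<gamma>1 * \<gamma>2))) ^ n"
    unfolding norm_mult[of u] norm_power power_mult_distrib[where 'a=real] by (simp only: mult.assoc)
  also have "norm (\<gamma>1 * \<gamma>2) * (1 / norm (\<gamma>1 * \<gamma>2)) = 1" using nz by simp
  finally show "norm (f (z * q powi (- 1 - int n)) * g (z * q powi (- 1 - int n)) *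
           of_real (grid_wt q a b c (z * q powi (- 1 - int n)))) =
     norm (f (z / q ^ Suc n) * (\<gamma>1 / of_real a) ^ Suc n * (g (z / q ^ Suc n) * (\<gamma>2 / of_real a) ^ Suc n)
      * of_real (far_wt (Suc n)) / (\<gamma>1 * \<gamma>2)) * (1 / norm (\<gamma>1 * \<gamma>2)) ^ n"
    unfolding far_grid_Suc e by (simp add: u_def)
qed (use \<gamma> in \<open>auto simp: divide_less_eq\<close>)

theorem is_phi_Hsp:
  assumes f: "is_phi q a b c z \<gamma>' f" "asymp f \<gamma> D" and \<gamma>: "norm \<gamma> > 1"
  shows "f \<in> Hsp q a b c z"
proof -
  define h where "h = (\<lambda>x. (norm (f x))\<^sup>2 * grid_wt q a b c x)"
  have n: "norm (f x * f x * of_real (grid_wt q a b c x)) = h x" if "x \<in> grid q z" for x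
    using grid_wt_pos[OF that] by (simp add: norm_mult h_def power2_eq_square)
  have nn: "h x \<ge> 0" if "x \<in> grid q z" for x using grid_wt_pos[OF that] by (simp add: h_def)
  have "1 * 1 < norm \<gamma> * norm \<gamma>" using \<gamma> by (intro mult_strict_mono) auto
  hence \<gamma>\<gamma>: "norm (\<gamma> * \<gamma>) > 1" by (simp add: norm_mult)
  have s1: "summable (\<lambda>k. h (- (q ^ k)))" and s2: "summable (\<lambda>k. h (z * q ^ k))"
    using summable_near_0[OF f(1) f(1)] unfolding n[OF neg_in_grid] n[OF pos_grid_nat] .
  have s3: "summable (\<lambda>k. h (z * q powi (- 1 - int k)))"
    using summable_far[OF f(2) f(2) \<gamma>\<gamma>] unfolding n[OF pos_in_grid] .
  have "(\<lambda>k::nat. h (- (q ^ k))) summable_on UNIV"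
    using s1 nn[OF neg_in_grid] by (simp add: summable_on_UNIV_nonneg_real_iff)
  moreover have "(\<lambda>i::int. h (z * q powi i)) summable_on UNIV"
  proof (rule has_sum_imp_summable[OF has_sum_int])
    show "summable (\<lambda>n. norm (h (z * q powi int n)))"
      using s2 nn[OF pos_grid_nat] by simp
    show "summable (\<lambda>n. norm (h (z * q powi (- 1 - int n))))"
      using s3 nn[OF pos_in_grid] by simp
  qed
  ultimately show ?thesis
    using f(1) by (simp add: Hsp_def h_def wt_neg_eq wt_pos_eq is_phi_def)
qed

lemma partial_form_LIMSEQ:
  assumes f: "is_phi q a b c z \<gamma>1' f" "asymp f \<gamma>1 D1" and g: "is_phi q a b c z \<gamma>2' g" "asymp g \<gamma>2 D2"
    and \<gamma>: "norm (\<gamma>1 * \<gamma>2) > 1"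
  shows "partial_form f g \<longlonglongrightarrow> ip q a b c z f (\<lambda>x. cnj (g x))"
proof -
  define h where "h = (\<lambda>x. f x * g x * of_real (grid_wt q a b c x))"
  have s1: "summable (\<lambda>k. norm (h (- (q ^ k))))" and s2: "summable (\<lambda>k. norm (h (z * q ^ k)))"
    unfolding h_def by (rule summable_near_0[OF f(1) g(1)])+
  have s3: "summable (\<lambda>k. norm (h (z * q powi (- 1 - int k))))"
    unfolding h_def by (rule summable_far[OF f(2) g(2) \<gamma>])
  have "infsum (\<lambda>k::nat. h (- (q ^ k))) UNIV = (\<Sum>k. h (- (q ^ k)))"
    by (intro infsumI norm_summable_imp_has_sum s1 summable_sums summable_norm_cancel)
  moreover have "(\<lambda>K. \<Sum>j. h (z * q powi (int j - int K))) \<longlonglongrightarrow> infsum (\<lambda>i::int. h (z * q powi i)) UNIV"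
    by (rule suminf_int_shift_LIMSEQ[of "\<lambda>i. h (z * q powi i)"]) (use s2 s3 in simp_all)
  ultimately have "(\<lambda>K. (\<Sum>k. h (- (q ^ k))) + (\<Sum>j. h (z * q powi (int j - int K))))
    \<longlonglongrightarrow> infsum (\<lambda>k::nat. h (- (q ^ k))) UNIV + infsum (\<lambda>i::int. h (z * q powi i)) UNIV"
    by (intro tendsto_add) simp_all
  thus ?thesis by (simp add: partial_form_def[abs_def] ip_def h_def wt_neg_eq wt_pos_eq)
qed

lemma casorati_far:
  assumes "\<gamma>1 \<noteq> 0" "\<gamma>2 \<noteq> 0"
  shows "casorati q a b c f g (z / q ^ Suc K) * (\<gamma>1 * \<gamma>2) ^ K =
    of_real (far_wt (Suc K) * ((a * b + q ^ Suc K / z) * (a * c + q ^ Suc K / z) / (b * c)) / a) *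
    ((f (z / q ^ K) * (\<gamma>1 / of_real a) ^ K) * (g (z / q ^ Suc K) * (\<gamma>2 / of_real a) ^ Suc K) / \<gamma>2
     - (f (z / q ^ Suc K) * (\<gamma>1 / of_real a) ^ Suc K) * (g (z / q ^ K) * (\<gamma>2 / of_real a) ^ K) / \<gamma>1)"
proof -
  define x where "x = z / q ^ Suc K"
  have x: "x > 0" using z_pos q_pos by (simp add: x_def)
  have qx: "q * x = z / q ^ K" by (simp add: x_def)
  have ix: "q ^ Suc K / z = 1 / x" by (simp add: x_def)
  define A where "A = (a * b + 1 / x) * (a * c + 1 / x) / (b * c)"
  define w where "w = grid_wt q a b c x"
  have A: "(a * b * x + 1) * (a * c * x + 1) / (b * c * x\<^sup>2) = A"
  proof -
    have "(a * b * x + 1) * (a * c * x + 1) = ((a * b + 1 / x) * (a * c + 1 / x)) * x\<^sup>2"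
      using x by (simp add: field_simps power2_eq_square)
    thus ?thesis using x by (simp add: A_def)
  qed
  define fK gK fS gS where "fK = f (z / q ^ K)" and "gK = g (z / q ^ K)" and "fS = f x" and "gS = g x"
  define \<alpha> where "\<alpha> = complex_of_real a"
  have \<alpha>: "\<alpha> \<noteq> 0" using a_pos by (simp add: \<alpha>_def)
  have far: "far_wt (Suc K) / a = w * a ^ K * a ^ K * a"
    using a_pos by (simp add: far_wt_def w_def x_def power_mult power2_eq_square power_mult_distrib)
  have 1: "fK * (\<gamma>1 / \<alpha>) ^ K * (gS * (\<gamma>2 / \<alpha>) ^ Suc K) / \<gamma>2 * (\<alpha> ^ K * \<alpha> ^ K * \<alpha>)
      = fK * gS * (\<gamma>1 * \<gamma>2) ^ K"
    using \<alpha> assms by (simp add: power_divide power_mult_distrib)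
  have 2: "fS * (\<gamma>1 / \<alpha>) ^ Suc K * (gK * (\<gamma>2 / \<alpha>) ^ K) / \<gamma>1 * (\<alpha> ^ K * \<alpha> ^ K * \<alpha>)
      = fS * gK * (\<gamma>1 * \<gamma>2) ^ K"
    using \<alpha> assms by (simp add: power_divide power_mult_distrib)
  have cas: "casorati q a b c f g x = of_real (w * A) * (fK * gS - fS * gK)"
    unfolding casorati_def A qx w_def fK_def gK_def fS_def gS_def ..
  have "casorati q a b c f g x * (\<gamma>1 * \<gamma>2) ^ K
      = of_real (w * A) * (fK * gS * (\<gamma>1 * \<gamma>2) ^ K - fS * gK * (\<gamma>1 * \<gamma>2) ^ K)"
    unfolding cas by (simp only: left_diff_distrib mult.assoc)
  also have "\<dots> = of_real (w * A) * (\<alpha> ^ K * \<alpha> ^ K * \<alpha>) *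
     (fK * (\<gamma>1 / \<alpha>) ^ K * (gS * (\<gamma>2 / \<alpha>) ^ Suc K) / \<gamma>2
      - fS * (\<gamma>1 / \<alpha>) ^ Suc K * (gK * (\<gamma>2 / \<alpha>) ^ K) / \<gamma>1)"
    unfolding 1[symmetric] 2[symmetric] by (simp only: left_diff_distrib right_diff_distrib mult_ac)
  also have "of_real (w * A) * (\<alpha> ^ K * \<alpha> ^ K * \<alpha>) = of_real (far_wt (Suc K) / a * A)"
    unfolding far by (simp add: \<alpha>_def)
  also have "far_wt (Suc K) / a * A = far_wt (Suc K) * A / a" by simp
  finally show ?thesis
    unfolding x_def[symmetric] ix A_def fK_def gK_def fS_def gS_def \<alpha>_def .
qed

lemma casorati_factor_LIMSEQ:
  "(\<lambda>K. far_wt (Suc K) * ((a * b + q ^ Suc K / z) * (a * c + q ^ Suc K / z) / (b * c)) / a)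
     \<longlonglongrightarrow> limit_weight * a"
proof -
  have w: "far_wt \<longlonglongrightarrow> limit_weight" unfolding far_wt_def[abs_def] by (rule grid_wt_at_infinity)
  have qn: "(\<lambda>K. q ^ Suc K) \<longlonglongrightarrow> 0"
    using q_pos q_less_1 by (intro LIMSEQ_Suc LIMSEQ_power_zero) auto
  have "(\<lambda>K. far_wt (Suc K) * ((a * b + q ^ Suc K / z) * (a * c + q ^ Suc K / z) / (b * c)) / a)
     \<longlonglongrightarrow> limit_weight * ((a * b + 0 / z) * (a * c + 0 / z) / (b * c)) / a"
    using a_pos b_pos c_pos z_pos
    by (intro tendsto_mult tendsto_divide tendsto_add tendsto_const LIMSEQ_Suc[OF w] qn) auto
  thus ?thesis using a_pos b_pos c_pos by (simp add: field_simps)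
qed

text \<open>The spectral parameters \<open>\<gamma>1'\<close> and \<open>\<gamma>2'\<close> of the equation may differ from the parameters \<open>\<gamma>1\<close> and \<open>\<gamma>2\<close>
  of the decay, of which only \<open>|\<gamma>1 \<gamma>2| > 1\<close> is required.\<close>

theorem orthogonal:
  assumes f: "is_phi q a b c z \<gamma>1' f" "asymp f \<gamma>1 D1" and g: "is_phi q a b c z \<gamma>2' g" "asymp g \<gamma>2 D2"
    and \<gamma>: "norm (\<gamma>1 * \<gamma>2) > 1" and \<mu>: "mu a \<gamma>1' \<noteq> mu a \<gamma>2'"
  shows "ip q a b c z f (\<lambda>x. cnj (g x)) = 0"
proof -
  have nz: "\<gamma>1 \<noteq> 0" "\<gamma>2 \<noteq> 0" using \<gamma> by auto
  note fl = f(2)[unfolded asymp_def] and gl = g(2)[unfolded asymp_def]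
  define W where "W = (\<lambda>K. casorati q a b c f g (z / q ^ Suc K))"
  have W_eq: "W K * (\<gamma>1 * \<gamma>2) ^ K = 
    of_real (far_wt (Suc K) * ((a * b + q ^ Suc K / z) * (a * c + q ^ Suc K / z) / (b * c)) / a) *
    ((f (z / q ^ K) * (\<gamma>1 / of_real a) ^ K) * (g (z / q ^ Suc K) * (\<gamma>2 / of_real a) ^ Suc K) / \<gamma>2
     - (f (z / q ^ Suc K) * (\<gamma>1 / of_real a) ^ Suc K) * (g (z / q ^ K) * (\<gamma>2 / of_real a) ^ K) / \<gamma>1)" for K
    unfolding W_def by (rule casorati_far[OF nz])
  have l1: "(\<lambda>K. W K * (\<gamma>1 * \<gamma>2) ^ K)
      \<longlonglongrightarrow> of_real (limit_weight * a) * (D1 * D2 / \<gamma>2 - D1 * D2 / \<gamma>1)"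
    unfolding W_eq
    by (rule tendsto_mult[OF tendsto_of_real[OF casorati_factor_LIMSEQ]
          tendsto_diff[OF tendsto_divide[OF tendsto_mult[OF fl LIMSEQ_Suc[OF gl]] tendsto_const nz(2)]
            tendsto_divide[OF tendsto_mult[OF LIMSEQ_Suc[OF fl] gl] tendsto_const nz(1)]]])
  have "norm (1 / (\<gamma>1 * \<gamma>2)) < 1" using \<gamma> by (auto simp: norm_divide divide_less_eq)
  hence "(\<lambda>K. (1 / (\<gamma>1 * \<gamma>2)) ^ K) \<longlonglongrightarrow> 0" by (rule LIMSEQ_power_zero)
  from tendsto_mult[OF l1 this] have "(\<lambda>K. W K * (\<gamma>1 * \<gamma>2) ^ K * (1 / (\<gamma>1 * \<gamma>2)) ^ K) \<longlonglongrightarrow> 0" by simp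
  hence W0: "W \<longlonglongrightarrow> 0" using nz by (simp add: power_divide)
  have "partial_form f g = (\<lambda>K. - W K / (mu a \<gamma>1' - mu a \<gamma>2'))"
  proof
    fix K
    have "(mu a \<gamma>1' - mu a \<gamma>2') * partial_form f g K = - W K"
      unfolding W_def using green[OF f(1) g(1), of K] unfolding far_grid_Suc' .
    thus "partial_form f g K = - W K / (mu a \<gamma>1' - mu a \<gamma>2')"
      using \<mu> by (intro eq_divide_imp) (simp_all add: mult.commute)
  qed
  moreover have "(\<lambda>K. - W K / (mu a \<gamma>1' - mu a \<gamma>2')) \<longlonglongrightarrow> - 0 / (mu a \<gamma>1' - mu a \<gamma>2')"
    using \<mu> by (intro tendsto_divide tendsto_minus W0 tendsto_const) simp
  ultimately have "partial_form f g \<longlonglongrightarrow> 0" by simp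
  with partial_form_LIMSEQ[OF f g \<gamma>] show ?thesis by (rule LIMSEQ_unique)
qed

subsection \<open>The norm\<close>

text \<open>The solution \<open>\<phi>\<^sub>\<gamma>\<close> on the grid, for \<open>|\<gamma>| > 1\<close> and \<open>b \<le> 1\<close>.\<close>

definition Egrid :: "complex \<Rightarrow> real \<Rightarrow> complex" where
  "Egrid \<gamma> = (\<lambda>x\<in>grid q z. E \<gamma> (of_real x))"

lemma Egrid_eq: "x \<in> grid q z \<Longrightarrow> Egrid \<gamma> x = E \<gamma> (of_real x)"
  by (simp add: Egrid_def)

lemma is_phi_Egrid:
  assumes "b \<le> 1" "norm \<gamma> > 1"
  shows "is_phi q a b c z \<gamma> (Egrid \<gamma>)"
  unfolding Egrid_def using assms b_pos by (intro is_phi_E) (auto simp: norm_divide divide_less_eq)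

lemma E_bounded:
  assumes \<rho>: "\<rho> < 1"
  obtains B where "\<And>\<gamma> x. norm \<gamma> \<le> R \<Longrightarrow> norm (of_real b / \<gamma>) \<le> \<rho> \<Longrightarrow> x \<in> grid q z \<Longrightarrow> \<bar>x\<bar> \<le> X \<Longrightarrow>
      norm (E \<gamma> (of_real x)) \<le> B"
proof -
  obtain K where K: "\<And>\<gamma> x. norm \<gamma> \<le> R \<Longrightarrow> norm x \<le> X \<Longrightarrow> norm (of_real b / \<gamma>) \<le> \<rho> \<Longrightarrow>
       norm (bigG q (of_real a) (of_real b) (of_real c) \<gamma> x) \<le> K"
    using C.bigG_bounded[OF \<rho>, of R X] by blast
  have "qpoch_inf q y \<noteq> 0" if "y \<in> {- (b * c * X)..b * c}" for y
  proof -
    have "y < 1" using that bc_less by auto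
    from qpoch_inf_pos[OF this] show ?thesis by simp
  qed
  hence "continuous_on {- (b * c * X)..b * c} (\<lambda>y. inverse (qpoch_inf q y))"
    by (intro continuous_on_inverse continuous_on_qpoch_inf continuous_on_id ballI)
  hence "bounded ((\<lambda>y. inverse (qpoch_inf q y)) ` {- (b * c * X)..b * c})"
    by (intro compact_imp_bounded compact_continuous_image) auto
  from this[unfolded bounded_iff] obtain L where
    "\<forall>v\<in>(\<lambda>y. inverse (qpoch_inf q y)) ` {- (b * c * X)..b * c}. norm v \<le> L" by blast
  hence L: "\<bar>inverse (qpoch_inf q y)\<bar> \<le> L" if "y \<in> {- (b * c * X)..b * c}" for y
    using imageI[OF that, of "\<lambda>y. inverse (qpoch_inf q y)"] unfolding real_norm_def by (rule bspec)
  define N where "N = norm (inverse (qpoch_inf q (complex_of_real a * of_real b)))"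
  show ?thesis
  proof (rule that)
    fix \<gamma> :: complex and x assume \<gamma>: "norm \<gamma> \<le> R" "norm (of_real b / \<gamma>) \<le> \<rho>" and x: "x \<in> grid q z" "\<bar>x\<bar> \<le> X"
    have bc: "b * c > 0" using b_pos c_pos by simp
    have "- 1 \<le> x" using x(1)
    proof (cases rule: grid_cases)
      case (neg k) thus ?thesis using q_power_le[of k] by simp
    next
      case (pos i) thus ?thesis using pos_grid_pos[of i] by simp
    qed
    hence "b * c * (- x) \<le> b * c * 1" "b * c * x \<le> b * c * X"
      using bc x(2) by (intro mult_left_mono; simp)+
    hence "\<bar>inverse (qpoch_inf q (- (b * c * x)))\<bar> \<le> L" by (intro L) simp
    hence P3: "norm (inverse (qpoch_inf q (- (of_real b * of_real c * complex_of_real x)))) \<le> L"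
      using qpoch_inf_of_real[of "- (b * c * x)", where 'a=complex] by (simp add: norm_inverse)
    have P1: "norm (qpoch_inf q (of_real b / \<gamma>)) \<le> exp (\<rho> / (1 - q))"
    proof (rule order_trans[OF norm_qpoch_inf_le iffD2[OF exp_le_cancel_iff]])
      show "norm (of_real b / \<gamma>) / (1 - q) \<le> \<rho> / (1 - q)"
        using \<gamma>(2) q_less_1 by (intro divide_right_mono) simp_all
    qed
    have P2: "norm (bigG q (of_real a) (of_real b) (of_real c) \<gamma> (of_real x)) \<le> K"
      by (rule K[OF \<gamma>(1) _ \<gamma>(2)]) (use x in simp)
    have K0: "0 \<le> K" using norm_ge_zero P2 by (rule order_trans)
    have "norm (E \<gamma> (of_real x)) = norm (qpoch_inf q (of_real b / \<gamma>)) *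
        norm (bigG q (of_real a) (of_real b) (of_real c) \<gamma> (of_real x)) * (N *
        norm (inverse (qpoch_inf q (- (of_real b * of_real c * complex_of_real x)))))"
      unfolding bigE_def N_def by (simp add: norm_mult norm_divide norm_inverse divide_inverse)
    also have "\<dots> \<le> exp (\<rho> / (1 - q)) * K * (N * L)"
      by (intro mult_mono P1 P2 P3 mult_nonneg_nonneg order_refl norm_ge_zero exp_ge_zero K0)
         (simp_all add: N_def)
    finally show "norm (E \<gamma> (of_real x)) \<le> exp (\<rho> / (1 - q)) * K * (N * L)" .
  qed
qed

lemma holomorphic_E: 
  assumes "b \<le> 1"
  shows "(\<lambda>\<gamma>. E \<gamma> x) holomorphic_on {\<gamma>. norm \<gamma> > 1}"
proof (cases "qpoch_inf q (- (of_real b * of_real c * x)) = 0")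
  case False
  have "(\<lambda>\<gamma>. bigG q (of_real a) (of_real b) (of_real c) \<gamma> x) holomorphic_on {\<gamma>. norm \<gamma> > 1}"
    by (rule holomorphic_on_subset[OF C.holomorphic_bigG_\<gamma>]) (use assms b_pos in auto)
  thus ?thesis unfolding bigE_def using False C.qpoch_inf_ab_ac_bc_nz(1)
    by (intro holomorphic_intros) auto
qed (simp add: bigE_def)

lemma holomorphic_partial_form:
  assumes b: "b \<le> 1" and f: "is_phi q a b c z \<gamma>' f"
  shows "(\<lambda>\<gamma>. partial_form (Egrid \<gamma>) f K) holomorphic_on {\<gamma>. norm \<gamma> > 1}"
proof -
  have series: "(\<lambda>\<gamma>. \<Sum>n. Egrid \<gamma> (x n) * f (x n) * of_real (grid_wt q a b c (x n))) holomorphic_on {\<gamma>. norm \<gamma> > 1}"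
    if x: "\<And>n. x n \<in> grid q z" "\<And>n. \<bar>x n\<bar> \<le> X"
      and sm: "summable (\<lambda>n. norm (f (x n) * of_real (grid_wt q a b c (x n))))" for x :: "nat \<Rightarrow> real" and X
  proof (rule holomorphic_on_suminf[OF C.open_norm_gt])
    show "(\<lambda>\<gamma>. Egrid \<gamma> (x n) * f (x n) * of_real (grid_wt q a b c (x n))) holomorphic_on {\<gamma>. norm \<gamma> > 1}" for n
      unfolding Egrid_eq[OF x(1)] by (intro holomorphic_intros holomorphic_E[OF b])
    fix \<gamma> :: complex assume \<gamma>: "\<gamma> \<in> {\<gamma>. norm \<gamma> > 1}"
    define d where "d = (norm \<gamma> - 1) / 2"
    have d: "d > 0" "norm \<gamma> = 1 + 2 * d" using \<gamma> by (simp_all add: d_def field_simps)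
    have near: "1 + d \<le> norm y" "norm y \<le> norm \<gamma> + d" if "y \<in> cball \<gamma> d" for y
    proof -
      have "norm (\<gamma> - y) \<le> d" using that by (simp add: dist_norm)
      thus "1 + d \<le> norm y" "norm y \<le> norm \<gamma> + d"
        using norm_triangle_sub[of \<gamma> y] norm_triangle_sub[of y \<gamma>] d
        by (simp_all add: norm_minus_commute)
    qed
    have "1 / (1 + d) < 1" using d(1) by (simp add: divide_less_eq)
    then obtain B where B: "\<And>\<gamma>' x. norm \<gamma>' \<le> norm \<gamma> + d \<Longrightarrow> norm (of_real b / \<gamma>') \<le> 1 / (1 + d) \<Longrightarrow>
        x \<in> grid q z \<Longrightarrow> \<bar>x\<bar> \<le> X \<Longrightarrow> norm (E \<gamma>' (of_real x)) \<le> B"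
      using E_bounded[of "1 / (1 + d)" "norm \<gamma> + d" X] by blast
    have bound: "norm (Egrid y (x n) * f (x n) * of_real (grid_wt q a b c (x n)))
        \<le> B * norm (f (x n) * of_real (grid_wt q a b c (x n)))" if "y \<in> cball \<gamma> d" for y n
    proof -
      have "norm (of_real b / y) \<le> 1 / (1 + d)"
        unfolding norm_divide using near[OF that] b b_pos d by (intro frac_le) auto
      hence "norm (E y (of_real (x n))) \<le> B" by (intro B near that x)
      thus ?thesis
        unfolding Egrid_eq[OF x(1)] mult.assoc norm_mult[of "E y (of_real (x n))"]
        by (intro mult_right_mono) auto
    qed
    have "summable (\<lambda>n. B * norm (f (x n) * of_real (grid_wt q a b c (x n))))"
      using sm by (intro summable_mult)
    moreover have "cball \<gamma> d \<subseteq> {\<gamma>. norm \<gamma> > 1}" using near d by fastforce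
    ultimately show "\<exists>d>0. \<exists>M. cball \<gamma> d \<subseteq> {\<gamma>. norm \<gamma> > 1} \<and> summable M \<and>
        (\<forall>n. \<forall>y\<in>cball \<gamma> d. norm (Egrid y (x n) * f (x n) * of_real (grid_wt q a b c (x n))) \<le> M n)"
      using d bound by (intro exI[of _ d] exI[of _ "\<lambda>n. B * norm (f (x n) * of_real (grid_wt q a b c (x n)))"] conjI)
        blast+
  qed
  have 1: "(\<lambda>\<gamma>. \<Sum>k. Egrid \<gamma> (- (q ^ k)) * f (- (q ^ k)) * of_real (grid_wt q a b c (- (q ^ k))))
      holomorphic_on {\<gamma>. norm \<gamma> > 1}"
    by (rule series[of "\<lambda>k. - (q ^ k)" 1, OF neg_in_grid])
       (use q_power_le in \<open>auto intro: summable_weighted(1)[OF is_phi_tendsto_0(1)[OF f grid_LIMSEQ_0(2) neg_in_grid]]\<close>)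
  have 2: "(\<lambda>\<gamma>. \<Sum>j. Egrid \<gamma> (z * q powi (int j - int K)) * f (z * q powi (int j - int K)) *
      of_real (grid_wt q a b c (z * q powi (int j - int K)))) holomorphic_on {\<gamma>. norm \<gamma> > 1}"
  proof (rule series[of "\<lambda>j. z * q powi (int j - int K)" "z * q powi (- int K)", OF pos_in_grid])
    show "\<bar>z * q powi (int j - int K)\<bar> \<le> z * q powi (- int K)" for j
      using pos_grid_pos[of "int j - int K"] z_pos q_pos q_less_1
      by (simp add: power_int_decreasing)
    have "summable (\<lambda>k. norm (f (z * q ^ k) * complex_of_real (grid_wt q a b c (z * q ^ k))))"
      by (rule summable_weighted(2)[OF is_phi_tendsto_0(1)[OF f grid_LIMSEQ_0(1) pos_grid_nat]])
    hence "summable (\<lambda>j. norm (f (z * q powi (int (j + K) - int K)) *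
        complex_of_real (grid_wt q a b c (z * q powi (int (j + K) - int K)))))" by simp
    thus "summable (\<lambda>j. norm (f (z * q powi (int j - int K)) *
        complex_of_real (grid_wt q a b c (z * q powi (int j - int K)))))"
      by (rule summable_iff_shift[THEN iffD1])
  qed
  show ?thesis unfolding partial_form_def by (intro holomorphic_on_add 1 2)
qed

text \<open>If the coefficient \<open>cfun\<close> of the growing solution has a zero at \<open>\<gamma>\<^sub>0\<close>, then the norm of the
  eigenfunction is the value at \<open>\<gamma>\<^sub>0\<close> of the limit of the holomorphic functions
  \<open>S\<^sub>K(\<gamma>) = (\<gamma>\<^sub>0/\<gamma>)\<^sup>K partial_form \<phi>\<^sub>\<gamma> \<phi>\<^sub>\<gamma>\<^sub>0 K\<close>. Off \<open>\<gamma>\<^sub>0\<close> the limit is read off from Green's formula; by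
  the maximum principle it extends to \<open>\<gamma>\<^sub>0\<close>.\<close>

theorem norm_eigenfunction:
  assumes b: "b \<le> 1" and \<gamma>0: "norm \<gamma>\<^sub>0 > 1" and f: "is_phi q a b c z \<gamma>\<^sub>0 f" "asymp f \<gamma>\<^sub>0 D"
    and r: "r > 0" "ball \<gamma>\<^sub>0 r \<subseteq> {\<gamma>. norm \<gamma> > 1}" and h: "h holomorphic_on ball \<gamma>\<^sub>0 r"
    and cfun: "\<And>\<gamma>. \<gamma> \<in> ball \<gamma>\<^sub>0 r \<Longrightarrow> cfun \<gamma> = (\<gamma> - \<gamma>\<^sub>0) * h \<gamma>"
  shows "ip q a b c z f (\<lambda>x. cnj (f x)) = of_real limit_weight * D * (\<gamma>\<^sub>0 * h \<gamma>\<^sub>0)"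
proof -
  have \<gamma>0nz: "\<gamma>\<^sub>0 \<noteq> 0" using \<gamma>0 by auto
  define V where "V = (\<lambda>\<gamma>. of_real limit_weight * D * (\<gamma> * h \<gamma>))"
  define S where "S = (\<lambda>k \<gamma>. partial_form (Egrid \<gamma>) f k * (\<gamma>\<^sub>0 / \<gamma>) ^ k)"
  define \<rho> where "\<rho> = r / 2"
  have \<rho>: "\<rho> > 0" "cball \<gamma>\<^sub>0 \<rho> \<subseteq> ball \<gamma>\<^sub>0 r" using r(1) by (auto simp: \<rho>_def)
  have E0: "Egrid \<gamma>\<^sub>0 = f"
    using phi_eqI[OF \<gamma>0nz is_phi_Egrid[OF b \<gamma>0]] phi_eqI[OF \<gamma>0nz f(1)] by simp
  have S0: "S k \<gamma>\<^sub>0 = partial_form f f k" for k using \<gamma>0nz by (simp add: S_def E0)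
  have ball_nz: "\<gamma> \<noteq> 0" if "\<gamma> \<in> ball \<gamma>\<^sub>0 r" for \<gamma>
    using subsetD[OF r(2) that] by auto
  have hol: "(\<lambda>\<gamma>. S k \<gamma> - V \<gamma>) holomorphic_on ball \<gamma>\<^sub>0 r" for k
    unfolding S_def V_def
    by (intro holomorphic_intros h ball_nz
          holomorphic_on_subset[OF holomorphic_partial_form[OF b f(1)] r(2)])
  have lim: "((\<lambda>(k, \<gamma>). S k \<gamma> - V \<gamma>) \<longlongrightarrow> 0) (sequentially \<times>\<^sub>F nhds s)" if s: "s \<in> sphere \<gamma>\<^sub>0 \<rho>" for s
  proof -
    let ?F = "sequentially \<times>\<^sub>F nhds s"
    have s_ball: "s \<in> ball \<gamma>\<^sub>0 r" using s \<rho>(2) by auto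
    have s1: "norm s > 1" and snz: "s \<noteq> 0" and ne: "s \<noteq> \<gamma>\<^sub>0" 
      using subsetD[OF r(2) s_ball] ball_nz[OF s_ball] s \<rho>(1) by auto
    have fst_lim: "filterlim fst sequentially ?F" and snd_lim: "(snd \<longlongrightarrow> s) ?F"
      by (rule filterlim_fst, rule filterlim_snd)
    define e where "e = (\<lambda>k \<gamma>. Egrid \<gamma> (z / q ^ k) * (inverse \<gamma> / of_real a) ^ k)"
    have e_lim: "((\<lambda>p. e (fst p) (snd p)) \<longlongrightarrow> cfun s) ?F"
    proof -
      have "e k \<gamma> = E \<gamma> (of_real (z / q ^ k)) / (of_real a * \<gamma>) ^ k" for k \<gamma>
        unfolding e_def Egrid_eq[OF far_grid]
        by (simp add: divide_inverse mult_ac power_mult_distrib power_inverse)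
      hence "(\<lambda>p. e (fst p) (snd p)) = (\<lambda>(k, \<gamma>). E \<gamma> (of_real (z / q ^ k)) / (of_real a * \<gamma>) ^ k)"
        by (simp only: case_prod_unfold)
      thus ?thesis using E_at_infinity[OF b s1] by (simp only:)
    qed
    have "filterlim (\<lambda>p. (Suc (fst p), snd p)) ?F ?F"
      by (intro filterlim_Pair filterlim_compose[OF filterlim_Suc fst_lim] snd_lim)
    from filterlim_compose[OF e_lim this]
    have e_lim': "((\<lambda>p. e (Suc (fst p)) (snd p)) \<longlongrightarrow> cfun s) ?F" by simp
    define \<psi> where "\<psi> = (\<lambda>k. f (z / q ^ k) * (\<gamma>\<^sub>0 / of_real a) ^ k)"
    have \<psi>: "\<psi> \<longlonglongrightarrow> D" using f(2) by (simp add: asymp_def \<psi>_def)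
    have \<psi>_lim: "((\<lambda>p. \<psi> (fst p)) \<longlongrightarrow> D) ?F" and \<psi>_lim': "((\<lambda>p. \<psi> (Suc (fst p))) \<longlongrightarrow> D) ?F"
      by (rule filterlim_compose[OF \<psi> fst_lim], rule filterlim_compose[OF LIMSEQ_Suc[OF \<psi>] fst_lim])
    define w where "w = (\<lambda>K. far_wt (Suc K) * ((a * b + q ^ Suc K / z) * (a * c + q ^ Suc K / z) / (b * c)) / a)"
    have w_lim: "((\<lambda>p. complex_of_real (w (fst p))) \<longlongrightarrow> of_real (limit_weight * a)) ?F"
      unfolding w_def by (intro tendsto_of_real filterlim_compose[OF casorati_factor_LIMSEQ fst_lim])
    define m where "m = (\<lambda>\<gamma>. of_real a * ((\<gamma> - \<gamma>\<^sub>0) * (1 - inverse \<gamma> * inverse \<gamma>\<^sub>0)))"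
    have m: "mu a \<gamma> - mu a \<gamma>\<^sub>0 = m \<gamma>" if "\<gamma> \<noteq> 0" for \<gamma>
      using that \<gamma>0nz by (simp add: mu_def m_def field_simps)
    have m_nz: "m \<gamma> \<noteq> 0" if "norm \<gamma> > 1" "\<gamma> \<noteq> \<gamma>\<^sub>0" for \<gamma>
    proof -
      have "norm (inverse \<gamma> * inverse \<gamma>\<^sub>0) < 1"
      proof -
        have "inverse (norm \<gamma>) * inverse (norm \<gamma>\<^sub>0) < 1 * 1"
          using that(1) \<gamma>0 by (intro mult_strict_mono) (auto simp: inverse_less_1_iff)
        thus ?thesis by (simp add: norm_mult norm_inverse)
      qed
      hence "inverse \<gamma> * inverse \<gamma>\<^sub>0 \<noteq> 1" by (metis less_irrefl norm_one)
      thus ?thesis using that(2) a_pos by (simp add: m_def)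
    qed
    have S_eq: "S k \<gamma> = - (of_real (w k) * (e k \<gamma> * \<psi> (Suc k) / \<gamma>\<^sub>0 - e (Suc k) \<gamma> * \<psi> k * \<gamma>)) / m \<gamma>"
      if \<gamma>: "norm \<gamma> > 1" "\<gamma> \<noteq> \<gamma>\<^sub>0" for k \<gamma>
    proof -
      have \<gamma>nz: "\<gamma> \<noteq> 0" "inverse \<gamma> \<noteq> 0" using \<gamma> by auto
      have pf: "m \<gamma> * partial_form (Egrid \<gamma>) f k = - casorati q a b c (Egrid \<gamma>) f (z / q ^ Suc k)"
        using green[OF is_phi_Egrid[OF b \<gamma>(1)] f(1), of k] unfolding m[OF \<gamma>nz(1)] far_grid_Suc' .
      have "m \<gamma> * S k \<gamma> = m \<gamma> * partial_form (Egrid \<gamma>) f k * (inverse \<gamma> * \<gamma>\<^sub>0) ^ k"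
        unfolding S_def divide_inverse by (simp only: mult_ac)
      also have "\<dots> = - (casorati q a b c (Egrid \<gamma>) f (z / q ^ Suc k) * (inverse \<gamma> * \<gamma>\<^sub>0) ^ k)"
        unfolding pf by (simp only: mult_minus_left)
      also have "casorati q a b c (Egrid \<gamma>) f (z / q ^ Suc k) * (inverse \<gamma> * \<gamma>\<^sub>0) ^ k
          = of_real (w k) * (e k \<gamma> * \<psi> (Suc k) / \<gamma>\<^sub>0 - e (Suc k) \<gamma> * \<psi> k * \<gamma>)"
        unfolding casorati_far[OF \<gamma>nz(2) \<gamma>0nz] w_def e_def \<psi>_def by simp
      finally show ?thesis using m_nz[OF \<gamma>] by (simp add: field_simps)
    qed
    have m_lim: "((\<lambda>p. m (snd p)) \<longlongrightarrow> m s) ?F"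
      unfolding m_def using snz by (intro tendsto_intros snd_lim)
    have "((\<lambda>p. - (of_real (w (fst p)) * (e (fst p) (snd p) * \<psi> (Suc (fst p)) / \<gamma>\<^sub>0
        - e (Suc (fst p)) (snd p) * \<psi> (fst p) * snd p)) / m (snd p))
      \<longlongrightarrow> - (of_real (limit_weight * a) * (cfun s * D / \<gamma>\<^sub>0 - cfun s * D * s)) / m s) ?F"
      using \<gamma>0nz m_nz[OF s1 ne]
      by (intro tendsto_divide tendsto_minus tendsto_mult tendsto_diff w_lim e_lim e_lim' \<psi>_lim \<psi>_lim'
            snd_lim m_lim tendsto_const)
    moreover have "- (of_real (limit_weight * a) * (cfun s * D / \<gamma>\<^sub>0 - cfun s * D * s)) / m s = V s"
    proof -
      have "- (of_real (limit_weight * a) * (cfun s * D / \<gamma>\<^sub>0 - cfun s * D * s))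
          = of_real limit_weight * D * h s * (of_real a * (s - \<gamma>\<^sub>0) * (s - inverse \<gamma>\<^sub>0))"
        unfolding cfun[OF s_ball] by (simp add: algebra_simps divide_inverse)
      also have "s - inverse \<gamma>\<^sub>0 = s * (1 - inverse s * inverse \<gamma>\<^sub>0)"
        using snz by (simp add: right_diff_distrib)
      also have "of_real limit_weight * D * h s * (of_real a * (s - \<gamma>\<^sub>0) * (s * (1 - inverse s * inverse \<gamma>\<^sub>0))) = V s * m s"
        by (simp add: V_def m_def mult_ac)
      finally show ?thesis using m_nz[OF s1 ne] by simp
    qed
    ultimately have "((\<lambda>p. - (of_real (w (fst p)) * (e (fst p) (snd p) * \<psi> (Suc (fst p)) / \<gamma>\<^sub>0
        - e (Suc (fst p)) (snd p) * \<psi> (fst p) * snd p)) / m (snd p)) \<longlongrightarrow> V s) ?F" by simp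
    moreover have "\<forall>\<^sub>F p in ?F. - (of_real (w (fst p)) * (e (fst p) (snd p) * \<psi> (Suc (fst p)) / \<gamma>\<^sub>0
        - e (Suc (fst p)) (snd p) * \<psi> (fst p) * snd p)) / m (snd p) = S (fst p) (snd p)"
    proof -
      have "\<forall>\<^sub>F p in ?F. 1 < norm (snd p)" using tendsto_norm[OF snd_lim] s1 by (rule order_tendstoD)
      moreover have "\<forall>\<^sub>F p in ?F. snd p \<noteq> \<gamma>\<^sub>0" using snd_lim ne by (rule tendsto_imp_eventually_ne)
      ultimately show ?thesis by eventually_elim (simp add: S_eq)
    qed
    ultimately have "((\<lambda>p. S (fst p) (snd p)) \<longlongrightarrow> V s) ?F" by (rule Lim_transform_eventually)
    moreover have "((\<lambda>p. V (snd p)) \<longlongrightarrow> V s) ?F"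
    proof (rule filterlim_compose[OF _ snd_lim])
      have "continuous_on (ball \<gamma>\<^sub>0 r) V"
        unfolding V_def by (intro continuous_intros holomorphic_on_imp_continuous_on h)
      hence "isCont V s" using s_ball by (simp add: continuous_on_eq_continuous_at)
      thus "(V \<longlongrightarrow> V s) (nhds s)" by (simp add: isCont_def tendsto_nhds_iff)
    qed
    ultimately have "((\<lambda>p. S (fst p) (snd p) - V (snd p)) \<longlongrightarrow> V s - V s) ?F" by (rule tendsto_diff)
    thus ?thesis by (simp only: case_prod_unfold diff_self)
  qed
  have "(\<lambda>k. partial_form f f k) \<longlonglongrightarrow> V \<gamma>\<^sub>0"
  proof (rule LIMSEQ_I)
    fix \<epsilon> :: real assume "\<epsilon> > 0"
    hence "\<epsilon> / 2 > 0" by simp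
    from joint_limit_uniform_on_compact[OF compact_sphere lim this]
    obtain N where N: "\<And>k \<gamma>. k \<ge> N \<Longrightarrow> \<gamma> \<in> sphere \<gamma>\<^sub>0 \<rho> \<Longrightarrow> norm (S k \<gamma> - V \<gamma>) < \<epsilon> / 2" by blast
    have "norm (partial_form f f k - V \<gamma>\<^sub>0) < \<epsilon>" if k: "k \<ge> N" for k
    proof -
      have "norm (S k \<gamma>\<^sub>0 - V \<gamma>\<^sub>0) \<le> \<epsilon> / 2"
      proof (rule maximum_modulus_frontier[of "\<lambda>\<gamma>. S k \<gamma> - V \<gamma>" "cball \<gamma>\<^sub>0 \<rho>"])
        show "(\<lambda>\<gamma>. S k \<gamma> - V \<gamma>) holomorphic_on interior (cball \<gamma>\<^sub>0 \<rho>)"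
          by (rule holomorphic_on_subset[OF hol]) (use \<rho>(2) interior_subset in blast)
        show "continuous_on (closure (cball \<gamma>\<^sub>0 \<rho>)) (\<lambda>\<gamma>. S k \<gamma> - V \<gamma>)"
          using holomorphic_on_imp_continuous_on[OF hol] \<rho>(2) by (auto intro: continuous_on_subset)
        show "norm (S k \<gamma> - V \<gamma>) \<le> \<epsilon> / 2" if "\<gamma> \<in> frontier (cball \<gamma>\<^sub>0 \<rho>)" for \<gamma>
          using N[OF k, of \<gamma>] that \<rho>(1) by (simp add: frontier_cball)
      qed (use \<rho>(1) in auto)
      thus ?thesis using \<open>\<epsilon> > 0\<close> by (simp add: S0)
    qed
    thus "\<exists>N. \<forall>k\<ge>N. norm (partial_form f f k - V \<gamma>\<^sub>0) < \<epsilon>" by blast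
  qed
  moreover have "partial_form f f \<longlonglongrightarrow> ip q a b c z f (\<lambda>x. cnj (f x))"
  proof (rule partial_form_LIMSEQ[OF f f])
    have "1 * 1 < norm \<gamma>\<^sub>0 * norm \<gamma>\<^sub>0" using \<gamma>0 by (intro mult_strict_mono) auto
    thus "norm (\<gamma>\<^sub>0 * \<gamma>\<^sub>0) > 1" by (simp add: norm_mult)
  qed
  ultimately show ?thesis unfolding V_def using LIMSEQ_unique by blast
qed

end

section \<open>Theta functions and real eigenfunctions\<close>

lemma triangular_pred: "(i - 1) * i div 2 = i * (i + 1) div 2 - (i :: int)"
proof -
  have "i * (i + 1) = (i - 1) * i + i * 2" by (simp add: algebra_simps)
  hence "i * (i + 1) div 2 = (i - 1) * i div 2 + i" by simp
  thus ?thesis by simp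
qed

context qbase
begin

lemma theta_shift_1:
  fixes x :: "'a::{real_normed_field, banach}"
  assumes x: "x \<noteq> 0"
  shows "qpoch_inf q (x / of_real q) * qpoch_inf q (of_real q / (x / of_real q))
    = - (x / of_real q) * (qpoch_inf q x * qpoch_inf q (of_real q / x))"
proof -
  have 1: "qpoch_inf q (x / of_real q) = (1 - x / of_real q) * qpoch_inf q x"
    using qpoch_inf_step[of "x / of_real q"] by simp
  have 2: "qpoch_inf q (of_real q / x) = (1 - of_real q / x) * qpoch_inf q (of_real q / (x / of_real q))"
    using qpoch_inf_step[of "of_real q / x"] by simp
  have "- (x / of_real q) * (1 - of_real q / x) = 1 - x / of_real q"
    using x by (simp add: field_simps)
  thus ?thesis unfolding 1 2 by (metis mult.assoc mult.left_commute)
qed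

text \<open>Quasi-periodicity of \<open>\<theta>(x) = (x, q/x; q)\<^sub>\<infinity>\<close>.\<close>

lemma theta_shift:
  fixes x :: "'a::{real_normed_field, banach}"
  assumes x: "x \<noteq> 0"
  shows "qpoch_inf q (x / of_real q powi k) * qpoch_inf q (of_real q / (x / of_real q powi k))
    = (- x) powi k * of_real q powi (- (k * (k + 1) div 2)) * (qpoch_inf q x * qpoch_inf q (of_real q / x))"
proof -
  define Q where "Q = (of_real q :: 'a)"
  have Q: "Q \<noteq> 0" by (simp add: Q_def)
  define T where "T = (\<lambda>y. qpoch_inf q y * qpoch_inf q (Q / y))"
  have T1: "T (y / Q) = - (y / Q) * T y" if "y \<noteq> 0" for y
    unfolding T_def Q_def by (rule theta_shift_1[OF that])
  have "T (x / Q powi k) = (- x) powi k * Q powi (- (k * (k + 1) div 2)) * T x"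
  proof (induction k rule: int_induct[where k = 0])
    case (step1 i)
    have e: "x / Q powi (i + 1) = x / Q powi i / Q" using Q by (simp add: power_int_add)
    have "T (x / Q powi (i + 1)) = - (x / Q powi i / Q) * T (x / Q powi i)"
      unfolding e by (rule T1) (use x Q in simp)
    also have "\<dots> = (- x) powi (i + 1) * (Q powi (- (i * (i + 1) div 2)) / (Q powi i * Q)) * T x"
      unfolding step1.IH using x by (simp add: power_int_add)
    also have "Q powi (- (i * (i + 1) div 2)) / (Q powi i * Q) = Q powi (- ((i + 1) * (i + 1 + 1) div 2))"
    proof -
      have "(i + 1) * (i + 1 + 1) div 2 = i * (i + 1) div 2 + i + 1"
        using triangular_pred[of "i + 1"] by simp
      hence "- ((i + 1) * (i + 1 + 1) div 2) = - (i * (i + 1) div 2) - (i + 1)" by simp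
      thus ?thesis using Q by (simp only: power_int_diff power_int_add power_int_1_right simp_thms)
    qed
    finally show ?case .
  next
    case (step2 i)
    have e: "x / Q powi (i - 1) / Q = x / Q powi i" using Q by (simp add: power_int_diff)
    have "T (x / Q powi (i - 1) / Q) = - (x / Q powi (i - 1) / Q) * T (x / Q powi (i - 1))"
      by (rule T1) (use x Q in simp)
    hence "T (x / Q powi (i - 1)) = - (Q powi i / x) * T (x / Q powi i)"
      unfolding e using x Q by (simp add: field_simps)
    also have "\<dots> = (- x) powi (i - 1) * (Q powi (- (i * (i + 1) div 2)) * Q powi i) * T x"
      unfolding step2.IH using x by (simp add: power_int_diff)
    also have "Q powi (- (i * (i + 1) div 2)) * Q powi i = Q powi (- ((i - 1) * (i - 1 + 1) div 2))"
      using Q triangular_pred[of i] by (simp flip: power_int_add)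
    finally show ?case .
  qed simp
  thus ?thesis unfolding T_def Q_def .
qed

end

context bigq
begin

lemma qtheta_shift:
  "x \<noteq> 0 \<Longrightarrow> qtheta q (x / q powi k) = (- x) powi k * q powi (- (k * (k + 1) div 2)) * qtheta q x"
  using theta_shift[of x k] by (simp add: qtheta_eq)

lemma qtheta_neg_pos: "t > 0 \<Longrightarrow> qtheta q (- t) > 0"
  unfolding qtheta_eq using q_pos by (intro mult_pos_pos qpoch_inf_pos) (auto simp: less_le_trans[of _ 0])

lemma F_real:
  assumes x: "b * c * \<bar>x\<bar> < 1"
  shows "cnj (F (of_real \<gamma>) (of_real x)) = F (of_real \<gamma>) (of_real x)"
proof -
  have "norm (of_real b * of_real c * complex_of_real x) < 1"
    using x b_pos c_pos by (simp add: norm_mult)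
  note sm = C.summable_bigF[OF this, of "of_real \<gamma>"]
  have "cnj (bigF_term q (of_real a) (of_real b) (of_real c) (of_real \<gamma>) (of_real x) n)
      = bigF_term q (of_real a) (of_real b) (of_real c) (of_real \<gamma>) (of_real x) n" for n
    by (simp add: bigF_term_def qpochn_def)
  thus ?thesis
    unfolding bigF_def bounded_linear.suminf[OF bounded_linear_cnj sm] by simp
qed

text \<open>For real \<open>\<gamma>\<close> the eigenfunction is real, by uniqueness.\<close>

lemma is_phi_cnj:
  assumes f: "is_phi q a b c z (of_real \<gamma>) f" and \<gamma>: "\<gamma> \<noteq> 0" and x: "x \<in> grid q z"
  shows "cnj (f x) = f x"
proof -
  define g where "g = (\<lambda>x\<in>grid q z. cnj (f x))"
  have bc: "b * c > 0" using b_pos c_pos by simp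
  have "is_phi q a b c z (of_real \<gamma>) g"
    unfolding is_phi_def
  proof (intro conjI ballI)
    show "g \<in> extensional (grid q z)" by (simp add: g_def)
    fix x assume x: "x \<in> grid q z"
    have \<mu>: "cnj (mu a (of_real \<gamma>)) = mu a (of_real \<gamma>)" by (simp add: mu_def)
    have "grid_qdiff q a b c (mu a (of_real \<gamma>)) f x" using f x by (auto simp: is_phi_def)
    hence eq: "of_real ((a * b * x + 1) * (a * c * x + 1)) * (cnj (f (q * x)) - cnj (f x))
     + of_real ((b * c * x + q) * (x + 1)) * (cnj (f (x / q)) - cnj (f x))
     = of_real (b * c * x\<^sup>2) * (mu a (of_real \<gamma>) * cnj (f x))"
      unfolding grid_qdiff_def
      by (metis (no_types, lifting) \<mu> complex_cnj_add complex_cnj_complex_of_real complex_cnj_diff complex_cnj_mult)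
    show "grid_qdiff q a b c (mu a (of_real \<gamma>)) g x"
    proof (cases "x = -1")
      case True
      thus ?thesis using eq x q_times_in_grid[OF x] by (simp add: grid_qdiff_def g_def)
    next
      case False
      thus ?thesis using eq x q_times_in_grid[OF x] div_q_in_grid[OF x] by (simp add: grid_qdiff_def g_def)
    qed
  next
    show "\<exists>\<delta>>0. \<forall>x\<in>grid q z. \<bar>x\<bar> < \<delta> \<longrightarrow> g x = F (of_real \<gamma>) (of_real x)"
    proof (intro exI[of _ "1 / (b * c)"] conjI ballI impI)
      fix x assume x: "x \<in> grid q z" "\<bar>x\<bar> < 1 / (b * c)"
      hence "b * c * \<bar>x\<bar> < 1" using bc by (simp add: field_simps)
      thus "g x = F (of_real \<gamma>) (of_real x)"
        using is_phi_eq_F[OF _ f x(1)] \<gamma> F_real x(1) by (simp add: g_def)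
    qed (use bc in simp)
  qed
  moreover have "complex_of_real \<gamma> \<noteq> 0" using \<gamma> by simp
  ultimately have "g = f" using phi_eqI[of "of_real \<gamma>" g] phi_eqI[of "of_real \<gamma>" f] f by simp
  hence "g x = f x" by simp
  thus ?thesis using x by (simp add: g_def)
qed

lemma ip_cong_grid:
  assumes "\<And>x. x \<in> grid q z \<Longrightarrow> g x = g' x"
  shows "ip q a b c z f g = ip q a b c z f g'"
  unfolding ip_def using assms neg_in_grid pos_in_grid by simp

section \<open>The eigenvalues of the first kind\<close>

lemma holomorphic_on_ctheta [holomorphic_intros]:
  "f holomorphic_on S \<Longrightarrow> (\<And>x. x \<in> S \<Longrightarrow> f x \<noteq> 0) \<Longrightarrow> (\<lambda>x. ctheta (f x)) holomorphic_on S"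
  unfolding ctheta_def by (intro holomorphic_intros)

lemma qpoch_inf_inverse_square_nz:
  assumes "norm \<gamma> > 1"
  shows "qpoch_inf q (inverse (\<gamma>\<^sup>2) :: complex) \<noteq> 0"
proof (rule qpoch_inf_nonzero_small)
  have "1 * 1 < norm \<gamma> * norm \<gamma>" using assms by (intro mult_strict_mono) auto
  moreover have "norm (inverse (\<gamma>\<^sup>2)) = inverse (norm \<gamma> * norm \<gamma>)"
    by (simp add: power2_eq_square norm_inverse norm_mult)
  ultimately show "norm (inverse (\<gamma>\<^sup>2)) < 1" by (simp only: inverse_less_1_iff) simp
qed

text \<open>The part of the denominator of \<open>cfun\<close> that does not depend on \<open>\<gamma>\<close>.\<close>

definition cfun_denom :: real where
  "cfun_denom = qpoch_inf q (a * b) * qpoch_inf q (a * c) * qtheta q (- (b * c * z))"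

lemma cfun_denom_nz: "cfun_denom \<noteq> 0"
  using qpoch_inf_pos[OF ab_less] qpoch_inf_pos[OF ac_less] qtheta_neg_pos[of "b * c * z"]
    b_pos c_pos z_pos by (simp add: cfun_denom_def)

lemma a_term_zero:
  assumes "i > n"
  shows "bigF_term q (of_real a) (of_real b) (of_real c) (of_real (a * q ^ n)) x i = 0"
proof -
  have "qpochn q (of_real a / of_real (a * q ^ n)) i = (0::complex)"
    unfolding qpochn_eq_0_iff using assms a_pos by (intro exI[of _ n]) auto
  thus ?thesis by (simp only: bigF_term_def) simp
qed

text \<open>For \<open>\<gamma> = a q\<^sup>n\<close> the series terminates and is a polynomial in \<open>x\<close>, which satisfies the
  difference equation everywhere.\<close>

lemma F_polynomial:
  "F (of_real (a * q ^ n)) x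
    = (\<Sum>i\<le>n. bigF_term q (of_real a) (of_real b) (of_real c) (of_real (a * q ^ n)) x i)"
  unfolding bigF_def using a_term_zero by (intro suminf_finite) auto

lemma F_polynomial_qdiff:
  "big_qdiff q (of_real a) (of_real b) (of_real c)
     (of_real (a * q ^ n) + inverse (of_real (a * q ^ n))) (F (of_real (a * q ^ n))) x"
proof -
  define \<gamma> where "\<gamma> = complex_of_real (a * q ^ n)"
  have \<gamma>: "\<gamma> \<noteq> 0" using a_pos by (simp add: \<gamma>_def)
  define A B C where "A = complex_of_real a" and "B = complex_of_real b" and "C = complex_of_real c"
  define H where "H = (\<lambda>x. (A * B * x + 1) * (A * C * x + 1) * (F \<gamma> (of_real q * x) - F \<gamma> x)
     + (B * C * x + of_real q) * (x + 1) * (F \<gamma> (x / of_real q) - F \<gamma> x)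
     - B * C * x\<^sup>2 * (-1 - A\<^sup>2 + A * (\<gamma> + inverse \<gamma>)) * F \<gamma> x)"
  have hol: "(\<lambda>x. F \<gamma> (g x)) holomorphic_on S" if "g holomorphic_on S" for g S
    unfolding F_polynomial \<gamma>_def bigF_term_def using that by (intro holomorphic_intros)
  have "H holomorphic_on UNIV"
    unfolding H_def by (intro holomorphic_intros hol) auto
  moreover define U where "U = ball 0 (q / (b * c)) - {0 :: complex}"
  have bc: "b * c > 0" using b_pos c_pos by simp
  have "H y = 0" if "y \<in> U" for y
  proof -
    have y: "y \<noteq> 0" "norm y < q / (b * c)" using that by (auto simp: U_def)
    have yq: "b * c * norm y < q" using y(2) bc by (simp add: field_simps)
    have "big_qdiff q A B C (\<gamma> + inverse \<gamma>) (F \<gamma>) y"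
      unfolding A_def B_def C_def
    proof (rule C.bigF_qdiff[OF \<gamma> y(1)])
      show "norm (of_real b * of_real c * y) < 1"
        using yq q_less_1 b_pos c_pos by (simp add: norm_mult)
      show "y = - 1 \<or> norm (of_real b * of_real c * (y / of_real q)) < 1"
        using yq q_pos b_pos c_pos by (simp add: norm_mult norm_divide field_simps)
    qed
    thus ?thesis by (simp add: H_def big_qdiff_def)
  qed
  moreover have "0 islimpt U"
    unfolding U_def using bc q_pos by (simp add: islimpt_punctured[symmetric] interior_limit_point)
  ultimately have "H x = 0"
    by (intro analytic_continuation[of H UNIV U 0 x]) auto
  thus ?thesis unfolding big_qdiff_def H_def \<gamma>_def A_def B_def C_def by simp
qed

lemma is_phi_polynomial:
  "is_phi q a b c z (of_real (a * q ^ n)) (\<lambda>x\<in>grid q z. F (of_real (a * q ^ n)) (of_real x))"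
  unfolding is_phi_def
proof (intro conjI ballI)
  fix x assume x: "x \<in> grid q z"
  show "grid_qdiff q a b c (mu a (of_real (a * q ^ n)))
      (\<lambda>x\<in>grid q z. F (of_real (a * q ^ n)) (of_real x)) x"
    by (rule grid_qdiffI[OF F_polynomial_qdiff]) (use x q_times_in_grid div_q_in_grid in auto)
qed (auto intro: exI[of _ 1])

text \<open>The coefficient of \<open>q\<^sup>-\<^sup>n\<^sup>k\<close> in the asymptotics of the polynomial for \<open>\<gamma> = a q\<^sup>n\<close> at \<open>z q\<^sup>-\<^sup>k\<close>, that
  is, its leading coefficient times \<open>z\<^sup>n\<close>.\<close>

definition Dpos :: "nat \<Rightarrow> real" where
  "Dpos n = qpochn q (a\<^sup>2 * q ^ n) n * qpochn q (1 / q ^ n) n /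
     (qpochn q q n * qpochn q (a * b) n * qpochn q (a * c) n) * (- (b * c * z)) ^ n"

lemma asymp_polynomial:
  "asymp (\<lambda>x\<in>grid q z. F (of_real (a * q ^ n)) (of_real x)) (of_real (a * q ^ n)) (of_real (Dpos n))"
proof -
  define u where "u = (\<lambda>i. qpochn q (a\<^sup>2 * q ^ n) i * qpochn q (1 / q ^ n) i /
     (qpochn q q i * qpochn q (a * b) i * qpochn q (a * c) i))"
  have lim0: "(\<lambda>k. q ^ k) \<longlonglongrightarrow> 0" using q_pos q_less_1 by (intro LIMSEQ_power_zero) auto
  have term_eq: "bigF_term q (of_real a) (of_real b) (of_real c) (of_real (a * q ^ n)) (of_real (z / q ^ k)) i * of_real (q ^ n) ^ k
     = of_real (u i * (\<Prod>j<i. - (b * c) * (z + q ^ j * q ^ k)) * (q ^ k) ^ (n - i))" if i: "i \<le> n" for i k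
  proof -
    have "qpochn q (of_real a * of_real (a * q ^ n)) i = complex_of_real (qpochn q (a\<^sup>2 * q ^ n) i)"
      unfolding of_real_mult[symmetric] qpochn_of_real by (simp add: power2_eq_square mult.assoc)
    moreover have "qpochn q (of_real a / of_real (a * q ^ n)) i = complex_of_real (qpochn q (1 / q ^ n) i)"
      unfolding of_real_divide[symmetric] qpochn_of_real using a_pos by simp
    moreover have "qpochn q (of_real a * of_real b) i = complex_of_real (qpochn q (a * b) i)"
      "qpochn q (of_real a * of_real c) i = complex_of_real (qpochn q (a * c) i)"
      unfolding of_real_mult[symmetric] qpochn_of_real by simp_all
    ultimately have "bigF_term q (of_real a) (of_real b) (of_real c) (of_real (a * q ^ n)) (of_real (z / q ^ k)) i
        = of_real (u i * (\<Prod>j<i. - (b * c) * (z / q ^ k + q ^ j)))"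
      by (simp add: bigF_term_def u_def qpochn_of_real)
    moreover have "(\<Prod>j<i. - (b * c) * (z / q ^ k + q ^ j)) * (q ^ n) ^ k
        = (\<Prod>j<i. - (b * c) * (z + q ^ j * q ^ k)) * (q ^ k) ^ (n - i)"
    proof -
      have "(q ^ n) ^ k = (\<Prod>j<i. q ^ k) * (q ^ k) ^ (n - i)"
      proof -
        have "(q ^ n) ^ k = (q ^ k) ^ n" by (simp add: mult.commute flip: power_mult)
        also have "\<dots> = (q ^ k) ^ (i + (n - i))" using i by simp
        finally show ?thesis by (simp only: power_add prod_constant card_lessThan)
      qed
      hence "(\<Prod>j<i. - (b * c) * (z / q ^ k + q ^ j)) * (q ^ n) ^ k
        = (\<Prod>j<i. - (b * c) * (z / q ^ k + q ^ j) * q ^ k) * (q ^ k) ^ (n - i)"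
        by (simp only: prod.distrib mult.assoc)
      also have "(\<Prod>j<i. - (b * c) * (z / q ^ k + q ^ j) * q ^ k) = (\<Prod>j<i. - (b * c) * (z + q ^ j * q ^ k))"
      proof (intro prod.cong refl)
        fix j
        have "(z / q ^ k + q ^ j) * q ^ k = z + q ^ j * q ^ k" by (simp add: distrib_right)
        thus "- (b * c) * (z / q ^ k + q ^ j) * q ^ k = - (b * c) * (z + q ^ j * q ^ k)"
          by (simp only: mult.assoc)
      qed
      finally show ?thesis .
    qed
    ultimately show ?thesis by (simp only: mult.assoc of_real_mult[symmetric] of_real_power[symmetric])
  qed
  have "(\<lambda>k. \<Sum>i\<le>n. u i * (\<Prod>j<i. - (b * c) * (z + q ^ j * q ^ k)) * (q ^ k) ^ (n - i))
    \<longlonglongrightarrow> (\<Sum>i\<le>n. u i * (\<Prod>j<i. - (b * c) * (z + q ^ j * 0)) * 0 ^ (n - i))"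
    by (intro tendsto_sum tendsto_mult tendsto_const tendsto_prod tendsto_add tendsto_power lim0)
  also have "(\<Sum>i\<le>n. u i * (\<Prod>j<i. - (b * c) * (z + q ^ j * 0)) * 0 ^ (n - i))
      = (\<Sum>i\<le>n. if i = n then u i * (- (b * c * z)) ^ i else 0)"
    by (intro sum.cong refl) (auto simp: power_0_left)
  also have "\<dots> = Dpos n" by (simp add: Dpos_def u_def)
  finally have "(\<lambda>k. complex_of_real (\<Sum>i\<le>n. u i * (\<Prod>j<i. - (b * c) * (z + q ^ j * q ^ k)) * (q ^ k) ^ (n - i)))
      \<longlonglongrightarrow> of_real (Dpos n)" by (rule tendsto_of_real)
  moreover have "(\<lambda>x\<in>grid q z. F (of_real (a * q ^ n)) (of_real x)) (z / q ^ k) * (of_real (a * q ^ n) / of_real a) ^ k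
     = complex_of_real (\<Sum>i\<le>n. u i * (\<Prod>j<i. - (b * c) * (z + q ^ j * q ^ k)) * (q ^ k) ^ (n - i))" for k
  proof -
    have "complex_of_real (a * q ^ n) / of_real a = of_real (q ^ n)" using a_pos by simp
    hence "(\<lambda>x\<in>grid q z. F (of_real (a * q ^ n)) (of_real x)) (z / q ^ k) * (of_real (a * q ^ n) / of_real a) ^ k
      = (\<Sum>i\<le>n. bigF_term q (of_real a) (of_real b) (of_real c) (of_real (a * q ^ n)) (of_real (z / q ^ k)) i
          * of_real (q ^ n) ^ k)"
      using far_grid[of k] unfolding F_polynomial by (simp only: restrict_apply if_True sum_distrib_right)
    also have "\<dots> = (\<Sum>i\<le>n. complex_of_real (u i * (\<Prod>j<i. - (b * c) * (z + q ^ j * q ^ k)) * (q ^ k) ^ (n - i)))"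
      by (intro sum.cong refl term_eq) simp
    finally show ?thesis by (simp only: of_real_sum)
  qed
  ultimately show ?thesis unfolding asymp_def by (simp only:)
qed

text \<open>Here \<open>(a/\<gamma>;q)\<^sub>\<infinity>\<close>, a factor of \<open>cfun\<close>, vanishes at \<open>\<gamma> = a q\<^sup>n\<close>; its factor number \<open>n\<close> provides
  \<open>\<gamma> - a q\<^sup>n\<close>.\<close>

lemma norm_polynomial:
  assumes b: "b \<le> 1" and \<gamma>: "a * q ^ n > 1"
  defines "f \<equiv> (\<lambda>x\<in>grid q z. F (of_real (a * q ^ n)) (of_real x))"
  shows "ip q a b c z f f = of_real (limit_weight * Dpos n *
    (qpochn q (1 / q ^ n) n * qpoch_inf q q * qpoch_inf q (b / (a * q ^ n)) * qpoch_inf q (c / (a * q ^ n)) *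
     qtheta q (- (a * b * c * z * (a * q ^ n))) / (cfun_denom * qpoch_inf q (1 / (a * q ^ n)\<^sup>2))))"
proof -
  define g0 where "g0 = a * q ^ n"
  define \<gamma>0 where "\<gamma>0 = complex_of_real g0"
  have g0: "g0 > 1" using \<gamma> by (simp add: g0_def)
  have \<gamma>0: "norm \<gamma>0 > 1" using g0 by (simp add: \<gamma>0_def)
  have f: "is_phi q a b c z \<gamma>0 f" "asymp f \<gamma>0 (of_real (Dpos n))"
    unfolding f_def \<gamma>0_def g0_def by (rule is_phi_polynomial, rule asymp_polynomial)
  define h where "h = (\<lambda>\<gamma>::complex. inverse \<gamma> * (qpochn q (of_real a / \<gamma>) n * qpoch_inf q (of_real a / \<gamma> * of_real q ^ Suc n)
     * qpoch_inf q (of_real b / \<gamma>) * qpoch_inf q (of_real c / \<gamma>)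
     * ctheta (- (of_real (a * b * c * z) * \<gamma>)) / (of_real cfun_denom * qpoch_inf q (inverse (\<gamma>\<^sup>2)))))"
  define r where "r = g0 - 1"
  have ball: "ball \<gamma>0 r \<subseteq> {\<gamma>. norm \<gamma> > 1}"
  proof
    fix \<gamma> assume "\<gamma> \<in> ball \<gamma>0 r"
    hence "norm (\<gamma>0 - \<gamma>) < g0 - 1" by (simp add: dist_norm r_def)
    moreover have "norm \<gamma>0 = g0" using g0 by (simp add: \<gamma>0_def)
    ultimately show "\<gamma> \<in> {\<gamma>. norm \<gamma> > 1}" using norm_triangle_sub[of \<gamma>0 \<gamma>] by simp
  qed
  have nz: "\<gamma> \<noteq> 0" if "\<gamma> \<in> ball \<gamma>0 r" for \<gamma> using subsetD[OF ball that] by auto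
  have abcz: "complex_of_real (a * b * c * z) \<noteq> 0" using a_pos b_pos c_pos z_pos by simp
  have "ip q a b c z f (\<lambda>x. cnj (f x)) = of_real limit_weight * of_real (Dpos n) * (\<gamma>0 * h \<gamma>0)"
  proof (rule norm_eigenfunction[OF b \<gamma>0 f _ ball])
    show "r > 0" using g0 by (simp add: r_def)
    show "h holomorphic_on ball \<gamma>0 r"
      unfolding h_def using nz abcz cfun_denom_nz qpoch_inf_inverse_square_nz subsetD[OF ball]
      by (intro holomorphic_intros) auto
    fix \<gamma> assume "\<gamma> \<in> ball \<gamma>0 r"
    hence \<gamma>nz: "\<gamma> \<noteq> 0" by (rule nz)
    have "qpoch_inf q (of_real a / \<gamma>) = qpochn q (of_real a / \<gamma>) n * (1 - of_real a / \<gamma> * of_real q ^ n)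
        * qpoch_inf q (of_real a / \<gamma> * of_real q ^ Suc n)"
      using qpoch_inf_split[of "of_real a / \<gamma>" "Suc n"] by (simp add: qpochn_Suc)
    also have "1 - of_real a / \<gamma> * of_real q ^ n = (\<gamma> - \<gamma>0) * inverse \<gamma>"
      using \<gamma>nz by (simp add: \<gamma>0_def g0_def field_simps)
    finally have P: "qpoch_inf q (of_real a / \<gamma>) = qpochn q (of_real a / \<gamma>) n * ((\<gamma> - \<gamma>0) * inverse \<gamma>)
        * qpoch_inf q (of_real a / \<gamma> * of_real q ^ Suc n)" .
    show "cfun \<gamma> = (\<gamma> - \<gamma>0) * h \<gamma>"
      unfolding cfun_def P h_def cfun_denom_def by (simp only: times_divide_eq_right mult_ac)
  qed
  also have "\<gamma>0 * h \<gamma>0 = of_real (qpochn q (1 / q ^ n) n * qpoch_inf q q * qpoch_inf q (b / g0) * qpoch_inf q (c / g0) *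
     qtheta q (- (a * b * c * z * g0)) / (cfun_denom * qpoch_inf q (1 / g0\<^sup>2)))"
  proof -
    have e: "complex_of_real a / \<gamma>0 = of_real (1 / q ^ n)" using a_pos by (simp add: \<gamma>0_def g0_def)
    have e': "complex_of_real (1 / q ^ n) * of_real q ^ Suc n = of_real q" by simp
    have es: "complex_of_real b / \<gamma>0 = of_real (b / g0)" "complex_of_real c / \<gamma>0 = of_real (c / g0)"
      "- (complex_of_real (a * b * c * z) * \<gamma>0) = of_real (- (a * b * c * z * g0))"
      "inverse (\<gamma>0\<^sup>2) = of_real (1 / g0\<^sup>2)" by (simp_all add: \<gamma>0_def divide_inverse)
    have k: "\<gamma>0 * (inverse \<gamma>0 * X) = X" for X using g0 by (simp add: \<gamma>0_def)
    show ?thesis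
      unfolding h_def k e e' es qpochn_of_real qpoch_inf_of_real ctheta_of_real by simp
  qed
  also have "ip q a b c z f (\<lambda>x. cnj (f x)) = ip q a b c z f f"
    using is_phi_cnj[OF f(1)[unfolded \<gamma>0_def]] g0 by (intro ip_cong_grid) auto
  finally show ?thesis by (simp add: g0_def)
qed

end

context bigq
begin

lemma qtheta_mult_power: 
  assumes "x \<noteq> 0"
  shows "qtheta q (x * q ^ n) * ((- x) ^ n * q ^ (\<Sum>{..n})) = q ^ n * qtheta q x"
proof (induction n)
  case (Suc n)
  have "qtheta q (x * q ^ n) = - (x * q ^ n) * qtheta q (x * q ^ Suc n)"
    using theta_shift_1[of "x * q ^ Suc n"] assms by (simp add: qtheta_eq)
  hence "qtheta q (x * q ^ Suc n) * ((- x) ^ Suc n * q ^ (\<Sum>{..Suc n}))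
      = q * (qtheta q (x * q ^ n) * ((- x) ^ n * q ^ (\<Sum>{..n})))"
    by (simp add: power_add mult_ac)
  thus ?case unfolding Suc.IH by simp
qed simp

lemma Mconst_limit_weight:
  "limit_weight * Mconst q a b c z
    = (qpoch_inf q (a * b) * qpoch_inf q (a * c))\<^sup>2 * (qtheta q (- (b * c * z)))\<^sup>2"
proof -
  have "qtheta q (- (a * b * z)) > 0" "qtheta q (- (a * c * z)) > 0" "qtheta q (- (1 / z)) > 0"
    using a_pos b_pos c_pos z_pos by (auto intro!: qtheta_neg_pos)
  thus ?thesis using q_less_1 z_pos
    unfolding limit_weight_def Mconst_def qthetas_def qpochs_inf_def
    by (simp add: field_simps power2_eq_square)
qed

lemma sum_atMost_nat: "2 * (\<Sum>{..n}) = n * (n + 1)" for n :: nat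
  by (induction n) auto

lemma norm_eq_nu_pos:
  assumes \<gamma>: "a * q ^ n > 1" and b: "b < 1" and c: "c < 1"
  shows "limit_weight * Dpos n *
    (qpochn q (1 / q ^ n) n * qpoch_inf q q * qpoch_inf q (b / (a * q ^ n)) * qpoch_inf q (c / (a * q ^ n)) *
     qtheta q (- (a * b * c * z * (a * q ^ n))) / (cfun_denom * qpoch_inf q (1 / (a * q ^ n)\<^sup>2)))
    = inverse (nu_pos q a b c z a b c n)"
proof -
  have qn: "q ^ n \<le> 1" "q ^ n > 0" using q_power_le by auto
  have "a * q ^ n \<le> a * 1" using a_pos qn by (intro mult_left_mono) auto
  hence a1: "a > 1" using \<gamma> by simp
  define s :: real where "s = (-1) ^ n"
  have s: "s = 1 \<or> s = -1" by (simp add: s_def uminus_power_if)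
  define t where "t = q ^ (\<Sum>{..n})"
  define X where "X = q ^ n"
  define An Bn Cn Zn where "An = a ^ n" and "Bn = b ^ n" and "Cn = c ^ n" and "Zn = z ^ n"
  have nz1: "t > 0" "X > 0" "An > 0" "Bn > 0" "Cn > 0" "Zn > 0"
    using q_pos a_pos b_pos c_pos z_pos by (simp_all add: t_def X_def An_def Bn_def Cn_def Zn_def)
  define qq qab qac abn acn a2 a2q where "qq = qpochn q q n" and "qab = qpochn q (q * a / b) n"
    and "qac = qpochn q (q * a / c) n" and "abn = qpochn q (a * b) n" and "acn = qpochn q (a * c) n"
    and "a2 = qpochn q (a\<^sup>2) n" and "a2q = qpochn q (a\<^sup>2 * q ^ n) n"
  have a2_big: "a\<^sup>2 * q ^ i > 1" if "i \<le> 2 * n" for i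
  proof -
    have "1 * 1 < (a * q ^ n) * (a * q ^ n)" using \<gamma> by (intro mult_strict_mono) auto
    also have "\<dots> = a\<^sup>2 * q ^ (2 * n)" by (simp add: power2_eq_square power_mult power_mult_distrib algebra_simps flip: power_add)
    also have "\<dots> \<le> a\<^sup>2 * q ^ i" using that q_pos q_less_1 by (intro mult_left_mono power_decreasing) auto
    finally show ?thesis by simp
  qed
  have big: "q * a / e * q ^ i \<noteq> 1" if e: "e > 0" "e < 1" "a * e < 1" and i: "i < n" for e i
  proof
    assume "q * a / e * q ^ i = 1"
    hence "e = a * q ^ Suc i" using e by (simp add: field_simps)
    hence "a * e = a\<^sup>2 * q ^ Suc i" by (simp add: power2_eq_square)
    thus False using a2_big[of "Suc i"] i e(3) by simp
  qed
  have nz2: "qq \<noteq> 0" "qab \<noteq> 0" "qac \<noteq> 0" "abn \<noteq> 0" "acn \<noteq> 0" "a2 \<noteq> 0" "a2q \<noteq> 0"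
  proof -
    show "qq \<noteq> 0" using qpochn_q_nonzero[where 'a=real] by (simp add: qq_def)
    show "qab \<noteq> 0" "qac \<noteq> 0" unfolding qab_def qac_def qpochn_eq_0_iff
      using big[of b] big[of c] b c b_pos c_pos ab_less ac_less by auto
    show "abn \<noteq> 0" "acn \<noteq> 0" unfolding abn_def acn_def qpochn_eq_0_iff
      using mult_q_power_neq_1[of "a * b"] mult_q_power_neq_1[of "a * c"] a_pos b_pos c_pos ab_less ac_less by auto
    show "a2 \<noteq> 0" unfolding a2_def qpochn_eq_0_iff
    proof clarify
      fix i assume "i < n" "a\<^sup>2 * of_real q ^ i = 1"
      thus False using a2_big[of i] by simp
    qed
    show "a2q \<noteq> 0" unfolding a2q_def qpochn_eq_0_iff
    proof clarify
      fix i assume "i < n" "a\<^sup>2 * q ^ n * of_real q ^ i = 1"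
      thus False using a2_big[of "n + i"] by (simp add: power_add mult.assoc)
    qed
  qed
  define Pq Pab Pac Pba Pca Pa2 where "Pq = qpoch_inf q q" and "Pab = qpoch_inf q (a * b)"
    and "Pac = qpoch_inf q (a * c)" and "Pba = qpoch_inf q (b / a)" and "Pca = qpoch_inf q (c / a)"
    and "Pa2 = qpoch_inf q (1 / a\<^sup>2)"
  define th th2 where "th = qtheta q (- (b * c * z))" and "th2 = qtheta q (- (a\<^sup>2 * b * c * z))"
  have "1 / a\<^sup>2 < 1" using a1 by (simp add: divide_less_eq power2_eq_square less_1_mult)
  hence nz3: "Pq > 0" "Pab > 0" "Pac > 0" "Pba > 0" "Pca > 0" "Pa2 > 0" "th > 0" "th2 > 0"
    using q_less_1 ab_less ac_less a1 b c a_pos b_pos c_pos z_pos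
    by (auto simp: Pq_def Pab_def Pac_def Pba_def Pca_def Pa2_def th_def th2_def divide_less_eq
          intro!: qpoch_inf_pos qtheta_neg_pos)
  have a2X: "1 - a\<^sup>2 \<noteq> 0" "1 - a\<^sup>2 * X\<^sup>2 \<noteq> 0"
    using a2_big[of 0] a2_big[of "2 * n"] by (auto simp: X_def power_mult mult.commute[of 2] simp flip: power_mult)
  have M: "limit_weight * Mconst q a b c z = (Pab * Pac)\<^sup>2 * th\<^sup>2"
    unfolding Pab_def Pac_def th_def by (rule Mconst_limit_weight)
  have f1: "qpochn q (1 / q ^ n) n = s / t * qq"
    using qpochn_reverse[of q "1::real" n] by (simp add: s_def t_def qq_def)
  have f2: "qpoch_inf q (b / (a * q ^ n)) = s * Bn / An / t * qab * Pba"
    using qpoch_inf_reverse[of "b / a" n] a_pos b_pos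
    by (simp add: s_def t_def qab_def Pba_def Bn_def An_def power_divide power_minus[of "b / a"])
  have f3: "qpoch_inf q (c / (a * q ^ n)) = s * Cn / An / t * qac * Pca"
    using qpoch_inf_reverse[of "c / a" n] a_pos c_pos
    by (simp add: s_def t_def qac_def Pca_def Cn_def An_def power_divide power_minus[of "c / a"])
  have f4: "qtheta q (- (a * b * c * z * (a * q ^ n))) = X * th2 / (An * An * Bn * Cn * Zn * t)"
  proof -
    have e1: "qtheta q (- (a\<^sup>2 * b * c * z) * q ^ n) * ((a\<^sup>2 * b * c * z) ^ n * t) = X * th2"
      using qtheta_mult_power[of "- (a\<^sup>2 * b * c * z)" n] a_pos b_pos c_pos z_pos
      by (simp add: t_def X_def th2_def)
    have e2: "(a\<^sup>2 * b * c * z) ^ n = An * An * Bn * Cn * Zn"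
      by (simp add: An_def Bn_def Cn_def Zn_def power_mult_distrib power2_eq_square)
    have e3: "- (a\<^sup>2 * b * c * z) * q ^ n = - (a * b * c * z * (a * q ^ n))"
      by (simp add: power2_eq_square)
    have nz: "An * An * Bn * Cn * Zn * t \<noteq> 0" using nz1 by simp
    show ?thesis using e1 unfolding e2 e3 by (intro eq_divide_imp nz)
  qed
  have f5: "qpoch_inf q (1 / (a * q ^ n)\<^sup>2) = X / (An * An * An * An * (t * t * t * t))
      * (a2 * a2q * (1 - a\<^sup>2 * X\<^sup>2) / (1 - a\<^sup>2)) * Pa2"
  proof -
    have e: "(a * q ^ n)\<^sup>2 = a\<^sup>2 * q ^ (2 * n)"
      by (simp add: power_mult_distrib power_mult[symmetric] mult.commute)
    have t2: "q ^ (\<Sum>{..2 * n}) * X = t * t * t * t"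
    proof -
      have "2 * (\<Sum>{..2 * n}) = 4 * (n * n) + 2 * n" "2 * (\<Sum>{..n}) = n * n + n"
        using sum_atMost_nat[of n] sum_atMost_nat[of "2 * n"] by (simp_all add: algebra_simps)
      hence "(\<Sum>{..2 * n}) + n = (\<Sum>{..n}) + (\<Sum>{..n}) + (\<Sum>{..n}) + (\<Sum>{..n})" by linarith
      hence "q ^ ((\<Sum>{..2 * n}) + n) = q ^ ((\<Sum>{..n}) + (\<Sum>{..n}) + (\<Sum>{..n}) + (\<Sum>{..n}))"
        by (simp only:)
      thus ?thesis unfolding X_def t_def power_add .
    qed
    have pw: "(- (1 / a\<^sup>2)) ^ (2 * n) = 1 / (An * An * An * An)"
    proof -
      have "4 * n = n + n + n + n" by simp
      hence "a ^ (4 * n) = a ^ (n + n + n + n)" by (simp only:)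
      hence "a ^ (4 * n) = An * An * An * An" by (simp only: power_add An_def)
      thus ?thesis by (simp add: power_divide power_mult[symmetric])
    qed
    have "qpochn q (a\<^sup>2) (Suc (2 * n)) = (1 - a\<^sup>2) * qpochn q (a\<^sup>2 * q) (2 * n)"
      by (simp add: qpochn_Suc_left)
    moreover have "qpochn q (a\<^sup>2) (Suc (2 * n)) = a2 * a2q * (1 - a\<^sup>2 * X\<^sup>2)"
      unfolding qpochn_Suc mult_2 qpochn_add a2_def a2q_def X_def
      by (simp add: power_add power2_eq_square)
    ultimately have q2: "qpochn q (q * a\<^sup>2) (2 * n) = a2 * a2q * (1 - a\<^sup>2 * X\<^sup>2) / (1 - a\<^sup>2)"
      using a2X by (simp add: eq_divide_eq mult.commute)
    have "qpoch_inf q (1 / (a * q ^ n)\<^sup>2) = 1 / (An * An * An * An) / q ^ (\<Sum>{..2 * n}) *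
        qpochn q (q * a\<^sup>2) (2 * n) * Pa2"
      using qpoch_inf_reverse[of "1 / a\<^sup>2" "2 * n"] a_pos unfolding pw by (simp add: Pa2_def e)
    also have "1 / (An * An * An * An) / q ^ (\<Sum>{..2 * n}) = X / (An * An * An * An * (t * t * t * t))"
      unfolding t2[symmetric] using nz1 q_pos by simp
    finally show ?thesis unfolding q2 .
  qed
  have D: "Dpos n = a2q * (s / t * qq) / (qq * abn * acn) * (s * (Bn * Cn * Zn))"
    unfolding Dpos_def f1 a2q_def qq_def abn_def acn_def
    by (simp add: s_def Bn_def Cn_def Zn_def power_mult_distrib power_minus[of "b * c * z"])
  have r: "(- (q powr ((real n + 1) / 2)) / (b * c)) ^ n = s * t / (Bn * Cn)"
  proof -
    have "(q powr ((real n + 1) / 2)) ^ n = q powr (real n * ((real n + 1) / 2))"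
      using q_pos by (simp add: powr_power mult.commute)
    also have "real n * ((real n + 1) / 2) = real (\<Sum>{..n})"
    proof -
      have "real (2 * (\<Sum>{..n})) = real (n * (n + 1))" by (simp only: sum_atMost_nat)
      thus ?thesis by (simp add: field_simps)
    qed
    finally have "(q powr ((real n + 1) / 2)) ^ n = t"
      unfolding t_def powr_realpow[OF q_pos] .
    moreover have "- (q powr ((real n + 1) / 2)) / (b * c) = (-1) * (q powr ((real n + 1) / 2) / (b * c))"
      by simp
    ultimately show ?thesis
      by (simp only: power_mult_distrib power_divide s_def Bn_def Cn_def times_divide_eq_right)
  qed
  have nu: "nu_pos q a b c z a b c n = Mconst q a b c z * Pa2 / (Pq * Pab * Pba * Pac * Pca * (th * th2))
      * (a2 * abn * acn / (qq * qab * qac)) * ((1 - a\<^sup>2 * X\<^sup>2) / (1 - a\<^sup>2)) * (s * t / (Bn * Cn))"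
    unfolding nu_pos_def qpochs_inf_def qpochs_def qthetas_def qpoch_of_nat r
    by (simp add: Pq_def Pab_def Pac_def Pba_def Pca_def Pa2_def th_def th2_def a2_def abn_def acn_def
          qq_def qab_def qac_def X_def mult.assoc flip: power_mult) (simp add: mult.commute mult.left_commute)
  have "limit_weight * Dpos n * (s / t * qq * Pq * (s * Bn / An / t * qab * Pba) * (s * Cn / An / t * qac * Pca) *
     (X * th2 / (An * An * Bn * Cn * Zn * t)) / (Pab * Pac * th *
      (X / (An * An * An * An * (t * t * t * t)) * (a2 * a2q * (1 - a\<^sup>2 * X\<^sup>2) / (1 - a\<^sup>2)) * Pa2)))
     * nu_pos q a b c z a b c n = 1"
  proof -
    define d where "d = 1 - a\<^sup>2"
    define d' where "d' = 1 - a\<^sup>2 * X\<^sup>2"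
    have d: "d \<noteq> 0" "d' \<noteq> 0" using a2X by (simp_all add: d_def d'_def)
    define L where "L = limit_weight"
    define M' where "M' = Mconst q a b c z"
    have "L * (a2q * (s / t * qq) / (qq * abn * acn) * (s * (Bn * Cn * Zn))) * (s / t * qq * Pq * (s * Bn / An / t * qab * Pba) * (s * Cn / An / t * qac * Pca) *
     (X * th2 / (An * An * Bn * Cn * Zn * t)) / (Pab * Pac * th *
      (X / (An * An * An * An * (t * t * t * t)) * (a2 * a2q * d' / d) * Pa2)))
     * (M' * Pa2 / (Pq * Pab * Pba * Pac * Pca * (th * th2))
      * (a2 * abn * acn / (qq * qab * qac)) * (d' / d) * (s * t / (Bn * Cn)))
     = L * M' / ((Pab * Pac)\<^sup>2 * th\<^sup>2)"
      using s nz1 nz2 nz3 d by (elim disjE) (simp_all add: field_simps power2_eq_square)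
    also have "\<dots> = 1" unfolding L_def M'_def M using nz3 by simp
    finally show ?thesis unfolding D nu d_def d'_def L_def M'_def .
  qed
  hence "nu_pos q a b c z a b c n * (limit_weight * Dpos n * (s / t * qq * Pq * (s * Bn / An / t * qab * Pba) * (s * Cn / An / t * qac * Pca) *
     (X * th2 / (An * An * Bn * Cn * Zn * t)) / (Pab * Pac * th *
      (X / (An * An * An * An * (t * t * t * t)) * (a2 * a2q * (1 - a\<^sup>2 * X\<^sup>2) / (1 - a\<^sup>2)) * Pa2)))) = 1"
    by (simp only: mult.commute)
  from inverse_unique[OF this] show ?thesis unfolding f1 f2 f3 f4 f5 cfun_denom_def Pq_def[symmetric]
      Pab_def[symmetric] Pac_def[symmetric] th_def[symmetric] by (rule sym)
qed

section \<open>The eigenvalues of the second kind\<close>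

text \<open>Here \<open>(-abc\<gamma>x;q)\<^sub>\<infinity>\<close> vanishes at \<open>x = z q\<^sup>-\<^sup>k\<close>, so that the first \<open>k\<close> terms of the series vanish;
  the remaining terms have a limit that is summed by the q-binomial theorem.\<close>

lemma E_decay:
  assumes b: "b \<le> 1" and \<gamma>: "norm \<gamma> > 1" and eq: "of_real (a * b * c * z) * \<gamma> = - of_real q"
  shows "(\<lambda>k. E \<gamma> (of_real (z / q ^ k)) * (\<gamma> / of_real a) ^ k) \<longlonglongrightarrow>
    qpoch_inf q (of_real a * \<gamma>) * qpoch_inf q (of_real b * \<gamma>) * qpoch_inf q (of_real c * \<gamma>)
      * qpoch_inf q (of_real q / \<gamma>\<^sup>2) / of_real cfun_denom"
proof -
  have \<gamma>nz: "\<gamma> \<noteq> 0" using \<gamma> by auto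
  have bg: "norm (of_real b / \<gamma>) < 1" using b b_pos \<gamma> by (auto simp: norm_divide divide_less_eq)
  define w where "w = of_real b / \<gamma>"
  define Y where "Y = complex_of_real (- (a * c * z))"
  define Y3 where "Y3 = complex_of_real (- (b * c * z))"
  define P3 where "P3 = inverse (qpoch_inf q Y3)"
  define r1 where "r1 = complex_of_real (- (q / (a * c * z)))"
  define r3 where "r3 = complex_of_real (- (q / (b * c * z)))"
  have t: "q / (a * c * z) \<ge> 0" "q / (b * c * z) \<ge> 0" "b * c * z \<ge> 0"
    using a_pos b_pos c_pos z_pos by simp_all
  define u where "u = (\<lambda>m k. gcoeff \<gamma> (k + m) * w ^ m *
    (qpochn q r1 k * qpochn q Y m * qpoch_inf q (of_real q * of_real q ^ m) * inverse (qpochn q r3 k) * P3))"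
  have minus: "- (of_real (a * b * c * z) * \<gamma>) = of_real q" unfolding eq by simp
  have early: "norm_term k \<gamma> n = 0" if "n < k" for k n
  proof -
    have "qpochn q (of_real q / - (of_real (a * b * c * z) * \<gamma>)) (k - n) = 0"
      unfolding minus qpochn_eq_0_iff using that by (intro exI[of _ 0]) auto
    thus ?thesis using norm_term_initial[OF \<gamma>nz, of n k] that by simp
  qed
  have late: "norm_term k \<gamma> (k + m) * (\<gamma>\<^sup>2) ^ k = u m k" for k m
  proof -
    have "inverse (\<gamma>\<^sup>2) ^ k * (\<gamma>\<^sup>2) ^ k = 1" using \<gamma>nz by (simp flip: power_mult_distrib)
    hence "g * (inverse (\<gamma>\<^sup>2) ^ k * v) * p * (\<gamma>\<^sup>2) ^ k = g * v * p" for g v p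
      by (metis (no_types, lifting) mult.assoc mult.commute mult.left_neutral)
    thus ?thesis unfolding norm_term_final[OF \<gamma>nz] minus u_def w_def r1_def r3_def Y_def P3_def Y3_def .
  qed
  have sum_eq: "E \<gamma> (of_real (z / q ^ k)) * (\<gamma> / of_real a) ^ k
      = qpoch_inf q w / of_real (qpoch_inf q (a * b)) * (\<Sum>m. u m k)" for k
  proof -
    note sm = summable_norm_term[OF bg, of k]
    have "(\<Sum>n. norm_term k \<gamma> n) = (\<Sum>m. norm_term k \<gamma> (m + k)) + (\<Sum>n<k. norm_term k \<gamma> n)"
      by (rule suminf_split_initial_segment[OF sm])
    also have "(\<Sum>n<k. norm_term k \<gamma> n) = 0" using early by simp
    finally have "(\<Sum>n. norm_term k \<gamma> n) * (\<gamma>\<^sup>2) ^ k = (\<Sum>m. norm_term k \<gamma> (m + k)) * (\<gamma>\<^sup>2) ^ k" by simp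
    also have "\<dots> = (\<Sum>m. norm_term k \<gamma> (m + k) * (\<gamma>\<^sup>2) ^ k)"
      by (rule suminf_mult2) (use sm in simp)
    also have "\<dots> = (\<Sum>m. u m k)" using late[of k] by (simp add: add.commute)
    finally have S: "(\<Sum>n. norm_term k \<gamma> n) * (\<gamma>\<^sup>2) ^ k = (\<Sum>m. u m k)" .
    have "E \<gamma> (of_real (z / q ^ k)) * (\<gamma> / of_real a) ^ k
        = E \<gamma> (of_real (z / q ^ k)) / (of_real a * \<gamma>) ^ k * (\<gamma>\<^sup>2) ^ k"
      using \<gamma>nz a_pos by (simp add: power_divide power_mult_distrib power2_eq_square)
    thus ?thesis unfolding E_norm_term[OF bg, symmetric] S[symmetric] w_def by (simp only: mult.assoc)
  qed
  have P_nz: "qpochn q r3 k \<noteq> 0" "qpoch_inf q r3 \<noteq> 0" for k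
    using qpochn_neg_ge_1[OF t(2), of k] qpoch_inf_neg_ge_1[OF t(2)]
    unfolding r3_def qpochn_of_real qpoch_inf_of_real by auto
  define G where "G = qpoch_inf q (of_real a * \<gamma>) * qpoch_inf q (of_real c * \<gamma>) /
      (qpoch_inf q (of_real q) * qpoch_inf q (of_real a * of_real c))"
  have Pq: "qpoch_inf q (of_real q :: complex) \<noteq> 0" using q_pos q_less_1 by (intro qpoch_inf_nonzero_small) simp
  have g_lim: "(\<lambda>k. gcoeff \<gamma> (k + m)) \<longlonglongrightarrow> G" for m
    unfolding bigG_coeff_def G_def using Pq C.qpoch_inf_ab_ac_bc_nz(2)
    by (intro tendsto_divide tendsto_mult LIMSEQ_ignore_initial_segment[OF qpochn_LIMSEQ]) auto
  have u_lim: "(\<lambda>k. u m k) \<longlonglongrightarrow> G * w ^ m * (qpoch_inf q r1 * qpochn q Y m *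
      qpoch_inf q (of_real q * of_real q ^ m) * inverse (qpoch_inf q r3) * P3)" for m
    unfolding u_def by (intro tendsto_mult g_lim tendsto_const qpochn_LIMSEQ tendsto_inverse P_nz)
  obtain K0 where K0: "K0 > 0" "\<And>\<gamma>' n. norm \<gamma>' \<le> norm \<gamma> \<Longrightarrow> norm (gcoeff \<gamma>' n) \<le> K0"
    using C.bigG_coeff_bound[of "norm \<gamma>"] by blast
  define K where "K = K0 * (exp (norm r1 / (1 - q)) * exp (norm Y / (1 - q)) * exp (1 / (1 - q)) * 1 * norm P3)"
  have bound: "norm (u m k) \<le> K * norm w ^ m" for m k
  proof -
    have PQ: "norm (qpoch_inf q (of_real q * complex_of_real q ^ m)) \<le> exp (1 / (1 - q))"
    proof (rule order_trans[OF norm_qpoch_inf_le iffD2[OF exp_le_cancel_iff]])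
      have "norm (of_real q * complex_of_real q ^ m) \<le> 1"
        using q_power_le(1)[of "Suc m"] by (simp add: norm_mult)
      thus "norm (of_real q * complex_of_real q ^ m) / (1 - q) \<le> 1 / (1 - q)"
        using q_less_1 by (intro divide_right_mono) simp_all
    qed
    have i3: "norm (inverse (qpochn q r3 k)) \<le> 1"
      unfolding r3_def by (rule norm_inverse_qpochn_neg_le[OF t(2)])
    have "norm (u m k) = norm (gcoeff \<gamma> (k + m)) * (norm (qpochn q r1 k) * norm (qpochn q Y m) *
      norm (qpoch_inf q (of_real q * complex_of_real q ^ m)) * norm (inverse (qpochn q r3 k)) * norm P3) * norm w ^ m"
      unfolding u_def by (simp only: norm_mult norm_power mult_ac)
    also have "\<dots> \<le> K * norm w ^ m"
      unfolding K_def
      by (intro mult_right_mono mult_mono K0(2) order_refl norm_qpochn_le PQ i3 norm_ge_zero zero_le_power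
            mult_nonneg_nonneg exp_ge_zero zero_le_one less_imp_le[OF K0(1)])
    finally show ?thesis .
  qed
  have "(\<lambda>k. \<Sum>m. u m k) \<longlonglongrightarrow> (\<Sum>m. G * w ^ m * (qpoch_inf q r1 * qpochn q Y m *
      qpoch_inf q (of_real q * of_real q ^ m) * inverse (qpoch_inf q r3) * P3))"
  proof -
    have "\<forall>\<^sub>F (m, k) in at_top \<times>\<^sub>F sequentially. norm (u m k) \<le> K * norm w ^ m"
      using bound by (intro always_eventually) auto
    moreover have "summable (\<lambda>m. K * norm w ^ m)"
      using bg by (intro summable_mult summable_geometric) (simp add: w_def)
    ultimately show ?thesis using tannerys_theorem[OF u_lim] by auto
  qed
  moreover have "(\<Sum>m. G * w ^ m * (qpoch_inf q r1 * qpochn q Y m *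
      qpoch_inf q (of_real q * of_real q ^ m) * inverse (qpoch_inf q r3) * P3))
    = G * qpoch_inf q r1 * inverse (qpoch_inf q r3) * P3 * qpoch_inf q (of_real q) * (qpoch_inf q (Y * w) / qpoch_inf q w)"
  proof -
    define R where "R = G * qpoch_inf q r1 * inverse (qpoch_inf q r3) * P3 * qpoch_inf q (of_real q)"
    have "G * w ^ m * (qpoch_inf q r1 * qpochn q Y m * qpoch_inf q (of_real q * of_real q ^ m) * inverse (qpoch_inf q r3) * P3)
        = R * (qpochn q Y m / qpochn q (of_real q) m * w ^ m)" for m
      using qpoch_inf_split[of "complex_of_real q" m] by (simp add: R_def)
    moreover have "(\<lambda>m. R * (qpochn q Y m / qpochn q (of_real q) m * w ^ m)) sums (R * (qpoch_inf q (Y * w) / qpoch_inf q w))"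
      using bg by (intro sums_mult q_binomial) (simp add: w_def)
    ultimately show ?thesis unfolding R_def by (simp add: sums_iff)
  qed
  ultimately have "(\<lambda>k. qpoch_inf q w / of_real (qpoch_inf q (a * b)) * (\<Sum>m. u m k)) \<longlonglongrightarrow>
     qpoch_inf q w / of_real (qpoch_inf q (a * b)) *
      (G * qpoch_inf q r1 * inverse (qpoch_inf q r3) * P3 * qpoch_inf q (of_real q) * (qpoch_inf q (Y * w) / qpoch_inf q w))"
    by (intro tendsto_mult tendsto_const) simp
  also have "qpoch_inf q w / of_real (qpoch_inf q (a * b)) *
      (G * qpoch_inf q r1 * inverse (qpoch_inf q r3) * P3 * qpoch_inf q (of_real q) * (qpoch_inf q (Y * w) / qpoch_inf q w))
    = qpoch_inf q (of_real a * \<gamma>) * qpoch_inf q (of_real b * \<gamma>) * qpoch_inf q (of_real c * \<gamma>)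
      * qpoch_inf q (of_real q / \<gamma>\<^sup>2) / of_real cfun_denom"
  proof -
    have Pw: "qpoch_inf q w \<noteq> 0" unfolding w_def by (rule qpoch_inf_nonzero_small[OF bg])
    have acz: "complex_of_real (a * c * z) \<noteq> 0" using a_pos c_pos z_pos by simp
    have "of_real (a * c * z) * (of_real b * \<gamma>) = - complex_of_real q" using eq by (simp add: mult_ac)
    hence r1: "r1 = of_real b * \<gamma>"
      using acz unfolding r1_def by (simp add: field_simps)
    have Yw: "Y * w = of_real q / \<gamma>\<^sup>2"
    proof -
      have "Y * w * \<gamma>\<^sup>2 = - (of_real (a * b * c * z) * \<gamma>)"
        using \<gamma>nz by (simp add: Y_def w_def power2_eq_square)
      thus ?thesis using \<gamma>nz unfolding minus by (simp add: eq_divide_eq)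
    qed
    have I: "inverse (qpoch_inf q r3) * P3 = inverse (of_real (qtheta q (- (b * c * z))))"
      unfolding P3_def Y3_def r3_def qpoch_inf_of_real qtheta_eq by simp
    have ac: "complex_of_real (qpoch_inf q (a * c)) = qpoch_inf q (of_real a * of_real c)"
      by (simp flip: qpoch_inf_of_real)
    have frac: "W / p * (A * B / (r * s) * R * I * P * r * (Z / W)) = A * R * B * Z * (I * P) / (p * s)"
      if "W \<noteq> 0" "r \<noteq> 0" for W p A B r s R I P Z :: complex
      using that by (simp add: divide_simps)
    show ?thesis
      unfolding G_def frac[OF Pw Pq] unfolding Yw I cfun_denom_def of_real_mult ac
      using r1 by (simp add: divide_inverse mult_ac)
  qed
  finally show ?thesis unfolding sum_eq .
qed

end

lemma tri_int: "2 * (k * (k + 1) div 2) = k * (k + 1)" for k :: int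
proof -
  have "even (k * (k + 1))" by simp
  thus ?thesis by (rule dvd_mult_div_cancel)
qed

text \<open>The cancellation in \<open>norm_eq_nu_neg\<close>, in independent variables.\<close>

lemma norm_terms_cancel:
  fixes A B C Z X S P2 G E R Pq P th y s L M :: real
  assumes "A \<noteq> 0" "B \<noteq> 0" "C \<noteq> 0" "Z \<noteq> 0" "X \<noteq> 0" "S \<noteq> 0" "P2 \<noteq> 0" "G \<noteq> 0" "E \<noteq> 0" "R \<noteq> 0"
    "Pq \<noteq> 0" "P \<noteq> 0" "th \<noteq> 0" "y \<noteq> 0"
  shows "L * (s * (S * S) / (A * A * B * C * Z) * (G * P2 / (P * (B * C * Z / S * th))))
       * (s / S * (Pq * Pq) * E / (P * th * (y * P2)))
       * (M / (Pq * Pq * R) / (E * (S * X / (A * A * B * C * Z)) * (S * X / (A * B * B * C * Z)) * (S * X / (A * B * C * C * Z)))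
        * (R / G) * (X * X * y) * (S * X / (A * A * B * B * C * C * Z)))
      = s * s * L * M / (P\<^sup>2 * th\<^sup>2)"
  using assms by (simp add: field_simps power2_eq_square)

context bigq
begin

text \<open>The decay coefficient at \<open>g = -q\<^sup>k\<^sup>+\<^sup>1/(abcz)\<close>. It is obtained from \<open>E_decay\<close> with \<open>z q\<^sup>-\<^sup>k\<close> in place
  of \<open>z\<close>, which leaves the positive part of the grid unchanged; the power of \<open>g/a\<close> results from
  renumbering that part.\<close>

definition Dneg :: "int \<Rightarrow> real \<Rightarrow> real" where
  "Dneg k g = (g / a) powi k * (qpoch_inf q (a * g) * qpoch_inf q (b * g) * qpoch_inf q (c * g) *
     qpoch_inf q (q / g\<^sup>2) / (qpoch_inf q (a * b) * qpoch_inf q (a * c) * qtheta q (- (b * c * (z / q powi k)))))"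

lemma asymp_second:
  assumes b: "b \<le> 1" and g: "\<bar>g\<bar> > 1" and eq: "g = - (q powi (k + 1)) / (a * b * c * z)"
  shows "asymp (Egrid (of_real g)) (of_real g) (of_real (Dneg k g))"
proof -
  define \<zeta> where "\<zeta> = z / q powi k"
  interpret Z: bigq q a b c \<zeta>
    using a_pos b_pos c_pos z_pos ab_less ac_less bc_less q_pos by unfold_locales (simp_all add: \<zeta>_def)
  define \<gamma> where "\<gamma> = complex_of_real g"
  have \<gamma>: "norm \<gamma> > 1" using g by (simp add: \<gamma>_def)
  have gnz: "g \<noteq> 0" using g by auto
  have "a * b * c * \<zeta> * g = - q"
    using a_pos b_pos c_pos z_pos by (simp add: \<zeta>_def eq power_int_add)
  hence "complex_of_real (a * b * c * \<zeta>) * \<gamma> = - of_real q"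
    unfolding \<gamma>_def of_real_mult[symmetric] of_real_minus[symmetric] by (simp only:)
  note lim = Z.E_decay[OF b \<gamma> this]
  define L where "L = qpoch_inf q (a * g) * qpoch_inf q (b * g) * qpoch_inf q (c * g) *
     qpoch_inf q (q / g\<^sup>2) / (qpoch_inf q (a * b) * qpoch_inf q (a * c) * qtheta q (- (b * c * \<zeta>)))"
  have "qpoch_inf q (of_real a * \<gamma>) * qpoch_inf q (of_real b * \<gamma>) * qpoch_inf q (of_real c * \<gamma>)
      * qpoch_inf q (of_real q / \<gamma>\<^sup>2) / of_real Z.cfun_denom = of_real L"
    unfolding L_def Z.cfun_denom_def \<gamma>_def of_real_mult of_real_divide qpoch_inf_of_real[symmetric, where 'a=complex]
    by simp
  note lim = lim[unfolded this]
  define v where "v = (\<lambda>J. E \<gamma> (of_real (\<zeta> / q ^ J)) * (\<gamma> / of_real a) ^ J)"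
  define u where "u = (\<lambda>j. Egrid \<gamma> (z / q ^ j) * (\<gamma> / of_real a) ^ j)"
  have u: "u j = E \<gamma> (of_real (z / q ^ j)) * (\<gamma> / of_real a) ^ j" for j
    unfolding u_def Egrid_eq[OF far_grid] ..
  have v: "v \<longlonglongrightarrow> of_real L" using lim by (simp add: v_def)
  define \<beta> where "\<beta> = \<gamma> / of_real a"
  have \<beta>: "\<beta> \<noteq> 0" using gnz a_pos by (simp add: \<beta>_def \<gamma>_def)
  have "u \<longlonglongrightarrow> of_real L * \<beta> powi k"
  proof (cases "k \<ge> 0")
    case True
    then obtain p where p: "k = int p" using nonneg_int_cases by blast
    have "\<zeta> / q ^ J = z / q ^ (J + p)" for J by (simp add: \<zeta>_def p power_add)
    hence "u (J + p) = v J * \<beta> powi k" for J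
      by (simp add: u v_def p power_add \<beta>_def)
    hence "(\<lambda>J. u (J + p)) \<longlonglongrightarrow> of_real L * \<beta> powi k"
      using tendsto_mult[OF v tendsto_const] by simp
    thus ?thesis by (rule LIMSEQ_offset)
  next
    case False
    define p where "p = nat (- k)"
    have p: "k = - int p" using False by (simp add: p_def)
    have e: "\<zeta> / q ^ (J + p) = z / q ^ J" for J by (simp add: \<zeta>_def p power_add power_int_minus)
    have "v (J + p) * \<beta> powi k = u J" for J
      unfolding u v_def e unfolding \<beta>_def[symmetric] p power_int_minus power_add using \<beta> by simp
    moreover have "(\<lambda>J. v (J + p) * \<beta> powi k) \<longlonglongrightarrow> of_real L * \<beta> powi k"
      by (rule tendsto_mult[OF LIMSEQ_ignore_initial_segment[OF v] tendsto_const])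
    ultimately show ?thesis by simp
  qed
  moreover have "of_real L * \<beta> powi k = of_real (Dneg k g)"
    by (simp add: Dneg_def L_def \<beta>_def \<gamma>_def \<zeta>_def of_real_power_int)
  ultimately show ?thesis by (simp add: asymp_def u_def \<gamma>_def)
qed

text \<open>The value at \<open>g = -q\<^sup>k\<^sup>+\<^sup>1/(abcz)\<close> of \<open>\<gamma>\<close> times the derivative of \<open>cfun\<close>; the vanishing factor of
  \<open>cfun\<close> is the theta function, brought to the argument \<open>\<gamma>/g\<close> by quasi-periodicity.\<close>

definition Hneg :: "int \<Rightarrow> real \<Rightarrow> real" where
  "Hneg k g = (-1) powi k * q powi (- (k * (k + 1) div 2)) * (qpoch_inf q q)\<^sup>2 *
     (qpoch_inf q (a / g) * qpoch_inf q (b / g) * qpoch_inf q (c / g)) /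
     (cfun_denom * qpoch_inf q (1 / g\<^sup>2))"

lemma norm_second:
  assumes b: "b \<le> 1" and g: "\<bar>g\<bar> > 1" and eq: "g = - (q powi (k + 1)) / (a * b * c * z)"
  defines "f \<equiv> Egrid (of_real g)"
  shows "ip q a b c z f f = of_real (limit_weight * Dneg k g * Hneg k g)"
proof -
  define \<gamma>0 where "\<gamma>0 = complex_of_real g"
  have \<gamma>0: "norm \<gamma>0 > 1" using g by (simp add: \<gamma>0_def)
  have \<gamma>0nz: "\<gamma>0 \<noteq> 0" using \<gamma>0 by auto
  have f: "is_phi q a b c z \<gamma>0 f" "asymp f \<gamma>0 (of_real (Dneg k g))"
    unfolding f_def \<gamma>0_def by (rule is_phi_Egrid[OF b \<gamma>0[unfolded \<gamma>0_def]], rule asymp_second[OF b g eq])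
  define Q where "Q = complex_of_real q"
  define j where "j = - (k + 1)"
  define tr where "tr = j * (j + 1) div 2"
  have tr: "tr = k * (k + 1) div 2" by (simp add: tr_def j_def algebra_simps)
  define C where "C = complex_of_real cfun_denom"
  have C: "C \<noteq> 0" using cfun_denom_nz by (simp add: C_def)
  define h where "h = (\<lambda>\<gamma>. - inverse \<gamma>0 * ((qpoch_inf q (of_real a / \<gamma>) * qpoch_inf q (of_real b / \<gamma>) * qpoch_inf q (of_real c / \<gamma>))
     * ((- (\<gamma> / \<gamma>0)) powi j * Q powi (- tr) * (qpoch_inf q (\<gamma> / \<gamma>0 * Q) * qpoch_inf q (Q / (\<gamma> / \<gamma>0))))
     / (C * qpoch_inf q (inverse (\<gamma>\<^sup>2)))))"
  define r where "r = \<bar>g\<bar> - 1"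
  have ball: "ball \<gamma>0 r \<subseteq> {\<gamma>. norm \<gamma> > 1}"
  proof
    fix \<gamma> assume "\<gamma> \<in> ball \<gamma>0 r"
    hence "norm (\<gamma>0 - \<gamma>) < \<bar>g\<bar> - 1" by (simp add: dist_norm r_def)
    moreover have "norm \<gamma>0 = \<bar>g\<bar>" by (simp add: \<gamma>0_def)
    ultimately show "\<gamma> \<in> {\<gamma>. norm \<gamma> > 1}" using norm_triangle_sub[of \<gamma>0 \<gamma>] by simp
  qed
  have nz: "\<gamma> \<noteq> 0" if "\<gamma> \<in> ball \<gamma>0 r" for \<gamma> using subsetD[OF ball that] by auto
  have "ip q a b c z f (\<lambda>x. cnj (f x)) = of_real limit_weight * of_real (Dneg k g) * (\<gamma>0 * h \<gamma>0)"
  proof (rule norm_eigenfunction[OF b \<gamma>0 f _ ball])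
    show "r > 0" using g by (simp add: r_def)
    show "h holomorphic_on ball \<gamma>0 r"
      unfolding h_def using nz C \<gamma>0nz qpoch_inf_inverse_square_nz subsetD[OF ball]
      by (intro holomorphic_intros holomorphic_on_power_int) auto
    fix \<gamma> assume "\<gamma> \<in> ball \<gamma>0 r"
    hence \<gamma>nz: "\<gamma> \<noteq> 0" by (rule nz)
    define t where "t = \<gamma> / \<gamma>0"
    have t: "t \<noteq> 0" using \<gamma>nz \<gamma>0nz by (simp add: t_def)
    have "a * b * c * z * g = - (q powi (k + 1))"
      using a_pos b_pos c_pos z_pos by (simp add: eq)
    hence "complex_of_real (a * b * c * z) * \<gamma>0 = - (Q powi (k + 1))"
      unfolding \<gamma>0_def Q_def of_real_power_int[symmetric] of_real_mult[symmetric] of_real_minus[symmetric] by (simp only:)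
    moreover have "\<gamma> = \<gamma>0 * t" using \<gamma>0nz by (simp add: t_def)
    ultimately have "- (of_real (a * b * c * z) * \<gamma>) = Q powi (k + 1) * t" by (simp add: mult.assoc[symmetric])
    also have "\<dots> = t / Q powi j" unfolding j_def power_int_minus by (simp add: divide_inverse)
    finally have arg: "- (of_real (a * b * c * z) * \<gamma>) = t / Q powi j" .
    have "ctheta (t / Q powi j) = (- t) powi j * Q powi (- tr) * (qpoch_inf q t * qpoch_inf q (Q / t))"
      unfolding ctheta_def Q_def tr_def using theta_shift[OF t, of j] .
    also have "qpoch_inf q t = (\<gamma> - \<gamma>0) * (- inverse \<gamma>0) * qpoch_inf q (t * Q)"
      using qpoch_inf_step[of t] \<gamma>0nz by (simp add: t_def Q_def divide_inverse algebra_simps)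
    finally have th: "ctheta (- (of_real (a * b * c * z) * \<gamma>)) = (- t) powi j * Q powi (- tr) *
        ((\<gamma> - \<gamma>0) * (- inverse \<gamma>0) * qpoch_inf q (t * Q) * qpoch_inf q (Q / t))" unfolding arg .
    show "cfun \<gamma> = (\<gamma> - \<gamma>0) * h \<gamma>"
      unfolding cfun_def th h_def C_def cfun_denom_def t_def[symmetric]
      by (simp only: times_divide_eq_right mult_ac)
  qed
  also have "\<gamma>0 * h \<gamma>0 = of_real (Hneg k g)"
  proof -
    have s: "- ((- 1) powi j) = ((- 1) powi k :: complex)"
      unfolding j_def by (cases "even k") simp_all
    have k: "\<gamma>0 * (- inverse \<gamma>0 * Y) = - Y" for Y using \<gamma>0nz by simp
    have one: "\<gamma>0 / \<gamma>0 = 1" using \<gamma>0nz by simp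
    have es: "complex_of_real a / \<gamma>0 = of_real (a / g)" "complex_of_real b / \<gamma>0 = of_real (b / g)"
      "complex_of_real c / \<gamma>0 = of_real (c / g)" "inverse (\<gamma>0\<^sup>2) = of_real (1 / g\<^sup>2)"
      by (simp_all add: \<gamma>0_def divide_inverse)
    have "\<gamma>0 * h \<gamma>0 = (- ((- 1) powi j)) * (of_real (qpoch_inf q (a / g) * qpoch_inf q (b / g) * qpoch_inf q (c / g)) *
       (Q powi (- tr) * of_real ((qpoch_inf q q)\<^sup>2)) / (C * of_real (qpoch_inf q (1 / g\<^sup>2))))"
      unfolding h_def k one es qpoch_inf_of_real mult_1 div_by_1 unfolding Q_def qpoch_inf_of_real
      by (simp add: power2_eq_square)
    thus ?thesis unfolding s unfolding Hneg_def tr C_def Q_def by (simp add: of_real_power_int mult_ac)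
  qed
  also have "ip q a b c z f (\<lambda>x. cnj (f x)) = ip q a b c z f f"
    using is_phi_cnj[OF f(1)[unfolded \<gamma>0_def]] g by (intro ip_cong_grid) auto
  finally show ?thesis by simp
qed

lemma qpoch_neg_ratio:
  assumes "v < 0"
  shows "qpoch q v k = qpoch_inf q v / qpoch_inf q (v * q powi k)"
proof -
  have "v * q powi k < 0" using assms q_pos by (simp add: mult_less_0_iff)
  hence "qpoch_inf q (v * q powi k) > 0" by (intro qpoch_inf_pos) simp
  thus ?thesis using qpoch_eq_ratio[OF q_pos q_less_1, of v k] by simp
qed

text \<open>The product of the two symbols in \<open>nu_neg\<close> that belong to the same parameter, by
  quasi-periodicity of \<open>\<theta>\<close>.\<close>

lemma qpoch_theta:
  assumes v: "v < 0"
  shows "qpoch_inf q v * qpoch q (q / v) k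
    = qpoch_inf q (v / q powi k) * q powi (k * (k + 1) div 2) / (- v) powi k"
proof -
  define X where "X = q powi k"
  have X: "X > 0" using q_pos by (simp add: X_def)
  have neg: "q / v < 0" "q / v * X < 0"
    using v q_pos X by (simp_all add: divide_pos_neg mult_neg_pos)
  have P: "qpoch_inf q (q / v * X) > 0" using neg(2) by (intro qpoch_inf_pos) simp
  have arg: "q / (v / X) = q / v * X" by simp
  have vk: "(- v) powi k \<noteq> 0" using v by simp
  have "qpoch_inf q (v / X) * qpoch_inf q (q / v * X)
      = (- v) powi k * inverse (q powi (k * (k + 1) div 2)) * (qpoch_inf q v * qpoch_inf q (q / v))"
    using theta_shift[of v k] v arg by (simp add: X_def power_int_minus)
  hence "qpoch_inf q v * qpoch_inf q (q / v)
      = qpoch_inf q (v / X) * qpoch_inf q (q / v * X) * q powi (k * (k + 1) div 2) / (- v) powi k"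
    using vk q_pos by (simp add: field_simps)
  thus ?thesis unfolding qpoch_neg_ratio[OF neg(1)] X_def[symmetric] using P by (simp add: field_simps)
qed

lemma norm_eq_nu_neg:
  assumes g: "\<bar>g\<bar> > 1" and eq: "g = - (q powi (k + 1)) / (a * b * c * z)"
  shows "limit_weight * Dneg k g * Hneg k g = inverse (nu_neg q a b c z k)"
proof -
  define X where "X = q powi k"
  define S where "S = q powi (k * (k + 1) div 2)"
  define A B C Z where "A = a powi k" and "B = b powi k" and "C = c powi k" and "Z = z powi k"
  have pos: "X > 0" "S > 0" "A > 0" "B > 0" "C > 0" "Z > 0"
    using q_pos a_pos b_pos c_pos z_pos by (simp_all add: X_def S_def A_def B_def C_def Z_def)
  have XX: "X powi k = S * S / X"
  proof -
    define T where "T = k * (k + 1) div 2"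
    have "X powi k = q powi (k * k)" by (simp add: X_def power_int_mult)
    also have "k * k = T + T - k" using tri_int[of k] by (simp add: T_def algebra_simps)
    also have "q powi (T + T - k) = q powi (T + T) / q powi k"
      by (rule power_int_diff) simp
    also have "q powi (T + T) = q powi T * q powi T"
      by (rule power_int_add) simp
    finally show ?thesis by (simp add: S_def X_def T_def)
  qed
  have gX: "g = - (q * X / (a * b * c * z))"
    by (simp add: eq X_def power_int_add mult.commute)
  define s :: real where "s = (-1) powi k"
  have s: "s = 1 \<or> s = -1" by (cases "even k") (simp_all add: s_def)
  define y where "y = 1 - 1 / g\<^sup>2"
  have "1 * 1 < \<bar>g\<bar> * \<bar>g\<bar>" using g by (intro mult_strict_mono) auto
  hence g2: "g\<^sup>2 > 1" by (simp add: power2_eq_square)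
  have "1 / g\<^sup>2 < 1" by (subst divide_less_eq_1_pos) (use g2 in linarith)+
  hence y: "y > 0" by (simp add: y_def)
  define Ra Rb Rc where "Ra = qpoch_inf q (- (q / (b * c * z)))" and "Rb = qpoch_inf q (- (q / (a * c * z)))"
    and "Rc = qpoch_inf q (- (q / (a * b * z)))"
  define Ga Gb Gc where "Ga = qpoch_inf q (a * g)" and "Gb = qpoch_inf q (b * g)" and "Gc = qpoch_inf q (c * g)"
  define Ea Eb Ec where "Ea = qpoch_inf q (a / g)" and "Eb = qpoch_inf q (b / g)" and "Ec = qpoch_inf q (c / g)"
  define Pq Pab Pac th P2 where "Pq = qpoch_inf q q" and "Pab = qpoch_inf q (a * b)"
    and "Pac = qpoch_inf q (a * c)" and "th = qtheta q (- (b * c * z))" and "P2 = qpoch_inf q (q / g\<^sup>2)"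
  have g_neg: "g < 0" using gX q_pos pos a_pos b_pos c_pos z_pos by simp
  have "q / g\<^sup>2 < 1"
  proof -
    have "q < g\<^sup>2" using q_less_1 g2 by linarith
    thus ?thesis by (subst divide_less_eq_1_pos) (use g2 in linarith)+
  qed
  hence P2: "P2 > 0" unfolding P2_def by (rule qpoch_inf_pos)
  have negP: "qpoch_inf q x > 0" if "x < 0" for x :: real using that by (intro qpoch_inf_pos) simp
  have args: "- (q / (b * c * z)) < 0" "- (q / (a * c * z)) < 0" "- (q / (a * b * z)) < 0"
    "a * g < 0" "b * g < 0" "c * g < 0" "a / g < 0" "b / g < 0" "c / g < 0"
    using g_neg q_pos a_pos b_pos c_pos z_pos by (simp_all add: mult_pos_neg divide_pos_neg)
  have posP: "Ra > 0" "Rb > 0" "Rc > 0" "Ga > 0" "Gb > 0" "Gc > 0" "Ea > 0" "Eb > 0" "Ec > 0" "Pq > 0" "Pab > 0" "Pac > 0" "th > 0"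
    unfolding Ra_def Rb_def Rc_def Ga_def Gb_def Gc_def Ea_def Eb_def Ec_def Pq_def Pab_def Pac_def th_def
    using args[THEN negP] qpoch_inf_pos[OF q_less_1] qpoch_inf_pos[OF ab_less] qpoch_inf_pos[OF ac_less]
      qtheta_neg_pos[of "b * c * z"] b_pos c_pos z_pos
    by (simp_all only: mult_pos_pos simp_thms)
  have M: "limit_weight * Mconst q a b c z = (Pab * Pac)\<^sup>2 * th\<^sup>2"
    unfolding Pab_def Pac_def th_def by (rule Mconst_limit_weight)
  define va vb vc where "va = - (a\<^sup>2 * b * c * z / q)" and "vb = - (a * b\<^sup>2 * c * z / q)" and "vc = - (a * b * c\<^sup>2 * z / q)"
  have v_neg: "va < 0" "vb < 0" "vc < 0"
    using q_pos a_pos b_pos c_pos z_pos by (simp_all add: va_def vb_def vc_def)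
  have vX: "va / X = a / g" "vb / X = b / g" "vc / X = c / g"
    using pos q_pos a_pos b_pos c_pos z_pos by (simp_all add: va_def vb_def vc_def gX power2_eq_square field_simps)
  have qv: "- (q\<^sup>2 / (a\<^sup>2 * b * c * z)) = q / va" "- (q\<^sup>2 / (a * b\<^sup>2 * c * z)) = q / vb"
    "- (q\<^sup>2 / (a * b * c\<^sup>2 * z)) = q / vc"
    by (simp_all add: va_def vb_def vc_def power2_eq_square)
  have vk: "(- va) powi k = A * A * B * C * Z / X" "(- vb) powi k = A * B * B * C * Z / X"
    "(- vc) powi k = A * B * C * C * Z / X"
    unfolding va_def vb_def vc_def minus_minus power2_eq_square power_int_mult_distrib power_int_divide_distrib
      A_def B_def C_def Z_def X_def by (simp_all only: mult_ac)
  define Wa Wb Wc where "Wa = qpoch q (q / va) k" and "Wb = qpoch q (q / vb) k" and "Wc = qpoch q (q / vc) k"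
  have W: "qpoch_inf q va * Wa = Ea * S * X / (A * A * B * C * Z)"
    "qpoch_inf q vb * Wb = Eb * S * X / (A * B * B * C * Z)"
    "qpoch_inf q vc * Wc = Ec * S * X / (A * B * C * C * Z)"
    unfolding Wa_def Wb_def Wc_def using qpoch_theta[OF v_neg(1), of k] qpoch_theta[OF v_neg(2), of k]
      qpoch_theta[OF v_neg(3), of k]
    by (simp_all add: vk vX[unfolded X_def] Ea_def Eb_def Ec_def S_def X_def)
  have R: "qpoch q (- (q / (a * b * z))) k = Rc / Gc" "qpoch q (- (q / (a * c * z))) k = Rb / Gb"
    "qpoch q (- (q / (b * c * z))) k = Ra / Ga"
  proof -
    have e: "- (q / (a * b * z)) * q powi k = c * g" "- (q / (a * c * z)) * q powi k = b * g"
      "- (q / (b * c * z)) * q powi k = a * g"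
      using a_pos b_pos c_pos z_pos by (simp_all add: gX X_def)
    have n: "- (q / (a * b * z)) < 0" "- (q / (a * c * z)) < 0" "- (q / (b * c * z)) < 0"
      using q_pos a_pos b_pos c_pos z_pos by simp_all
    show "qpoch q (- (q / (a * b * z))) k = Rc / Gc" "qpoch q (- (q / (a * c * z))) k = Rb / Gb"
      "qpoch q (- (q / (b * c * z))) k = Ra / Ga"
      unfolding qpoch_neg_ratio[OF n(1)] qpoch_neg_ratio[OF n(2)] qpoch_neg_ratio[OF n(3)] e
        Ra_def Rb_def Rc_def Ga_def Gb_def Gc_def by (rule refl)+
  qed
  have Y: "q powi (2 * k) - a\<^sup>2 * b\<^sup>2 * c\<^sup>2 * z\<^sup>2 / q\<^sup>2 = X * X * y"
  proof -
    have "q powi (2 * k) = X * X" unfolding X_def mult_2 by (rule power_int_add) simp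
    moreover have "X * X * (1 / g\<^sup>2) = a\<^sup>2 * b\<^sup>2 * c\<^sup>2 * z\<^sup>2 / q\<^sup>2"
      using pos by (simp add: gX power2_eq_square)
    ultimately show ?thesis by (simp add: y_def right_diff_distrib)
  qed
  have qp: "(q powr ((real_of_int k + 3) / 2) / (a\<^sup>2 * b\<^sup>2 * c\<^sup>2 * z)) powi k = S * X / (A * A * B * B * C * C * Z)"
  proof -
    have "(q powr ((real_of_int k + 3) / 2)) powi k = (q powr ((real_of_int k + 3) / 2)) powr real_of_int k"
      using q_pos by (intro powr_real_of_int'[symmetric]) auto
    also have "\<dots> = q powr ((real_of_int k + 3) / 2 * real_of_int k)" by (rule powr_powr)
    also have "(real_of_int k + 3) / 2 * real_of_int k = real_of_int (k * (k + 1) div 2 + k)"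
    proof -
      define t where "t = k * (k + 1) div 2"
      have "2 * t = k * (k + 1)" unfolding t_def by (rule tri_int)
      hence "real_of_int (2 * t) = real_of_int (k * (k + 1))" by (simp only:)
      hence "2 * real_of_int t = real_of_int k * (real_of_int k + 1)"
        by (simp only: of_int_mult of_int_add of_int_numeral of_int_1)
      hence "(real_of_int k + 3) / 2 * real_of_int k = real_of_int (t + k)" by (simp add: field_simps)
      thus ?thesis by (simp only: t_def)
    qed
    also have "q powr real_of_int (k * (k + 1) div 2 + k) = q powi (k * (k + 1) div 2 + k)"
      using q_pos by (intro powr_real_of_int') auto
    also have "\<dots> = S * X" unfolding S_def X_def by (rule power_int_add) simp
    finally have "(q powr ((real_of_int k + 3) / 2)) powi k = S * X" .
    thus ?thesis unfolding power_int_divide_distrib power_int_mult_distrib power2_eq_square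
        A_def B_def C_def Z_def by (simp add: mult_ac)
  qed
  have nu: "nu_neg q a b c z k = Mconst q a b c z / (Pq * Pq * Rc * Rb * Ra) / (qpoch_inf q va * Wa * (qpoch_inf q vb * Wb) * (qpoch_inf q vc * Wc))
      * (Rc / Gc * (Rb / Gb * (Ra / Ga))) * (X * X * y) * (S * X / (A * A * B * B * C * C * Z))"
    unfolding nu_neg_def qpochs_inf_def qpochs_def list.map prod_list.Cons prod_list.Nil R qv Y qp
      va_def[symmetric] vb_def[symmetric] vc_def[symmetric] Wa_def[symmetric] Wb_def[symmetric] Wc_def[symmetric]
      Ra_def[symmetric] Rb_def[symmetric] Rc_def[symmetric] Pq_def[symmetric]
    by (simp add: divide_inverse mult_ac)
  have D: "Dneg k g = s * (S * S) / (A * A * B * C * Z) * (Ga * Gb * Gc * P2 / (Pab * Pac * (B * C * Z / S * th)))"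
  proof -
    have "(g / a) powi k = ((-1) * (q * X / (a * a * b * c * z))) powi k"
      by (simp add: gX mult_ac)
    also have "\<dots> = s * (X * (S * S / X)) / (A * A * B * C * Z)"
      unfolding power_int_mult_distrib power_int_divide_distrib XX s_def A_def B_def C_def Z_def X_def[symmetric]
      by (simp add: mult_ac)
    finally have ga: "(g / a) powi k = s * (S * S) / (A * A * B * C * Z)" using pos by simp
    have "qtheta q (- (b * c * (z / q powi k))) = (b * c * z) powi k * q powi (- (k * (k + 1) div 2)) * th"
      using qtheta_shift[of "- (b * c * z)" k] b_pos c_pos z_pos by (simp add: th_def)
    also have "\<dots> = B * C * Z / S * th"
      by (simp add: B_def C_def Z_def S_def power_int_mult_distrib power_int_minus divide_inverse)
    finally have tt: "qtheta q (- (b * c * (z / q powi k))) = B * C * Z / S * th" .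
    show ?thesis unfolding Dneg_def ga tt Ga_def Gb_def Gc_def P2_def Pab_def Pac_def ..
  qed
  have H: "Hneg k g = s / S * (Pq * Pq) * (Ea * Eb * Ec) / (Pab * Pac * th * (y * P2))"
  proof -
    have "qpoch_inf q (1 / g\<^sup>2) = y * P2"
      using qpoch_inf_step[of "1 / g\<^sup>2"] by (simp add: y_def P2_def)
    thus ?thesis
      by (simp add: Hneg_def cfun_denom_def s_def S_def Pq_def Ea_def Eb_def Ec_def Pab_def Pac_def th_def
            power_int_minus power2_eq_square divide_inverse mult_ac)
  qed
  have "limit_weight * Dneg k g * Hneg k g * nu_neg q a b c z k = 1"
  proof -
    define L where "L = limit_weight"
    define M' where "M' = Mconst q a b c z"
    have e: "Pq * Pq * Rc * Rb * Ra = Pq * Pq * (Ra * Rb * Rc)" "Rc / Gc * (Rb / Gb * (Ra / Ga)) = (Ra * Rb * Rc) / (Ga * Gb * Gc)"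
      "Ea * S * X / (A * A * B * C * Z) * (Eb * S * X / (A * B * B * C * Z)) * (Ec * S * X / (A * B * C * C * Z))
        = Ea * Eb * Ec * (S * X / (A * A * B * C * Z)) * (S * X / (A * B * B * C * Z)) * (S * X / (A * B * C * C * Z))"
      by (simp_all only: times_divide_times_eq times_divide_eq_left times_divide_eq_right mult_ac divide_divide_eq_left)
    have "s * s = 1" using s by auto
    hence "L * (s * (S * S) / (A * A * B * C * Z) * (Ga * Gb * Gc * P2 / (Pab * Pac * (B * C * Z / S * th))))
       * (s / S * (Pq * Pq) * (Ea * Eb * Ec) / (Pab * Pac * th * (y * P2)))
       * (M' / (Pq * Pq * Rc * Rb * Ra) / (Ea * S * X / (A * A * B * C * Z) * (Eb * S * X / (A * B * B * C * Z)) * (Ec * S * X / (A * B * C * C * Z)))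
        * (Rc / Gc * (Rb / Gb * (Ra / Ga))) * (X * X * y) * (S * X / (A * A * B * B * C * C * Z)))
      = L * M' / ((Pab * Pac)\<^sup>2 * th\<^sup>2)"
      unfolding e using pos posP P2 y by (subst norm_terms_cancel) simp_all
    also have "\<dots> = 1" unfolding L_def M'_def M using posP by simp
    finally show ?thesis unfolding D H nu W L_def M'_def .
  qed
  hence "nu_neg q a b c z k * (limit_weight * Dneg k g * Hneg k g) = 1" by (simp only: mult.commute)
  from inverse_unique[OF this] show ?thesis by (rule sym)
qed

end

section \<open>Symmetries in the parameters\<close>

text \<open>The assertions on a family of functions \<open>\<phi> \<gamma>\<close> indexed by the spectral points: each satisfies the
  conditions that characterise \<open>\<phi>\<^sub>\<gamma>\<close>, they are square summable and orthogonal, and their norms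
  are given by the point masses.\<close>

definition spectral ::
  "real \<Rightarrow> real \<Rightarrow> real \<Rightarrow> real \<Rightarrow> real \<Rightarrow> (real \<Rightarrow> real \<Rightarrow> complex) \<Rightarrow> bool" where
  "spectral q a b c z \<phi> \<longleftrightarrow>
     (\<forall>\<gamma>\<in>Sset q a b c z. is_phi q a b c z (of_real \<gamma>) (\<phi> \<gamma>) \<and> \<phi> \<gamma> \<in> Hsp q a b c z)
     \<and> (\<forall>\<gamma>\<in>Sset q a b c z. \<forall>\<gamma>'\<in>Sset q a b c z. \<gamma> \<noteq> \<gamma>' \<longrightarrow> ip q a b c z (\<phi> \<gamma>) (\<phi> \<gamma>') = 0)
     \<and> (\<forall>e f g k. {#e, f, g#} = {#a, b, c#} \<and> 1 / (q ^ k * e) < 1 \<longrightarrow>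
          ip q a b c z (\<phi> (1 / (q ^ k * e))) (\<phi> (1 / (q ^ k * e)))
            = of_real (inverse (nu_pos q a b c z e f g k)))
     \<and> (\<forall>k. a * b * c * z / q powi (k + 1) < 1 \<longrightarrow>
          ip q a b c z (\<phi> (- (a * b * c * z / q powi (k + 1)))) (\<phi> (- (a * b * c * z / q powi (k + 1))))
            = of_real (inverse (nu_neg q a b c z k)))"

lemma spectral_swap_bc: "spectral q a c b z = spectral q a b c z"
proof -
  have F: "bigF q a' c' b' = bigF q a' b' c'" for a' b' c'
    by (intro ext) (simp add: bigF_def bigF_term_def mult_ac)
  have D: "grid_qdiff q a c b = grid_qdiff q a b c"
    by (intro ext) (simp add: grid_qdiff_def mult_ac)
  have phi: "is_phi q a c b = is_phi q a b c"
    by (intro ext) (simp add: is_phi_def D F[of "of_real a"])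
  have p: "pfun q a c b = pfun q a b c"
    by (intro ext) (simp add: pfun_def qpochs_inf_def mult_ac)
  have H: "Hsp q a c b = Hsp q a b c"
    by (intro ext) (simp add: Hsp_def wt_neg_def wt_pos_def p)
  have I: "ip q a c b = ip q a b c"
    by (intro ext) (simp add: ip_def wt_neg_def wt_pos_def p)
  have acb: "a * c * b * z = a * b * c * z" by (simp add: mult_ac)
  have S: "Sset q a c b z = Sset q a b c z"
    unfolding Sset_def acb by (simp add: insert_commute)
  have M: "Mconst q a c b z = Mconst q a b c z"
    by (simp add: Mconst_def qpochs_inf_def qthetas_def mult_ac)
  have np: "nu_pos q a c b z = nu_pos q a b c z"
    by (intro ext) (simp add: nu_pos_def M)
  have nn: "nu_neg q a c b z = nu_neg q a b c z"
    by (intro ext) (simp add: nu_neg_def M qpochs_inf_def qpochs_def mult_ac)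
  have ms: "{#a, c, b#} = {#a, b, c#}" by simp
  show ?thesis by (intro ext) (simp only: spectral_def phi H I S np nn acb ms)
qed

context bigq
begin

text \<open>The limit at \<open>x = 0\<close> of the factor that interchanges \<open>a\<close> and \<open>b\<close>; its square relates the two norms.\<close>

definition swap_const :: real where
  "swap_const = qpoch_inf q (b * c) / qpoch_inf q (a * c)"

lemma swap_const_nz: "swap_const \<noteq> 0"
  using qpoch_inf_pos[of "b * c"] qpoch_inf_pos[of "a * c"] ac_less bc_less by (simp add: swap_const_def)

text \<open>The factor that interchanges \<open>a\<close> and \<open>b\<close>, applied to a function on the grid.\<close>

definition gauged :: "(real \<Rightarrow> complex) \<Rightarrow> real \<Rightarrow> complex" where
  "gauged f = (\<lambda>x\<in>grid q z. C.gauge (of_real x) * f x)"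

lemma gauged_eq: "x \<in> grid q z \<Longrightarrow> gauged f x = C.gauge (of_real x) * f x"
  by (simp add: gauged_def)

lemma is_phi_gauged:
  assumes \<gamma>: "\<gamma> \<noteq> 0" and f: "is_phi q b a c z \<gamma> f"
  shows "is_phi q a b c z \<gamma> (gauged f)"
  unfolding is_phi_def
proof (intro conjI ballI)
  show "gauged f \<in> extensional (grid q z)" by (simp add: gauged_def)
  fix x assume x: "x \<in> grid q z"
  have "grid_qdiff q b a c (mu b \<gamma>) f x" using f x by (auto simp: is_phi_def)
  hence "big_qdiff q (of_real b) (of_real a) (of_real c) (\<gamma> + inverse \<gamma>) (\<lambda>y. f (Re y)) (of_real x)"
    unfolding grid_qdiff_def big_qdiff_def of_real_mult[symmetric] of_real_divide[symmetric]
      Re_complex_of_real mu_def by (simp add: mult_ac)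
  hence "big_qdiff q (of_real a) (of_real b) (of_real c) (\<gamma> + inverse \<gamma>)
      (\<lambda>y. C.gauge y * f (Re y)) (of_real x)"
  proof (rule C.gauge_qdiff)
    show "complex_of_real x = -1 \<or> qpoch_inf q (- (of_real b * of_real c * (of_real x / of_real q))) \<noteq> (0::complex)"
    proof (cases "x = -1")
      case False
      thus ?thesis using qpoch_inf_bc_grid_nz[OF div_q_in_grid[OF x]] by simp
    qed simp
  qed (rule qpoch_inf_bc_grid_nz[OF x])
  moreover have "x = -1 \<or> gauged f (x / q) = C.gauge (of_real (x / q)) * f (Re (of_real (x / q)))"
    using gauged_eq[OF div_q_in_grid[OF x]] by (cases "x = -1") simp_all
  ultimately show "grid_qdiff q a b c (mu a \<gamma>) (gauged f) x"
    by (intro grid_qdiffI[where h = "\<lambda>y. C.gauge y * f (Re y)"])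
      (simp_all add: gauged_eq x q_times_in_grid[OF x])
next
  obtain \<delta> where \<delta>: "\<delta> > 0" and eq: "\<And>x. x \<in> grid q z \<Longrightarrow> \<bar>x\<bar> < \<delta> \<Longrightarrow>
      f x = bigF q (of_real b) (of_real a) (of_real c) \<gamma> (of_real x)"
    using f unfolding is_phi_def by blast
  have pos: "b * c > 0" "a * c > 0" using a_pos b_pos c_pos by simp_all
  show "\<exists>\<delta>>0. \<forall>x\<in>grid q z. \<bar>x\<bar> < \<delta> \<longrightarrow> gauged f x = F \<gamma> (of_real x)"
  proof (intro exI[of _ "min \<delta> (min (1 / (b * c)) (1 / (a * c)))"] conjI ballI impI)
    fix x assume x: "x \<in> grid q z" "\<bar>x\<bar> < min \<delta> (min (1 / (b * c)) (1 / (a * c)))"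
    have "(b * c) * \<bar>x\<bar> < 1" "(a * c) * \<bar>x\<bar> < 1" using x pos by (simp_all add: field_simps)
    hence "norm (complex_of_real b * of_real c * of_real x) < 1" "norm (complex_of_real a * of_real c * of_real x) < 1"
      using a_pos b_pos c_pos by (simp_all add: norm_mult)
    from C.bigF_gauge[OF \<gamma> this] show "gauged f x = F \<gamma> (of_real x)"
      using eq x by (simp add: gauged_eq)
  qed (use \<delta> pos in simp)
qed

lemma gauge_real:
  "C.gauge (of_real x) = of_real (swap_const * qpoch_inf q (- (a * c * x)) / qpoch_inf q (- (b * c * x)))"
  unfolding C.gauge_def of_real_mult[symmetric] of_real_minus[symmetric] qpoch_inf_of_real
  by (simp add: swap_const_def)

lemma gauge_weight:
  assumes x: "x \<in> grid q z"
  shows "(swap_const * qpoch_inf q (- (a * c * x)) / qpoch_inf q (- (b * c * x)))\<^sup>2 * grid_wt q a b c x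
    = swap_const\<^sup>2 * grid_wt q b a c x"
proof -
  define R P S T where "R = qpoch_inf q (- (a * c * x))" and "P = qpoch_inf q (- (b * c * x))"
    and "S = qpoch_inf q (- (a * b * x))" and "T = qpoch_inf q (- (q * x))"
  have pos: "R > 0" "P > 0" "S > 0" "T > 0"
    unfolding R_def P_def S_def T_def
    using a_pos b_pos c_pos ab_less ac_less bc_less q_pos q_less_1 by (auto intro!: grid_qpoch_inf_pos[OF x])
  have p1: "pfun q a b c x = S * R / (P * T)"
    by (simp add: pfun_def qpochs_inf_def R_def P_def S_def T_def)
  have p2: "pfun q b a c x = S * P / (R * T)"
    by (simp add: pfun_def qpochs_inf_def R_def P_def S_def T_def mult.commute)
  have "(swap_const * R / P)\<^sup>2 * ((1 - q) * \<bar>x\<bar> / (S * R / (P * T)))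
      = swap_const\<^sup>2 * ((1 - q) * \<bar>x\<bar> / (S * P / (R * T)))"
    using pos by (simp add: field_simps power2_eq_square)
  thus ?thesis unfolding grid_wt_def p1 p2 R_def P_def .
qed

lemma gauged_product:
  assumes x: "x \<in> grid q z"
  shows "gauged f x * cnj (gauged g x) * of_real (grid_wt q a b c x)
    = of_real (swap_const\<^sup>2) * (f x * cnj (g x) * of_real (grid_wt q b a c x))"
proof -
  define r where "r = swap_const * qpoch_inf q (- (a * c * x)) / qpoch_inf q (- (b * c * x))"
  have "gauged f x * cnj (gauged g x) * of_real (grid_wt q a b c x)
      = (f x * cnj (g x)) * of_real (r\<^sup>2 * grid_wt q a b c x)"
    unfolding gauged_eq[OF x] gauge_real r_def[symmetric] by (simp add: power2_eq_square mult_ac)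
  also have "r\<^sup>2 * grid_wt q a b c x = swap_const\<^sup>2 * grid_wt q b a c x"
    unfolding r_def by (rule gauge_weight[OF x])
  finally show ?thesis by (simp add: mult_ac)
qed

lemma gauged_norm:
  assumes x: "x \<in> grid q z"
  shows "(norm (gauged f x))\<^sup>2 * grid_wt q a b c x
    = swap_const\<^sup>2 * ((norm (f x))\<^sup>2 * grid_wt q b a c x)"
proof -
  define r where "r = swap_const * qpoch_inf q (- (a * c * x)) / qpoch_inf q (- (b * c * x))"
  have "(norm (gauged f x))\<^sup>2 * grid_wt q a b c x = (norm (f x))\<^sup>2 * (r\<^sup>2 * grid_wt q a b c x)"
    unfolding gauged_eq[OF x] gauge_real r_def[symmetric] norm_mult norm_of_real power_mult_distrib power2_abs
    by (simp only: mult_ac)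
  also have "r\<^sup>2 * grid_wt q a b c x = swap_const\<^sup>2 * grid_wt q b a c x"
    unfolding r_def by (rule gauge_weight[OF x])
  finally show ?thesis by (simp add: mult_ac)
qed

lemma swapped: "bigq q b a c z"
  using a_pos b_pos c_pos z_pos ab_less ac_less bc_less
  by unfold_locales (simp_all add: mult.commute)

lemma ip_gauged: "ip q a b c z (gauged f) (gauged g) = of_real (swap_const\<^sup>2) * ip q b a c z f g"
proof -
  interpret S: bigq q b a c z by (rule swapped)
  show ?thesis
    unfolding ip_def wt_neg_eq wt_pos_eq S.wt_neg_eq S.wt_pos_eq
      gauged_product[OF neg_in_grid] gauged_product[OF pos_in_grid] infsum_cmult_right' distrib_left ..
qed

lemma Hsp_gauged:
  assumes "f \<in> Hsp q b a c z"
  shows "gauged f \<in> Hsp q a b c z"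
proof -
  interpret S: bigq q b a c z by (rule swapped)
  show ?thesis
    using assms unfolding Hsp_def wt_neg_eq wt_pos_eq S.wt_neg_eq S.wt_pos_eq mem_Collect_eq
      gauged_norm[OF neg_in_grid] gauged_norm[OF pos_in_grid]
    by (auto intro!: summable_on_cmult_right simp: gauged_def)
qed

lemma Mconst_swap: "Mconst q b a c z = swap_const\<^sup>2 * Mconst q a b c z"
proof -
  have "qpoch_inf q (a * c) \<noteq> 0" using qpoch_inf_pos[OF ac_less] by simp
  hence e: "qpochs_inf q [b * a, b * c] = swap_const * qpochs_inf q [a * b, a * c]"
    by (simp add: qpochs_inf_def swap_const_def mult.commute)
  have t: "qthetas q [- (b * a * z), - (b * c * z), - (a * c * z)] = qthetas q [- (a * b * z), - (a * c * z), - (b * c * z)]"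
    by (simp add: qthetas_def mult_ac)
  show ?thesis unfolding Mconst_def e t by (simp add: power_mult_distrib)
qed

lemma nu_pos_swap: "nu_pos q b a c z e f g k = swap_const\<^sup>2 * nu_pos q a b c z e f g k"
  unfolding nu_pos_def Mconst_swap by (simp add: mult.assoc)

lemma nu_neg_swap: "nu_neg q b a c z k = swap_const\<^sup>2 * nu_neg q a b c z k"
proof -
  have e: "- (q / (b * a * z)) = - (q / (a * b * z))" "- (b\<^sup>2 * a * c * z / q) = - (a * b\<^sup>2 * c * z / q)"
    "- (b * a\<^sup>2 * c * z / q) = - (a\<^sup>2 * b * c * z / q)" "- (b * a * c\<^sup>2 * z / q) = - (a * b * c\<^sup>2 * z / q)"
    "- (q\<^sup>2 / (b\<^sup>2 * a * c * z)) = - (q\<^sup>2 / (a * b\<^sup>2 * c * z))"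
    "- (q\<^sup>2 / (b * a\<^sup>2 * c * z)) = - (q\<^sup>2 / (a\<^sup>2 * b * c * z))"
    "- (q\<^sup>2 / (b * a * c\<^sup>2 * z)) = - (q\<^sup>2 / (a * b * c\<^sup>2 * z))"
    "b\<^sup>2 * a\<^sup>2 * c\<^sup>2 * z\<^sup>2 = a\<^sup>2 * b\<^sup>2 * c\<^sup>2 * z\<^sup>2" "b\<^sup>2 * a\<^sup>2 * c\<^sup>2 * z = a\<^sup>2 * b\<^sup>2 * c\<^sup>2 * z"
    by (simp_all add: mult_ac)
  show ?thesis
    unfolding nu_neg_def Mconst_swap e qpochs_inf_def qpochs_def list.map prod_list.Cons prod_list.Nil
    by (simp add: mult_ac)
qed

lemma Sset_nonzero: "\<gamma> \<in> Sset q a b c z \<Longrightarrow> \<gamma> \<noteq> 0"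
  unfolding Sset_def using a_pos b_pos c_pos z_pos by auto

lemma spectral_gauged:
  assumes "spectral q b a c z \<phi>"
  shows "spectral q a b c z (\<lambda>\<gamma>. gauged (\<phi> \<gamma>))"
proof -
  have bac: "b * a * c * z = a * b * c * z" by simp
  have S: "Sset q b a c z = Sset q a b c z" unfolding Sset_def bac by (simp add: insert_commute)
  have ms: "{#b, a, c#} = {#a, b, c#}" by simp
  have inv: "of_real (swap_const\<^sup>2) * of_real (inverse (swap_const\<^sup>2 * y)) = complex_of_real (inverse y)" for y
    unfolding of_real_mult[symmetric] using swap_const_nz by (simp add: field_simps)
  note * = assms[unfolded spectral_def S ms bac nu_pos_swap nu_neg_swap]
  show ?thesis
    unfolding spectral_def
  proof (intro conjI ballI allI impI)
    fix e f g k assume "{#e, f, g#} = {#a, b, c#} \<and> 1 / (q ^ k * e) < 1"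
    with * have "ip q b a c z (\<phi> (1 / (q ^ k * e))) (\<phi> (1 / (q ^ k * e)))
        = of_real (inverse (swap_const\<^sup>2 * nu_pos q a b c z e f g k))" by blast
    thus "ip q a b c z (gauged (\<phi> (1 / (q ^ k * e)))) (gauged (\<phi> (1 / (q ^ k * e))))
        = of_real (inverse (nu_pos q a b c z e f g k))" by (simp only: ip_gauged inv)
  next
    fix k assume "a * b * c * z / q powi (k + 1) < 1"
    with * have "ip q b a c z (\<phi> (- (a * b * c * z / q powi (k + 1)))) (\<phi> (- (a * b * c * z / q powi (k + 1))))
        = of_real (inverse (swap_const\<^sup>2 * nu_neg q a b c z k))" by blast
    thus "ip q a b c z (gauged (\<phi> (- (a * b * c * z / q powi (k + 1)))))
          (gauged (\<phi> (- (a * b * c * z / q powi (k + 1)))))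
        = of_real (inverse (nu_neg q a b c z k))" by (simp only: ip_gauged inv)
  next
    fix \<gamma> assume \<gamma>: "\<gamma> \<in> Sset q a b c z"
    have nz: "complex_of_real \<gamma> \<noteq> 0" using Sset_nonzero[OF \<gamma>] by simp
    show "is_phi q a b c z (of_real \<gamma>) (gauged (\<phi> \<gamma>))"
      by (rule is_phi_gauged[OF nz]) (use * \<gamma> in blast)
    show "gauged (\<phi> \<gamma>) \<in> Hsp q a b c z"
      by (rule Hsp_gauged) (use * \<gamma> in blast)
  next
    fix \<gamma> \<gamma>' assume "\<gamma> \<in> Sset q a b c z" "\<gamma>' \<in> Sset q a b c z" "\<gamma> \<noteq> \<gamma>'"
    with * have "ip q b a c z (\<phi> \<gamma>) (\<phi> \<gamma>') = 0" by blast
    thus "ip q a b c z (gauged (\<phi> \<gamma>)) (gauged (\<phi> \<gamma>')) = 0" by (simp add: ip_gauged)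
  qed
qed

section \<open>The eigenfunctions when a is the largest parameter\<close>

lemma Egrid_polynomial:
  assumes b: "b \<le> 1" and n: "a * q ^ n > 1"
  shows "Egrid (of_real (a * q ^ n)) = (\<lambda>x\<in>grid q z. F (of_real (a * q ^ n)) (of_real x))"
proof -
  have nz: "complex_of_real (a * q ^ n) \<noteq> 0" using n by auto
  have "norm (complex_of_real (a * q ^ n)) > 1" unfolding norm_of_real using n by linarith
  from phi_eqI[OF nz is_phi_Egrid[OF b this]] phi_eqI[OF nz is_phi_polynomial] show ?thesis by simp
qed

text \<open>If \<open>b, c < 1\<close>, then \<open>e q\<^sup>k > 1\<close> forces \<open>e = a\<close>; the spectral points are the inverses of the
  numbers at which the solution decays.\<close>

lemma Sset_cases:
  assumes b: "b < 1" and c: "c < 1" and \<gamma>: "\<gamma> \<in> Sset q a b c z"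
  obtains n where "a * q ^ n > 1" "\<gamma> = inverse (a * q ^ n)"
  | k g where "\<bar>g\<bar> > 1" "g = - (q powi (k + 1)) / (a * b * c * z)" "\<gamma> = inverse g"
proof -
  consider e n where "e \<in> {a, b, c}" "1 / (q ^ n * e) < 1" "\<gamma> = 1 / (q ^ n * e)"
    | k where "a * b * c * z / q powi (k + 1) < 1" "\<gamma> = - (a * b * c * z / q powi (k + 1))"
    using \<gamma> unfolding Sset_def by blast
  thus ?thesis
  proof cases
    case (1 e n)
    have e: "e > 0" using 1(1) a_pos b_pos c_pos by auto
    hence "q ^ n * e > 0" using q_pos by simp
    hence n: "q ^ n * e > 1" using 1(2) by (simp add: divide_less_eq)
    have "q ^ n * e \<le> 1 * e" using e q_power_le[of n] by (intro mult_right_mono) auto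
    hence "e > 1" using n by simp
    hence "e = a" using 1(1) b c by auto
    thus ?thesis using that(1)[of n] n 1(3) by (simp add: mult.commute inverse_eq_divide)
  next
    case (2 k)
    define g where "g = - (q powi (k + 1)) / (a * b * c * z)"
    have pos: "a * b * c * z > 0" "q powi (k + 1) > 0" using a_pos b_pos c_pos z_pos q_pos by simp_all
    have "\<bar>g\<bar> = q powi (k + 1) / (a * b * c * z)" using pos by (simp add: g_def)
    moreover have "a * b * c * z < q powi (k + 1)" using 2(1) pos by (simp add: divide_less_eq)
    ultimately have "\<bar>g\<bar> > 1" using pos by (simp add: less_divide_eq)
    moreover have "\<gamma> = inverse g" by (simp add: 2(2) g_def)
    ultimately show ?thesis using that(2)[of g k] g_def by blast
  qed
qed

lemma mu_inj:
  assumes g: "\<bar>g\<bar> > 1" "\<bar>g'\<bar> > 1" and ne: "g \<noteq> g'"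
  shows "mu a (of_real g) \<noteq> mu a (of_real g')"
proof
  assume eq: "mu a (of_real g) = mu a (of_real g')"
  have nz: "g \<noteq> 0" "g' \<noteq> 0" using g by auto
  have "complex_of_real (a * (g + inverse g)) = of_real (a * (g' + inverse g'))"
    using eq by (simp add: mu_def)
  hence "a * (g + inverse g) = a * (g' + inverse g')" by (simp only: of_real_eq_iff)
  hence "g + inverse g = g' + inverse g'" using a_pos by simp
  hence "(g - g') * (g * g' - 1) = 0" using nz by (simp add: field_simps)
  hence "g * g' = 1" using ne by simp
  moreover have "1 * 1 < \<bar>g\<bar> * \<bar>g'\<bar>" using g by (intro mult_strict_mono) auto
  ultimately show False by (simp flip: abs_mult)
qed

lemma nu_pos_commute: "nu_pos q a b c z e g f k = nu_pos q a b c z e f g k"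
  by (simp add: nu_pos_def qpochs_inf_def qpochs_def qthetas_def mult_ac)

lemma spectral_E:
  assumes b: "b < 1" and c: "c < 1"
  shows "spectral q a b c z (\<lambda>\<gamma>. Egrid (of_real (inverse \<gamma>)))"
proof -
  have b': "b \<le> 1" using b by simp
  have pt: "\<bar>inverse \<gamma>\<bar> > 1 \<and> (\<exists>D. asymp (Egrid (of_real (inverse \<gamma>))) (of_real (inverse \<gamma>)) D)"
    if "\<gamma> \<in> Sset q a b c z" for \<gamma>
    using b c that
  proof (cases rule: Sset_cases)
    case (1 n)
    thus ?thesis using asymp_polynomial[of n] Egrid_polynomial[OF b' 1(1)] by (auto simp del: of_real_mult of_real_power)
  next
    case (2 k g)
    thus ?thesis using asymp_second[OF b' 2(1,2)] by auto
  qed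
  have phi: "is_phi q a b c z (of_real (inverse \<gamma>)) (Egrid (of_real (inverse \<gamma>)))" if "\<gamma> \<in> Sset q a b c z" for \<gamma>
    using pt[OF that] by (intro is_phi_Egrid[OF b']) (simp only: norm_of_real)
  show ?thesis
    unfolding spectral_def
  proof (intro conjI ballI allI impI)
    fix \<gamma> assume \<gamma>: "\<gamma> \<in> Sset q a b c z"
    show "is_phi q a b c z (of_real \<gamma>) (Egrid (of_real (inverse \<gamma>)))"
      using phi[OF \<gamma>] is_phi_inverse[of "of_real \<gamma>"] by (simp only: of_real_inverse)
    obtain D where "asymp (Egrid (of_real (inverse \<gamma>))) (of_real (inverse \<gamma>)) D" using pt[OF \<gamma>] by blast
    thus "Egrid (of_real (inverse \<gamma>)) \<in> Hsp q a b c z"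
      using is_phi_Hsp[OF phi[OF \<gamma>]] pt[OF \<gamma>] by (simp only: norm_of_real)
  next
    fix \<gamma> \<gamma>' assume s: "\<gamma> \<in> Sset q a b c z" "\<gamma>' \<in> Sset q a b c z" and ne: "\<gamma> \<noteq> \<gamma>'"
    define g g' where "g = inverse \<gamma>" and "g' = inverse \<gamma>'"
    have gg: "g \<noteq> g'" "\<bar>g\<bar> > 1" "\<bar>g'\<bar> > 1" using ne pt[OF s(1)] pt[OF s(2)] by (simp_all add: g_def g'_def)
    obtain D D' where D: "asymp (Egrid (of_real g)) (of_real g) D" "asymp (Egrid (of_real g')) (of_real g') D'"
      using pt[OF s(1)] pt[OF s(2)] unfolding g_def g'_def by blast
    note phi' = phi[OF s(1), folded g_def] phi[OF s(2), folded g'_def]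
    have "1 * 1 < \<bar>g\<bar> * \<bar>g'\<bar>" using gg by (intro mult_strict_mono) auto
    hence "norm (complex_of_real g * of_real g') > 1" by (simp add: norm_mult)
    from orthogonal[OF phi'(1) D(1) phi'(2) D(2) this mu_inj[OF gg(2,3,1)]]
    have "ip q a b c z (Egrid (of_real g)) (\<lambda>x. cnj (Egrid (of_real g') x)) = 0" .
    also have "ip q a b c z (Egrid (of_real g)) (\<lambda>x. cnj (Egrid (of_real g') x))
        = ip q a b c z (Egrid (of_real g)) (Egrid (of_real g'))"
      using is_phi_cnj[OF phi'(2)] gg(3) by (intro ip_cong_grid) auto
    finally show "ip q a b c z (Egrid (of_real (inverse \<gamma>))) (Egrid (of_real (inverse \<gamma>'))) = 0"
      unfolding g_def g'_def .
  next
    fix e f g n assume *: "{#e, f, g#} = {#a, b, c#} \<and> 1 / (q ^ n * e) < 1"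
    have "set_mset {#e, f, g#} = set_mset {#a, b, c#}" using * by (simp only:)
    hence e_in: "e \<in> {a, b, c}" by auto
    have e: "e > 0" using e_in a_pos b_pos c_pos by auto
    hence "q ^ n * e > 0" using q_pos by simp
    hence n: "q ^ n * e > 1" using * by (simp add: divide_less_eq)
    have "q ^ n * e \<le> 1 * e" using e q_power_le[of n] by (intro mult_right_mono) auto
    hence "e > 1" using n by simp
    hence ea: "e = a" using e_in b c by auto
    hence "{#f, g#} = {#b, c#}" using * by simp
    hence "(f = b \<and> g = c) \<or> (f = c \<and> g = b)" by (auto simp: add_mset_eq_single add_eq_conv_ex)
    hence nu: "nu_pos q a b c z e f g n = nu_pos q a b c z a b c n"
      using ea nu_pos_commute by auto
    have n': "a * q ^ n > 1" using n ea by (simp add: mult.commute)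
    have inv: "inverse (1 / (q ^ n * e)) = a * q ^ n" by (simp add: ea mult.commute)
    show "ip q a b c z (Egrid (of_real (inverse (1 / (q ^ n * e))))) (Egrid (of_real (inverse (1 / (q ^ n * e)))))
        = of_real (inverse (nu_pos q a b c z e f g n))"
      unfolding nu inv Egrid_polynomial[OF b' n'] norm_polynomial[OF b' n'] norm_eq_nu_pos[OF n' b c] ..
  next
    fix k assume k: "a * b * c * z / q powi (k + 1) < 1"
    define g where "g = - (q powi (k + 1)) / (a * b * c * z)"
    have inv: "inverse (- (a * b * c * z / q powi (k + 1))) = g" by (simp add: g_def)
    have "- (a * b * c * z / q powi (k + 1)) \<in> Sset q a b c z" using k unfolding Sset_def by blast
    from pt[OF this] have g: "\<bar>g\<bar> > 1" unfolding inv by blast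
    show "ip q a b c z (Egrid (of_real (inverse (- (a * b * c * z / q powi (k + 1))))))
          (Egrid (of_real (inverse (- (a * b * c * z / q powi (k + 1))))))
        = of_real (inverse (nu_neg q a b c z k))"
      unfolding inv norm_second[OF b' g g_def] norm_eq_nu_neg[OF g g_def] ..
  qed
qed

end

text \<open>The largest parameter can be moved to the first position by the two interchanges.\<close>

lemma (in bigq) spectral_exists: "\<exists>\<phi>. spectral q a b c z \<phi>"
proof -
  have small: "y < 1" if "y \<le> x" "0 < y" "x * y < 1" for x y :: real
  proof (rule ccontr)
    assume "\<not> y < 1"
    hence "1 * 1 \<le> x * y" using that by (intro mult_mono) auto
    thus False using that by simp
  qed
  consider "b \<le> a" "c \<le> a" | "a \<le> b" "c \<le> b" | "a \<le> c" "b \<le> c" by linarith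
  thus ?thesis
  proof cases
    case 1
    thus ?thesis using spectral_E small[of b a] small[of c a] b_pos c_pos ab_less ac_less by blast
  next
    case 2
    interpret S: bigq q b a c z by (rule swapped)
    have "spectral q b a c z (\<lambda>\<gamma>. S.Egrid (of_real (inverse \<gamma>)))"
      using 2 small[of a b] small[of c b] a_pos c_pos ab_less bc_less by (intro S.spectral_E) (simp_all add: mult.commute)
    thus ?thesis using spectral_gauged by blast
  next
    case 3
    interpret T: bigq q c b a z
      using a_pos b_pos c_pos z_pos ab_less ac_less bc_less by unfold_locales (simp_all add: mult.commute)
    interpret U: bigq q b c a z by (rule T.swapped)
    have "spectral q c b a z (\<lambda>\<gamma>. T.Egrid (of_real (inverse \<gamma>)))"
      using 3 small[of a c] small[of b c] a_pos b_pos ac_less bc_less by (intro T.spectral_E) (simp_all add: mult.commute)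
    hence "\<exists>\<phi>. spectral q b c a z \<phi>" using U.spectral_gauged by blast
    hence "\<exists>\<phi>. spectral q b a c z \<phi>" unfolding spectral_swap_bc[of q b c a] .
    thus ?thesis using spectral_gauged by blast
  qed
qed

theorem corollary8p5:
  fixes q z a b c :: real
  assumes "0 < q" and "q < 1" and "z > 0" and "(a, b, c) \<in> par_dom"
  shows "(\<forall>\<gamma>\<in>Sset q a b c z. phi q a b c z (of_real \<gamma>) \<in> Ddom q a b c z)
    \<and> (\<forall>\<gamma>\<in>Sset q a b c z. \<forall>\<gamma>'\<in>Sset q a b c z. \<gamma> \<noteq> \<gamma>' \<longrightarrow>
          ip q a b c z (phi q a b c z (of_real \<gamma>)) (phi q a b c z (of_real \<gamma>')) = 0)
    \<and> (\<forall>e f g (k :: nat). {#e, f, g#} = {#a, b, c#} \<and> 1 / (q ^ k * e) < 1 \<longrightarrow>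
          (let \<phi> = phi q a b c z (of_real (1 / (q ^ k * e)))
           in ip q a b c z \<phi> \<phi> = of_real (inverse (nu_pos q a b c z e f g k))))
    \<and> (\<forall>k :: int. a * b * c * z / q powi (k + 1) < 1 \<longrightarrow>
          (let \<phi> = phi q a b c z (of_real (- (a * b * c * z / q powi (k + 1))))
           in ip q a b c z \<phi> \<phi> = of_real (inverse (nu_neg q a b c z k))))"
proof -
  interpret bigq q a b c z
    using assms by unfold_locales (auto simp: par_dom_def)
  obtain \<phi> where s: "spectral q a b c z \<phi>" using spectral_exists by blast
  have sol: "is_phi q a b c z (of_real \<gamma>) (\<phi> \<gamma>)" "\<phi> \<gamma> \<in> Hsp q a b c z" if "\<gamma> \<in> Sset q a b c z" for \<gamma>
    using s that by (auto simp: spectral_def)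
  have eq: "phi q a b c z (of_real \<gamma>) = \<phi> \<gamma>" if "\<gamma> \<in> Sset q a b c z" for \<gamma>
    using Sset_nonzero[OF that] by (intro phi_eqI sol(1)[OF that]) simp
  show ?thesis
    unfolding Let_def
  proof (intro conjI ballI allI impI)
    fix \<gamma> assume \<gamma>: "\<gamma> \<in> Sset q a b c z"
    show "phi q a b c z (of_real \<gamma>) \<in> Ddom q a b c z"
      unfolding eq[OF \<gamma>] by (rule is_phi_Ddom[OF sol[OF \<gamma>]])
  next
    fix \<gamma> \<gamma>' assume \<gamma>: "\<gamma> \<in> Sset q a b c z" "\<gamma>' \<in> Sset q a b c z" "\<gamma> \<noteq> \<gamma>'"
    show "ip q a b c z (phi q a b c z (of_real \<gamma>)) (phi q a b c z (of_real \<gamma>')) = 0"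
      unfolding eq[OF \<gamma>(1)] eq[OF \<gamma>(2)] using s \<gamma> by (auto simp: spectral_def)
  next
    fix e f g k assume *: "{#e, f, g#} = {#a, b, c#} \<and> 1 / (q ^ k * e) < 1"
    have "set_mset {#e, f, g#} = set_mset {#a, b, c#}" using * by (simp only:)
    hence "e \<in> {a, b, c}" by auto
    hence mem: "1 / (q ^ k * e) \<in> Sset q a b c z" using * unfolding Sset_def by blast
    show "ip q a b c z (phi q a b c z (of_real (1 / (q ^ k * e)))) (phi q a b c z (of_real (1 / (q ^ k * e))))
        = of_real (inverse (nu_pos q a b c z e f g k))"
      unfolding eq[OF mem] using s * unfolding spectral_def by blast
  next
    fix k assume k: "a * b * c * z / q powi (k + 1) < 1"
    hence mem: "- (a * b * c * z / q powi (k + 1)) \<in> Sset q a b c z" unfolding Sset_def by blast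
    show "ip q a b c z (phi q a b c z (of_real (- (a * b * c * z / q powi (k + 1)))))
        (phi q a b c z (of_real (- (a * b * c * z / q powi (k + 1)))))
        = of_real (inverse (nu_neg q a b c z k))"
      unfolding eq[OF mem] using s k unfolding spectral_def by blast
  qed
qed

end
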